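(* Let $\alpha$ be an algebraic irrational number, let $d=\deg(\alpha)\geq2$ be its degree over $\mathbb{Q}$, let $K=\mathbb{Q}(\alpha)$, and let $\mathfrak{a}$ be the ideal denominator of the fractional ideal $(\alpha)$ of $K$. For $x\geq1$ let $C_\alpha(x)$ be the number of integers $n\in[1,x]$ for which there exists a prime ideal $\mathfrak{p}$ of $K$ with $$\mathfrak{p}\mid (n+\alpha)\mathfrak{a}\quad\text{and}\quad \mathfrak{p}\nmid \prod_{\substack{1\leq m\leq x\\ m\neq n}}(m+\alpha)\mathfrak{a}.$$ Then for all sufficiently large $x$, $$C_\alpha(x)\geq\left\{1-\frac{1}{2d}-\frac{3}{16d^2}-\frac1d\sqrt{\frac{3}{16d}+\left(\frac{3}{16d}\right)^2}\right\}x,$$ and in particular $C_\alpha(x)>0.543x$ for all sufficiently large $x$.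
   Context: The ideal denominator of $(\alpha)$ is the integral ideal $\mathfrak{a}$ of $\mathcal{O}_K$ such that $(\alpha)=\mathfrak{b}\mathfrak{a}^{-1}$ with $\mathfrak{a},\mathfrak{b}$ coprime integral ideals; then $(n+\alpha)\mathfrak{a}$ is an integral ideal for every $n\in\mathbb{Z}$. *)

theory Defs
  imports Complex_Main
    "HOL-Computational_Algebra.Polynomial"
    "HOL-Algebra.Algebra"
    "HOL-Algebra.Algebraic_Closure_Type"
begin

abbreviation complex_field :: "complex ring"
  where "complex_field \<equiv> ring_of_type_algebra"

definition alg_degree :: "complex \<Rightarrow> nat"
  where "alg_degree \<alpha> = Polynomials.degree (ring.Irr complex_field \<rat> \<alpha>)"

text \<open>The field \<open>\<rat>(\<alpha>)\<close>: every subfield of the complex numbers contains \<open>\<rat>\<close>,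
  so only \<open>\<alpha>\<close> has to be listed as a generator.\<close>

definition rat_adjoin :: "complex \<Rightarrow> complex set"
  where "rat_adjoin \<alpha> = generate_field complex_field {\<alpha>}"

definition integer_ring :: "complex set \<Rightarrow> complex ring"
  where "integer_ring K = complex_field\<lparr>carrier := {x \<in> K. algebraic_int x}\<rparr>"

text \<open>Fractional ideals of \<open>K\<close> are represented as sets of complex numbers. Their product is
  \<open>ideal_prod complex_field\<close>, the set of finite sums of products; on integral
  ideals it coincides with \<open>ideal_prod (integer_ring K)\<close>.\<close>

definition principal_frac :: "complex set \<Rightarrow> complex \<Rightarrow> complex set"
  where "principal_frac K \<beta> = {\<beta> * y | y. y \<in> carrier (integer_ring K)}"

definition ideal_inverse :: "complex set \<Rightarrow> complex set \<Rightarrow> complex set"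
  where "ideal_inverse K I = {x \<in> K. \<forall>y\<in>I. x * y \<in> carrier (integer_ring K)}"

definition is_ideal_denominator :: "complex set \<Rightarrow> complex \<Rightarrow> complex set \<Rightarrow> bool"
  where "is_ideal_denominator K \<beta> \<aa> \<longleftrightarrow>
    ideal \<aa> (integer_ring K) \<and> \<aa> \<noteq> {0} \<and>
    (\<exists>\<bb>. ideal \<bb> (integer_ring K) \<and>
         \<aa> <+>\<^bsub>integer_ring K\<^esub> \<bb> = carrier (integer_ring K) \<and>
         principal_frac K \<beta> = ideal_prod complex_field \<bb> (ideal_inverse K \<aa>))"

definition shifted_ideal :: "complex \<Rightarrow> complex set \<Rightarrow> int \<Rightarrow> complex set"
  where "shifted_ideal \<alpha> \<aa> n =
    ideal_prod complex_field (principal_frac (rat_adjoin \<alpha>) (of_int n + \<alpha>)) \<aa>"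

text \<open>Divisibility and the finite product below are those of the multiplicative monoid
  \<open>ideals_set\<close> of integral ideals. The zero ideal satisfies \<open>primeideal\<close>, but is
  not a prime of \<open>K\<close>.\<close>

definition has_private_prime :: "complex \<Rightarrow> complex set \<Rightarrow> real \<Rightarrow> int \<Rightarrow> bool"
  where "has_private_prime \<alpha> \<aa> x n \<longleftrightarrow>
    (let R = integer_ring (rat_adjoin \<alpha>) in
      \<exists>\<pp>. primeideal \<pp> R \<and> \<pp> \<noteq> {0} \<and>
          \<pp> divides\<^bsub>ideals_set R\<^esub> shifted_ideal \<alpha> \<aa> n \<and>
          \<not> \<pp> divides\<^bsub>ideals_set R\<^esub>
            finprod (ideals_set R) (shifted_ideal \<alpha> \<aa>)
              {m. 1 \<le> m \<and> of_int m \<le> x \<and> m \<noteq> n})"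

definition private_prime_count :: "complex \<Rightarrow> complex set \<Rightarrow> real \<Rightarrow> nat"
  where "private_prime_count \<alpha> \<aa> x =
    card {n::int. 1 \<le> n \<and> of_int n \<le> x \<and> has_private_prime \<alpha> \<aa> x n}"

end

theory Submission
  imports Defs "Jordan_Normal_Form.Char_Poly"
    "HOL-Real_Asymp.Real_Asymp" "HOL-Analysis.L2_Norm"
begin

text \<open>
  Choose an integer \<open>c \<noteq> 0\<close> such that \<open>\<theta> = c\<alpha>\<close> is an algebraic integer, let \<open>f\<close> be its minimal
  polynomial, and write \<open>F(n)\<close> for the norm of \<open>cn + \<theta>\<close>, which is \<open>f(-cn)\<close> up to sign. If a large prime
  \<open>p > x\<close> divides \<open>F(n)\<close> with \<open>n \<le> x\<close>, then the kernel of the reduction \<open>\<theta> \<mapsto> -cn\<close> modulo \<open>p\<close> is a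
  prime ideal that divides \<open>(n + \<alpha>)\<aa>\<close> but no other \<open>(m + \<alpha>)\<aa>\<close> with \<open>m \<le> x\<close>. So it suffices to bound
  the proportion \<open>s\<close> of those \<open>n \<le> N\<close> for which all primes dividing \<open>F(n)\<close> are at most \<open>N\<close>.

  For such \<open>n\<close>, \<open>d log n\<close> is essentially the sum of \<open>log p\<close> over the primes \<open>p \<le> N\<close> dividing
  \<open>F(n)\<close>. By Mertens' theorem for the roots of \<open>f\<close> modulo \<open>p\<close>, the primes above \<open>\<surd>N\<close> contribute
  \<open>1/2 log N\<close> on average over all \<open>n \<le> N\<close>, while the contribution of the primes up to \<open>\<surd>N\<close> has mean
  \<open>1/2 log N\<close> and variance \<open>1/8 log\<^sup>2 N\<close>. By the Cauchy-Schwarz inequality,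
  \<open>d s \<le> 1/2 + s/2 + \<surd>(s(1 - s)/8) + o(1)\<close>. This is slightly stronger than
  \<open>d s \<le> 1/2 + \<surd>(3s/8)\<close>, the case of equality in which gives the constant of the theorem; the
  difference absorbs all error terms.

  Mertens' theorem is obtained by comparing the sum of \<open>log |N(g(\<theta>))|\<close> over all polynomials \<open>g\<close> of
  degree less than \<open>d\<close> in a box of coefficients with the prime factorisations of these norms: the
  \<open>g\<close> that vanish at a given root modulo \<open>p\<close> form a lattice of index \<open>p\<close>, and the exponent of \<open>p\<close> in
  the norm is the number of such roots unless \<open>g\<close> lies in one of boundedly many ideals of index at
  least \<open>p\<^sup>2\<close>.
\<close>

section \<open>Algebraic integers and norms\<close>

text \<open>The box has side \<open>K = k H\<close> with \<open>k\<close> large and fixed: all but a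
  proportion 2d/k of its members have norm at least H^d, and for p \<le> H^d the lattice counts have
  relative error of order 1/k. The cut at sqrt N comes from the second moment: the pairs p, q \<le>
  R carry a total error of order R^2, which must stay below order N. If rho(p) counts roots modulo
  p, the sum of rho(p) ln^2 p / p over p \<le> R is about 1/2 ln^2 R, and R = sqrt N turns this into
  1/8 ln^2 N. Plain Cauchy-Schwarz over the smooth n uses the second moment 1/4 + 1/8 = 3/8 and
  yields exactly the constant of the theorem. Subtracting the mean first replaces sqrt(3s/8) by s/2
  + sqrt(s(1 - s)/8), which is strictly smaller except at s = 2/3; there the right-hand side 1/2 +
  s/2 + sqrt(s(1 - s)/8) equals 1, while d s is at least 4/3.\<close>

hide_const (open) Polynomials.degree Divisibility.prime Divisibility.irreducible

section \<open>Algebraic integers form a ring\<close>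

text \<open>Listed as a vector, the generators are an eigenvector with eigenvalue \<open>x\<close>
  of an integer matrix, whose characteristic polynomial is monic and integral. The element
  \<open>v0\<close> makes this vector nonzero.\<close>

lemma algebraic_int_of_finite_module:
  fixes x :: complex
  assumes V: "finite V" "v0 \<in> V" "v0 \<noteq> 0"
    and eq: "\<And>v. v \<in> V \<Longrightarrow> x * v = (\<Sum>w\<in>V. of_int (c v w) * w)"
  shows "algebraic_int x"
proof -
  obtain vs where vs: "set vs = V" "distinct vs"
    using finite_distinct_list[OF V(1)] by blast
  define n where "n = length vs"
  define A where "A = mat n n (\<lambda>(i, j). c (vs ! i) (vs ! j))"
  define v where "v = vec n (\<lambda>i. vs ! i)"
  let ?A = "map_mat (of_int :: int \<Rightarrow> complex) A"
  have A: "A \<in> carrier_mat n n" and A': "?A \<in> carrier_mat n n"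
    by (auto simp: A_def)
  have "?A *\<^sub>v v = x \<cdot>\<^sub>v v"
  proof (intro eq_vecI)
    fix i assume "i < dim_vec (x \<cdot>\<^sub>v v)"
    then have i: "i < n" by (simp add: v_def)
    have "(?A *\<^sub>v v) $ i = (\<Sum>j<n. of_int (c (vs ! i) (vs ! j)) * (vs ! j))"
      using i by (auto simp: A_def v_def scalar_prod_def atLeast0LessThan)
    also have "\<dots> = (\<Sum>w\<in>V. of_int (c (vs ! i) w) * w)"
      using bij_betw_nth[of vs "{..<n}" V] vs n_def
      by (intro sum.reindex_bij_betw) auto
    also have "\<dots> = x * (vs ! i)"
      using i vs n_def eq nth_mem[of i vs] by auto
    finally show "(?A *\<^sub>v v) $ i = (x \<cdot>\<^sub>v v) $ i"
      using i by (simp add: v_def)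
  qed (simp add: A_def v_def)
  moreover have "v \<noteq> 0\<^sub>v n"
  proof -
    obtain i where "i < n" "vs ! i = v0"
      using V(2) vs n_def by (auto simp: in_set_conv_nth)
    then have "v $ i \<noteq> 0\<^sub>v n $ i" using V(3) by (simp add: v_def)
    then show ?thesis by auto
  qed
  ultimately have "eigenvalue ?A x"
    by (auto simp: eigenvalue_def eigenvector_def v_def A_def intro!: exI[of _ v])
  then have "poly (char_poly ?A) x = 0"
    using eigenvalue_root_char_poly[OF A'] by simp
  moreover have "char_poly ?A = map_poly of_int (char_poly A)"
    by (rule of_int_hom.char_poly_hom[OF A])
  moreover have "lead_coeff (char_poly A) = 1"
    using degree_monic_char_poly[OF A] by simp
  ultimately show ?thesis
    unfolding algebraic_int_altdef_ipoly by metis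
qed

definition zspan :: "complex set \<Rightarrow> complex set" where
  "zspan V = {\<Sum>w\<in>V. of_int (c w) * w | c. True}"

lemma zspanI: "a = (\<Sum>w\<in>V. of_int (c w) * w) \<Longrightarrow> a \<in> zspan V"
  unfolding zspan_def by blast

lemma zspan_add: "a \<in> zspan V \<Longrightarrow> b \<in> zspan V \<Longrightarrow> a + b \<in> zspan V"
proof -
  assume "a \<in> zspan V" "b \<in> zspan V"
  then obtain c1 c2 where "a = (\<Sum>w\<in>V. of_int (c1 w) * w)" "b = (\<Sum>w\<in>V. of_int (c2 w) * w)"
    unfolding zspan_def by blast
  then have "a + b = (\<Sum>w\<in>V. of_int (c1 w + c2 w) * w)"
    by (simp add: sum.distrib algebra_simps)
  then show ?thesis by (rule zspanI)
qed

lemma zspan_scale: "a \<in> zspan V \<Longrightarrow> of_int k * a \<in> zspan V"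
proof -
  assume "a \<in> zspan V"
  then obtain c1 where "a = (\<Sum>w\<in>V. of_int (c1 w) * w)"
    unfolding zspan_def by blast
  then have "of_int k * a = (\<Sum>w\<in>V. of_int (k * c1 w) * w)"
    by (simp add: sum_distrib_left mult_ac)
  then show ?thesis by (rule zspanI)
qed

lemma zspan_0: "0 \<in> zspan V"
  unfolding zspan_def by (auto intro!: exI[of _ "\<lambda>_. 0"])

lemma zspan_base: "finite V \<Longrightarrow> v \<in> V \<Longrightarrow> v \<in> zspan V"
  unfolding zspan_def
  by (auto intro!: exI[of _ "\<lambda>w. if w = v then 1 else 0"] simp: if_distrib[of of_int] if_distrib[of "\<lambda>x. x * _"] cong: if_cong)

lemma zspan_sum: "(\<And>i. i \<in> I \<Longrightarrow> g i \<in> zspan V) \<Longrightarrow> (\<Sum>i\<in>I. g i) \<in> zspan V"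
  by (induction I rule: infinite_finite_induct) (auto intro: zspan_0 zspan_add)

lemma zspan_closed:
  assumes "\<And>v. v \<in> V \<Longrightarrow> x * v \<in> zspan V" "a \<in> zspan V"
  shows "x * a \<in> zspan V"
proof -
  from assms(2) obtain c1 where "a = (\<Sum>w\<in>V. of_int (c1 w) * w)"
    unfolding zspan_def by blast
  then have "x * a = (\<Sum>w\<in>V. of_int (c1 w) * (x * w))"
    by (simp add: sum_distrib_left mult_ac)
  then show ?thesis using assms(1) by (auto intro!: zspan_sum zspan_scale)
qed

lemma algebraic_int_of_zspan:
  assumes V: "finite V" "v0 \<in> V" "v0 \<noteq> 0"
    and eq: "\<And>v. v \<in> V \<Longrightarrow> x * v \<in> zspan V"
  shows "algebraic_int x"
proof -
  have "\<forall>v. \<exists>c. v \<in> V \<longrightarrow> x * v = (\<Sum>w\<in>V. of_int (c w) * w)"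
    using eq unfolding zspan_def by blast
  then obtain c where "\<forall>v. v \<in> V \<longrightarrow> x * v = (\<Sum>w\<in>V. of_int (c v w) * w)"
    by metis
  then show ?thesis
    using algebraic_int_of_finite_module[OF V, of x c] by blast
qed

text \<open>The monic equation rewrites x^m through lower powers. The free factor \<open>y\<close>
  lets the lemma act along either axis of a grid of monomials in two algebraic integers.\<close>

lemma algebraic_int_power_reduction:
  assumes "algebraic_int (x::complex)"
  obtains m where "m > 0" "\<And>y i. i < m \<Longrightarrow> x * (x ^ i * y) \<in> zspan ((\<lambda>i. x ^ i * y) ` {..<m})"
proof -
  obtain p :: "int poly" where p: "poly (map_poly of_int p) x = 0" "lead_coeff p = 1"
    using assms unfolding algebraic_int_altdef_ipoly by blast
  define m where "m = degree p"
  have deg: "degree (map_poly of_int p :: complex poly) = m"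
    by (simp add: m_def)
  have "m > 0"
  proof (rule ccontr)
    assume "\<not> m > 0"
    then have "p = [:1:]" using p(2) by (metis degree_eq_zeroE gr0I lead_coeff_pCons(2) m_def pCons_0_0)
    then show False using p(1) by simp
  qed
  have "(\<Sum>i\<le>m. of_int (coeff p i) * x ^ i) = 0"
    using p(1) unfolding poly_altdef deg by simp
  then have xm: "x ^ m = (\<Sum>i<m. of_int (- coeff p i) * x ^ i)"
    using p(2) by (simp add: m_def lessThan_Suc_atMost[symmetric] sum_negf eq_neg_iff_add_eq_0 add.commute)
  show thesis
  proof (rule that[OF \<open>m > 0\<close>])
    fix y i assume "i < m"
    let ?V = "(\<lambda>i. x ^ i * y) ` {..<m}"
    show "x * (x ^ i * y) \<in> zspan ?V"
    proof (cases "Suc i < m")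
      case True
      then have "x ^ Suc i * y \<in> zspan ?V"
        by (intro zspan_base) (auto simp del: power_Suc)
      then show ?thesis by (simp add: mult_ac)
    next
      case False
      then have "x * (x ^ i * y) = x ^ m * y" using \<open>i < m\<close>
        by (metis Suc_lessI mult.assoc power_Suc)
      also have "\<dots> = (\<Sum>i<m. of_int (- coeff p i) * (x ^ i * y))"
        by (simp only: xm sum_distrib_right mult.assoc)
      also have "\<dots> \<in> zspan ?V"
        by (intro zspan_sum zspan_scale zspan_base) auto
      finally show ?thesis .
    qed
  qed
qed

lemma zspan_mono: "finite W \<Longrightarrow> V \<subseteq> W \<Longrightarrow> zspan V \<subseteq> zspan W"
proof
  fix a assume W: "finite W" "V \<subseteq> W" and "a \<in> zspan V"
  then obtain c where a: "a = (\<Sum>w\<in>V. of_int (c w) * w)"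
    unfolding zspan_def by blast
  show "a \<in> zspan W" unfolding a using W by (intro zspan_sum zspan_scale zspan_base) auto
qed

text \<open>The monomials x^i y^j below the two degrees span a module stable under both numbers,
  hence under their sum and their product.\<close>

lemma algebraic_int_common_module:
  assumes "algebraic_int (x::complex)" "algebraic_int y"
  obtains V where "finite V" "1 \<in> V" "\<And>v. v \<in> V \<Longrightarrow> x * v \<in> zspan V" "\<And>v. v \<in> V \<Longrightarrow> y * v \<in> zspan V"
proof -
  obtain m where m: "m > 0" "\<And>y i. i < m \<Longrightarrow> x * (x ^ i * y) \<in> zspan ((\<lambda>i. x ^ i * y) ` {..<m})"
    using algebraic_int_power_reduction[OF assms(1)] by blast
  obtain n where n: "n > 0" "\<And>z i. i < n \<Longrightarrow> y * (y ^ i * z) \<in> zspan ((\<lambda>i. y ^ i * z) ` {..<n})"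
    using algebraic_int_power_reduction[OF assms(2)] by blast
  define V where "V = (\<lambda>(i, j). x ^ i * y ^ j) ` ({..<m} \<times> {..<n})"
  have fin: "finite V" by (auto simp: V_def)
  show thesis
  proof (rule that[OF fin])
    show "1 \<in> V" using m n unfolding V_def by (auto intro!: image_eqI[of _ _ "(0,0)"])
  next
    fix v assume "v \<in> V"
    then obtain i j where ij: "i < m" "j < n" "v = x ^ i * y ^ j" unfolding V_def by auto
    have "(\<lambda>i. x ^ i * y ^ j) ` {..<m} \<subseteq> V" using ij unfolding V_def by auto
    then show "x * v \<in> zspan V" using m(2)[OF ij(1), of "y ^ j"] zspan_mono[OF fin] ij(3) by blast
    have "(\<lambda>j. y ^ j * x ^ i) ` {..<n} \<subseteq> V" using ij unfolding V_def by (auto simp: mult.commute)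
    then show "y * v \<in> zspan V" using n(2)[OF ij(2), of "x ^ i"] zspan_mono[OF fin] ij(3)
      by (metis mult.commute subsetD)
  qed
qed

lemma algebraic_int_add [intro]:
  assumes "algebraic_int (x::complex)" "algebraic_int y" shows "algebraic_int (x + y)"
proof -
  obtain V where V: "finite V" "1 \<in> V" "\<And>v. v \<in> V \<Longrightarrow> x * v \<in> zspan V" "\<And>v. v \<in> V \<Longrightarrow> y * v \<in> zspan V"
    using algebraic_int_common_module[OF assms] by blast
  show ?thesis
    by (rule algebraic_int_of_zspan[OF V(1,2)]) (use V(3,4) zspan_add in \<open>auto simp: distrib_right\<close>)
qed

lemma algebraic_int_mult [intro]:
  assumes "algebraic_int (x::complex)" "algebraic_int y" shows "algebraic_int (x * y)"
proof -
  obtain V where V: "finite V" "1 \<in> V" "\<And>v. v \<in> V \<Longrightarrow> x * v \<in> zspan V" "\<And>v. v \<in> V \<Longrightarrow> y * v \<in> zspan V"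
    using algebraic_int_common_module[OF assms] by blast
  show ?thesis
    by (rule algebraic_int_of_zspan[OF V(1,2)])
       (use V(3,4) zspan_closed[of V x] in \<open>auto simp: mult.assoc\<close>)
qed

lemma algebraic_int_of_int [simp, intro]: "algebraic_int (of_int k :: complex)"
  by (rule int_imp_algebraic_int) simp

lemma algebraic_int_1 [simp, intro]: "algebraic_int (1 :: complex)"
  by (rule int_imp_algebraic_int) simp

lemma algebraic_int_diff [intro]:
  "algebraic_int (x::complex) \<Longrightarrow> algebraic_int y \<Longrightarrow> algebraic_int (x - y)"
  using algebraic_int_add[of x "- y"] by simp

lemma algebraic_int_sum [intro]:
  "(\<And>i. i \<in> I \<Longrightarrow> algebraic_int (g i)) \<Longrightarrow> algebraic_int (\<Sum>i\<in>I. g i :: complex)"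
  by (induction I rule: infinite_finite_induct) auto

lemma algebraic_int_prod [intro]:
  "(\<And>i. i \<in> I \<Longrightarrow> algebraic_int (g i)) \<Longrightarrow> algebraic_int (\<Prod>i\<in>I. g i :: complex)"
  by (induction I rule: infinite_finite_induct) auto

lemma algebraic_int_poly [intro]:
  assumes "\<And>i. algebraic_int (coeff p i)" "algebraic_int (x::complex)"
  shows "algebraic_int (poly p x)"
proof -
  have "algebraic_int (x ^ i)" for i by (induction i) (use assms(2) in auto)
  then show ?thesis unfolding poly_altdef using assms(1) by auto
qed

lemma algebraic_int_of_nat [simp, intro]: "algebraic_int (of_nat k :: complex)"
  by (rule int_imp_algebraic_int) simp

section \<open>Prime ideals of the ring of all algebraic integers\<close>

text \<open>Zorn's lemma gives an ideal maximal among those that contain \<open>p\<close> but not 1.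
  The family is nonempty because 1 in (p) would make the rational number 1/p an algebraic integer.
  Taking the ring of all algebraic integers avoids a choice of splitting field.\<close>

lemma exists_prime_ideal:
  assumes "prime (p::nat)"
  obtains P :: "complex set" where
    "\<And>x. x \<in> P \<Longrightarrow> algebraic_int x"
    "\<And>x y. x \<in> P \<Longrightarrow> y \<in> P \<Longrightarrow> x + y \<in> P"
    "\<And>x y. x \<in> P \<Longrightarrow> algebraic_int y \<Longrightarrow> y * x \<in> P"
    "\<And>x y. algebraic_int x \<Longrightarrow> algebraic_int y \<Longrightarrow> x * y \<in> P \<Longrightarrow> x \<in> P \<or> y \<in> P"
    "of_nat p \<in> P" "1 \<notin> P"
proof -
  define I where "I = (\<lambda>S::complex set. (\<forall>x\<in>S. algebraic_int x) \<and> (\<forall>x\<in>S. \<forall>y\<in>S. x + y \<in> S)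
     \<and> (\<forall>x\<in>S. \<forall>y. algebraic_int y \<longrightarrow> y * x \<in> S) \<and> of_nat p \<in> S \<and> 1 \<notin> S)"
  define A where "A = {S. I S}"
  define S0 where "S0 = {of_nat p * y | y :: complex. algebraic_int y}"
  have p1: "p > 1" using assms prime_gt_1_nat by blast
  have "1 \<notin> S0"
  proof
    assume "1 \<in> S0"
    then obtain y :: complex where y: "1 = of_nat p * y" "algebraic_int y" unfolding S0_def by blast
    then have "y = 1 / of_nat p" using p1 by (simp add: field_simps)
    then have "y \<in> \<rat>" by simp
    then have "y \<in> \<int>" using rational_algebraic_int_is_int[OF y(2)] by blast
    then obtain k where "y = of_int k" by (auto elim: Ints_cases)
    then have "of_int 1 = (of_int (int p * k) :: complex)" using y(1) by simp
    then have "1 = int p * k" by (metis of_int_eq_iff)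
    then have "int p dvd 1" by (metis dvd_triv_left)
    then show False using p1 by simp
  qed
  moreover have "\<forall>x\<in>S0. algebraic_int x"
    unfolding S0_def by auto
  moreover have "\<forall>x\<in>S0. \<forall>y\<in>S0. x + y \<in> S0"
  proof (intro ballI)
    fix x y assume "x \<in> S0" "y \<in> S0"
    then obtain a b where "x = of_nat p * a" "y = of_nat p * b" "algebraic_int a" "algebraic_int b"
      unfolding S0_def by blast
    then have "x + y = of_nat p * (a + b)" "algebraic_int (a + b)" by (auto simp: algebra_simps)
    then show "x + y \<in> S0" unfolding S0_def by blast
  qed
  moreover have "\<forall>x\<in>S0. \<forall>y. algebraic_int y \<longrightarrow> y * x \<in> S0"
  proof (intro ballI allI impI)
    fix x y :: complex assume "x \<in> S0" and y: "algebraic_int y"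
    then obtain a where "x = of_nat p * a" "algebraic_int a"
      unfolding S0_def by blast
    then have "y * x = of_nat p * (y * a)" "algebraic_int (y * a)" using y by (auto simp: algebra_simps)
    then show "y * x \<in> S0" unfolding S0_def by blast
  qed
  moreover have "of_nat p \<in> S0" unfolding S0_def by (auto intro!: exI[of _ 1])
  ultimately have "I S0" unfolding I_def by blast
  then have ne: "S0 \<in> A" unfolding A_def by blast
  have "\<exists>M\<in>A. \<forall>U\<in>A. M \<subseteq> U \<longrightarrow> U = M"
  proof (rule subset_Zorn_nonempty)
    fix C assume ne: "C \<noteq> {}" and C: "subset.chain A C"
    have CI: "I S" if "S \<in> C" for S
      using C that unfolding subset.chain_def A_def by blast
    have lin: "S \<subseteq> T \<or> T \<subseteq> S" if "S \<in> C" "T \<in> C" for S T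
      using C that unfolding subset.chain_def by blast
    have "x + y \<in> \<Union>C" if xy: "x \<in> \<Union>C" "y \<in> \<Union>C" for x y
    proof -
      obtain S T where ST: "S \<in> C" "T \<in> C" "x \<in> S" "y \<in> T" using xy by blast
      from lin[OF ST(1,2)] show ?thesis
      proof
        assume "S \<subseteq> T"
        then have "x + y \<in> T" using CI[OF ST(2)] ST unfolding I_def by blast
        then show ?thesis using ST by blast
      next
        assume "T \<subseteq> S"
        then have "x + y \<in> S" using CI[OF ST(1)] ST unfolding I_def by blast
        then show ?thesis using ST by blast
      qed
    qed
    moreover have "of_nat p \<in> \<Union>C" using ne CI unfolding I_def by blast
    moreover have "1 \<notin> \<Union>C" using CI unfolding I_def by blast
    moreover have "\<forall>x\<in>\<Union>C. algebraic_int x"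
      using CI unfolding I_def by blast
    moreover have "\<forall>x\<in>\<Union>C. \<forall>y. algebraic_int y \<longrightarrow> y * x \<in> \<Union>C"
      using CI unfolding I_def by blast
    ultimately show "\<Union>C \<in> A"
      unfolding A_def I_def by simp
  qed (use ne in blast)
  then obtain P where P: "I P" "\<And>U. I U \<Longrightarrow> P \<subseteq> U \<Longrightarrow> U = P" unfolding A_def by blast
  have Pd: "\<And>x. x \<in> P \<Longrightarrow> algebraic_int x"
    "\<And>x y. x \<in> P \<Longrightarrow> y \<in> P \<Longrightarrow> x + y \<in> P"
    "\<And>x y. x \<in> P \<Longrightarrow> algebraic_int y \<Longrightarrow> y * x \<in> P"
    "of_nat p \<in> P" "1 \<notin> P"
    using P(1) unfolding I_def by blast+
  show thesis
  proof (rule that[OF Pd(1-3) _ Pd(4,5)])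
    fix x y assume xy: "algebraic_int x" "algebraic_int y" "x * y \<in> P"
    show "x \<in> P \<or> y \<in> P"
    proof (rule ccontr)
      assume n: "\<not> (x \<in> P \<or> y \<in> P)"
      \<comment> \<open>The ideal P + (x) is strictly larger than \<open>P\<close>, so by maximality
        it contains 1; multiplying 1 = a + x b by \<open>y\<close> then puts \<open>y\<close> into
        \<open>P\<close>.\<close>
      define U where "U = {a + x * b | a b. a \<in> P \<and> algebraic_int b}"
      have "a = a + x * 0" for a by simp
      then have sub: "P \<subseteq> U" unfolding U_def using algebraic_int_0 by blast
      have "0 \<in> P" using Pd(3)[OF Pd(4), of 0] by simp
      have "x = 0 + x * 1" by simp
      then have "x \<in> U" unfolding U_def using \<open>0 \<in> P\<close> algebraic_int_1 by blast
      then have "\<not> I U" using P(2)[OF _ sub] n by blast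
      moreover have "\<forall>a\<in>U. algebraic_int a" unfolding U_def using Pd(1) xy(1) by auto
      moreover have "\<forall>a\<in>U. \<forall>b\<in>U. a + b \<in> U"
      proof (intro ballI)
        fix a b assume "a \<in> U" "b \<in> U"
        then obtain a1 a2 b1 b2 where *: "a = a1 + x * a2" "b = b1 + x * b2" "a1 \<in> P" "b1 \<in> P"
          "algebraic_int a2" "algebraic_int b2"
          unfolding U_def by blast
        have "a + b = (a1 + b1) + x * (a2 + b2)" using * by (simp add: algebra_simps)
        then show "a + b \<in> U" unfolding U_def using * Pd(2) by blast
      qed
      moreover have "\<forall>a\<in>U. \<forall>b. algebraic_int b \<longrightarrow> b * a \<in> U"
      proof (intro ballI allI impI)
        fix a b :: complex assume "a \<in> U" and b: "algebraic_int b"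
        then obtain a1 a2 where *: "a = a1 + x * a2" "a1 \<in> P" "algebraic_int a2"
          unfolding U_def by blast
        have "b * a = b * a1 + x * (b * a2)" using * by (simp add: algebra_simps)
        then show "b * a \<in> U" unfolding U_def using * Pd(3) b by blast
      qed
      ultimately have "1 \<in> U" unfolding I_def using sub Pd(4) by blast
      then obtain a b where ab: "1 = a + x * b" "a \<in> P" "algebraic_int b" unfolding U_def by blast
      have "y = y * (a + x * b)" using ab(1) by simp
      also have "\<dots> = y * a + b * (x * y)" by (simp add: algebra_simps)
      also have "\<dots> \<in> P" using Pd(2,3) ab xy by blast
      finally show False using n by blast
    qed
  qed
qed

section \<open>Interpolation and rationality of norms\<close>

text \<open>Serves three purposes: bounding coefficients by the values at the conjugates, clearing
  denominators with the discriminant, and counting arguments at which a polynomial is divisible by a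
  high prime power.\<close>

lemma lagrange_interpolation:
  fixes g :: "'a::field poly"
  assumes S: "finite S" "degree g < card S"
  shows "g = (\<Sum>a\<in>S. smult (poly g a / (\<Prod>b\<in>S-{a}. a - b)) (\<Prod>b\<in>S-{a}. [:-b, 1:]))"
    (is "g = ?h")
proof -
  have root: "poly (g - ?h) c = 0" if c: "c \<in> S" for c
  proof -
    have "poly ?h c = (\<Sum>a\<in>S. poly g a / (\<Prod>b\<in>S-{a}. a - b) * (\<Prod>b\<in>S-{a}. c - b))"
      by (simp add: poly_sum poly_prod)
    also have "\<dots> = (\<Sum>a\<in>S. if a = c then poly g c else 0)"
    proof (rule sum.cong)
      fix a assume a: "a \<in> S"
      show "poly g a / (\<Prod>b\<in>S-{a}. a - b) * (\<Prod>b\<in>S-{a}. c - b) = (if a = c then poly g c else 0)"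
        using a c S(1) by (auto simp: prod_zero_iff)
    qed auto
    also have "\<dots> = poly g c" using c S(1) by simp
    finally show ?thesis by simp
  qed
  have "degree ?h \<le> card S - 1"
  proof (rule degree_sum_le[OF S(1)])
    fix a assume "a \<in> S"
    have "degree (\<Prod>b\<in>S-{a}. [:-b, 1:]) \<le> (\<Sum>b\<in>S-{a}. degree [:-b, 1:])"
      using degree_prod_sum_le[of "S - {a}" "\<lambda>b. [:-b, 1:]"] S by (simp add: o_def)
    then show "degree (smult (poly g a / (\<Prod>b\<in>S-{a}. a - b)) (\<Prod>b\<in>S-{a}. [:-b, 1:])) \<le> card S - 1"
      using degree_smult_le S(1) \<open>a \<in> S\<close> by (auto intro: order_trans)
  qed
  then have deg: "degree (g - ?h) < card S"
    using S by (intro degree_diff_less) auto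
  have "g - ?h = 0"
  proof (rule ccontr)
    assume "g - ?h \<noteq> 0"
    then have "card S \<le> card {x. poly (g - ?h) x = 0}"
      using root by (intro card_mono poly_roots_finite) auto
    also have "\<dots> \<le> degree (g - ?h)"
      by (rule card_poly_roots_bound) fact
    finally show False using deg by simp
  qed
  then show ?thesis by simp
qed

interpretation of_rat_poly_hom: map_poly_inj_idom_hom "of_rat :: rat \<Rightarrow> complex" ..

definition rat_coeffs :: "complex poly \<Rightarrow> bool" where
  "rat_coeffs p \<longleftrightarrow> (\<forall>i. coeff p i \<in> \<rat>)"

lemma rat_coeffs_iff: "rat_coeffs p \<longleftrightarrow> (\<exists>q. p = map_poly of_rat q)"
proof
  assume p: "rat_coeffs p"
  define r where "r = (\<lambda>z::complex. if z = 0 then 0 else (SOME q. z = of_rat q))"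
  have r: "of_rat (r z) = z" if "z \<in> \<rat>" for z
    using that someI_ex[of "\<lambda>q. z = of_rat q"] unfolding r_def by (auto elim!: Rats_cases)
  have "p = map_poly of_rat (map_poly r p)"
  proof (rule poly_eqI)
    fix n
    have "coeff (map_poly of_rat (map_poly r p)) n = of_rat (coeff (map_poly r p) n)"
      by (simp add: coeff_map_poly)
    also have "coeff (map_poly r p) n = r (coeff p n)" by (rule coeff_map_poly) (simp add: r_def)
    finally show "coeff p n = coeff (map_poly of_rat (map_poly r p)) n" using r p unfolding rat_coeffs_def by simp
  qed
  then show "\<exists>q. p = map_poly of_rat q" by blast
qed (auto simp: rat_coeffs_def coeff_map_poly)

lemma prod_mset_linear_neq_0: "(\<Prod>a\<in>#A. [:-a, 1::'a::idom:]) \<noteq> 0"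
  by (induction A) (auto simp del: mult_pCons_left)

lemma degree_prod_mset_linear: "degree (\<Prod>a\<in>#A. [:-a, 1::'a::idom:]) = size A"
proof (induction A)
  case (add x A)
  then show ?case
    using degree_mult_eq[of "[:-x, 1:]" "\<Prod>a\<in>#A. [:-a, 1:]"] prod_mset_linear_neq_0[of A]
    by simp
qed simp

text \<open>The product is a resultant, evaluated by the Euclidean algorithm instead of symmetric
  functions. Let f be the product of the linear factors over \<open>A\<close>. Replacing
  \<open>g\<close> by its remainder r modulo f changes no value on \<open>A\<close>; then the
  product of r(a) over \<open>A\<close> equals, up to sign and a power of the leading coefficient of
  r, the product of f(b) over the roots b of r, and there are fewer of these. Roots of r may repeat,
  hence multisets.\<close>

lemma poly_prod_mset_rational:
  assumes "rat_coeffs (\<Prod>a\<in>#A. [:-a, 1:])" "rat_coeffs g"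
  shows "(\<Prod>a\<in>#A. poly g a) \<in> \<rat>"
  using assms
proof (induction "size A" arbitrary: A g rule: less_induct)
  case less
  let ?f = "\<Prod>a\<in>#A. [:-a, 1:] :: complex poly"
  have degf: "degree ?f = size A"
    by (rule degree_prod_mset_linear)
  obtain f' g' where fg: "?f = map_poly of_rat f'" "g = map_poly of_rat g'"
    using less.prems unfolding rat_coeffs_iff by blast
  define r' where "r' = g' mod f'"
  define r where "r = (map_poly of_rat r' :: complex poly)"
  have f'0: "f' \<noteq> 0"
  proof
    assume "f' = 0"
    then have "?f = 0" using fg by simp
    then show False by (auto simp: prod_mset_zero_iff)
  qed
  have "g' = f' * (g' div f') + r'" unfolding r'_def by simp
  then have "g = ?f * map_poly of_rat (g' div f') + r"
    unfolding fg r_def by (metis of_rat_poly_hom.hom_add of_rat_poly_hom.hom_mult)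
  moreover have "poly ?f a = 0" if "a \<in># A" for a
    using that by (auto simp: poly_prod_mset prod_mset_zero_iff)
  ultimately have gr: "poly g a = poly r a" if "a \<in># A" for a
    using that by simp
  have "(\<Prod>a\<in>#A. poly g a) = (\<Prod>a\<in>#A. poly r a)"
    using gr by (metis (no_types, lifting) image_mset_cong)
  also have "\<dots> \<in> \<rat>"
  proof (cases "r = 0 \<or> size A = 0")
    case True
    then show ?thesis by (cases "A = {#}") (auto simp: prod_mset_zero_iff)
  next
    case False
    define B where "B = proots r"
    have rB: "r = smult (lead_coeff r) (\<Prod>b\<in>#B. [:-b, 1:])"
      unfolding B_def by (rule complex_poly_decompose_multiset[symmetric])
    have "degree r < size A"
    proof -
      have "r' \<noteq> 0" using False r_def by auto
      then have "degree r' < degree f'" unfolding r'_def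
        by (metis f'0 degree_mod_less)
      moreover have "degree r = degree r'" unfolding r_def by simp
      moreover have "degree f' = size A" using degf unfolding fg by simp
      ultimately show ?thesis by simp
    qed
    then have szB: "size B < size A" unfolding B_def size_proots_complex .
    have lc: "lead_coeff r \<in> \<rat>" unfolding r_def by (simp add: coeff_map_poly)
    have lc0: "lead_coeff r \<noteq> 0" using False by simp
    have "(\<Prod>b\<in>#B. [:-b, 1:]) = smult (1 / lead_coeff r) r"
      using lc0 by (subst (3) rB) simp
    moreover have "rat_coeffs r" unfolding rat_coeffs_iff r_def by blast
    ultimately have "rat_coeffs (\<Prod>b\<in>#B. [:-b, 1:])"
      using lc unfolding rat_coeffs_def by (simp add: Rats_divide)
    from less.hyps[OF szB this less.prems(1)]
    have IH: "(\<Prod>b\<in>#B. poly ?f b) \<in> \<rat>" .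
    have "poly r a = lead_coeff r * (\<Prod>b\<in>#B. a - b)" for a
      by (subst rB) (simp add: poly_prod_mset)
    then have "(\<Prod>a\<in>#A. poly r a) = lead_coeff r ^ size A * (\<Prod>a\<in>#A. \<Prod>b\<in>#B. a - b)"
      by (simp add: prod_mset.distrib)
    also have "(\<Prod>a\<in>#A. \<Prod>b\<in>#B. a - b) = (\<Prod>b\<in>#B. \<Prod>a\<in>#A. - (b - a))"
      by (subst prod_mset.swap) simp
    also have "\<dots> = (\<Prod>b\<in>#B. (-1) ^ size A * (\<Prod>a\<in>#A. b - a))"
    proof -
      have "(\<Prod>a\<in>#A. - (b - a)) = (-1) ^ size A * (\<Prod>a\<in>#A. b - a)" for b
        by (induction A) (auto simp: algebra_simps)
      then show ?thesis by simp
    qed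
    also have "\<dots> = ((-1) ^ size A) ^ size B * (\<Prod>b\<in>#B. poly ?f b)"
      by (simp add: prod_mset.distrib poly_prod_mset)
    finally show ?thesis using IH lc by (auto intro!: Rats_mult Rats_power simp del: mult_minus_left)
  qed
  finally show ?case .
qed

definition prime_ideal_over :: "nat \<Rightarrow> complex set \<Rightarrow> bool" where
  "prime_ideal_over p P \<longleftrightarrow> (\<forall>x\<in>P. algebraic_int x) \<and> (\<forall>x\<in>P. \<forall>y\<in>P. x + y \<in> P)
     \<and> (\<forall>x\<in>P. \<forall>y. algebraic_int y \<longrightarrow> y * x \<in> P)
     \<and> (\<forall>x y. algebraic_int x \<longrightarrow> algebraic_int y \<longrightarrow> x * y \<in> P \<longrightarrow> x \<in> P \<or> y \<in> P)
     \<and> of_nat p \<in> P \<and> 1 \<notin> P"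

lemma prime_ideal_over_exists: "prime p \<Longrightarrow> \<exists>P. prime_ideal_over p P"
proof (rule exists_prime_ideal[of p])
  fix P :: "complex set"
  assume *: "\<And>x. x \<in> P \<Longrightarrow> algebraic_int x"
    "\<And>x y. x \<in> P \<Longrightarrow> y \<in> P \<Longrightarrow> x + y \<in> P"
    "\<And>x y. x \<in> P \<Longrightarrow> algebraic_int y \<Longrightarrow> y * x \<in> P"
    "\<And>x y. algebraic_int x \<Longrightarrow> algebraic_int y \<Longrightarrow> x * y \<in> P \<Longrightarrow> x \<in> P \<or> y \<in> P"
    "of_nat p \<in> P" "1 \<notin> P"
  have "prime_ideal_over p P"
    unfolding prime_ideal_over_def
    by (intro conjI ballI allI impI) (rule *; assumption)+
  then show ?thesis by blast
qed

lemma prime_ideal_overD: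
  assumes "prime_ideal_over p P"
  shows "x \<in> P \<Longrightarrow> algebraic_int x"
    "x \<in> P \<Longrightarrow> y \<in> P \<Longrightarrow> x + y \<in> P"
    "x \<in> P \<Longrightarrow> algebraic_int y \<Longrightarrow> y * x \<in> P"
    "x \<in> P \<Longrightarrow> algebraic_int y \<Longrightarrow> x * y \<in> P"
    "algebraic_int x \<Longrightarrow> algebraic_int y \<Longrightarrow> x * y \<in> P \<Longrightarrow> x \<in> P \<or> y \<in> P"
    "of_nat p \<in> P" "1 \<notin> P" "0 \<in> P"
    "x \<in> P \<Longrightarrow> - x \<in> P"
    "x \<in> P \<Longrightarrow> y \<in> P \<Longrightarrow> x - y \<in> P"
proof -
  note * = assms[unfolded prime_ideal_over_def]
  show 1: "x \<in> P \<Longrightarrow> algebraic_int x" for x using * by blast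
  show 2: "x \<in> P \<Longrightarrow> y \<in> P \<Longrightarrow> x + y \<in> P" for x y using * by blast
  show 3: "x \<in> P \<Longrightarrow> algebraic_int y \<Longrightarrow> y * x \<in> P" for x y using * by blast
  then show "x \<in> P \<Longrightarrow> algebraic_int y \<Longrightarrow> x * y \<in> P" by (metis mult.commute)
  show "algebraic_int x \<Longrightarrow> algebraic_int y \<Longrightarrow> x * y \<in> P \<Longrightarrow> x \<in> P \<or> y \<in> P" using * by blast
  show 6: "of_nat p \<in> P" "1 \<notin> P" using * by blast+
  show "0 \<in> P" using 3[OF 6(1), of 0] by simp
  show 9: "x \<in> P \<Longrightarrow> - x \<in> P" for x using 3[of x "-1"] by simp
  show "x \<in> P \<Longrightarrow> y \<in> P \<Longrightarrow> x - y \<in> P" using 2[of x "-y"] 9[of y] by simp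
qed

text \<open>An integer of \<open>P\<close> prime to \<open>p\<close> would give 1 in
  \<open>P\<close> by Bezout. This turns membership in \<open>P\<close> into divisibility by
  \<open>p\<close> and back.\<close>

lemma prime_ideal_over_of_int:
  assumes "prime p" "prime_ideal_over p P"
  shows "of_int k \<in> P \<longleftrightarrow> int p dvd k"
proof
  note D = prime_ideal_overD[OF assms(2)]
  assume k: "of_int k \<in> P"
  show "int p dvd k"
  proof (rule ccontr)
    assume "\<not> int p dvd k"
    then have "Rings.coprime (int p) k" using assms(1) by (simp add: prime_imp_coprime)
    then obtain u v where uv: "u * int p + v * k = 1"
      using bezout_int[of "int p" k] by (metis coprime_imp_gcd_eq_1)
    have "of_int u * of_nat p + of_int v * of_int k \<in> P"
      by (intro D(2,3) D(6) k) auto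
    also have "of_int u * of_nat p + of_int v * of_int k = (of_int (u * int p + v * k) :: complex)"
      by simp
    finally show False using D(7) uv by simp
  qed
next
  note D = prime_ideal_overD[OF assms(2)]
  assume "int p dvd k"
  then obtain m where "k = int p * m" by (auto elim: dvdE)
  then show "of_int k \<in> P" using D(4)[OF D(6), of "of_int m"] by simp
qed

lemma prime_ideal_over_prod:
  assumes "prime_ideal_over p P" "finite I" "(\<Prod>i\<in>I. g i) \<in> P" "\<And>i. i \<in> I \<Longrightarrow> algebraic_int (g i)"
  shows "\<exists>i\<in>I. g i \<in> P"
  using assms(2-4)
proof (induction I rule: finite_induct)
  case empty
  then show ?case using prime_ideal_overD(7)[OF assms(1)] by simp
next
  case (insert i I)
  have "algebraic_int (\<Prod>i\<in>I. g i)" using insert.prems by auto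
  then have "g i \<in> P \<or> (\<Prod>i\<in>I. g i) \<in> P"
    using prime_ideal_overD(5)[OF assms(1)] insert by simp
  then show ?case using insert by auto
qed

lemma prime_ideal_over_prod_mem:
  assumes "prime_ideal_over p P" "finite I" "i \<in> I" "g i \<in> P" "\<And>i. i \<in> I \<Longrightarrow> algebraic_int (g i)"
  shows "(\<Prod>i\<in>I. g i) \<in> P"
  using assms(2-5) prime_ideal_overD(4)[OF assms(1), of "g i" "\<Prod>i\<in>I-{i}. g i"]
  by (subst prod.remove[of I i]) auto

section \<open>Conjugates, norm and discriminant\<close>

text \<open>Elements of Z[theta] are represented by integer polynomials, so that one object can be
  evaluated at all conjugates of theta and at integers modulo \<open>p\<close>.\<close>

definition ev :: "int poly \<Rightarrow> complex \<Rightarrow> complex" where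
  "ev g z = poly (map_poly of_int g) z"

definition evr :: "rat poly \<Rightarrow> complex \<Rightarrow> complex" where
  "evr g z = poly (map_poly of_rat g) z"

lemma ev_simps [simp]:
  "ev 0 z = 0" "ev 1 z = 1" "ev (g + h) z = ev g z + ev h z" "ev (g - h) z = ev g z - ev h z"
  "ev (g * h) z = ev g z * ev h z" "ev (pCons a g) z = of_int a + z * ev g z" "ev (- g) z = - ev g z"
  "ev (smult k g) z = of_int k * ev g z" "ev (monom a n) z = of_int a * z ^ n"
  unfolding ev_def by (simp_all add: hom_distribs poly_monom)

lemma evr_simps [simp]:
  "evr 0 z = 0" "evr 1 z = 1" "evr (g + h) z = evr g z + evr h z" "evr (g - h) z = evr g z - evr h z"
  "evr (g * h) z = evr g z * evr h z" "evr (pCons a g) z = of_rat a + z * evr g z" "evr (- g) z = - evr g z"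
  "evr (smult k g) z = of_rat k * evr g z"
  unfolding evr_def by (simp_all add: hom_distribs of_rat_poly_hom.hom_minus of_rat_poly_hom.hom_uminus)

lemma evr_of_int: "evr (map_poly of_int g) z = ev g z"
  unfolding evr_def ev_def by (simp add: map_poly_map_poly o_def)

lemma evr_pcompose: "evr (pcompose s q) z = evr s (evr q z)"
  by (induction s) (auto simp: pcompose_pCons)

lemma ev_of_int: "ev g (of_int k) = of_int (poly g k)"
  unfolding ev_def by simp

lemma algebraic_int_ev [intro]: "algebraic_int z \<Longrightarrow> algebraic_int (ev g z)"
  unfolding ev_def by (rule algebraic_int_poly) (auto simp: coeff_map_poly)

lemma ev_altdef: "(\<And>i. i \<ge> n \<Longrightarrow> coeff g i = 0) \<Longrightarrow> ev g z = (\<Sum>i<n. of_int (coeff g i) * z ^ i)"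
proof -
  assume *: "\<And>i. i \<ge> n \<Longrightarrow> coeff g i = 0"
  have "ev g z = (\<Sum>i\<le>degree g. of_int (coeff g i) * z ^ i)"
    unfolding ev_def poly_altdef by simp
  also have "\<dots> = (\<Sum>i<n. of_int (coeff g i) * z ^ i)"
    using * by (intro sum.mono_neutral_cong) (auto simp: not_less le_degree intro: coeff_eq_0)
  finally show ?thesis .
qed

text \<open>The quotient has integer coefficients and serves every \<open>z\<close> at once, so its
  value at an algebraic integer is integral; a congruence between \<open>z\<close> and
  \<open>r\<close> therefore passes to the values of \<open>g\<close>.\<close>

lemma ev_diff_dvd: "\<exists>q. \<forall>z. ev g z - of_int (poly g r) = (z - of_int r) * ev q z"
proof -
  have "[:- r, 1:] dvd g - [:poly g r:]" by (simp add: poly_eq_0_iff_dvd[symmetric])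
  then obtain q where "g - [:poly g r:] = [:- r, 1:] * q" by (auto elim: dvdE)
  then have "ev (g - [:poly g r:]) z = ev ([:- r, 1:] * q) z" for z by simp
  then have "ev g z - of_int (poly g r) = (z - of_int r) * ev q z" for z
    by (simp add: algebra_simps del: mult_pCons_left)
  then show ?thesis by blast
qed

locale number_field_poly =
  fixes f :: "int poly" and d :: nat
  assumes monic: "lead_coeff f = 1" and deg: "degree f = d" and d_pos: "d \<ge> 1"
    and irr: "irreducible (map_poly of_int f :: rat poly)"
begin

definition \<Theta> :: "complex set" where "\<Theta> = {z. ev f z = 0}"

abbreviation "fr \<equiv> (map_poly of_int f :: rat poly)"
abbreviation "fc \<equiv> (map_poly of_int f :: complex poly)"

lemma fr_dvd:
  assumes "\<theta> \<in> \<Theta>" "evr g \<theta> = 0"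
  shows "fr dvd g"
proof (rule ccontr)
  assume "\<not> fr dvd g"
  then have "Rings.coprime fr g"
    using irr by (simp add: prime_elem_imp_coprime irreducible_imp_prime_elem_gcd)
  then obtain a b where ab: "a * fr + b * g = 1"
    using bezout_coefficients_fst_snd[of fr g] by (metis coprime_imp_gcd_eq_1)
  have "evr (a * fr + b * g) \<theta> = 0"
    using assms by (simp add: evr_of_int \<Theta>_def)
  then show False unfolding ab by simp
qed

text \<open>Takes the place of the embedding of Q(theta) that sends one root of \<open>f\<close> to
  another.\<close>

lemma evr_conj: "\<theta> \<in> \<Theta> \<Longrightarrow> \<theta>' \<in> \<Theta> \<Longrightarrow> evr g \<theta> = 0 \<Longrightarrow> evr g \<theta>' = 0"
  using fr_dvd[of \<theta> g] by (auto simp: dvd_def evr_of_int \<Theta>_def)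

lemma evr_eq_0_imp: "\<theta> \<in> \<Theta> \<Longrightarrow> evr g \<theta> = 0 \<Longrightarrow> degree g < d \<Longrightarrow> g = 0"
  using fr_dvd[of \<theta> g] dvd_imp_degree_le[of fr g] deg by auto

lemma ev_eq_0_imp: "\<theta> \<in> \<Theta> \<Longrightarrow> ev g \<theta> = 0 \<Longrightarrow> degree g < d \<Longrightarrow> g = 0"
  using evr_eq_0_imp[of \<theta> "map_poly of_int g"] by (simp add: evr_of_int)

lemma f_nz: "f \<noteq> 0" using deg d_pos by auto

lemma finite_\<Theta> [simp]: "finite \<Theta>"
  unfolding \<Theta>_def ev_def using f_nz by (intro poly_roots_finite) simp

lemma pderiv_neq_0:
  assumes "\<theta> \<in> \<Theta>" shows "ev (pderiv f) \<theta> \<noteq> 0"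
proof
  assume "ev (pderiv f) \<theta> = 0"
  moreover have "degree (pderiv f) < d" using deg d_pos by (simp add: degree_pderiv)
  ultimately have "pderiv f = 0" using ev_eq_0_imp assms by blast
  then show False using deg d_pos by (simp add: pderiv_eq_0_iff)
qed

lemma ev_pderiv: "ev (pderiv g) z = poly (pderiv (map_poly of_int g)) z"
  unfolding ev_def by (simp add: of_int_hom.map_poly_pderiv)

lemma rsquarefree_fc: "rsquarefree fc"
  unfolding rsquarefree_roots using pderiv_neq_0 ev_pderiv[of f] unfolding \<Theta>_def by (auto simp: ev_def)

lemma fc_prod: "fc = (\<Prod>z\<in>\<Theta>. [:-z, 1:])"
  using complex_poly_decompose_rsquarefree[OF rsquarefree_fc] monic unfolding \<Theta>_def ev_def by simp

lemma card_\<Theta>: "card \<Theta> = d"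
proof -
  have "d = degree fc" using deg by simp
  also have "\<dots> = card \<Theta>" unfolding fc_prod by (subst degree_prod_eq_sum_degree) auto
  finally show ?thesis by simp
qed

lemma \<Theta>_ne: "\<Theta> \<noteq> {}" using card_\<Theta> d_pos by auto

lemma ev_f_prod: "ev f z = (\<Prod>\<theta>\<in>\<Theta>. z - \<theta>)"
  unfolding ev_def by (subst fc_prod) (simp add: poly_prod)

lemma algebraic_int_\<Theta> [intro]: "\<theta> \<in> \<Theta> \<Longrightarrow> algebraic_int \<theta>"
  unfolding algebraic_int_altdef_ipoly using monic by (auto simp: \<Theta>_def ev_def)

lemma prod_rational: "(\<Prod>\<theta>\<in>\<Theta>. evr g \<theta>) \<in> \<rat>"
proof -
  have "(\<Prod>a\<in>#mset_set \<Theta>. [:-a, 1:]) = fc" by (simp add: fc_prod prod_unfold_prod_mset)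
  moreover have "rat_coeffs fc" unfolding rat_coeffs_def by (simp add: coeff_map_poly)
  moreover have "rat_coeffs (map_poly of_rat g)" unfolding rat_coeffs_iff by blast
  ultimately show ?thesis using poly_prod_mset_rational[of "mset_set \<Theta>" "map_poly of_rat g"]
    unfolding evr_def by (simp add: prod_unfold_prod_mset)
qed

lemma prod_ev_Ints: "(\<Prod>\<theta>\<in>\<Theta>. ev g \<theta>) \<in> \<int>"
  using prod_rational[of "map_poly of_int g"] unfolding evr_of_int
  by (intro rational_algebraic_int_is_int) auto

text \<open>The resultant of \<open>f\<close> and \<open>g\<close>; \<open>prod_ev_Ints\<close>
  supplies the integer that the description selects.\<close>

definition Nm :: "int poly \<Rightarrow> int" where "Nm g = (THE k. of_int k = (\<Prod>\<theta>\<in>\<Theta>. ev g \<theta>))"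

lemma of_int_Nm: "of_int (Nm g) = (\<Prod>\<theta>\<in>\<Theta>. ev g \<theta>)"
proof -
  obtain k where k: "(\<Prod>\<theta>\<in>\<Theta>. ev g \<theta>) = of_int k" using prod_ev_Ints by (auto elim: Ints_cases)
  show ?thesis unfolding Nm_def k by simp
qed

lemma Nm_eq_0_iff: "degree g < d \<Longrightarrow> Nm g = 0 \<longleftrightarrow> g = 0"
proof -
  assume g: "degree g < d"
  have "Nm g = 0 \<longleftrightarrow> (of_int (Nm g) = (0::complex))" by simp
  also have "\<dots> \<longleftrightarrow> (\<exists>\<theta>\<in>\<Theta>. ev g \<theta> = 0)" unfolding of_int_Nm by simp
  also have "\<dots> \<longleftrightarrow> g = 0" using ev_eq_0_imp[OF _ _ g] \<Theta>_ne by auto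
  finally show ?thesis .
qed

lemma Nm_linear: "Nm [:k, 1:] = (-1) ^ d * poly f (- k)"
proof -
  have "of_int (Nm [:k, 1:]) = (\<Prod>\<theta>\<in>\<Theta>. - (of_int (- k) - \<theta>))"
    unfolding of_int_Nm by (simp add: algebra_simps)
  also have "\<dots> = (-1) ^ d * ev f (of_int (-k))"
    unfolding ev_f_prod by (subst prod_uminus) (simp add: card_\<Theta>)
  also have "\<dots> = of_int ((-1) ^ d * poly f (-k))" unfolding ev_of_int by simp
  finally show ?thesis by (simp only: of_int_eq_iff)
qed

text \<open>Up to sign the discriminant of \<open>f\<close>.\<close>

definition discr :: int where "discr = Nm (pderiv f)"

lemma discr_neq_0: "discr \<noteq> 0"
proof -
  have "of_int discr \<noteq> (0::complex)"
    unfolding discr_def of_int_Nm using pderiv_neq_0 by simp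
  then show ?thesis by simp
qed

lemma ev_pderiv_prod: "\<theta> \<in> \<Theta> \<Longrightarrow> ev (pderiv f) \<theta> = (\<Prod>t\<in>\<Theta>-{\<theta>}. \<theta> - t)"
proof -
  assume \<theta>: "\<theta> \<in> \<Theta>"
  have "fc = [:-\<theta>, 1:] * (\<Prod>z\<in>\<Theta>-{\<theta>}. [:-z, 1:])"
    unfolding fc_prod using \<theta> by (subst prod.remove[of _ \<theta>]) auto
  then have "pderiv fc = pderiv ([:-\<theta>, 1:] * (\<Prod>z\<in>\<Theta>-{\<theta>}. [:-z, 1:]))" by simp
  also have "\<dots> = (\<Prod>z\<in>\<Theta>-{\<theta>}. [:-z, 1:]) + [:-\<theta>, 1:] * pderiv (\<Prod>z\<in>\<Theta>-{\<theta>}. [:-z, 1:])"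
    by (subst pderiv_mult) (simp add: pderiv_pCons del: mult_pCons_left)
  finally show ?thesis unfolding ev_pderiv by (simp add: poly_prod)
qed

text \<open>The familiar fact that the discriminant multiplies integral elements into Z[theta].
  Interpolation at the conjugates a writes the coefficients of discr s as sums of discr s(a) / f'(a)
  times coefficients of products of linear factors X - b. Each ingredient is an algebraic integer
  and the result is rational, hence an integer.\<close>

lemma discr_integral:
  assumes "degree s < d" "\<And>\<theta>. \<theta> \<in> \<Theta> \<Longrightarrow> algebraic_int (evr s \<theta>)"
  obtains t where "degree t < d" "\<And>z. ev t z = of_int discr * evr s z"
proof -
  define sc where "sc = (map_poly of_rat s :: complex poly)"
  have "sc = (\<Sum>a\<in>\<Theta>. smult (poly sc a / (\<Prod>b\<in>\<Theta>-{a}. a - b)) (\<Prod>b\<in>\<Theta>-{a}. [:-b, 1:]))"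
    by (rule lagrange_interpolation) (use assms(1) card_\<Theta> in \<open>auto simp: sc_def\<close>)
  also have "\<dots> = (\<Sum>a\<in>\<Theta>. smult (evr s a / ev (pderiv f) a) (\<Prod>b\<in>\<Theta>-{a}. [:-b, 1:]))"
    by (intro sum.cong) (auto simp: ev_pderiv_prod sc_def evr_def)
  finally have "smult (of_int discr) sc =
      (\<Sum>a\<in>\<Theta>. smult (of_int discr * (evr s a / ev (pderiv f) a)) (\<Prod>b\<in>\<Theta>-{a}. [:-b, 1:]))"
    by (metis (no_types, lifting) smult_sum2 smult_smult sum.cong)
  then have coeff: "coeff (smult (of_int discr) sc) i =
      (\<Sum>a\<in>\<Theta>. of_int discr * (evr s a / ev (pderiv f) a) * coeff (\<Prod>b\<in>\<Theta>-{a}. [:-b, 1:]) i)" for i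
    by (simp add: coeff_sum)
  \<comment> \<open>f'(a) divides \<open>discr\<close>, the cofactor being the product of the other
    conjugates of f'(theta).\<close>
  have ai: "algebraic_int (of_int discr * (evr s a / ev (pderiv f) a))" if a: "a \<in> \<Theta>" for a
  proof -
    have "of_int discr = ev (pderiv f) a * (\<Prod>t\<in>\<Theta>-{a}. ev (pderiv f) t)"
      unfolding discr_def of_int_Nm using a by (subst prod.remove[of _ a]) auto
    then have "of_int discr * (evr s a / ev (pderiv f) a) = evr s a * (\<Prod>t\<in>\<Theta>-{a}. ev (pderiv f) t)"
      using pderiv_neq_0[OF a] by simp
    then show ?thesis using assms(2)[OF a] by auto
  qed
  have ac: "algebraic_int (coeff (\<Prod>b\<in>A. [:-b, 1:]) i)" if "A \<subseteq> \<Theta>" for A i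
    using finite_subset[OF that finite_\<Theta>] that
  proof (induction A arbitrary: i rule: finite_induct)
    case empty
    then show ?case by (cases i) (auto simp: coeff_pCons split: nat.splits)
  next
    case (insert x F)
    then have "algebraic_int x" by auto
    with insert show ?case
      by (cases i) (auto simp: coeff_pCons intro!: algebraic_int_add algebraic_int_mult algebraic_int_diff)
  qed
  have "coeff (smult (of_int discr) sc) i \<in> \<int>" for i
  proof (rule rational_algebraic_int_is_int)
    show "algebraic_int (coeff (smult (of_int discr) sc) i)"
      unfolding coeff by (intro algebraic_int_sum algebraic_int_mult ai ac) auto
    show "coeff (smult (of_int discr) sc) i \<in> \<rat>" unfolding sc_def by (simp add: coeff_map_poly)
  qed
  then have "\<forall>i. \<exists>k. coeff (smult (of_int discr) sc) i = of_int k"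
    by (metis Ints_cases)
  then obtain k where k: "\<And>i. coeff (smult (of_int discr) sc) i = of_int (k i)" by metis
  define t where "t = (\<Sum>i<d. monom (k i) i)"
  have degsc: "degree (smult (of_int discr) sc) < d"
    using assms(1) by (simp add: sc_def)
  have "map_poly of_int t = smult (of_int discr) sc"
  proof (rule poly_eqI)
    fix n
    have "coeff t n = (if n < d then k n else 0)"
      unfolding t_def by (simp add: coeff_sum)
    moreover have "k n = 0" if "\<not> n < d"
      using k[of n] coeff_eq_0[of "smult (of_int discr) sc" n] degsc that by simp
    ultimately show "coeff (map_poly of_int t) n = coeff (smult (of_int discr) sc) n"
      using k by (auto simp: coeff_map_poly)
  qed
  then have ev: "ev t z = of_int discr * evr s z" for z
    unfolding ev_def evr_def sc_def by simp
  have "degree t < d"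
    using \<open>map_poly of_int t = smult (of_int discr) sc\<close> degsc by (metis of_int_hom.degree_map_poly_hom)
  then show thesis using that ev by blast
qed

text \<open>The product of the other conjugates of g(theta) is the norm divided by g(theta), so it
  is an integral element of Q(theta), and \<open>discr\<close> moves it into Z[theta]. A single
  \<open>t\<close> works at all conjugates.\<close>

lemma exists_cofactor:
  assumes "Nm g \<noteq> 0"
  shows "\<exists>t. degree t < d \<and> (\<forall>\<theta>\<in>\<Theta>. ev t \<theta> * ev g \<theta> = of_int (discr * Nm g))
    \<and> (\<forall>\<theta>\<in>\<Theta>. ev t \<theta> = of_int discr * (\<Prod>t\<in>\<Theta>-{\<theta>}. ev g t))"
proof -
  have nz: "ev g \<theta> \<noteq> 0" if "\<theta> \<in> \<Theta>" for \<theta>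
  proof
    assume "ev g \<theta> = 0"
    then have "of_int (Nm g) = (0::complex)" unfolding of_int_Nm using that by auto
    then show False using assms by simp
  qed
  have "\<not> fr dvd map_poly of_int g"
  proof
    assume "fr dvd map_poly of_int g"
    then obtain k where "map_poly of_int g = fr * k" by (auto elim: dvdE)
    then have "evr (map_poly of_int g) \<theta> = evr (fr * k) \<theta>" for \<theta> by simp
    then have "evr (map_poly of_int g) \<theta> = 0" if "\<theta> \<in> \<Theta>" for \<theta>
      using that by (simp add: evr_of_int \<Theta>_def)
    then show False using nz \<Theta>_ne by (auto simp: evr_of_int)
  qed
  then have "Rings.coprime fr (map_poly of_int g)"
    using irr by (simp add: prime_elem_imp_coprime irreducible_imp_prime_elem_gcd)
  then obtain a b where ab: "a * fr + b * map_poly of_int g = 1"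
    using bezout_coefficients_fst_snd[of fr "map_poly of_int g"] by (metis coprime_imp_gcd_eq_1)
  \<comment> \<open>\<open>b\<close> inverts \<open>g\<close> modulo \<open>f\<close>, so
    \<open>s\<close> represents the norm divided by g(theta).\<close>
  define s where "s = smult (of_int (Nm g)) b mod fr"
  have degs: "degree s < d" unfolding s_def
    using degree_mod_less'[of fr "smult (of_int (Nm g)) b"] f_nz deg d_pos
    by (cases "smult (of_int (Nm g)) b mod fr = 0") auto
  have b: "evr b \<theta> * ev g \<theta> = 1" if "\<theta> \<in> \<Theta>" for \<theta>
  proof -
    have "evr (a * fr + b * map_poly of_int g) \<theta> = 1" unfolding ab by simp
    then show ?thesis using that by (simp add: evr_of_int \<Theta>_def)
  qed
  have evs: "evr s \<theta> = of_int (Nm g) * evr b \<theta>" if "\<theta> \<in> \<Theta>" for \<theta>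
  proof -
    have "smult (of_int (Nm g)) b = fr * (smult (of_int (Nm g)) b div fr) + s"
      unfolding s_def by simp
    then have "evr (smult (of_int (Nm g)) b) \<theta> = evr (fr * (smult (of_int (Nm g)) b div fr) + s) \<theta>" by simp
    then show ?thesis using that by (simp add: evr_of_int \<Theta>_def)
  qed
  have evs': "evr s \<theta> = (\<Prod>t\<in>\<Theta>-{\<theta>}. ev g t)" if "\<theta> \<in> \<Theta>" for \<theta>
  proof -
    have "evr s \<theta> * ev g \<theta> = of_int (Nm g)" using evs[OF that] b[OF that] by simp
    also have "\<dots> = ev g \<theta> * (\<Prod>t\<in>\<Theta>-{\<theta>}. ev g t)"
      unfolding of_int_Nm using that by (subst prod.remove[of _ \<theta>]) auto
    finally show ?thesis using nz[OF that] by simp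
  qed
  then have "algebraic_int (evr s \<theta>)" if "\<theta> \<in> \<Theta>" for \<theta>
    using that by auto
  then obtain t where t: "degree t < d" "\<And>z. ev t z = of_int discr * evr s z"
    using discr_integral[OF degs] by blast
  show ?thesis
  proof (intro exI[of _ t] conjI ballI t(1))
    fix \<theta> assume \<theta>: "\<theta> \<in> \<Theta>"
    show "ev t \<theta> = of_int discr * (\<Prod>t\<in>\<Theta>-{\<theta>}. ev g t)" using t(2) evs'[OF \<theta>] by simp
    show "ev t \<theta> * ev g \<theta> = of_int (discr * Nm g)"
      using t(2) evs[OF \<theta>] b[OF \<theta>] by simp
  qed
qed

end

section \<open>Ideals of polynomials and boxes of coefficients\<close>

text \<open>The coefficient range is a parameter because three ranges occur: the symmetric box,
  {0..m} for the pigeonhole argument, and residues modulo an integer.\<close>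

definition coeff_box :: "nat \<Rightarrow> int set \<Rightarrow> int poly set" where
  "coeff_box n S = {g. (\<forall>i\<ge>n. coeff g i = 0) \<and> (\<forall>i<n. coeff g i \<in> S)}"

lemma coeff_box_0: "coeff_box 0 S = {0}"
  unfolding coeff_box_def by (auto simp: poly_eq_iff)

lemma coeff_box_Suc: "coeff_box (Suc n) S = (\<lambda>(a, g). pCons a g) ` (S \<times> coeff_box n S)"
proof (intro equalityI subsetI)
  fix g assume g: "g \<in> coeff_box (Suc n) S"
  obtain a h where gh: "g = pCons a h" by (cases g)
  have "a \<in> S" using g unfolding coeff_box_def gh by (auto dest: spec[of _ 0])
  moreover have "h \<in> coeff_box n S"
    using g unfolding coeff_box_def gh by (auto simp: coeff_pCons split: nat.splits)
  ultimately show "g \<in> (\<lambda>(a, g). pCons a g) ` (S \<times> coeff_box n S)" using gh by auto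
qed (auto simp: coeff_box_def coeff_pCons split: nat.splits)

lemma finite_coeff_box [simp]: "finite S \<Longrightarrow> finite (coeff_box n S)"
  by (induction n) (auto simp: coeff_box_0 coeff_box_Suc)

lemma card_coeff_box: "finite S \<Longrightarrow> card (coeff_box n S) = card S ^ n"
proof (induction n)
  case (Suc n)
  have "inj_on (\<lambda>(a, g). pCons a g) (S \<times> coeff_box n S)" by (auto simp: inj_on_def)
  then show ?case using Suc by (simp add: coeff_box_Suc card_image card_cartesian_product)
qed (simp add: coeff_box_0)

lemma degree_coeff_box: "g \<in> coeff_box n S \<Longrightarrow> n > 0 \<Longrightarrow> degree g < n"
  unfolding coeff_box_def
  by (metis (mono_tags, lifting) degree_0 leading_coeff_0_iff mem_Collect_eq not_le_imp_less)

abbreviation Box :: "nat \<Rightarrow> nat \<Rightarrow> int poly set" where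
  "Box n H \<equiv> coeff_box n {- int H..int H}"

lemma BoxI: "degree g < n \<Longrightarrow> (\<And>i. \<bar>coeff g i\<bar> \<le> int H) \<Longrightarrow> g \<in> Box n H"
  unfolding coeff_box_def by (auto simp: coeff_eq_0 abs_le_iff minus_le_iff)

lemma BoxD: "g \<in> Box n H \<Longrightarrow> \<bar>coeff g i\<bar> \<le> int H"
  unfolding coeff_box_def by (cases "i < n") (auto simp: abs_le_iff minus_le_iff)

lemma card_Box: "card (Box n H) = (2 * H + 1) ^ n"
  by (simp add: card_coeff_box nat_add_distrib nat_mult_distrib)

lemma Box_add: "g \<in> Box n H \<Longrightarrow> h \<in> Box n K \<Longrightarrow> g + h \<in> Box n (H + K)"
  unfolding coeff_box_def by force

lemma Box_diff: "g \<in> Box n H \<Longrightarrow> h \<in> Box n K \<Longrightarrow> g - h \<in> Box n (H + K)"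
  unfolding coeff_box_def by force

section \<open>Counting the points of an ideal in a box\<close>

context number_field_poly
begin

lemma ev_Box_bound:
  obtains C :: nat where "C \<ge> 1"
    "\<And>T g \<theta>. \<theta> \<in> \<Theta> \<Longrightarrow> degree g < d \<Longrightarrow> (\<And>i. real_of_int \<bar>coeff g i\<bar> \<le> T) \<Longrightarrow> norm (ev g \<theta>) \<le> real C * T"
proof -
  define C0 where "C0 = (\<Sum>\<theta>\<in>\<Theta>. \<Sum>i<d. norm \<theta> ^ i)"
  obtain C1 :: nat where C1: "C0 \<le> real C1" using real_arch_simple by blast
  show thesis
  proof (rule that[of "C1 + 1"])
    fix T g \<theta> assume \<theta>: "\<theta> \<in> \<Theta>" and g: "degree g < d" and b: "\<And>i. real_of_int \<bar>coeff g i\<bar> \<le> T"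
    have T: "T \<ge> 0" using b[of 0] by linarith
    have "norm (ev g \<theta>) = norm (\<Sum>i<d. of_int (coeff g i) * \<theta> ^ i)"
      by (subst ev_altdef[of d]) (use g in \<open>auto intro: coeff_eq_0\<close>)
    also have "\<dots> \<le> (\<Sum>i<d. T * norm \<theta> ^ i)"
      using b by (intro order_trans[OF norm_sum] sum_mono) (auto simp: norm_mult norm_power intro!: mult_right_mono)
    also have "\<dots> = T * (\<Sum>i<d. norm \<theta> ^ i)" by (simp add: sum_distrib_left)
    also have "(\<Sum>i<d. norm \<theta> ^ i) \<le> C0"
      unfolding C0_def by (rule member_le_sum[OF \<theta>]) (auto intro: sum_nonneg)
    then have "T * (\<Sum>i<d. norm \<theta> ^ i) \<le> T * real (C1 + 1)"
      using C1 T by (intro mult_left_mono) auto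
    finally show "norm (ev g \<theta>) \<le> real (C1 + 1) * T" by (simp add: mult.commute)
  qed auto
qed

text \<open>Interpolation at the conjugates recovers the coefficients linearly from the values.
  Together with \<open>ev_Box_bound\<close>, size of coefficients and size of conjugates are
  equivalent up to constants in degree below \<open>d\<close>.\<close>

lemma coeff_bound:
  obtains C :: nat where "C \<ge> 1"
    "\<And>T g i. degree g < d \<Longrightarrow> (\<And>\<theta>. \<theta> \<in> \<Theta> \<Longrightarrow> norm (ev g \<theta>) \<le> T) \<Longrightarrow> real_of_int \<bar>coeff g i\<bar> \<le> real C * T"
proof -
  define L where "L = (\<lambda>a. \<Prod>b\<in>\<Theta>-{a}. [:-b, 1:])"
  define w where "w = (\<lambda>a. \<Prod>b\<in>\<Theta>-{a}. a - b)"
  define C0 where "C0 = (\<Sum>i<d. \<Sum>a\<in>\<Theta>. norm (coeff (L a) i / w a))"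
  obtain C1 :: nat where C1: "C0 \<le> real C1" using real_arch_simple by blast
  show thesis
  proof (rule that[of "C1 + 1"])
    fix T g i assume g: "degree g < d" and b: "\<And>\<theta>. \<theta> \<in> \<Theta> \<Longrightarrow> norm (ev g \<theta>) \<le> T"
    have T: "T \<ge> 0" using b \<Theta>_ne norm_ge_zero order_trans by blast
    show "real_of_int \<bar>coeff g i\<bar> \<le> real (C1 + 1) * T"
    proof (cases "i < d")
      case True
      have "map_poly of_int g = (\<Sum>a\<in>\<Theta>. smult (ev g a / w a) (L a))"
        unfolding ev_def w_def L_def
        by (rule lagrange_interpolation) (use g card_\<Theta> in auto)
      then have "coeff (map_poly of_int g) i = (\<Sum>a\<in>\<Theta>. ev g a / w a * coeff (L a) i)"
        by (simp add: coeff_sum)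
      then have "of_int (coeff g i) = (\<Sum>a\<in>\<Theta>. ev g a * (coeff (L a) i / w a))"
        by (simp add: coeff_map_poly)
      then have "norm (of_int (coeff g i) :: complex) = norm (\<Sum>a\<in>\<Theta>. ev g a * (coeff (L a) i / w a))"
        by simp
      also have "\<dots> \<le> (\<Sum>a\<in>\<Theta>. T * norm (coeff (L a) i / w a))"
        using b by (intro order_trans[OF norm_sum] sum_mono) (auto simp: norm_mult norm_divide intro!: mult_right_mono divide_right_mono)
      also have "\<dots> = T * (\<Sum>a\<in>\<Theta>. norm (coeff (L a) i / w a))" by (simp add: sum_distrib_left)
      also have "(\<Sum>a\<in>\<Theta>. norm (coeff (L a) i / w a)) \<le> C0"
        unfolding C0_def using True by (intro member_le_sum[of i "{..<d}"]) (auto intro: sum_nonneg)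
      then have "T * (\<Sum>a\<in>\<Theta>. norm (coeff (L a) i / w a)) \<le> T * real (C1 + 1)"
        using C1 T by (intro mult_left_mono) auto
      finally show ?thesis by (simp add: mult.commute)
    next
      case False
      then have "coeff g i = 0" using g by (intro coeff_eq_0) auto
      then show ?thesis using T by simp
    qed
  qed auto
qed

lemma mod_f: obtains q r where "g = f * q + r" "degree r < d"
proof -
  obtain q r where qr: "pseudo_divmod g f = (q, r)" by fastforce
  from pseudo_divmod[OF f_nz qr] monic deg d_pos have "g = f * q + r" "degree r < d" by auto
  then show thesis by (rule that)
qed

text \<open>Ideals of Z[X] containing \<open>f\<close> are the preimages of the ideals of Z[theta];
  this spares the quotient ring.\<close>

definition lattice_ideal :: "int poly set \<Rightarrow> bool" where
  "lattice_ideal J \<longleftrightarrow> (\<forall>g\<in>J. \<forall>h\<in>J. g + h \<in> J) \<and> (\<forall>g\<in>J. \<forall>q. q * g \<in> J) \<and> f \<in> J"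

lemma lattice_idealD:
  assumes "lattice_ideal J"
  shows "g \<in> J \<Longrightarrow> h \<in> J \<Longrightarrow> g + h \<in> J" "g \<in> J \<Longrightarrow> q * g \<in> J" "g \<in> J \<Longrightarrow> g * q \<in> J" "f \<in> J" "0 \<in> J"
    "g \<in> J \<Longrightarrow> - g \<in> J" "g \<in> J \<Longrightarrow> h \<in> J \<Longrightarrow> g - h \<in> J"
proof -
  note * = assms[unfolded lattice_ideal_def]
  show 1: "g \<in> J \<Longrightarrow> h \<in> J \<Longrightarrow> g + h \<in> J" for g h using * by blast
  show 2: "g \<in> J \<Longrightarrow> q * g \<in> J" for g q using * by blast
  then show "g \<in> J \<Longrightarrow> g * q \<in> J" by (metis mult.commute)
  show "f \<in> J" using * by blast
  then show "0 \<in> J" using 2[of f 0] by simp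
  show 6: "g \<in> J \<Longrightarrow> - g \<in> J" for g using 2[of g "-1"] by simp
  show "g \<in> J \<Longrightarrow> h \<in> J \<Longrightarrow> g - h \<in> J" using 1[of g "-h"] 6[of h] by simp
qed

definition res_class :: "int poly set \<Rightarrow> int poly \<Rightarrow> int poly set" where
  "res_class J g = {h. h - g \<in> J}"

text \<open>\<open>card\<close> is 0 on infinite sets, which is why finiteness of the set of classes
  accompanies each statement about the index.\<close>

definition index :: "int poly set \<Rightarrow> nat" where
  "index J = card (range (res_class J))"

lemma res_class_eq_iff: "lattice_ideal J \<Longrightarrow> res_class J g = res_class J h \<longleftrightarrow> g - h \<in> J"
proof
  assume J: "lattice_ideal J" "res_class J g = res_class J h"
  have "g \<in> res_class J g" using lattice_idealD(5)[OF J(1)] unfolding res_class_def by simp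
  then have "g \<in> res_class J h" using J(2) by simp
  then show "g - h \<in> J" unfolding res_class_def by simp
next
  assume J: "lattice_ideal J" "g - h \<in> J"
  have "x - g \<in> J \<longleftrightarrow> x - h \<in> J" for x
  proof
    assume "x - g \<in> J"
    then show "x - h \<in> J" using lattice_idealD(1)[OF J(1) _ J(2), of "x - g"] by simp
  next
    assume "x - h \<in> J"
    then show "x - g \<in> J" using lattice_idealD(7)[OF J(1) _ J(2), of "x - h"] by simp
  qed
  then show "res_class J g = res_class J h" unfolding res_class_def by simp
qed

text \<open>Pigeonhole instead of Minkowski: the box with coefficients 0..m has more points than
  there are classes, and the difference of two congruent points is short.\<close>

lemma small_element:
  assumes J: "lattice_ideal J" "finite (range (res_class J))" and m: "index J < (m + 1) ^ d"
  obtains b where "b \<in> J" "b \<noteq> 0" "b \<in> Box d m"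
proof -
  let ?A = "coeff_box d {0..int m}"
  have "card ?A = (m + 1) ^ d" by (simp add: card_coeff_box nat_add_distrib)
  moreover have "card (res_class J ` ?A) \<le> index J"
    unfolding index_def by (rule card_mono[OF J(2)]) blast
  ultimately have "card (res_class J ` ?A) < card ?A"
    using m by linarith
  then have "\<not> inj_on (res_class J) ?A" by (rule pigeonhole)
  then obtain g h where gh: "g \<in> ?A" "h \<in> ?A" "g \<noteq> h" "g - h \<in> J"
    unfolding inj_on_def res_class_eq_iff[OF J(1)] by blast
  have "g - h \<in> Box d m" using gh(1,2) unfolding coeff_box_def by force
  then show thesis using that[of "g - h"] gh by simp
qed

text \<open>Division with remainder by a short element \<open>b\<close> of \<open>J\<close>:
  subtract from \<open>g\<close> the multiple \<open>b s\<close>, where \<open>s\<close> is the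
  quotient g/b rounded coefficientwise. The remainder is \<open>b\<close> times a fractional part,
  so its conjugates are bounded by a constant times \<open>m\<close>. The ring structure makes
  \<open>C\<close> independent of \<open>J\<close>; a general lattice of that index could be long
  and thin.\<close>

lemma small_representatives:
  obtains C :: nat where "C \<ge> 1"
    "\<And>J m g. lattice_ideal J \<Longrightarrow> finite (range (res_class J)) \<Longrightarrow> index J < (m + 1) ^ d \<Longrightarrow>
       \<exists>g'\<in>Box d (C * m). g' - g \<in> J"
proof -
  obtain C1 :: nat where C1: "C1 \<ge> 1"
    "\<And>T g \<theta>. \<theta> \<in> \<Theta> \<Longrightarrow> degree g < d \<Longrightarrow> (\<And>i. real_of_int \<bar>coeff g i\<bar> \<le> T) \<Longrightarrow> norm (ev g \<theta>) \<le> real C1 * T"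
    using ev_Box_bound by blast
  obtain C2 :: nat where C2: "C2 \<ge> 1"
    "\<And>T g i. degree g < d \<Longrightarrow> (\<And>\<theta>. \<theta> \<in> \<Theta> \<Longrightarrow> norm (ev g \<theta>) \<le> T) \<Longrightarrow> real_of_int \<bar>coeff g i\<bar> \<le> real C2 * T"
    using coeff_bound by blast
  show thesis
  proof (rule that[of "C2 * C1 * C1"])
    show "1 \<le> C2 * C1 * C1" using C1(1) C2(1) by simp
    fix J m g assume J: "lattice_ideal J" "finite (range (res_class J))" "index J < (m + 1) ^ d"
    obtain b where b: "b \<in> J" "b \<noteq> 0" "b \<in> Box d m" using small_element[OF J] by blast
    have degb: "degree b < d" using degree_coeff_box[OF b(3)] d_pos by simp
    have nz: "Nm b \<noteq> 0" using Nm_eq_0_iff[OF degb] b(2) by simp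
    obtain t where t: "degree t < d" "\<And>\<theta>. \<theta> \<in> \<Theta> \<Longrightarrow> ev t \<theta> * ev b \<theta> = of_int (discr * Nm b)"
      using exists_cofactor[OF nz] by blast
    \<comment> \<open>Since t b = M at every conjugate, g/b = g t / M = u/M there.\<close>
    define M where "M = discr * Nm b"
    have M: "M \<noteq> 0" unfolding M_def using nz discr_neq_0 by simp
    obtain q u where u: "g * t = f * q + u" "degree u < d" using mod_f by blast
    have evu: "ev u \<theta> = ev g \<theta> * ev t \<theta>" if "\<theta> \<in> \<Theta>" for \<theta>
    proof -
      have "ev (g * t) \<theta> = ev (f * q + u) \<theta>" using u(1) by simp
      then show ?thesis using that by (simp add: \<Theta>_def)
    qed
    \<comment> \<open>Integral part of u/M, coefficient by coefficient; \<rho>/M is the fractional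
      part.\<close>
    define s where "s = map_poly (\<lambda>c. c div M) u"
    define \<rho> where "\<rho> = map_poly (\<lambda>c. c mod M) u"
    have u_eq: "u = smult M s + \<rho>"
      by (rule poly_eqI) (simp add: s_def \<rho>_def coeff_map_poly)
    have "degree \<rho> < d" using u(2) degree_map_poly_le[of "\<lambda>c. c mod M" u] unfolding \<rho>_def by linarith
    moreover have "real_of_int \<bar>coeff \<rho> i\<bar> \<le> real_of_int \<bar>M\<bar>" for i
      unfolding \<rho>_def using M abs_mod_less[of M "coeff u i"] by (simp add: coeff_map_poly)
    ultimately have ev\<rho>: "norm (ev \<rho> \<theta>) \<le> real C1 * real_of_int \<bar>M\<bar>" if "\<theta> \<in> \<Theta>" for \<theta>
      using C1(2)[OF that] by blast
    have evb: "norm (ev b \<theta>) \<le> real C1 * real m" if "\<theta> \<in> \<Theta>" for \<theta>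
      using BoxD[OF b(3)] by (intro C1(2)[OF that degb]) (metis of_int_le_iff of_int_of_nat_eq)
    obtain q' g' where g': "g - b * s = f * q' + g'" "degree g' < d" using mod_f by blast
    have evg': "norm (ev g' \<theta>) \<le> real C1 * real C1 * real m" if \<theta>: "\<theta> \<in> \<Theta>" for \<theta>
    proof -
      have "ev (g - b * s) \<theta> = ev (f * q' + g') \<theta>" using g'(1) by simp
      then have 1: "ev g' \<theta> = ev g \<theta> - ev b \<theta> * ev s \<theta>" using \<theta> by (simp add: \<Theta>_def)
      have "of_int M * ev g' \<theta> = ev b \<theta> * (ev g \<theta> * ev t \<theta> - of_int M * ev s \<theta>)"
        using t(2)[OF \<theta>] unfolding 1 M_def[symmetric] by (simp add: algebra_simps)
      also have "ev g \<theta> * ev t \<theta> - of_int M * ev s \<theta> = ev \<rho> \<theta>"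
        unfolding evu[OF \<theta>, symmetric] by (subst u_eq) simp
      finally have "norm (of_int M * ev g' \<theta>) = norm (ev b \<theta>) * norm (ev \<rho> \<theta>)"
        by (simp add: norm_mult)
      also have "\<dots> \<le> (real C1 * real m) * (real C1 * real_of_int \<bar>M\<bar>)"
        using evb[OF \<theta>] ev\<rho>[OF \<theta>] by (intro mult_mono) auto
      finally show ?thesis using M by (simp add: norm_mult field_simps)
    qed
    have "real_of_int \<bar>coeff g' i\<bar> \<le> real (C2 * C1 * C1 * m)" for i
      using C2(2)[OF g'(2) evg', of i] by (simp add: mult_ac)
    then have "\<bar>coeff g' i\<bar> \<le> int (C2 * C1 * C1 * m)" for i
      by (metis of_int_le_iff of_int_of_nat_eq)
    then have "g' \<in> Box d (C2 * C1 * C1 * m)" using g'(2) by (intro BoxI) auto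
    moreover have "g' - g = - (f * q' + b * s)" using g'(1) by (simp add: algebra_simps)
    then have "g' - g \<in> J" using lattice_idealD[OF J(1)] b(1) by simp
    ultimately show "\<exists>g'\<in>Box d (C2 * C1 * C1 * m). g' - g \<in> J" by blast
  qed
qed

text \<open>Tiling: adding to each point of \<open>J\<close> in the box a short representative of
  each class gives distinct polynomials, since the class is recovered modulo \<open>J\<close>. They
  lie in the box enlarged by C m, and they fill the box shrunk by C m, because every polynomial
  minus the representative of its own class is in \<open>J\<close>.\<close>

lemma lattice_count:
  "\<exists>C::nat. C \<ge> 1 \<and> (\<forall>J m H. lattice_ideal J \<longrightarrow> finite (range (res_class J)) \<longrightarrow> index J < (m + 1) ^ d \<longrightarrow>
     index J * card (J \<inter> Box d H) \<le> (2 * (H + C * m) + 1) ^ d \<and>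
     (C * m \<le> H \<longrightarrow> (2 * (H - C * m) + 1) ^ d \<le> index J * card (J \<inter> Box d H)))"
proof -
  obtain C :: nat where C: "C \<ge> 1"
    "\<And>J m g. lattice_ideal J \<Longrightarrow> finite (range (res_class J)) \<Longrightarrow> index J < (m + 1) ^ d \<Longrightarrow>
       \<exists>g'\<in>Box d (C * m). g' - g \<in> J"
    using small_representatives by blast
  have rep: "\<exists>rep. \<forall>g. rep (res_class J g) \<in> Box d (C * m) \<and> rep (res_class J g) - g \<in> J"
    if J: "lattice_ideal J" "finite (range (res_class J))" "index J < (m + 1) ^ d" for J m
  proof -
    have "\<forall>c. \<exists>g'. c \<in> range (res_class J) \<longrightarrow> g' \<in> Box d (C * m) \<and> g' \<in> c"
      using C(2)[OF J] unfolding res_class_def by blast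
    then obtain rep where "\<forall>c. c \<in> range (res_class J) \<longrightarrow> rep c \<in> Box d (C * m) \<and> rep c \<in> c"
      by metis
    then show ?thesis unfolding res_class_def by (intro exI[of _ rep]) auto
  qed
  show ?thesis
  proof (rule exI[of _ C], rule conjI[OF C(1)], intro allI impI)
    fix J m H assume J: "lattice_ideal J" "finite (range (res_class J))" "index J < (m + 1) ^ d"
    note D = lattice_idealD[OF J(1)]
    obtain rep where rep: "\<And>g. rep (res_class J g) \<in> Box d (C * m)" "\<And>g. rep (res_class J g) - g \<in> J"
      using rep[OF J] by blast
    let ?D = "range (res_class J) \<times> (J \<inter> Box d H)"
    let ?F = "\<lambda>(c, h). h + rep c"
    have cD: "card ?D = index J * card (J \<inter> Box d H)" unfolding index_def by (rule card_cartesian_product)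
    have inj: "inj_on ?F ?D"
    proof (rule inj_onI, clarify)
      fix g h g' h' assume *: "h \<in> J" "h' \<in> J" "h + rep (res_class J g) = h' + rep (res_class J g')"
      have "g - g' = (rep (res_class J g') - g') - (rep (res_class J g) - g) + (h' - h)
          + ((h + rep (res_class J g)) - (h' + rep (res_class J g')))"
        by (simp add: algebra_simps)
      also have "\<dots> \<in> J" using D rep *(1,2) unfolding *(3) by simp
      finally have "res_class J g = res_class J g'" using res_class_eq_iff[OF J(1)] by simp
      then show "res_class J g = res_class J g' \<and> h = h'" using * by simp
    qed
    have "?F ` ?D \<subseteq> Box d (H + C * m)"
    proof (rule image_subsetI)
      fix x assume "x \<in> ?D"
      then obtain c h where x: "x = (c, h)" "c \<in> range (res_class J)" "h \<in> Box d H" by blast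
      then obtain g where "c = res_class J g" by blast
      then show "?F x \<in> Box d (H + C * m)" using Box_add[OF x(3) rep(1)[of g]] x(1) by simp
    qed
    then have "card ?D \<le> card (Box d (H + C * m))"
      by (rule card_inj_on_le[OF inj]) simp
    then have upper: "index J * card (J \<inter> Box d H) \<le> (2 * (H + C * m) + 1) ^ d"
      unfolding cD card_Box .
    have lower: "(2 * (H - C * m) + 1) ^ d \<le> index J * card (J \<inter> Box d H)" if H: "C * m \<le> H"
    proof -
    have "Box d (H - C * m) \<subseteq> ?F ` ?D"
    proof
      fix b assume b: "b \<in> Box d (H - C * m)"
      have "b - rep (res_class J b) \<in> Box d ((H - C * m) + C * m)" using Box_diff[OF b rep(1)] .
      then have "b - rep (res_class J b) \<in> Box d H" using H by simp
      moreover have "b - rep (res_class J b) \<in> J" using D(6)[OF rep(2)[of b]] by simp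
      ultimately have "(res_class J b, b - rep (res_class J b)) \<in> ?D" by blast
      then show "b \<in> ?F ` ?D" by (rule rev_image_eqI) simp
    qed
    then have "card (Box d (H - C * m)) \<le> card ?D"
      using J(2) by (intro surj_card_le) auto
    then show ?thesis
      unfolding cD card_Box .
    qed
    show "index J * card (J \<inter> Box d H) \<le> (2 * (H + C * m) + 1) ^ d \<and>
      (C * m \<le> H \<longrightarrow> (2 * (H - C * m) + 1) ^ d \<le> index J * card (J \<inter> Box d H))"
      using upper lower by blast
  qed
qed

text \<open>Chosen once, so that later bounds can name the constant and remain visibly uniform in
  the ideal and the box.\<close>

definition lattice_const :: nat where
  "lattice_const = (SOME C::nat. C \<ge> 1 \<and> (\<forall>J m H. lattice_ideal J \<longrightarrow> finite (range (res_class J)) \<longrightarrow> index J < (m + 1) ^ d \<longrightarrow>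
     index J * card (J \<inter> Box d H) \<le> (2 * (H + C * m) + 1) ^ d \<and>
     (C * m \<le> H \<longrightarrow> (2 * (H - C * m) + 1) ^ d \<le> index J * card (J \<inter> Box d H))))"

lemmas lattice_const_spec = someI_ex[OF lattice_count, folded lattice_const_def]

lemma lattice_const_ge_1: "lattice_const \<ge> 1"
  by (rule lattice_const_spec[THEN conjunct1])

lemma lattice_count_le:
  assumes "lattice_ideal J" "finite (range (res_class J))" "index J < (m + 1) ^ d"
  shows "index J * card (J \<inter> Box d H) \<le> (2 * (H + lattice_const * m) + 1) ^ d"
  by (rule lattice_const_spec[THEN conjunct2, rule_format, THEN conjunct1, OF assms])

lemma lattice_count_ge:
  assumes "lattice_ideal J" "finite (range (res_class J))" "index J < (m + 1) ^ d" "lattice_const * m \<le> H"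
  shows "(2 * (H - lattice_const * m) + 1) ^ d \<le> index J * card (J \<inter> Box d H)"
  by (rule lattice_const_spec[THEN conjunct2, rule_format, THEN conjunct2, rule_format, OF assms])

text \<open>Reduction modulo the monic \<open>f\<close>, followed by reduction of the coefficients
  modulo \<open>M\<close>, leaves finitely many representatives.\<close>

lemma finite_res_classes:
  assumes J: "lattice_ideal J" and M: "[:M:] \<in> J" "M > 0"
  shows "finite (range (res_class J))"
proof (rule finite_subset)
  show "range (res_class J) \<subseteq> res_class J ` coeff_box d {0..<M}"
  proof (rule image_subsetI)
    fix g
    obtain q r where qr: "g = f * q + r" "degree r < d" using mod_f by blast
    define r1 where "r1 = map_poly (\<lambda>c. c mod M) r"
    define r2 where "r2 = map_poly (\<lambda>c. c div M) r"
    have r: "r = [:M:] * r2 + r1"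
      by (rule poly_eqI) (simp add: r1_def r2_def coeff_map_poly)
    have "r1 \<in> coeff_box d {0..<M}"
      using qr(2) M(2) unfolding coeff_box_def r1_def by (auto simp: coeff_map_poly coeff_eq_0)
    moreover have "g - r1 = f * q + [:M:] * r2" using qr(1) r by simp
    then have "g - r1 \<in> J" using lattice_idealD[OF J] M(1) by (metis (no_types))
    ultimately show "res_class J g \<in> res_class J ` coeff_box d {0..<M}"
      using res_class_eq_iff[OF J] by blast
  qed
qed simp

lemma index_ge:
  assumes J: "lattice_ideal J" "finite (range (res_class J))"
    and S: "\<And>g h. g \<in> S \<Longrightarrow> h \<in> S \<Longrightarrow> g - h \<in> J \<Longrightarrow> g = h"
  shows "card S \<le> index J"
proof -
  have "inj_on (res_class J) S" unfolding inj_on_def res_class_eq_iff[OF J(1)] using S by blast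
  then have "card S = card (res_class J ` S)" by (simp add: card_image)
  also have "\<dots> \<le> index J" unfolding index_def by (rule card_mono[OF J(2)]) blast
  finally show ?thesis .
qed

text \<open>For a prime \<open>p\<close> dividing f(r) this is the degree-one prime (p, theta - r),
  as a preimage in Z[X].\<close>

definition root_ideal :: "nat \<Rightarrow> int \<Rightarrow> int poly set" where
  "root_ideal p r = {g. int p dvd poly g r}"

lemma root_ideal:
  assumes "p > 0" "int p dvd poly f r"
  shows "lattice_ideal (root_ideal p r)" "finite (range (res_class (root_ideal p r)))"
    "index (root_ideal p r) = p"
proof -
  show J: "lattice_ideal (root_ideal p r)"
    unfolding lattice_ideal_def root_ideal_def using assms by simp
  show fin: "finite (range (res_class (root_ideal p r)))"
    by (rule finite_res_classes[OF J, of "int p"]) (use assms in \<open>auto simp: root_ideal_def\<close>)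
  have "card ((\<lambda>k. [:k:]) ` {0..<int p}) \<le> index (root_ideal p r)"
  proof (rule index_ge[OF J fin])
    fix g h assume "g \<in> (\<lambda>k. [:k:]) ` {0..<int p}" "h \<in> (\<lambda>k. [:k:]) ` {0..<int p}"
      and d: "g - h \<in> root_ideal p r"
    then obtain a b where ab: "g = [:a:]" "h = [:b:]" "0 \<le> a" "a < int p" "0 \<le> b" "b < int p" by auto
    then have "int p dvd a - b" using d by (simp add: root_ideal_def)
    then have "a = b" using ab by (metis mod_eq_dvd_iff mod_pos_pos_trivial)
    then show "g = h" using ab by simp
  qed
  moreover have "card ((\<lambda>k. [:k:]) ` {0..<int p}) = p" by (simp add: card_image inj_on_def)
  moreover have "index (root_ideal p r) \<le> card {0..<int p}"
    unfolding index_def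
  proof (rule surj_card_le)
    show "range (res_class (root_ideal p r)) \<subseteq> (\<lambda>k. res_class (root_ideal p r) [:k:]) ` {0..<int p}"
    proof (rule image_subsetI)
      fix g
      have "g - [:poly g r mod int p:] \<in> root_ideal p r"
        unfolding root_ideal_def by (simp add: mod_eq_dvd_iff[symmetric])
      then have "res_class (root_ideal p r) g = res_class (root_ideal p r) [:poly g r mod int p:]"
        using res_class_eq_iff[OF J] by blast
      then show "res_class (root_ideal p r) g \<in> (\<lambda>k. res_class (root_ideal p r) [:k:]) ` {0..<int p}"
        using assms by (intro image_eqI[of _ _ "poly g r mod int p"]) auto
    qed
  qed simp
  ultimately show "index (root_ideal p r) = p" by simp
qed

lemma exists_int_root: "\<exists>m. m ^ d \<le> Q \<and> Q < (m + 1) ^ d" for Q :: nat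
proof (induction Q)
  case 0
  then show ?case using d_pos by (intro exI[of _ 0]) auto
next
  case (Suc Q)
  then obtain m where m: "m ^ d \<le> Q" "Q < (m + 1) ^ d" by blast
  show ?case
  proof (cases "Suc Q < (m + 1) ^ d")
    case True
    then show ?thesis using m by (intro exI[of _ m]) auto
  next
    case False
    then have "Suc Q = (m + 1) ^ d" using m by simp
    moreover have "(m + 1) ^ d < (m + 1 + 1) ^ d" using d_pos by (intro power_strict_mono) auto
    ultimately show ?thesis by (intro exI[of _ "m + 1"]) auto
  qed
qed

text \<open>For ideals whose index is only known from below. With \<open>m\<close> the integer d-th
  root of the index, (a + b)^d \<le> 2^d (a^d + b^d) separates the volume term from the boundary
  term; the latter is a constant multiple of the index and leaves the summand 1.\<close>

lemma lattice_count_upper: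
  "\<exists>C::real. C > 0 \<and> (\<forall>J q H. lattice_ideal J \<longrightarrow> finite (range (res_class J)) \<longrightarrow> q > 0 \<longrightarrow> q \<le> index J \<longrightarrow>
       real (card (J \<inter> Box d H)) \<le> C * ((2 * real H + 1) ^ d / real q + 1))"
proof -
  define C where "C = lattice_const"
  note C = lattice_const_ge_1[folded C_def] lattice_count_le[folded C_def]
  have aux: "k \<le> c * (A / Q + B)" if "Q > 0" "Q * k \<le> c * (A + B * Q)" for k A B c Q :: real
  proof -
    have "A + B * Q = Q * (A / Q + B)" using that(1) by (simp add: distrib_left mult.commute)
    then have "c * (A + B * Q) = Q * (c * (A / Q + B))" by (metis mult.left_commute)
    then have "Q * k \<le> Q * (c * (A / Q + B))" using that(2) by metis
    then show ?thesis by (rule mult_left_le_imp_le) (rule that(1))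
  qed
  have aux2: "c * (B * A + B) = c * B * (A + 1)" for A B c :: real
    by (simp add: algebra_simps)
  show ?thesis
  proof (rule exI[of _ "2 ^ d * (2 * real C) ^ d"], intro conjI allI impI)
    show "0 < 2 ^ d * (2 * real C) ^ d" using C(1) by simp
    fix J q H assume J: "lattice_ideal J" "finite (range (res_class J))" and q: "q > 0" "q \<le> index J"
    obtain m where m: "m ^ d \<le> index J" "index J < (m + 1) ^ d" using exists_int_root by blast
    let ?Q = "real (index J)"
    have Q: "?Q > 0" using q by simp
    have "real (index J * card (J \<inter> Box d H)) \<le> real ((2 * (H + C * m) + 1) ^ d)"
      using C(2)[OF J m(2), of H] by (rule of_nat_mono)
    also have "real ((2 * (H + C * m) + 1) ^ d) = ((2 * real H + 1) + 2 * real C * real m) ^ d"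
      by (simp add: algebra_simps)
    finally have "?Q * card (J \<inter> Box d H) \<le> ((2 * real H + 1) + 2 * real C * real m) ^ d"
      by simp
    also have "\<dots> \<le> 2 ^ d * ((2 * real H + 1) ^ d + (2 * real C * real m) ^ d)"
    proof -
      define a where "a = 2 * real H + 1"
      define b where "b = 2 * real C * real m"
      have ab: "a \<ge> 0" "b \<ge> 0" unfolding a_def b_def by auto
      have "(a + b) ^ d \<le> (2 * max a b) ^ d" using ab by (intro power_mono) auto
      also have "\<dots> = 2 ^ d * (max a b) ^ d" by (simp add: power_mult_distrib)
      also have "\<dots> \<le> 2 ^ d * (a ^ d + b ^ d)" using ab by (auto simp: max_def)
      finally show ?thesis unfolding a_def b_def .
    qed
    also have "(2 * real C * real m) ^ d \<le> (2 * real C) ^ d * ?Q"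
    proof -
      have "real m ^ d \<le> ?Q" using m(1) by (metis of_nat_le_iff of_nat_power)
      then show ?thesis by (simp add: power_mult_distrib mult_left_mono)
    qed
    finally have "?Q * card (J \<inter> Box d H) \<le> 2 ^ d * ((2 * real H + 1) ^ d + (2 * real C) ^ d * ?Q)"
      by simp
    then have "real (card (J \<inter> Box d H)) \<le> 2 ^ d * ((2 * real H + 1) ^ d / ?Q + (2 * real C) ^ d)"
      by (rule aux[OF Q])
    also have "(2 * real H + 1) ^ d / ?Q \<le> (2 * real C) ^ d * ((2 * real H + 1) ^ d / real q)"
    proof -
      have "(2 * real H + 1) ^ d / ?Q \<le> 1 * ((2 * real H + 1) ^ d / real q)"
        using q by (simp add: divide_left_mono)
      also have "\<dots> \<le> (2 * real C) ^ d * ((2 * real H + 1) ^ d / real q)"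
        using C(1) by (intro mult_right_mono one_le_power) auto
      finally show ?thesis .
    qed
    finally show "real (card (J \<inter> Box d H)) \<le> 2 ^ d * (2 * real C) ^ d * ((2 * real H + 1) ^ d / real q + 1)"
      unfolding aux2 by simp
  qed
qed

lemma f_dvd:
  assumes "\<theta> \<in> \<Theta>" "ev g \<theta> = 0"
  shows "f dvd g"
proof -
  obtain q r where qr: "g = f * q + r" "degree r < d" using mod_f by blast
  have "ev r \<theta> = 0" using assms unfolding qr(1) by (simp add: \<Theta>_def)
  then have "r = 0" using ev_eq_0_imp[OF assms(1) _ qr(2)] by blast
  then show ?thesis using qr(1) by simp
qed

section \<open>Exceptional ideals of index at least p^2\<close>

text \<open>Otherwise f'(theta), as the product of the differences of theta with the other roots,
  would lie in \<open>P\<close>, and with it the discriminant.\<close>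

lemma conjugates_incongruent:
  assumes p: "prime p" "prime_ideal_over p P" "\<not> int p dvd discr"
    and \<theta>: "\<theta> \<in> \<Theta>" "\<theta>' \<in> \<Theta>" "\<theta> \<noteq> \<theta>'"
  shows "\<theta> - \<theta>' \<notin> P"
proof
  assume "\<theta> - \<theta>' \<in> P"
  then have "(\<Prod>t\<in>\<Theta>-{\<theta>}. \<theta> - t) \<in> P"
    using \<theta> by (intro prime_ideal_over_prod_mem[OF p(2), of _ \<theta>']) auto
  then have "ev (pderiv f) \<theta> \<in> P" using ev_pderiv_prod[OF \<theta>(1)] by simp
  then have "of_int discr \<in> P"
    unfolding discr_def of_int_Nm using \<theta>
    by (intro prime_ideal_over_prod_mem[OF p(2), of _ \<theta>]) auto
  then show False using prime_ideal_over_of_int[OF p(1,2)] p(3) by blast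
qed

text \<open>For two different conjugates, or for one congruent to no integer, the members are
  polynomials whose norm is divisible by \<open>p\<close> for a reason other than a single root of
  \<open>f\<close> modulo \<open>p\<close>.\<close>

definition conj_ideal :: "complex set \<Rightarrow> complex set \<Rightarrow> int poly set" where
  "conj_ideal P T = {g. \<forall>\<theta>\<in>T. ev g \<theta> \<in> P}"

text \<open>The preimage under \<open>g \<mapsto> g(\<theta>)\<close> of \<open>(p\<^sup>2)\<close> localised at \<open>P\<close>.\<close>

definition conj_sq_ideal :: "nat \<Rightarrow> complex set \<Rightarrow> complex \<Rightarrow> int poly set" where
  "conj_sq_ideal p P \<theta> = {g. \<exists>s q1 q2. ev s \<theta> \<notin> P \<and> s * g = [:int p ^ 2:] * q1 + f * q2}"

lemma conj_ideal_lattice: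
  assumes p: "prime p" "prime_ideal_over p P" and T: "T \<subseteq> \<Theta>"
  shows "lattice_ideal (conj_ideal P T)" "finite (range (res_class (conj_ideal P T)))"
proof -
  note D = prime_ideal_overD[OF p(2)]
  show J: "lattice_ideal (conj_ideal P T)"
    unfolding lattice_ideal_def
  proof (intro conjI ballI allI)
    fix g q assume g: "g \<in> conj_ideal P T"
    have "ev q \<theta> * ev g \<theta> \<in> P" if "\<theta> \<in> T" for \<theta>
      using that g T by (intro D(3)) (auto simp: conj_ideal_def)
    then show "q * g \<in> conj_ideal P T" unfolding conj_ideal_def by simp
  next
    show "f \<in> conj_ideal P T" using T D(8) unfolding conj_ideal_def \<Theta>_def by auto
  qed (use D(2) in \<open>auto simp: conj_ideal_def\<close>)
  have "[:int p:] \<in> conj_ideal P T" unfolding conj_ideal_def using D(6) by simp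
  then show "finite (range (res_class (conj_ideal P T)))"
    using finite_res_classes[OF J] p(1) prime_gt_0_nat by simp
qed

lemma inverse_mod_prime:
  assumes "prime (p::nat)" "\<not> int p dvd b"
  obtains u v where "u * b = 1 + int p * v"
proof -
  have "Rings.coprime (int p) b" using assms by (simp add: prime_imp_coprime)
  then obtain u v where "u * int p + v * b = 1"
    using bezout_int[of "int p" b] by (metis coprime_imp_gcd_eq_1)
  then have "v * b = 1 + int p * (- u)" by (simp add: algebra_simps)
  then show thesis using that by blast
qed

text \<open>Common end of the two index bounds: once the linear coefficient of the difference
  vanishes modulo \<open>p\<close>, its constant coefficient is an integer lying in
  \<open>P\<close>.\<close>

lemma linear_pair_incongruent:
  assumes p: "prime p" "prime_ideal_over p P"
    and ab: "g \<in> (\<lambda>(a, b). [:a, b:]) ` ({0..<int p} \<times> {0..<int p})"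
      "h \<in> (\<lambda>(a, b). [:a, b:]) ` ({0..<int p} \<times> {0..<int p})"
    and diff: "\<And>a b. g - h = [:a, b:] \<Longrightarrow> int p dvd b"
    and ev: "ev (g - h) \<theta> \<in> P" and \<theta>: "algebraic_int \<theta>"
  shows "g = h"
proof -
  note D = prime_ideal_overD[OF p(2)]
  obtain a b a' b' where *: "g = [:a, b:]" "h = [:a', b':]" "0 \<le> a" "a < int p" "0 \<le> b" "b < int p"
    "0 \<le> a'" "a' < int p" "0 \<le> b'" "b' < int p" using ab by auto
  have "int p dvd b - b'" using diff[of "a - a'" "b - b'"] * by simp
  then have bb: "b = b'" using * by (metis mod_eq_dvd_iff mod_pos_pos_trivial)
  then have "of_int (a - a') \<in> P" using ev * by simp
  then have "int p dvd a - a'" using prime_ideal_over_of_int[OF p] by blast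
  then have "a = a'" using * by (metis mod_eq_dvd_iff mod_pos_pos_trivial)
  then show ?thesis using * bb by simp
qed

lemma card_linear_pairs: "card ((\<lambda>(a, b). [:a, b:]) ` ({0..<int p} \<times> {0..<int p})) = p ^ 2"
proof -
  have "inj_on (\<lambda>(a, b). [:a, b:]) ({0..<int p} \<times> {0..<int p})" by (auto simp: inj_on_def)
  then show ?thesis by (simp add: card_image card_cartesian_product power2_eq_square)
qed

text \<open>If a + b theta lay in \<open>P\<close> with \<open>b\<close> invertible modulo
  \<open>p\<close>, then theta would be congruent to an integer. So the residue ring contains the
  p^2 distinct classes of such linear forms.\<close>

lemma index_conj_ideal_single:
  assumes p: "prime p" "prime_ideal_over p P" and \<theta>: "\<theta> \<in> \<Theta>" "\<And>r. \<theta> - of_int r \<notin> P"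
  shows "p ^ 2 \<le> index (conj_ideal P {\<theta>})"
proof -
  note D = prime_ideal_overD[OF p(2)]
  have "card ((\<lambda>(a, b). [:a, b:]) ` ({0..<int p} \<times> {0..<int p})) \<le> index (conj_ideal P {\<theta>})"
  proof (rule index_ge)
    fix g h assume gh: "g \<in> (\<lambda>(a, b). [:a, b:]) ` ({0..<int p} \<times> {0..<int p})"
      "h \<in> (\<lambda>(a, b). [:a, b:]) ` ({0..<int p} \<times> {0..<int p})" and d: "g - h \<in> conj_ideal P {\<theta>}"
    show "g = h"
    proof (rule linear_pair_incongruent[OF p gh])
      show evP: "ev (g - h) \<theta> \<in> P" using d unfolding conj_ideal_def by blast
      show "algebraic_int \<theta>" using \<theta> by blast
      fix a b assume ab: "g - h = [:a, b:]"
      show "int p dvd b"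
      proof (rule ccontr)
        assume "\<not> int p dvd b"
        then obtain u v where uv: "u * b = 1 + int p * v" using inverse_mod_prime[OF p(1)] by blast
        have "of_int u * (of_int a + \<theta> * of_int b) - of_nat p * (of_int v * \<theta>) \<in> P"
          using evP ab \<theta>(1) by (intro D(10) D(3) D(4) D(6)) auto
        also have "of_int u * (of_int a + \<theta> * of_int b) - of_nat p * (of_int v * \<theta>)
            = of_int (u * a) + \<theta> * (of_int (u * b) - of_int (int p * v))"
          by (simp add: algebra_simps)
        also have "\<dots> = \<theta> - of_int (- (u * a))" unfolding uv by simp
        finally show False using \<theta>(2) by blast
      qed
    qed
  qed (use conj_ideal_lattice[OF p, of "{\<theta>}"] \<theta> in auto)
  then show ?thesis unfolding card_linear_pairs .
qed

text \<open>Subtracting the two conditions leaves b (theta - theta') in \<open>P\<close>, and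
  distinct conjugates are incongruent, so \<open>p\<close> divides \<open>b\<close>.\<close>

lemma index_conj_ideal_pair:
  assumes p: "prime p" "prime_ideal_over p P" "\<not> int p dvd discr"
    and \<theta>: "\<theta> \<in> \<Theta>" "\<theta>' \<in> \<Theta>" "\<theta> \<noteq> \<theta>'"
  shows "p ^ 2 \<le> index (conj_ideal P {\<theta>, \<theta>'})"
proof -
  note D = prime_ideal_overD[OF p(2)]
  have "card ((\<lambda>(a, b). [:a, b:]) ` ({0..<int p} \<times> {0..<int p})) \<le> index (conj_ideal P {\<theta>, \<theta>'})"
  proof (rule index_ge)
    fix g h assume gh: "g \<in> (\<lambda>(a, b). [:a, b:]) ` ({0..<int p} \<times> {0..<int p})"
      "h \<in> (\<lambda>(a, b). [:a, b:]) ` ({0..<int p} \<times> {0..<int p})" and d: "g - h \<in> conj_ideal P {\<theta>, \<theta>'}"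
    show "g = h"
    proof (rule linear_pair_incongruent[OF p(1,2) gh])
      show evP: "ev (g - h) \<theta> \<in> P" using d unfolding conj_ideal_def by blast
      have evP': "ev (g - h) \<theta>' \<in> P" using d unfolding conj_ideal_def by blast
      show "algebraic_int \<theta>" using \<theta> by blast
      fix a b assume ab: "g - h = [:a, b:]"
      have "(of_int a + \<theta> * of_int b) - (of_int a + \<theta>' * of_int b) \<in> P"
        using evP evP' ab by (intro D(10)) auto
      then have "of_int b * (\<theta> - \<theta>') \<in> P" by (simp add: algebra_simps)
      then have "of_int b \<in> P \<or> \<theta> - \<theta>' \<in> P" using \<theta> by (intro D(5)) auto
      then show "int p dvd b" using conjugates_incongruent[OF p \<theta>] prime_ideal_over_of_int[OF p(1,2)] by blast
    qed
  qed (use conj_ideal_lattice[OF p(1,2), of "{\<theta>, \<theta>'}"] \<theta> in auto)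
  then show ?thesis unfolding card_linear_pairs .
qed

lemma conj_sq_ideal_lattice:
  assumes p: "prime p" "prime_ideal_over p P" and \<theta>: "\<theta> \<in> \<Theta>"
  shows "lattice_ideal (conj_sq_ideal p P \<theta>)" "finite (range (res_class (conj_sq_ideal p P \<theta>)))"
proof -
  note D = prime_ideal_overD[OF p(2)]
  let ?J = "conj_sq_ideal p P \<theta>"
  show J: "lattice_ideal ?J"
    unfolding lattice_ideal_def
  proof (intro conjI ballI allI)
    fix g h assume "g \<in> ?J" "h \<in> ?J"
    then obtain s1 q1 q2 s3 q3 q4 where *: "ev s1 \<theta> \<notin> P" "s1 * g = [:int p ^ 2:] * q1 + f * q2"
      "ev s3 \<theta> \<notin> P" "s3 * h = [:int p ^ 2:] * q3 + f * q4"
      unfolding conj_sq_ideal_def by blast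
    have "ev (s1 * s3) \<theta> \<notin> P" using D(5)[of "ev s1 \<theta>" "ev s3 \<theta>"] * \<theta> by auto
    moreover have "(s1 * s3) * (g + h) = s3 * (s1 * g) + s1 * (s3 * h)" by (simp add: algebra_simps)
    then have "(s1 * s3) * (g + h) = [:int p ^ 2:] * (s3 * q1 + s1 * q3) + f * (s3 * q2 + s1 * q4)"
      unfolding * by (simp add: algebra_simps smult_add_right)
    ultimately show "g + h \<in> ?J" unfolding conj_sq_ideal_def by blast
  next
    fix g q assume "g \<in> ?J"
    then obtain s1 q1 q2 where *: "ev s1 \<theta> \<notin> P" "s1 * g = [:int p ^ 2:] * q1 + f * q2"
      unfolding conj_sq_ideal_def by blast
    have "s1 * (q * g) = q * (s1 * g)" by (simp add: algebra_simps)
    also have "\<dots> = [:int p ^ 2:] * (q * q1) + f * (q * q2)"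
      unfolding * by (simp only: distrib_left mult.left_commute)
    finally show "q * g \<in> ?J" unfolding conj_sq_ideal_def using *(1) by blast
  next
    have "1 * f = [:int p ^ 2:] * 0 + f * 1" by simp
    moreover have "ev 1 \<theta> \<notin> P" using D(7) by simp
    ultimately show "f \<in> ?J" unfolding conj_sq_ideal_def by blast
  qed
  have "1 * [:int p ^ 2:] = [:int p ^ 2:] * 1 + f * 0" by simp
  moreover have "ev 1 \<theta> \<notin> P" using D(7) by simp
  ultimately have "[:int p ^ 2:] \<in> ?J" unfolding conj_sq_ideal_def by blast
  then show "finite (range (res_class ?J))"
    using finite_res_classes[OF J, of "int p ^ 2"] p(1) prime_gt_0_nat by simp
qed

text \<open>If p^2 does not divide \<open>k\<close>, then gcd(k, p^2) divides \<open>p\<close>, and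
  Bezout replaces \<open>k\<close> by \<open>p\<close>: s p = p^2 a + f b. As \<open>f\<close> is
  monic, \<open>p\<close> divides \<open>b\<close> by Gauss's lemma; cancelling \<open>p\<close>
  gives s = p a + f b', so s(theta) would lie in \<open>P\<close>.\<close>

lemma const_in_conj_sq_ideal:
  assumes p: "prime p" "prime_ideal_over p P" and \<theta>: "\<theta> \<in> \<Theta>" and k: "[:k:] \<in> conj_sq_ideal p P \<theta>"
  shows "int (p ^ 2) dvd k"
proof (rule ccontr)
  note D = prime_ideal_overD[OF p(2)]
  assume n: "\<not> int (p ^ 2) dvd k"
  obtain s q1 q2 where s: "ev s \<theta> \<notin> P" "s * [:k:] = [:int p ^ 2:] * q1 + f * q2"
    using k unfolding conj_sq_ideal_def by blast
  define g where "g = gcd k (int p ^ 2)"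
  have "g dvd int p ^ 2" "g \<ge> 0" unfolding g_def by auto
  then obtain i where i: "i \<le> 2" "g = int p ^ i"
    using divides_primepow[of "int p" g 2] p(1) by (metis abs_of_nonneg normalize_int_def prime_int_nat_transfer prime_nat_int_transfer)
  have "i \<noteq> 2"
  proof
    assume "i = 2"
    then have "int p ^ 2 dvd k" using i unfolding g_def by (metis gcd_dvd1)
    then show False using n by simp
  qed
  then have "i = 0 \<or> i = 1" using i(1) by linarith
  then have "g dvd int p" using i(2) by auto
  then obtain e where e: "int p = g * e" by (auto elim: dvdE)
  obtain u v where uv: "u * k + v * (int p)^2 = g" unfolding g_def using bezout_int by blast
  have "s * [:int p:] = [:e:] * (s * [:g:])" unfolding e by (simp add: algebra_simps)
  also have "[:g:] = [:u:] * [:k:] + [:int p ^ 2:] * [:v:]" unfolding uv[symmetric] by (simp add: algebra_simps)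
  also have "s * ([:u:] * [:k:] + [:int p ^ 2:] * [:v:]) = [:u:] * (s * [:k:]) + [:int p ^ 2:] * ([:v:] * s)"
    by (simp only: distrib_left mult.left_commute mult.commute)
  also have "[:e:] * \<dots> = [:int p ^ 2:] * ([:e:] * ([:u:] * q1 + [:v:] * s)) + f * ([:e:] * ([:u:] * q2))"
    unfolding s(2) by (simp only: distrib_left mult.left_commute add.assoc add.commute add.left_commute)
  finally obtain a b where ab: "s * [:int p:] = [:int p ^ 2:] * a + f * b" by blast
  have pp: "[:int p ^ 2:] = [:int p:] * [:int p:]" by (simp add: power2_eq_square)
  have "f * b = [:int p:] * (s - [:int p:] * a)"
    using ab unfolding pp by (simp only: algebra_simps)
  then have "[:int p:] dvd f * b" by (metis dvd_triv_left)
  moreover have "prime_elem [:int p:]" using p(1) by (simp add: prime_elem_const_poly_iff)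
  moreover have "\<not> [:int p:] dvd f"
  proof
    assume "[:int p:] dvd f"
    then have "int p dvd lead_coeff f" by (simp add: const_poly_dvd_iff)
    then show False using monic p(1) by (auto simp: prime_nat_iff)
  qed
  ultimately have "[:int p:] dvd b" using prime_elem_dvd_mult_iff by blast
  then obtain b' where b': "b = [:int p:] * b'" by (auto elim: dvdE)
  have "[:int p:] * s = [:int p:] * ([:int p:] * a + f * b')"
    using ab unfolding pp b' by (simp only: algebra_simps)
  then have "s = [:int p:] * a + f * b'" using p(1) by (subst (asm) mult_cancel_left) auto
  then have "ev s \<theta> = ev ([:int p:] * a + f * b') \<theta>" by simp
  then have "ev s \<theta> = of_nat p * ev a \<theta>" using \<theta> by (simp add: \<Theta>_def)
  moreover have "of_nat p * ev a \<theta> \<in> P" using \<theta> by (intro D(4) D(6)) auto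
  ultimately show False using s(1) by simp
qed

lemma index_conj_sq_ideal:
  assumes p: "prime p" "prime_ideal_over p P" and \<theta>: "\<theta> \<in> \<Theta>"
  shows "p ^ 2 \<le> index (conj_sq_ideal p P \<theta>)"
proof -
  have "card ((\<lambda>k. [:k:]) ` {0..<int (p ^ 2)}) \<le> index (conj_sq_ideal p P \<theta>)"
  proof (rule index_ge)
    fix g h assume "g \<in> (\<lambda>k. [:k:]) ` {0..<int (p ^ 2)}" "h \<in> (\<lambda>k. [:k:]) ` {0..<int (p ^ 2)}"
      and d: "g - h \<in> conj_sq_ideal p P \<theta>"
    then obtain a b where ab: "g = [:a:]" "h = [:b:]" "0 \<le> a" "a < int (p ^ 2)" "0 \<le> b" "b < int (p ^ 2)"
      by auto
    then have "int (p ^ 2) dvd a - b" using const_in_conj_sq_ideal[OF p \<theta>] d by simp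
    then have "a = b" using ab by (metis mod_eq_dvd_iff mod_pos_pos_trivial)
    then show "g = h" using ab by simp
  qed (use conj_sq_ideal_lattice[OF p \<theta>] in auto)
  moreover have "card ((\<lambda>k. [:k:]) ` {0..<int (p ^ 2)}) = p ^ 2" by (simp add: card_image inj_on_def nat_power_eq)
  ultimately show ?thesis by simp
qed

end

section \<open>Mertens' theorem for the roots of a polynomial\<close>

text \<open>\<open>c\<close> is the scaling with theta = c alpha, so c (n + alpha) = c n + theta,
  and \<open>f\<close> is evaluated at -c n throughout.\<close>

locale scaled_field_poly = number_field_poly +
  fixes c :: int
  assumes c_nz: "c \<noteq> 0"
begin

text \<open>Roots of \<open>f\<close> modulo \<open>p\<close> are indexed by the class
  \<open>s\<close> of the integers n with p dividing F(n), not by the root -c s itself; the two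
  correspond bijectively when \<open>p\<close> does not divide \<open>c\<close>.\<close>

definition shift_root :: "nat \<Rightarrow> nat \<Rightarrow> bool" where
  "shift_root p s \<longleftrightarrow> s < p \<and> int p dvd poly f (- c * int s)"

definition nroots :: "nat \<Rightarrow> nat" where
  "nroots p = card {s. shift_root p s}"

definition nroots_of :: "nat \<Rightarrow> int poly \<Rightarrow> nat" where
  "nroots_of p g = card {s. shift_root p s \<and> int p dvd poly g (- c * int s)}"

definition good :: "nat \<Rightarrow> bool" where
  "good p \<longleftrightarrow> prime p \<and> \<not> int p dvd discr \<and> \<not> int p dvd c"

lemma finite_shift_root [simp]: "finite {s. shift_root p s}"
  by (rule finite_subset[of _ "{..<p}"]) (auto simp: shift_root_def)

lemma root_congruent_conjugate:
  assumes "prime p" "prime_ideal_over p P" "int p dvd poly f r"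
  obtains \<theta> where "\<theta> \<in> \<Theta>" "of_int r - \<theta> \<in> P"
proof -
  have "(\<Prod>\<theta>\<in>\<Theta>. of_int r - \<theta>) \<in> P"
    using prime_ideal_over_of_int[OF assms(1,2)] assms(3) by (metis ev_f_prod ev_of_int)
  then have "\<exists>\<theta>\<in>\<Theta>. of_int r - \<theta> \<in> P"
    by (intro prime_ideal_over_prod[OF assms(2)]) auto
  then show thesis using that by blast
qed

lemma ev_diff_mem:
  assumes "prime_ideal_over p P" "algebraic_int \<theta>" "of_int r - \<theta> \<in> P"
  shows "of_int (poly g r) - ev g \<theta> \<in> P"
proof -
  note D = prime_ideal_overD[OF assms(1)]
  obtain q where "\<And>z. ev g z - of_int (poly g r) = (z - of_int r) * ev q z"
    using ev_diff_dvd[of g r] by blast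
  then have "of_int (poly g r) - ev g \<theta> = (of_int r - \<theta>) * ev q \<theta>"
    by (metis minus_diff_eq mult_minus_left)
  then show ?thesis using D(4)[OF assms(3)] assms(2) by auto
qed

lemma congruent_conjugate_unique:
  assumes p: "good p" "prime_ideal_over p P" and st: "shift_root p s" "shift_root p t" "\<theta> \<in> \<Theta>"
    "of_int (- c * int s) - \<theta> \<in> P" "of_int (- c * int t) - \<theta> \<in> P"
  shows "s = t"
proof -
  note D = prime_ideal_overD[OF p(2)]
  have pr: "prime p" using p(1) unfolding good_def by simp
  have "(of_int (- c * int s) - \<theta>) - (of_int (- c * int t) - \<theta>) \<in> P" by (rule D(10)[OF st(4,5)])
  then have "of_int (- c * (int s - int t)) \<in> P" by (simp add: algebra_simps)
  then have "int p dvd - c * (int s - int t)" using prime_ideal_over_of_int[OF pr p(2)] by blast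
  then have "int p dvd c * (int s - int t)" by simp
  then have "int p dvd int s - int t"
    using pr p(1) unfolding good_def by (metis prime_dvd_mult_iff prime_nat_int_transfer)
  then have "int s mod int p = int t mod int p" by (simp add: mod_eq_dvd_iff)
  then show "s = t" using st(1,2) unfolding shift_root_def by simp
qed

text \<open>Each root modulo \<open>p\<close> is sent to a conjugate of theta congruent to it modulo
  \<open>P\<close>. For good \<open>p\<close> two roots cannot share a conjugate.\<close>

lemma nroots_le: "good p \<Longrightarrow> nroots p \<le> d"
proof -
  assume p: "good p"
  then have pr: "prime p" unfolding good_def by simp
  obtain P where P: "prime_ideal_over p P" using prime_ideal_over_exists[OF pr] by blast
  have "\<forall>s. \<exists>\<theta>. shift_root p s \<longrightarrow> \<theta> \<in> \<Theta> \<and> of_int (- c * int s) - \<theta> \<in> P"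
    using root_congruent_conjugate[OF pr P] unfolding shift_root_def by metis
  then obtain F where F: "\<And>s. shift_root p s \<Longrightarrow> F s \<in> \<Theta> \<and> of_int (- c * int s) - F s \<in> P" by metis
  have "inj_on F {s. shift_root p s}"
    using congruent_conjugate_unique[OF p P] F unfolding inj_on_def by (metis mem_Collect_eq)
  then have "card {s. shift_root p s} \<le> card \<Theta>"
    using F by (intro card_inj_on_le) auto
  then show ?thesis unfolding nroots_def card_\<Theta> .
qed

text \<open>If \<open>p\<close> divides the norm of \<open>g(\<theta>)\<close>, some conjugate of \<open>g(\<theta>)\<close> lies in \<open>P\<close>. Outside the exceptional
  ideals only one does, its \<open>\<theta>\<close> is congruent to an integer, and the cofactor of \<open>g(\<theta>)\<close> in the norm
  is prime to \<open>P\<close>, so that \<open>p\<^sup>2\<close> does not divide the norm.\<close>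

lemma norm_valuation_eq_nroots_of:
  assumes p: "good p" "prime_ideal_over p P" and g: "g \<noteq> 0" "degree g < d"
    and pair: "\<And>\<theta> \<theta>'. \<theta> \<in> \<Theta> \<Longrightarrow> \<theta>' \<in> \<Theta> \<Longrightarrow> (\<theta> = \<theta>' \<Longrightarrow> \<forall>r. \<theta> - of_int r \<notin> P) \<Longrightarrow> g \<notin> conj_ideal P {\<theta>, \<theta>'}"
    and sq: "\<And>\<theta>. \<theta> \<in> \<Theta> \<Longrightarrow> g \<notin> conj_sq_ideal p P \<theta>"
  shows "multiplicity (int p) (Nm g) = nroots_of p g"
proof -
  note D = prime_ideal_overD[OF p(2)]
  have pr: "prime p" and pD: "\<not> int p dvd discr" and pc: "\<not> int p dvd c" using p(1) unfolding good_def by auto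
  note PI = prime_ideal_over_of_int[OF pr p(2)]
  have nz: "Nm g \<noteq> 0" using Nm_eq_0_iff[OF g(2)] g(1) by simp
  have root: "\<exists>\<theta>\<in>\<Theta>. of_int (- c * int s) - \<theta> \<in> P \<and> ev g \<theta> \<in> P"
    if s: "shift_root p s" "int p dvd poly g (- c * int s)" for s
  proof -
    obtain \<theta> where \<theta>: "\<theta> \<in> \<Theta>" "of_int (- c * int s) - \<theta> \<in> P"
      using root_congruent_conjugate[OF pr p(2)] s(1) unfolding shift_root_def by blast
    have "of_int (poly g (- c * int s)) - (of_int (poly g (- c * int s)) - ev g \<theta>) \<in> P"
      using PI s(2) \<theta> by (intro D(10)[OF _ ev_diff_mem[OF p(2)]]) auto
    then show ?thesis using \<theta> by auto
  qed
  show ?thesis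
  proof (cases "int p dvd Nm g")
    case False
    have "{s. shift_root p s \<and> int p dvd poly g (- c * int s)} = {}"
    proof (rule ccontr)
      assume "\<not> ?thesis"
      then obtain \<theta> where \<theta>: "\<theta> \<in> \<Theta>" "ev g \<theta> \<in> P" using root by blast
      have "of_int (Nm g) \<in> P" unfolding of_int_Nm
        using \<theta> by (intro prime_ideal_over_prod_mem[OF p(2), of _ \<theta>]) auto
      then show False using PI False by blast
    qed
    then show ?thesis using False unfolding nroots_of_def by (simp add: not_dvd_imp_multiplicity_0)
  next
    case True
    then have "(\<Prod>\<theta>\<in>\<Theta>. ev g \<theta>) \<in> P" using PI of_int_Nm by metis
    then obtain \<theta> where \<theta>: "\<theta> \<in> \<Theta>" "ev g \<theta> \<in> P"
      using prime_ideal_over_prod[OF p(2), of \<Theta> "ev g"] by auto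
    have uniq: "\<theta>' = \<theta>" if "\<theta>' \<in> \<Theta>" "ev g \<theta>' \<in> P" for \<theta>'
      using pair[of \<theta> \<theta>'] that \<theta> unfolding conj_ideal_def by auto
    obtain r where r: "\<theta> - of_int r \<in> P"
      using pair[of \<theta> \<theta>] \<theta> unfolding conj_ideal_def by auto
    have "\<not> int p ^ 2 dvd Nm g"
    proof
      assume sqd: "int p ^ 2 dvd Nm g"
      obtain t where t: "\<And>\<theta>. \<theta> \<in> \<Theta> \<Longrightarrow> ev t \<theta> * ev g \<theta> = of_int (discr * Nm g)"
        "\<And>\<theta>. \<theta> \<in> \<Theta> \<Longrightarrow> ev t \<theta> = of_int discr * (\<Prod>t\<in>\<Theta>-{\<theta>}. ev g t)"
        using exists_cofactor[OF nz] by blast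
      have "(\<Prod>t\<in>\<Theta>-{\<theta>}. ev g t) \<notin> P"
      proof
        assume "(\<Prod>t\<in>\<Theta>-{\<theta>}. ev g t) \<in> P"
        then have "\<exists>t\<in>\<Theta>-{\<theta>}. ev g t \<in> P" by (intro prime_ideal_over_prod[OF p(2)]) auto
        then show False using uniq by blast
      qed
      moreover have "of_int discr \<notin> P" using PI pD by blast
      moreover have "algebraic_int (\<Prod>t\<in>\<Theta>-{\<theta>}. ev g t)" by auto
      ultimately have "ev t \<theta> \<notin> P" using D(5) t(2)[OF \<theta>(1)] by (metis algebraic_int_of_int)
      obtain e where e: "discr * Nm g = int p ^ 2 * e" using sqd by (metis dvdE dvd_mult)
      have "f dvd t * g - [:discr * Nm g:]"
        using t(1)[OF \<theta>(1)] by (intro f_dvd[OF \<theta>(1)]) simp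
      then obtain q where "t * g - [:discr * Nm g:] = f * q" by (auto elim: dvdE)
      then have "t * g = [:int p ^ 2:] * [:e:] + f * q" using e by (simp add: algebra_simps)
      then have "g \<in> conj_sq_ideal p P \<theta>" using \<open>ev t \<theta> \<notin> P\<close> unfolding conj_sq_ideal_def by blast
      then show False using sq \<theta>(1) by blast
    qed
    then have m1: "multiplicity (int p) (Nm g) = 1"
      using True by (intro multiplicity_eqI) (auto simp: numeral_2_eq_2)
    \<comment> \<open>With \<open>u\<close> inverse to \<open>c\<close> modulo \<open>p\<close>, the
      residue \<open>s\<close> of -u r satisfies -c s = r modulo \<open>p\<close>, which expresses
      the integer congruent to theta as a shifted root.\<close>
    obtain u v where uv: "u * c = 1 + int p * v" using inverse_mod_prime[OF pr pc] by blast
    define s where "s = nat ((- u * r) mod int p)"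
    have p0: "p > 0" using pr prime_gt_0_nat by blast
    have s: "s < p" "int s = (- u * r) mod int p" unfolding s_def using p0 by (auto simp: nat_less_iff)
    have "int p dvd int s - (- u * r)" unfolding s(2) by (rule mod_eq_dvd_iff[THEN iffD1]) simp
    then obtain w where w: "int s = - u * r + int p * w" by (metis add.commute diff_add_cancel dvdE)
    have "- c * int s = (u * c) * r - c * int p * w" unfolding w by (simp add: algebra_simps)
    also have "\<dots> = r + int p * (v * r - c * w)" unfolding uv by (simp add: algebra_simps)
    finally have sr: "- c * int s - r = int p * (v * r - c * w)" by simp
    have "of_int (- c * int s - r) \<in> P" using PI sr by (metis dvd_triv_left)
    then have "of_int (- c * int s - r) - (\<theta> - of_int r) \<in> P" using r D(10) by blast
    then have s\<theta>: "of_int (- c * int s) - \<theta> \<in> P" by simp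
    have mem: "int p dvd poly h (- c * int s)" if "ev h \<theta> \<in> P" for h
    proof -
      have "(of_int (poly h (- c * int s)) - ev h \<theta>) + ev h \<theta> \<in> P"
        using ev_diff_mem[OF p(2) _ s\<theta>] \<theta>(1) that by (intro D(2)) auto
      then show ?thesis using PI by simp
    qed
    have sroot: "shift_root p s" unfolding shift_root_def
      using s(1) mem[of f] D(8) \<theta>(1) by (simp add: \<Theta>_def)
    have "{s. shift_root p s \<and> int p dvd poly g (- c * int s)} = {s}"
    proof (intro equalityI subsetI)
      fix t assume "t \<in> {s. shift_root p s \<and> int p dvd poly g (- c * int s)}"
      then have t: "shift_root p t" "int p dvd poly g (- c * int t)" by auto
      obtain \<theta>' where \<theta>': "\<theta>' \<in> \<Theta>" "of_int (- c * int t) - \<theta>' \<in> P" "ev g \<theta>' \<in> P" using root[OF t] by blast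
      then have "\<theta>' = \<theta>" using uniq by blast
      then show "t \<in> {s}" using congruent_conjugate_unique[OF p sroot t(1) \<theta>(1) s\<theta>] \<theta>' by simp
    qed (use sroot mem[OF \<theta>(2)] in auto)
    then show ?thesis unfolding nroots_of_def m1 by simp
  qed
qed

text \<open>At most d^2 ideals \<open>conj_ideal\<close> and d ideals \<open>conj_sq_ideal\<close>
  contain every exceptional \<open>g\<close>, each of index at least p^2. The first term is summable
  over primes; the 1 costs a constant per prime, negligible because primes have density
  zero.\<close>

lemma exceptional_count:
  "\<exists>C::real. C > 0 \<and> (\<forall>p H. good p \<longrightarrow>
     real (card {g \<in> Box d H. g \<noteq> 0 \<and> multiplicity (int p) (Nm g) \<noteq> nroots_of p g})
       \<le> C * ((2 * real H + 1) ^ d / real p ^ 2 + 1))"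
proof -
  obtain C :: real where C: "C > 0"
    "\<forall>J q H. lattice_ideal J \<longrightarrow> finite (range (res_class J)) \<longrightarrow> q > 0 \<longrightarrow> q \<le> index J \<longrightarrow>
       real (card (J \<inter> Box d H)) \<le> C * ((2 * real H + 1) ^ d / real q + 1)"
    using lattice_count_upper by blast
  show ?thesis
  proof (rule exI[of _ "real (d * d + d) * C"], intro conjI allI impI)
    show "0 < real (d * d + d) * C" using C(1) d_pos by (intro mult_pos_pos) (auto simp del: of_nat_add of_nat_mult)
    fix p H assume p: "good p"
    then have pr: "prime p" and pD: "\<not> int p dvd discr" unfolding good_def by auto
    obtain P where P: "prime_ideal_over p P" using prime_ideal_over_exists[OF pr] by blast
    define T where "T = {(\<theta>, \<theta>'). \<theta> \<in> \<Theta> \<and> \<theta>' \<in> \<Theta> \<and> (\<theta> = \<theta>' \<longrightarrow> (\<forall>r. \<theta> - of_int r \<notin> P))}"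
    define \<J> where "\<J> = (\<lambda>(\<theta>, \<theta>'). conj_ideal P {\<theta>, \<theta>'}) ` T \<union> conj_sq_ideal p P ` \<Theta>"
    let ?E = "{g \<in> Box d H. g \<noteq> 0 \<and> multiplicity (int p) (Nm g) \<noteq> nroots_of p g}"
    let ?B = "C * ((2 * real H + 1) ^ d / real p ^ 2 + 1)"
    have T: "T \<subseteq> \<Theta> \<times> \<Theta>" unfolding T_def by auto
    then have finT: "finite T" by (rule finite_subset) simp
    have "card T \<le> d * d"
      using card_mono[OF _ T] by (simp add: card_cartesian_product card_\<Theta>)
    then have card\<J>: "card \<J> \<le> d * d + d"
      unfolding \<J>_def
      using card_Un_le[of "(\<lambda>(\<theta>, \<theta>'). conj_ideal P {\<theta>, \<theta>'}) ` T" "conj_sq_ideal p P ` \<Theta>"]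
        card_image_le[OF finT, of "\<lambda>(\<theta>, \<theta>'). conj_ideal P {\<theta>, \<theta>'}"]
        card_image_le[OF finite_\<Theta>, of "conj_sq_ideal p P"] card_\<Theta> by linarith
    have fin\<J>: "finite \<J>" unfolding \<J>_def using finT by simp
    have bound: "real (card (J \<inter> Box d H)) \<le> ?B" if J: "J \<in> \<J>" for J
    proof -
      have "lattice_ideal J \<and> finite (range (res_class J)) \<and> p ^ 2 \<le> index J"
      proof -
        consider \<theta> where "\<theta> \<in> \<Theta>" "J = conj_sq_ideal p P \<theta>"
          | a b where "(a, b) \<in> T" "J = conj_ideal P {a, b}"
          using J unfolding \<J>_def by auto
        then show ?thesis
        proof cases
          case 1
          then show ?thesis using conj_sq_ideal_lattice[OF pr P] index_conj_sq_ideal[OF pr P] by blast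
        next
          case 2
          then have ab: "a \<in> \<Theta>" "b \<in> \<Theta>" "a = b \<Longrightarrow> \<forall>r. a - of_int r \<notin> P" unfolding T_def by auto
          have "p ^ 2 \<le> index (conj_ideal P {a, b})"
            using index_conj_ideal_pair[OF pr P pD ab(1,2)] index_conj_ideal_single[OF pr P ab(1)] ab(3)
            by (cases "a = b") auto
          then show ?thesis using conj_ideal_lattice[OF pr P, of "{a, b}"] ab 2 by simp
        qed
      qed
      moreover have "p ^ 2 > 0" using pr prime_gt_0_nat by simp
      ultimately have "real (card (J \<inter> Box d H)) \<le> C * ((2 * real H + 1) ^ d / real (p ^ 2) + 1)"
        using C(2)[rule_format, of J "p ^ 2" H] by blast
      then show ?thesis by simp
    qed
    have "?E \<subseteq> (\<Union>J\<in>\<J>. J \<inter> Box d H)"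
    proof
      fix g assume g: "g \<in> ?E"
      have deg: "degree g < d" using g degree_coeff_box d_pos by fastforce
      have "\<exists>J\<in>\<J>. g \<in> J"
      proof (rule ccontr)
        assume n: "\<not> ?thesis"
        have "multiplicity (int p) (Nm g) = nroots_of p g"
        proof (rule norm_valuation_eq_nroots_of[OF p P _ deg])
          fix a b assume "a \<in> \<Theta>" "b \<in> \<Theta>" "a = b \<Longrightarrow> \<forall>r. a - of_int r \<notin> P"
          then have "(a, b) \<in> T" unfolding T_def by auto
          then have "conj_ideal P {a, b} \<in> \<J>" unfolding \<J>_def by (intro UnI1 image_eqI[of _ _ "(a, b)"]) auto
          then show "g \<notin> conj_ideal P {a, b}" using n by blast
        next
          fix a assume "a \<in> \<Theta>"
          then show "g \<notin> conj_sq_ideal p P a" using n unfolding \<J>_def by blast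
        qed (use g in blast)
        then show False using g by blast
      qed
      then show "g \<in> (\<Union>J\<in>\<J>. J \<inter> Box d H)" using g by blast
    qed
    then have "card ?E \<le> card (\<Union>J\<in>\<J>. J \<inter> Box d H)"
      using fin\<J> by (intro card_mono) auto
    also have "\<dots> \<le> (\<Sum>J\<in>\<J>. card (J \<inter> Box d H))" by (rule card_UN_le[OF fin\<J>])
    finally have "real (card ?E) \<le> real (\<Sum>J\<in>\<J>. card (J \<inter> Box d H))" by (simp only: of_nat_le_iff)
    also have "\<dots> = (\<Sum>J\<in>\<J>. real (card (J \<inter> Box d H)))" by simp
    also have "\<dots> \<le> of_nat (card \<J>) * ?B" using bound by (intro sum_bounded_above)
    also have "\<dots> \<le> real (d * d + d) * ?B"
      using card\<J> C(1) by (intro mult_right_mono) (auto simp del: of_nat_add of_nat_mult)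
    finally show "real (card ?E) \<le> real (d * d + d) * C * ((2 * real H + 1) ^ d / real p ^ 2 + 1)"
      by (simp only: mult.assoc)
  qed
qed

end

section \<open>Chebyshev bounds and logarithms of integers\<close>

definition primes_in :: "nat \<Rightarrow> nat \<Rightarrow> nat set" where
  "primes_in a b = {p. prime p \<and> a < p \<and> p \<le> b}"

lemma finite_primes_in [simp]: "finite (primes_in a b)"
  by (rule finite_subset[of _ "{..b}"]) (auto simp: primes_in_def)

lemma primes_in_split: "a \<le> b \<Longrightarrow> b \<le> c \<Longrightarrow> primes_in a c = primes_in a b \<union> primes_in b c"
  unfolding primes_in_def by auto

lemma sum_primes_in_split:
  "a \<le> b \<Longrightarrow> b \<le> c \<Longrightarrow> sum g (primes_in a c) = sum g (primes_in a b) + sum g (primes_in b c)"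
  unfolding primes_in_split by (rule sum.union_disjoint) (auto simp: primes_in_def)

lemma prod_primes_dvd:
  fixes N :: nat
  assumes "finite A" "\<And>p. p \<in> A \<Longrightarrow> prime p \<and> p dvd N"
  shows "\<Prod>A dvd N"
  using assms
proof (induction A rule: finite_induct)
  case (insert p A)
  have "Rings.coprime p (\<Prod>A)"
    using insert by (intro prod_coprime_right) (metis insertCI primes_coprime)
  then show ?case using insert by (simp add: divides_mult)
qed simp

lemma binomial_central_le: "(2 * m) choose m \<le> 4 ^ m"
proof -
  have "(2 * m) choose m \<le> 2 ^ (2 * m)" by (rule binomial_le_pow2)
  then show ?thesis by (simp add: power_mult)
qed

text \<open>Every prime in (m, 2m] divides the central binomial coefficient, which is at most
  4^m.\<close>

lemma theta_doubling: "(\<Sum>p\<in>primes_in m (2 * m). ln (real p)) \<le> 2 * real m"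
proof -
  let ?A = "primes_in m (2 * m)"
  have "\<Prod>?A dvd (2 * m) choose m"
  proof (rule prod_primes_dvd)
    fix p assume p: "p \<in> ?A"
    then have pr: "prime p" "m < p" "p \<le> 2 * m" unfolding primes_in_def by auto
    have "fact m * fact (2 * m - m) * ((2 * m) choose m) = (fact (2 * m) :: nat)"
      by (rule binomial_fact_lemma) simp
    moreover have "p dvd fact (2 * m)" using pr by (simp add: prime_dvd_fact_iff)
    ultimately have "p dvd fact m * fact m * ((2 * m) choose m)" by simp
    then show "prime p \<and> p dvd (2 * m) choose m"
      using pr by (simp add: prime_dvd_mult_iff prime_dvd_fact_iff)
  qed simp
  then have "\<Prod>?A \<le> (2 * m) choose m" by (rule dvd_imp_le) simp
  then have le: "\<Prod>?A \<le> 4 ^ m" using binomial_central_le[of m] by linarith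
  have pos: "\<And>p. p \<in> ?A \<Longrightarrow> real p > 0" unfolding primes_in_def using prime_gt_0_nat by auto
  have "(\<Sum>p\<in>?A. ln (real p)) = ln (\<Prod>p\<in>?A. real p)"
    using pos by (intro ln_prod[symmetric]) auto
  also have "\<dots> \<le> ln (4 ^ m)"
  proof (rule ln_mono)
    show "0 < (\<Prod>p\<in>?A. real p)" using pos by (intro prod_pos) auto
    have "real (\<Prod>?A) \<le> real (4 ^ m)" using le by (rule of_nat_mono)
    then show "(\<Prod>p\<in>?A. real p) \<le> 4 ^ m" by simp
  qed
  also have "\<dots> = real m * ln (2 ^ 2)" by (simp add: ln_realpow)
  also have "\<dots> = 2 * real m * ln 2" by (subst ln_realpow) simp_all
  also have "\<dots> \<le> 2 * real m * 1" using ln_2_less_1 by (intro mult_left_mono) auto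
  finally show ?thesis by simp
qed

text \<open>Halving: theta(2m) \<le> 4m + 2m by induction and doubling. For odd n = 2m + 1 a
  possible prime n adds ln(1 + 2m) \<le> 2m, and 8m \<le> 4n.\<close>

lemma theta_bound: "(\<Sum>p\<in>primes_in 0 n. ln (real p)) \<le> 4 * real n"
proof (induction n rule: less_induct)
  case (less n)
  show ?case
  proof (cases "n \<le> 1")
    case True
    then have "primes_in 0 n = {}" unfolding primes_in_def using prime_gt_1_nat by (auto dest: prime_gt_1_nat)
    then show ?thesis by simp
  next
    case False
    define m where "m = n div 2"
    have m: "m < n" "n = 2 * m \<or> n = 2 * m + 1" unfolding m_def using False by auto
    have 1: "(\<Sum>p\<in>primes_in 0 (2 * m). ln (real p)) \<le> 6 * real m"
      using less.IH[OF m(1)] theta_doubling[of m] sum_primes_in_split[of 0 m "2 * m" "\<lambda>p. ln (real p)"] by simp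
    show ?thesis
    proof (cases "n = 2 * m")
      case True
      then show ?thesis using 1 by simp
    next
      case False
      then have n: "n = 2 * m + 1" using m by blast
      have "primes_in (2 * m) n \<subseteq> {n}" unfolding primes_in_def n by auto
      then have "(\<Sum>p\<in>primes_in (2 * m) n. ln (real p)) \<le> (\<Sum>p\<in>{n}. ln (real p))"
        using n by (intro sum_mono2) auto
      also have "\<dots> = ln (1 + real (2 * m))" unfolding n by simp
      also have "\<dots> \<le> real (2 * m)" by (rule ln_add_one_self_le_self) simp
      finally have "(\<Sum>p\<in>primes_in (2 * m) n. ln (real p)) \<le> 2 * real m" by simp
      then show ?thesis
        using 1 sum_primes_in_split[of 0 "2 * m" n "\<lambda>p. ln (real p)"] n by simp
    qed
  qed
qed

text \<open>Each prime above sqrt n contributes at least (ln n)/2 to theta(n) \<le> 4n; the primes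
  up to sqrt n are bounded by their number of candidates.\<close>

lemma card_primes_bound:
  assumes "n \<ge> 2"
  shows "real (card (primes_in 0 n)) \<le> sqrt (real n) + 8 * real n / ln (real n)"
proof -
  define r where "r = nat \<lfloor>sqrt (real n)\<rfloor>"
  have r: "real r \<le> sqrt (real n)" "sqrt (real n) < real r + 1"
    unfolding r_def using floor_correct[of "sqrt (real n)"] by (simp_all add: of_nat_nat)
  have "sqrt (real n) \<le> real n" using assms by (intro real_le_lsqrt) (auto simp: power2_eq_square)
  then have rn: "r \<le> n" using r by linarith
  have ln0: "ln (real n) > 0" using assms by simp
  have "real (card (primes_in r n)) * (ln (real n) / 2) \<le> (\<Sum>p\<in>primes_in r n. ln (real p))"
  proof (rule sum_bounded_below)
    fix p assume "p \<in> primes_in r n"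
    then have "r + 1 \<le> p" unfolding primes_in_def by auto
    then have "sqrt (real n) \<le> real p" using r by linarith
    then have "ln (sqrt (real n)) \<le> ln (real p)" using assms by (intro ln_mono) auto
    then show "ln (real n) / 2 \<le> ln (real p)" using assms by (simp add: ln_sqrt)
  qed
  also have "\<dots> \<le> (\<Sum>p\<in>primes_in 0 n. ln (real p))"
    unfolding primes_in_def using prime_gt_0_nat by (intro sum_mono2) (auto simp: prime_gt_0_nat Suc_le_eq)
  also have "\<dots> \<le> 4 * real n" by (rule theta_bound)
  finally have "real (card (primes_in r n)) \<le> 8 * real n / ln (real n)" using ln0 by (simp add: field_simps)
  moreover have "card (primes_in 0 r) \<le> card {1..r}"
    by (rule card_mono) (auto simp: primes_in_def)
  moreover have "card (primes_in 0 n) \<le> card (primes_in 0 r) + card (primes_in r n)"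
    using rn by (subst primes_in_split[of 0 r n]) (auto intro: card_Un_le)
  ultimately show ?thesis using r by simp
qed

lemma card_primes_little_o:
  assumes "\<epsilon> > 0"
  shows "eventually (\<lambda>n::nat. real (card (primes_in 0 n)) \<le> \<epsilon> * real n) sequentially"
proof -
  have "((\<lambda>n::nat. (sqrt (real n) + 8 * real n / ln (real n)) / real n) \<longlongrightarrow> 0) sequentially"
    by real_asymp
  then have "eventually (\<lambda>n::nat. (sqrt (real n) + 8 * real n / ln (real n)) / real n < \<epsilon>) sequentially"
    using assms by (rule order_tendstoD)
  then show ?thesis using eventually_ge_at_top[of 2]
  proof eventually_elim
    case (elim n)
    then have "sqrt (real n) + 8 * real n / ln (real n) \<le> \<epsilon> * real n" by (simp add: pos_divide_less_eq)
    then show ?case using card_primes_bound[of n] elim by simp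
  qed
qed

lemma sum_inverse_squares:
  assumes "P > 0"
  shows "(\<Sum>p\<in>primes_in P Y. 1 / real p ^ 2) \<le> 1 / real P"
proof -
  have *: "(\<Sum>k\<in>{P<..P+n}. 1 / real k ^ 2) \<le> 1 / real P - 1 / real (P + n)" for n
  proof (induction n)
    case (Suc n)
    have "{P<..P + Suc n} = insert (P + Suc n) {P<..P+n}" by auto
    then have "(\<Sum>k\<in>{P<..P+Suc n}. 1 / real k ^ 2) = 1 / real (P + Suc n) ^ 2 + (\<Sum>k\<in>{P<..P+n}. 1 / real k ^ 2)" by simp
    also have "\<dots> \<le> 1 / real (P + Suc n) ^ 2 + (1 / real P - 1 / real (P + n))" using Suc by simp
    also have "1 / real (P + Suc n) ^ 2 \<le> 1 / real (P + n) - 1 / real (P + Suc n)"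
    proof -
      define x where "x = real (P + n)"
      have x: "x > 0" unfolding x_def using assms by simp
      have "1 / x - 1 / (x + 1) = 1 / (x * (x + 1))" using x by (simp add: field_simps)
      also have "\<dots> \<ge> 1 / (x + 1) ^ 2" using x by (intro divide_left_mono) (auto simp: power2_eq_square)
      finally show ?thesis unfolding x_def by (simp add: algebra_simps)
    qed
    finally show ?case by simp
  qed simp
  have "(\<Sum>p\<in>primes_in P Y. 1 / real p ^ 2) \<le> (\<Sum>k\<in>{P<..P+Y}. 1 / real k ^ 2)"
    by (intro sum_mono2) (auto simp: primes_in_def)
  also have "\<dots> \<le> 1 / real P - 1 / real (P + Y)" by (rule *)
  also have "\<dots> \<le> 1 / real P" by simp
  finally show ?thesis .
qed

text \<open>The range of primes depends only on the bound \<open>Y\<close>, so one range serves a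
  whole family of integers and the sums over integers and primes can be exchanged.\<close>

lemma ln_prime_factorization:
  assumes "n \<noteq> 0" "\<bar>n\<bar> \<le> int Y"
  shows "ln (real_of_int \<bar>n\<bar>) = (\<Sum>p\<in>primes_in 0 Y. real (multiplicity (int p) n) * ln (real p))"
proof -
  define m where "m = nat \<bar>n\<bar>"
  have m: "m > 0" "m \<le> Y" unfolding m_def using assms by auto
  have dvd: "int p ^ k dvd n \<longleftrightarrow> p ^ k dvd m" for p k
  proof -
    have "int p ^ k dvd n \<longleftrightarrow> int (p ^ k) dvd int m" unfolding m_def by simp
    then show ?thesis by (simp only: int_dvd_int_iff)
  qed
  have mult: "multiplicity (int p) n = multiplicity p m" if "prime p" for p
  proof (rule multiplicity_eqI)
    show "int p ^ multiplicity p m dvd n" unfolding dvd by (rule multiplicity_dvd)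
    show "\<not> int p ^ Suc (multiplicity p m) dvd n"
      unfolding dvd using that m by (metis multiplicity_decompose' multiplicity_geI not_less_eq_eq le_refl not_prime_unit not_gr0)
  qed
  have sub: "prime_factors m \<subseteq> primes_in 0 Y"
  proof
    fix p assume "p \<in> prime_factors m"
    then have "prime p" "p dvd m" by auto
    then show "p \<in> primes_in 0 Y" unfolding primes_in_def using m prime_gt_0_nat dvd_imp_le[of p m] by force
  qed
  have "real m = (\<Prod>p\<in>prime_factors m. real p ^ multiplicity p m)"
  proof -
    have "(\<Prod>p\<in>prime_factors m. p ^ multiplicity p m) = m" using prod_prime_factors[of m] m by simp
    then have "real m = real (\<Prod>p\<in>prime_factors m. p ^ multiplicity p m)" by simp
    then show ?thesis by simp
  qed
  then have "ln (real m) = ln (\<Prod>p\<in>prime_factors m. real p ^ multiplicity p m)" by simp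
  also have "\<dots> = (\<Sum>p\<in>prime_factors m. ln (real p ^ multiplicity p m))"
  proof (rule ln_prod)
    fix p assume "p \<in> prime_factors m"
    then have "prime p" by auto
    then show "real p ^ multiplicity p m \<noteq> 0" using prime_gt_0_nat by simp
  qed simp
  also have "\<dots> = (\<Sum>p\<in>prime_factors m. real (multiplicity p m) * ln (real p))"
    by (intro sum.cong) (use prime_gt_0_nat in \<open>auto simp: ln_realpow prime_factors_multiplicity\<close>)
  also have "\<dots> = (\<Sum>p\<in>primes_in 0 Y. real (multiplicity p m) * ln (real p))"
    by (intro sum.mono_neutral_left sub) (auto simp: prime_factors_multiplicity primes_in_def)
  also have "\<dots> = (\<Sum>p\<in>primes_in 0 Y. real (multiplicity (int p) n) * ln (real p))"
    by (intro sum.cong) (auto simp: mult primes_in_def)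
  finally show ?thesis unfolding m_def by simp
qed

lemma sum_mult_ln_le:
  assumes "n \<noteq> 0" "\<bar>n\<bar> \<le> int Y" "S \<subseteq> primes_in 0 Y"
  shows "(\<Sum>p\<in>S. real (multiplicity (int p) n) * ln (real p)) \<le> ln (real_of_int \<bar>n\<bar>)"
  unfolding ln_prime_factorization[OF assms(1,2)]
  by (intro sum_mono2 assms(3)) (use prime_gt_0_nat in \<open>auto simp: primes_in_def Suc_le_eq\<close>)

section \<open>Values divisible by high prime powers, and small norms\<close>

lemma card_congruent_le:
  fixes A :: "int set"
  assumes "A \<subseteq> {a..<a + int N}" "m > 0" "\<And>x y. x \<in> A \<Longrightarrow> y \<in> A \<Longrightarrow> int m dvd x - y"
  shows "real (card A) \<le> real N / real m + 1"
proof -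
  have fin: "finite A" by (rule finite_subset[OF assms(1)]) simp
  have "inj_on (\<lambda>x. (x - a) div int m) A"
  proof (rule inj_onI)
    fix x y assume xy: "x \<in> A" "y \<in> A" "(x - a) div int m = (y - a) div int m"
    have "int m dvd (x - a) - (y - a)" using assms(3) xy by simp
    then have "(x - a) mod int m = (y - a) mod int m" by (simp add: mod_eq_dvd_iff)
    then have "x - a = y - a" using xy(3) by (metis div_mult_mod_eq)
    then show "x = y" by simp
  qed
  moreover have "(\<lambda>x. (x - a) div int m) ` A \<subseteq> {0..int (N div m)}"
  proof (rule image_subsetI)
    fix x assume "x \<in> A"
    then have x: "0 \<le> x - a" "x - a \<le> int N" using assms(1) by auto
    then have "(x - a) div int m \<le> int N div int m" using assms(2) by (intro zdiv_mono1) auto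
    then show "(x - a) div int m \<in> {0..int (N div m)}"
      using x assms(2) by (auto simp: zdiv_int pos_imp_zdiv_nonneg_iff)
  qed
  ultimately have "card A \<le> card {0..int (N div m)}" by (rule card_inj_on_le) simp
  then have "card A \<le> N div m + 1" by (simp add: nat_add_distrib)
  then have "real (card A) \<le> real (N div m) + 1" by linarith
  also have "real (N div m) \<le> real N / real m" by (rule of_nat_div_le_of_nat)
  finally show ?thesis by simp
qed

text \<open>Interpolating at \<open>n + 1\<close> such arguments, the leading coefficient of \<open>h\<close> becomes a sum of fractions
  with numerators divisible by \<open>p\<^sup>K\<close> and denominators in which \<open>p\<close> occurs at most \<open>nj\<close> times.\<close>

lemma card_incongruent_roots_le:
  fixes h :: "complex poly" and T :: "int set"
  assumes h: "degree h = n" "lead_coeff h = of_int a" "a \<noteq> 0"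
    and w: "\<And>t. t \<in> T \<Longrightarrow> poly h (of_int t) = of_int (w t)" "\<And>t. t \<in> T \<Longrightarrow> int p ^ K dvd w t"
    and T: "finite T" "\<And>s t. s \<in> T \<Longrightarrow> t \<in> T \<Longrightarrow> s \<noteq> t \<Longrightarrow> \<not> int p ^ j dvd s - t"
    and p: "prime p" "n * j \<le> K" "\<bar>a\<bar> < int p ^ (K - n * j)"
  shows "card T \<le> n"
proof (rule ccontr)
  assume "\<not> card T \<le> n"
  then obtain S where S: "S \<subseteq> T" "card S = Suc n" "finite S"
    by (meson T(1) not_less_eq_eq obtain_subset_with_card_n)
  have pe: "prime_elem (int p)" using p(1) by simp
  have npu: "\<not> is_unit (int p)" using p(1) by (meson not_prime_unit prime_nat_int_transfer)
  define q where "q = (\<lambda>t. \<Prod>b\<in>S-{t}. t - b)"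
  have q0: "q t \<noteq> 0" for t unfolding q_def using S(3) by auto
  have mult: "multiplicity (int p) (q t) \<le> n * j" if t: "t \<in> S" for t
  proof -
    have "multiplicity (int p) (q t) = (\<Sum>b\<in>S-{t}. multiplicity (int p) (t - b))"
      unfolding q_def using S(3) pe by (intro prime_elem_multiplicity_prod_distrib) auto
    also have "\<dots> \<le> (\<Sum>b\<in>S-{t}. j)"
    proof (rule sum_mono)
      fix b assume b: "b \<in> S - {t}"
      then have "\<not> int p ^ j dvd t - b" using T(2) S(1) t by blast
      then show "multiplicity (int p) (t - b) \<le> j"
        by (metis multiplicity_dvd' nat_le_linear)
    qed
    also have "\<dots> = n * j" using S t by simp
    finally show ?thesis .
  qed
  have "\<exists>u. q t = int p ^ multiplicity (int p) (q t) * u \<and> \<not> int p dvd u" for t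
    using multiplicity_decompose'[of "q t" "int p"] q0 npu by metis
  then obtain u where u: "\<And>t. q t = int p ^ multiplicity (int p) (q t) * u t" "\<And>t. \<not> int p dvd u t"
    by metis
  \<comment> \<open>Multiplying by \<open>V\<close> removes the parts of the denominators prime to
    \<open>p\<close>; only powers of \<open>p\<close>, of exponent at most n j, remain in
    them.\<close>
  define V where "V = (\<Prod>t\<in>S. u t)"
  have V: "Rings.coprime (int p) V"
    unfolding V_def using u(2) pe by (intro prod_coprime_right prime_elem_imp_coprime) auto
  define S' where "S' = (of_int ` S :: complex set)"
  have S': "finite S'" "card S' = Suc n" unfolding S'_def using S by (auto simp: card_image inj_on_def)
  have "h = (\<Sum>x\<in>S'. smult (poly h x / (\<Prod>b\<in>S'-{x}. x - b)) (\<Prod>b\<in>S'-{x}. [:-b, 1:]))"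
    by (rule lagrange_interpolation) (use S' h in auto)
  then have "coeff h n = (\<Sum>x\<in>S'. poly h x / (\<Prod>b\<in>S'-{x}. x - b) * coeff (\<Prod>b\<in>S'-{x}. [:-b, 1:]) n)"
    by (metis (no_types, lifting) coeff_smult coeff_sum sum.cong)
  also have "\<dots> = (\<Sum>x\<in>S'. poly h x / (\<Prod>b\<in>S'-{x}. x - b))"
  proof (rule sum.cong)
    fix x assume x: "x \<in> S'"
    have "degree (\<Prod>b\<in>S'-{x}. [:-b, 1:]) = n"
      using S' x by (subst degree_prod_eq_sum_degree) auto
    then have "coeff (\<Prod>b\<in>S'-{x}. [:-b, 1:]) n = lead_coeff (\<Prod>b\<in>S'-{x}. [:-b, 1:])" by simp
    also have "\<dots> = 1" by (simp add: lead_coeff_prod)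
    finally show "poly h x / (\<Prod>b\<in>S'-{x}. x - b) * coeff (\<Prod>b\<in>S'-{x}. [:-b, 1:]) n = poly h x / (\<Prod>b\<in>S'-{x}. x - b)" by simp
  qed simp
  also have "\<dots> = (\<Sum>t\<in>S. poly h (of_int t) / (\<Prod>b\<in>S'-{of_int t}. of_int t - b))"
    unfolding S'_def by (subst sum.reindex) (auto simp: inj_on_def)
  also have "\<dots> = (\<Sum>t\<in>S. of_int (w t) / of_int (q t))"
  proof (rule sum.cong)
    fix t assume t: "t \<in> S"
    have "S' - {of_int t} = of_int ` (S - {t})" unfolding S'_def by auto
    then have "(\<Prod>b\<in>S'-{of_int t}. of_int t - b) = (of_int (q t) :: complex)"
      unfolding q_def by (simp add: prod.reindex inj_on_def)
    then show "poly h (of_int t) / (\<Prod>b\<in>S'-{of_int t}. of_int t - b) = of_int (w t) / of_int (q t)"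
      using w(1) t S(1) by auto
  qed simp
  finally have a: "of_int a = (\<Sum>t\<in>S. of_int (w t) / of_int (q t) :: complex)" using h by simp
  have quot: "\<exists>z. of_int (w t) / of_int (q t) * of_int V = (of_int (int p ^ (K - n * j) * z) :: complex)" if t: "t \<in> S" for t
  proof -
    define e where "e = multiplicity (int p) (q t)"
    have e: "e \<le> n * j" unfolding e_def using mult[OF t] .
    obtain z where z: "w t = int p ^ K * z" using w(2) t S(1) by (blast elim: dvdE)
    define R where "R = (\<Prod>x\<in>S-{t}. u x)"
    have VR: "V = u t * R" unfolding V_def R_def using t S(3) by (simp add: prod.remove)
    have qt: "q t = int p ^ e * u t" unfolding e_def by (rule u(1))
    have "int p ^ K = int p ^ e * (int p ^ (K - n * j) * int p ^ (n * j - e))"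
      using e p(2) by (simp flip: power_add)
    then have "w t * V = (int p ^ (K - n * j) * (int p ^ (n * j - e) * z * R)) * q t"
      unfolding z VR qt by (simp add: mult_ac)
    then have "of_int (w t) * of_int V = (of_int (int p ^ (K - n * j) * (int p ^ (n * j - e) * z * R)) * of_int (q t) :: complex)"
      by (metis of_int_mult)
    then have "of_int (w t) / of_int (q t) * of_int V = (of_int (int p ^ (K - n * j) * (int p ^ (n * j - e) * z * R)) :: complex)"
      using q0[of t] by (simp add: nonzero_divide_eq_eq)
    then show ?thesis by blast
  qed
  then obtain z where z: "\<And>t. t \<in> S \<Longrightarrow> of_int (w t) / of_int (q t) * of_int V = (of_int (int p ^ (K - n * j) * z t) :: complex)"
    by metis
  have "of_int (a * V) = (\<Sum>t\<in>S. of_int (w t) / of_int (q t) * of_int V :: complex)"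
    by (simp add: a sum_distrib_right)
  also have "\<dots> = (\<Sum>t\<in>S. of_int (int p ^ (K - n * j) * z t))" using z by (intro sum.cong) auto
  also have "\<dots> = of_int (int p ^ (K - n * j) * (\<Sum>t\<in>S. z t))" by (simp add: sum_distrib_left)
  finally have "a * V = int p ^ (K - n * j) * (\<Sum>t\<in>S. z t)" by (simp only: of_int_eq_iff)
  then have "int p ^ (K - n * j) dvd a * V" by simp
  then have "int p ^ (K - n * j) dvd a"
    using V by (metis coprime_dvd_mult_left_iff coprime_power_left_iff)
  then have "int p ^ (K - n * j) \<le> \<bar>a\<bar>" using h(3) dvd_imp_le_int[of a "int p ^ (K - n * j)"] by simp
  then show False using p(3) by simp
qed

text \<open>The solutions lie in at most \<open>n\<close> classes modulo p^j: otherwise n + 1 of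
  them, pairwise incongruent modulo p^j, would contradict \<open>card_incongruent_roots_le\<close>.
  The bound is weak but holds for every prime, including those where roots modulo \<open>p\<close>
  are multiple.\<close>

lemma card_prime_power_roots_le:
  fixes h :: "complex poly"
  assumes h: "degree h = n" "lead_coeff h = of_int a" "a \<noteq> 0" "\<And>t. poly h (of_int t) = of_int (w t)"
    and p: "prime p" "n * j \<le> K" "\<bar>a\<bar> < int p ^ (K - n * j)"
  shows "real (card {t \<in> {x..<x + int N}. int p ^ K dvd w t}) \<le> real n * (real N / real (p ^ j) + 1)"
proof -
  let ?A = "{t \<in> {x..<x + int N}. int p ^ K dvd w t}"
  have finA: "finite ?A" by (rule finite_subset[of _ "{x..<x + int N}"]) auto
  define m where "m = (\<lambda>t. t mod int (p ^ j))"
  have "m ` ?A \<subseteq> m ` ?A" ..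
  then obtain T where Tsub: "T \<subseteq> ?A" and injT: "inj_on m T" and mT: "m ` ?A = m ` T"
    unfolding subset_image_inj by blast
  from mT have "m ` T = m ` ?A" by simp
  then have card: "card (m ` ?A) = card T" using card_image[OF injT] by simp
  have "card T \<le> n"
  proof (rule card_incongruent_roots_le[OF h(1-3)])
    fix s t assume "s \<in> T" "t \<in> T" "s \<noteq> t"
    then show "\<not> int p ^ j dvd s - t" using injT unfolding m_def inj_on_def by (metis mod_eq_dvd_iff of_nat_power)
  qed (use h p Tsub finite_subset[OF Tsub finA] in auto)
  then have cm: "card (m ` ?A) \<le> n" using card by simp
  have pj: "p ^ j > 0" using p(1) prime_gt_0_nat by simp
  have "?A = (\<Union>r\<in>m ` ?A. {t \<in> ?A. m t = r})" by blast
  then have "card ?A \<le> (\<Sum>r\<in>m ` ?A. card {t \<in> ?A. m t = r})"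
    using card_UN_le[of "m ` ?A" "\<lambda>r. {t \<in> ?A. m t = r}"] finA by auto
  then have "real (card ?A) \<le> real (\<Sum>r\<in>m ` ?A. card {t \<in> ?A. m t = r})" by (rule of_nat_mono)
  also have "\<dots> = (\<Sum>r\<in>m ` ?A. real (card {t \<in> ?A. m t = r}))" by simp
  also have "\<dots> \<le> real (card (m ` ?A)) * (real N / real (p ^ j) + 1)"
  proof (rule sum_bounded_above)
    fix r
    show "real (card {t \<in> ?A. m t = r}) \<le> real N / real (p ^ j) + 1"
    proof (rule card_congruent_le[OF _ pj])
      show "{t \<in> ?A. m t = r} \<subseteq> {x..<x + int N}" by auto
      fix s t assume "s \<in> {t \<in> ?A. m t = r}" "t \<in> {t \<in> ?A. m t = r}"
      then show "int (p ^ j) dvd s - t" unfolding m_def by (simp add: mod_eq_dvd_iff[symmetric])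
    qed
  qed
  also have "\<dots> \<le> real n * (real N / real (p ^ j) + 1)"
    using cm by (intro mult_right_mono) auto
  finally show ?thesis .
qed

text \<open>Slicing along the constant coefficient. In its applications \<open>Q\<close> concerns
  the norm of t + X g', which for fixed g' is a monic polynomial of degree d in t.\<close>

lemma coeff_box_fibre_count:
  assumes S: "finite S" and r: "\<And>g'. real (card {t \<in> S. Q (pCons t g')}) \<le> r"
  shows "real (card {g \<in> coeff_box (Suc n) S. Q g}) \<le> r * real (card S) ^ n"
proof -
  have "{g \<in> coeff_box (Suc n) S. Q g} = (\<Union>g'\<in>coeff_box n S. (\<lambda>t. pCons t g') ` {t \<in> S. Q (pCons t g')})"
    unfolding coeff_box_Suc by auto
  then have "card {g \<in> coeff_box (Suc n) S. Q g} \<le> (\<Sum>g'\<in>coeff_box n S. card ((\<lambda>t. pCons t g') ` {t \<in> S. Q (pCons t g')}))"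
    using card_UN_le[of "coeff_box n S" "\<lambda>g'. (\<lambda>t. pCons t g') ` {t \<in> S. Q (pCons t g')}"] S by simp
  also have "\<dots> \<le> (\<Sum>g'\<in>coeff_box n S. card {t \<in> S. Q (pCons t g')})"
    using S by (intro sum_mono card_image_le) auto
  finally have "real (card {g \<in> coeff_box (Suc n) S. Q g}) \<le> real (\<Sum>g'\<in>coeff_box n S. card {t \<in> S. Q (pCons t g')})"
    by (rule of_nat_mono)
  also have "\<dots> = (\<Sum>g'\<in>coeff_box n S. real (card {t \<in> S. Q (pCons t g')}))" by simp
  also have "\<dots> \<le> real (card (coeff_box n S)) * r" using r by (intro sum_bounded_above)
  also have "\<dots> = r * real (card S) ^ n" using S by (simp add: card_coeff_box)
  finally show ?thesis .
qed

lemma card_near_le: "card {t::int. \<bar>real_of_int t + x\<bar> < real H} \<le> 2 * H + 1" "finite {t::int. \<bar>real_of_int t + x\<bar> < real H}"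
proof -
  have sub: "{t::int. \<bar>real_of_int t + x\<bar> < real H} \<subseteq> {\<lceil>- x\<rceil> - int H..\<lceil>- x\<rceil> + int H}"
    by (auto simp: abs_less_iff) linarith+
  then show "finite {t::int. \<bar>real_of_int t + x\<bar> < real H}" by (rule finite_subset) simp
  have "card {t::int. \<bar>real_of_int t + x\<bar> < real H} \<le> card {\<lceil>- x\<rceil> - int H..\<lceil>- x\<rceil> + int H}"
    using sub by (rule card_mono[rotated]) simp
  then show "card {t::int. \<bar>real_of_int t + x\<bar> < real H} \<le> 2 * H + 1" by simp
qed

context number_field_poly
begin

text \<open>A product of d factors below H^d has a factor below H in modulus. With the higher
  coefficients fixed, this confines the constant coefficient to one of d real intervals of length
  2H.\<close>

lemma card_small_norm_le:
  "real (card {g \<in> Box d K. \<bar>Nm g\<bar> < int H ^ d}) \<le> real d * (2 * real H + 1) * (2 * real K + 1) ^ (d - 1)"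
proof -
  have "real (card {g \<in> coeff_box (Suc (d - 1)) {- int K..int K}. \<bar>Nm g\<bar> < int H ^ d})
      \<le> (real d * (2 * real H + 1)) * real (card {- int K..int K}) ^ (d - 1)"
  proof (rule coeff_box_fibre_count)
    fix g'
    define B where "B = (\<lambda>\<theta>. {t::int. \<bar>real_of_int t + Re (\<theta> * ev g' \<theta>)\<bar> < real H})"
    have "{t \<in> {- int K..int K}. \<bar>Nm (pCons t g')\<bar> < int H ^ d} \<subseteq> (\<Union>\<theta>\<in>\<Theta>. B \<theta>)"
    proof
      fix t assume "t \<in> {t \<in> {- int K..int K}. \<bar>Nm (pCons t g')\<bar> < int H ^ d}"
      then have "\<bar>Nm (pCons t g')\<bar> < int H ^ d" by simp
      then have "real_of_int \<bar>Nm (pCons t g')\<bar> < real_of_int (int H ^ d)" by (simp only: of_int_less_iff)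
      then have "norm (of_int (Nm (pCons t g')) :: complex) < real H ^ d" by simp
      then have lt: "(\<Prod>\<theta>\<in>\<Theta>. norm (of_int t + \<theta> * ev g' \<theta>)) < real H ^ d"
        unfolding of_int_Nm by (simp add: prod_norm)
      have "\<exists>\<theta>\<in>\<Theta>. norm (of_int t + \<theta> * ev g' \<theta>) < real H"
      proof (rule ccontr)
        assume "\<not> ?thesis"
        then have "(\<Prod>\<theta>\<in>\<Theta>. real H) \<le> (\<Prod>\<theta>\<in>\<Theta>. norm (of_int t + \<theta> * ev g' \<theta>))"
          by (intro prod_mono) (auto simp: not_less)
        then show False using lt by (simp add: card_\<Theta>)
      qed
      then obtain \<theta> where \<theta>: "\<theta> \<in> \<Theta>" "norm (of_int t + \<theta> * ev g' \<theta>) < real H" by blast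
      have "\<bar>Re (of_int t + \<theta> * ev g' \<theta>)\<bar> < real H" using abs_Re_le_cmod \<theta>(2) by (rule order_le_less_trans)
      then have "t \<in> B \<theta>" unfolding B_def by simp
      then show "t \<in> (\<Union>\<theta>\<in>\<Theta>. B \<theta>)" using \<theta>(1) by blast
    qed
    moreover have finB: "finite (B \<theta>)" for \<theta> unfolding B_def by (rule card_near_le(2))
    ultimately have "card {t \<in> {- int K..int K}. \<bar>Nm (pCons t g')\<bar> < int H ^ d} \<le> card (\<Union>\<theta>\<in>\<Theta>. B \<theta>)"
      by (intro card_mono) auto
    also have "\<dots> \<le> (\<Sum>\<theta>\<in>\<Theta>. card (B \<theta>))" by (rule card_UN_le) simp
    also have "\<dots> \<le> card \<Theta> * (2 * H + 1)"
      using sum_bounded_above[of \<Theta> "\<lambda>\<theta>. card (B \<theta>)" "2 * H + 1"] card_near_le(1) unfolding B_def by simp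
    finally have "real (card {t \<in> {- int K..int K}. \<bar>Nm (pCons t g')\<bar> < int H ^ d}) \<le> real (d * (2 * H + 1))"
      unfolding card_\<Theta> by (rule of_nat_mono)
    then show "real (card {t \<in> {- int K..int K}. \<bar>Nm (pCons t g')\<bar> < int H ^ d}) \<le> real d * (2 * real H + 1)" by (simp add: algebra_simps)
  qed simp
  moreover have "real (card {- int K..int K}) = 2 * real K + 1" by simp
  moreover have "Suc (d - 1) = d" using d_pos by simp
  ultimately show ?thesis by simp
qed

text \<open>For fixed higher coefficients the norm is monic of degree d in the constant one. The
  exponent d j + 1 leaves p^1 > 1 to exceed this leading coefficient 1.\<close>

lemma card_norm_prime_power_le:
  assumes p: "prime p"
  shows "real (card {g \<in> Box d K. int p ^ (d * j + 1) dvd Nm g})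
     \<le> real d * ((2 * real K + 1) / real p ^ j + 1) * (2 * real K + 1) ^ (d - 1)"
proof -
  have "real (card {g \<in> coeff_box (Suc (d - 1)) {- int K..int K}. int p ^ (d * j + 1) dvd Nm g})
      \<le> (real d * (real (2 * K + 1) / real (p ^ j) + 1)) * real (card {- int K..int K}) ^ (d - 1)"
  proof (rule coeff_box_fibre_count)
    fix g'
    define h where "h = (\<Prod>\<theta>\<in>\<Theta>. [:\<theta> * ev g' \<theta>, 1:])"
    have "real (card {t \<in> {- int K..< - int K + int (2 * K + 1)}. int p ^ (d * j + 1) dvd Nm (pCons t g')})
      \<le> real d * (real (2 * K + 1) / real (p ^ j) + 1)"
    proof (rule card_prime_power_roots_le)
      show "degree h = d" unfolding h_def by (subst degree_prod_eq_sum_degree) (auto simp: card_\<Theta>)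
      show "lead_coeff h = of_int 1" unfolding h_def by (simp add: lead_coeff_prod)
      show "poly h (of_int t) = of_int (Nm (pCons t g'))" for t
        unfolding h_def of_int_Nm by (simp add: poly_prod add.commute)
      show "\<bar>1\<bar> < int p ^ (d * j + 1 - d * j)" using prime_gt_1_nat[OF p] by simp
    qed (use p in auto)
    moreover have "{- int K..< - int K + int (2 * K + 1)} = {- int K..int K}" by auto
    ultimately show "real (card {t \<in> {- int K..int K}. int p ^ (d * j + 1) dvd Nm (pCons t g')})
      \<le> real d * (real (2 * K + 1) / real (p ^ j) + 1)" by simp
  qed simp
  moreover have "real (card {- int K..int K}) = 2 * real K + 1" by simp
  moreover have "Suc (d - 1) = d" using d_pos by simp
  ultimately show ?thesis by (simp add: add.commute)
qed

lemma Nm_Box_bound: "\<exists>C::nat. C \<ge> 1 \<and> (\<forall>K g. g \<in> Box d K \<longrightarrow> \<bar>Nm g\<bar> \<le> int ((C * K) ^ d))"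
proof -
  obtain C :: nat where C: "C \<ge> 1"
    "\<And>T g \<theta>. \<theta> \<in> \<Theta> \<Longrightarrow> degree g < d \<Longrightarrow> (\<And>i. real_of_int \<bar>coeff g i\<bar> \<le> T) \<Longrightarrow> norm (ev g \<theta>) \<le> real C * T"
    using ev_Box_bound by blast
  have "\<bar>Nm g\<bar> \<le> int ((C * K) ^ d)" if g: "g \<in> Box d K" for K g
  proof -
    have deg: "degree g < d" using degree_coeff_box[OF g] d_pos by simp
    have co: "real_of_int \<bar>coeff g i\<bar> \<le> real K" for i
      using BoxD[OF g, of i] by linarith
    have "real_of_int \<bar>Nm g\<bar> = norm (of_int (Nm g) :: complex)" by simp
    also have "\<dots> = (\<Prod>\<theta>\<in>\<Theta>. norm (ev g \<theta>))" unfolding of_int_Nm by (simp add: prod_norm)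
    also have "\<dots> \<le> (\<Prod>\<theta>\<in>\<Theta>. real C * real K)"
      using C(2)[OF _ deg co] by (intro prod_mono) auto
    also have "\<dots> = real_of_int (int ((C * K) ^ d))" by (simp add: card_\<Theta>)
    finally show ?thesis by (simp only: of_int_le_iff)
  qed
  then show ?thesis using C(1) by blast
qed

definition norm_const :: nat where
  "norm_const = (SOME C::nat. C \<ge> 1 \<and> (\<forall>K g. g \<in> Box d K \<longrightarrow> \<bar>Nm g\<bar> \<le> int ((C * K) ^ d)))"

lemma norm_const: "norm_const \<ge> 1" "g \<in> Box d K \<Longrightarrow> \<bar>Nm g\<bar> \<le> int ((norm_const * K) ^ d)"
  using someI_ex[OF Nm_Box_bound, folded norm_const_def] by blast+

lemma Nm_Box_nz: "g \<in> Box d K - {0} \<Longrightarrow> Nm g \<noteq> 0"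
  using Nm_eq_0_iff degree_coeff_box[of g d] d_pos by auto

end

section \<open>Norms in a box against their prime factorisations\<close>

context scaled_field_poly
begin

definition exceptional_const :: real where
  "exceptional_const = (SOME C::real. C > 0 \<and> (\<forall>p H. good p \<longrightarrow>
     real (card {g \<in> Box d H. g \<noteq> 0 \<and> multiplicity (int p) (Nm g) \<noteq> nroots_of p g})
       \<le> C * ((2 * real H + 1) ^ d / real p ^ 2 + 1)))"

lemma exceptional_const: "exceptional_const > 0"
  "good p \<Longrightarrow> real (card {g \<in> Box d H. g \<noteq> 0 \<and> multiplicity (int p) (Nm g) \<noteq> nroots_of p g})
       \<le> exceptional_const * ((2 * real H + 1) ^ d / real p ^ 2 + 1)"
  using someI_ex[OF exceptional_count, folded exceptional_const_def] by blast+

definition prime_bound :: nat where "prime_bound = nat \<bar>discr\<bar> + nat \<bar>c\<bar>"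

lemma good_of_large: "prime p \<Longrightarrow> p > prime_bound \<Longrightarrow> good p"
proof -
  assume p: "prime p" "p > prime_bound"
  have "\<not> int p dvd k" if "k \<noteq> 0" "nat \<bar>k\<bar> \<le> prime_bound" for k
    using dvd_imp_le_int[of k "int p"] that p(2) by linarith
  then show "good p" unfolding good_def using p(1) discr_neq_0 c_nz by (simp add: prime_bound_def)
qed

lemma good_primes_in: "p \<in> primes_in P y \<Longrightarrow> P \<ge> prime_bound \<Longrightarrow> good p"
  using good_of_large unfolding primes_in_def by auto

lemma nroots_of_le: "nroots_of p g \<le> nroots p"
  unfolding nroots_def nroots_of_def by (rule card_mono) auto

text \<open>The total cost of replacing the valuation of the norm by the number of roots. An
  exceptional \<open>g\<close> costs at most (d + 1) ln Y at \<open>p\<close>, as ln Y bounds the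
  valuation times ln p; the number of such \<open>g\<close> is bounded by
  \<open>exceptional_const\<close>, and the sum of 1/p^2 beyond \<open>P\<close> is at most
  1/P.\<close>

lemma sum_deviation_le:
  assumes P: "P \<ge> prime_bound" "P > 0" and S: "S \<subseteq> primes_in P Y" and Y: "Y = (norm_const * K) ^ d" "K \<ge> 1"
  shows "(\<Sum>p\<in>S. ln (real p) * (\<Sum>g\<in>Box d K - {0}. \<bar>real (multiplicity (int p) (Nm g)) - real (nroots_of p g)\<bar>))
     \<le> (real d + 1) * exceptional_const * ln (real Y) * ((2 * real K + 1) ^ d / real P + real (card (primes_in 0 Y)))"
proof -
  let ?b = "(2 * real K + 1) ^ d"
  have finS: "finite S" by (rule finite_subset[OF S]) simp
  have "Y \<ge> 1" unfolding Y(1) using norm_const(1) Y(2) by simp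
  then have lnY: "ln (real Y) \<ge> 0" by simp
  have each: "ln (real p) * (\<Sum>g\<in>Box d K - {0}. \<bar>real (multiplicity (int p) (Nm g)) - real (nroots_of p g)\<bar>)
      \<le> (real d + 1) * ln (real Y) * (exceptional_const * (?b / real p ^ 2 + 1))" if p: "p \<in> S" for p
  proof -
    have pp: "prime p" "p \<le> Y" "P < p" using p S unfolding primes_in_def by auto
    have gd: "good p" using good_primes_in[of p P Y] p S P by blast
    have p1: "real p \<ge> 1" using pp(3) by simp
    then have lnp: "ln (real p) \<ge> 0" by simp
    let ?E = "{g \<in> Box d K. g \<noteq> 0 \<and> multiplicity (int p) (Nm g) \<noteq> nroots_of p g}"
    have "(\<Sum>g\<in>Box d K - {0}. ln (real p) * \<bar>real (multiplicity (int p) (Nm g)) - real (nroots_of p g)\<bar>)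
        = (\<Sum>g\<in>?E. ln (real p) * \<bar>real (multiplicity (int p) (Nm g)) - real (nroots_of p g)\<bar>)"
      by (intro sum.mono_neutral_right) auto
    also have "\<dots> \<le> real (card ?E) * ((real d + 1) * ln (real Y))"
    proof (rule sum_bounded_above)
      fix g assume g: "g \<in> ?E"
      have nz: "Nm g \<noteq> 0" using Nm_Box_nz[of g K] g by blast
      have bd: "\<bar>Nm g\<bar> \<le> int Y" using norm_const(2)[of g K] g Y(1) by simp
      have "real (multiplicity (int p) (Nm g)) * ln (real p) \<le> ln (real_of_int \<bar>Nm g\<bar>)"
        using sum_mult_ln_le[OF nz bd, of "{p}"] pp p1 by (simp add: primes_in_def)
      also have "\<dots> \<le> ln (real Y)"
      proof (rule ln_mono)
        show "real_of_int \<bar>Nm g\<bar> \<le> real Y" using bd by linarith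
      qed (use nz in simp)
      finally have 1: "real (multiplicity (int p) (Nm g)) * ln (real p) \<le> ln (real Y)" .
      have "real (nroots_of p g) * ln (real p) \<le> real d * ln (real Y)"
      proof (rule mult_mono)
        show "real (nroots_of p g) \<le> real d" using nroots_of_le[of p g] nroots_le[OF gd] by simp
        show "ln (real p) \<le> ln (real Y)" using pp p1 by (intro ln_mono) auto
      qed (use lnp in auto)
      moreover have "\<bar>real (multiplicity (int p) (Nm g)) - real (nroots_of p g)\<bar> \<le> real (multiplicity (int p) (Nm g)) + real (nroots_of p g)"
        by linarith
      then have "ln (real p) * \<bar>real (multiplicity (int p) (Nm g)) - real (nroots_of p g)\<bar>
          \<le> ln (real p) * (real (multiplicity (int p) (Nm g)) + real (nroots_of p g))"
        using lnp by (rule mult_left_mono)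
      ultimately show "ln (real p) * \<bar>real (multiplicity (int p) (Nm g)) - real (nroots_of p g)\<bar> \<le> (real d + 1) * ln (real Y)"
        using 1 by (simp add: algebra_simps)
    qed
    also have "\<dots> \<le> (exceptional_const * (?b / real p ^ 2 + 1)) * ((real d + 1) * ln (real Y))"
      using exceptional_const(2)[OF gd, of K] lnY by (intro mult_right_mono) auto
    finally show ?thesis by (simp add: sum_distrib_left mult_ac)
  qed
  have "(\<Sum>p\<in>S. ln (real p) * (\<Sum>g\<in>Box d K - {0}. \<bar>real (multiplicity (int p) (Nm g)) - real (nroots_of p g)\<bar>))
    \<le> (\<Sum>p\<in>S. (real d + 1) * ln (real Y) * (exceptional_const * (?b / real p ^ 2 + 1)))"
    by (intro sum_mono each)
  also have "\<dots> = (real d + 1) * exceptional_const * ln (real Y) * (?b * (\<Sum>p\<in>S. 1 / real p ^ 2) + real (card S))"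
  proof -
    have "(real d + 1) * ln (real Y) * (exceptional_const * (?b / real p ^ 2 + 1))
        = (real d + 1) * exceptional_const * ln (real Y) * (?b * (1 / real p ^ 2) + 1)" for p
      by simp
    then show ?thesis by (simp only: sum_distrib_left[symmetric] sum.distrib) simp
  qed
  also have "\<dots> \<le> (real d + 1) * exceptional_const * ln (real Y) * (?b / real P + real (card (primes_in 0 Y)))"
  proof (intro mult_left_mono add_mono)
    have "(\<Sum>p\<in>S. 1 / real p ^ 2) \<le> (\<Sum>p\<in>primes_in P Y. 1 / real p ^ 2)"
      using S by (intro sum_mono2) auto
    also have "\<dots> \<le> 1 / real P" by (rule sum_inverse_squares[OF P(2)])
    finally have "?b * (\<Sum>p\<in>S. 1 / real p ^ 2) \<le> ?b * (1 / real P)" by (intro mult_left_mono) auto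
    then show "?b * (\<Sum>p\<in>S. 1 / real p ^ 2) \<le> ?b / real P" by simp
    have "card S \<le> card (primes_in 0 Y)"
      using S by (intro card_mono) (auto simp: primes_in_def)
    then show "real (card S) \<le> real (card (primes_in 0 Y))" by simp
  qed (use lnY exceptional_const(1) in auto)
  finally show ?thesis .
qed

text \<open>Exchange of summation; the -1 removes the zero polynomial, which lies in every ideal but
  has no factorisation.\<close>

lemma sum_nroots_of:
  "(\<Sum>g\<in>Box d K - {0}. real (nroots_of p g))
     = (\<Sum>s | shift_root p s. real (card (root_ideal p (- c * int s) \<inter> Box d K)) - 1)"
proof -
  have "(\<Sum>g\<in>Box d K - {0}. real (nroots_of p g))
     = (\<Sum>g\<in>Box d K - {0}. \<Sum>s | shift_root p s. if g \<in> root_ideal p (- c * int s) then 1 else 0)"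
  proof (rule sum.cong)
    fix g
    have "{s. shift_root p s \<and> int p dvd poly g (- c * int s)} = {s \<in> {s. shift_root p s}. g \<in> root_ideal p (- c * int s)}"
      unfolding root_ideal_def by auto
    then show "real (nroots_of p g) = (\<Sum>s | shift_root p s. if g \<in> root_ideal p (- c * int s) then 1 else 0)"
      unfolding nroots_of_def by (simp add: sum.If_cases Int_def)
  qed simp
  also have "\<dots> = (\<Sum>s | shift_root p s. \<Sum>g\<in>Box d K - {0}. if g \<in> root_ideal p (- c * int s) then 1 else 0)"
    by (rule sum.swap)
  also have "\<dots> = (\<Sum>s | shift_root p s. real (card (root_ideal p (- c * int s) \<inter> Box d K)) - 1)"
  proof (rule sum.cong)
    fix s
    let ?A = "root_ideal p (- c * int s) \<inter> Box d K"
    have z: "0 \<in> ?A" unfolding root_ideal_def coeff_box_def by simp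
    have "(\<Sum>g\<in>Box d K - {0}. if g \<in> root_ideal p (- c * int s) then 1 else 0) = real (card (?A - {0}))"
    proof -
      have "(Box d K - {0}) \<inter> {g. g \<in> root_ideal p (- c * int s)} = ?A - {0}" by auto
      then show ?thesis by (simp add: sum.If_cases)
    qed
    also have "card (?A - {0}) = card ?A - 1" using z by (simp add: card_Diff_singleton)
    also have "real (card ?A - 1) = real (card ?A) - 1"
    proof -
      have "card ?A > 0" using z by (auto simp: card_gt_0_iff)
      then show ?thesis by (simp add: of_nat_diff)
    qed
    finally show "(\<Sum>g\<in>Box d K - {0}. if g \<in> root_ideal p (- c * int s) then 1 else 0) = real (card ?A) - 1" .
  qed simp
  finally show ?thesis .
qed

text \<open>The ideal has index \<open>p\<close>, and the d-th root of \<open>p\<close> that governs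
  the boundary error is replaced by the common bound \<open>J\<close>.\<close>

lemma root_box_count:
  assumes p: "prime p" "shift_root p s" "p \<le> J ^ d"
  shows "real (card (root_ideal p (- c * int s) \<inter> Box d K)) \<le> (2 * (real K + real lattice_const * real J) + 1) ^ d / real p"
    "lattice_const * J \<le> K \<Longrightarrow>
      (2 * (real K - real lattice_const * real J) + 1) ^ d / real p \<le> real (card (root_ideal p (- c * int s) \<inter> Box d K))"
proof -
  let ?I = "root_ideal p (- c * int s)"
  have p0: "p > 0" using p(1) prime_gt_0_nat by simp
  note I = root_ideal[OF p0, of "- c * int s"]
  have dv: "int p dvd poly f (- c * int s)" using p(2) unfolding shift_root_def by simp
  obtain m where m: "m ^ d \<le> p" "p < (m + 1) ^ d" using exists_int_root by blast
  have "m ^ d \<le> J ^ d" using m(1) p(3) by simp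
  then have mJ: "m \<le> J" using d_pos power_mono_iff[of m J d] by simp
  have "p * card (?I \<inter> Box d K) \<le> (2 * (K + lattice_const * m) + 1) ^ d"
    using lattice_count_le[OF I(1)[OF dv] I(2)[OF dv], of m K] I(3)[OF dv] m(2) by simp
  also have "\<dots> \<le> (2 * (K + lattice_const * J) + 1) ^ d" using mJ by (intro power_mono) auto
  finally have "real (p * card (?I \<inter> Box d K)) \<le> real ((2 * (K + lattice_const * J) + 1) ^ d)" by (rule of_nat_mono)
  then have "real p * real (card (?I \<inter> Box d K)) \<le> (2 * (real K + real lattice_const * real J) + 1) ^ d"
    by (simp add: algebra_simps)
  then show "real (card (?I \<inter> Box d K)) \<le> (2 * (real K + real lattice_const * real J) + 1) ^ d / real p"
    using p0 by (simp add: pos_le_divide_eq mult.commute)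
  assume KJ: "lattice_const * J \<le> K"
  have mJ': "lattice_const * m \<le> lattice_const * J" using mJ by simp
  have "(2 * (K - lattice_const * J) + 1) ^ d \<le> (2 * (K - lattice_const * m) + 1) ^ d"
    using diff_le_mono2[OF mJ', of K] by (intro power_mono) auto
  also have "\<dots> \<le> p * card (?I \<inter> Box d K)"
    using lattice_count_ge[OF I(1)[OF dv] I(2)[OF dv], of m K] I(3)[OF dv] m(2) mJ' KJ by simp
  finally have "real ((2 * (K - lattice_const * J) + 1) ^ d) \<le> real (p * card (?I \<inter> Box d K))" by (rule of_nat_mono)
  then have "(2 * (real K - real lattice_const * real J) + 1) ^ d \<le> real p * real (card (?I \<inter> Box d K))"
    using KJ by (simp add: of_nat_diff algebra_simps)
  then show "(2 * (real K - real lattice_const * real J) + 1) ^ d / real p \<le> real (card (?I \<inter> Box d K))"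
    using p0 by (simp add: pos_divide_le_eq mult.commute)
qed

definition mertens_sum :: "nat \<Rightarrow> nat \<Rightarrow> real" where
  "mertens_sum a b = (\<Sum>p\<in>primes_in a b. real (nroots p) * ln (real p) / real p)"

lemma ln_primes_in: "p \<in> primes_in a b \<Longrightarrow> ln (real p) \<ge> 0" "p \<in> primes_in a b \<Longrightarrow> real p > 0"
  unfolding primes_in_def by auto

lemma mertens_sum_nonneg: "mertens_sum a b \<ge> 0"
  unfolding mertens_sum_def using ln_primes_in by (intro sum_nonneg divide_nonneg_pos mult_nonneg_nonneg) auto

text \<open>For every nonzero \<open>g\<close> in the box the primes in (P, H^d] contribute at most
  ln Y to the logarithm of its norm. Summed over \<open>g\<close> and divided by the box volume
  \<open>b\<close>, the left side becomes the Mertens sum, because a root ideal contains about b/p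
  members of the box. Since Y is a constant multiple of H^d for fixed \<open>k\<close>, ln Y has the
  right main term.\<close>

lemma mertens_sum_upper:
  assumes k: "k \<ge> lattice_const" and H: "H \<ge> 1" and P: "P \<ge> prime_bound" "P > 0"
    and K: "K = k * H" and Y: "Y = (norm_const * K) ^ d" and b: "b = (2 * real K + 1) ^ d"
  shows "(1 - real lattice_const / real k) ^ d * mertens_sum P (H ^ d)
     \<le> ln (real Y) + 4 * real d + (real d + 1) * exceptional_const * ln (real Y) * (1 / real P + real (card (primes_in 0 Y)) / b)"
proof -
  let ?C = "lattice_const"
  have k1: "k \<ge> 1" using k lattice_const_ge_1 by simp
  have K1: "K \<ge> 1" unfolding K using k1 H by simp
  have Y1: "Y \<ge> 1" unfolding Y using norm_const(1) K1 by simp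
  then have lnY: "ln (real Y) \<ge> 0" by simp
  have b0: "b > 0" unfolding b by simp
  define S where "S = primes_in P (H ^ d)"
  have HY: "H ^ d \<le> Y" unfolding Y K
  proof (rule power_mono)
    have "1 * (1 * H) \<le> norm_const * (k * H)" using norm_const(1) k1 by (intro mult_mono) auto
    then show "H \<le> norm_const * (k * H)" by simp
  qed simp
  have S: "S \<subseteq> primes_in P Y" unfolding S_def primes_in_def using HY by auto
  define \<delta> where "\<delta> = (1 - real ?C / real k) ^ d"
  \<comment> \<open>For p \<le> H^d the boundary error shortens the side 2K + 1 by 2CH, a proportion
    of about C/k. The -1 per root comes from the zero polynomial.\<close>
  have nr: "(\<Sum>g\<in>Box d K - {0}. real (nroots_of p g)) \<ge> real (nroots p) * (\<delta> * b / real p - 1)" if p: "p \<in> S" for p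
  proof -
    have pr: "prime p" "p \<le> H ^ d" using p unfolding S_def primes_in_def by auto
    have p0: "real p > 0" using pr(1) prime_gt_0_nat by simp
    have "of_nat (card {s. shift_root p s}) * (\<delta> * b / real p - 1) \<le> (\<Sum>s | shift_root p s. real (card (root_ideal p (- c * int s) \<inter> Box d K)) - 1)"
    proof (rule sum_bounded_below)
      fix s assume "s \<in> {s. shift_root p s}"
      then have s: "shift_root p s" by simp
      have "\<delta> * b = ((1 - real ?C / real k) * (2 * real K + 1)) ^ d" unfolding \<delta>_def b by (simp add: power_mult_distrib)
      also have "\<dots> \<le> (2 * (real K - real ?C * real H) + 1) ^ d"
      proof (rule power_mono)
        have "(1 - real ?C / real k) * (2 * real K + 1) = 2 * real K + 1 - 2 * real ?C * real H - real ?C / real k"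
          unfolding K using k1 by (simp add: field_simps)
        then show "(1 - real ?C / real k) * (2 * real K + 1) \<le> 2 * (real K - real ?C * real H) + 1" by simp
        show "0 \<le> (1 - real ?C / real k) * (2 * real K + 1)" using k k1 by simp
      qed
      finally have "\<delta> * b / real p \<le> (2 * (real K - real ?C * real H) + 1) ^ d / real p"
        using p0 by (simp add: divide_right_mono)
      also have "\<dots> \<le> real (card (root_ideal p (- c * int s) \<inter> Box d K))"
        by (rule root_box_count(2)[OF pr(1) s pr(2)]) (use k in \<open>simp add: K\<close>)
      finally show "\<delta> * b / real p - 1 \<le> real (card (root_ideal p (- c * int s) \<inter> Box d K)) - 1" by simp
    qed
    then show ?thesis unfolding sum_nroots_of nroots_def by simp
  qed
  have "\<delta> * b * mertens_sum P (H ^ d) - real d * (\<Sum>p\<in>S. ln (real p)) \<le> (\<Sum>p\<in>S. ln (real p) * (\<Sum>g\<in>Box d K - {0}. real (nroots_of p g)))"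
  proof -
    have "\<delta> * b * mertens_sum P (H ^ d) - real d * (\<Sum>p\<in>S. ln (real p)) = (\<Sum>p\<in>S. ln (real p) * (real (nroots p) * (\<delta> * b / real p) - real d))"
      unfolding mertens_sum_def S_def[symmetric] by (simp add: sum_distrib_left sum_subtractf algebra_simps)
    also have "\<dots> \<le> (\<Sum>p\<in>S. ln (real p) * (\<Sum>g\<in>Box d K - {0}. real (nroots_of p g)))"
    proof (intro sum_mono mult_left_mono)
      fix p assume p: "p \<in> S"
      have "real (nroots p) \<le> real d" using nroots_le[of p] good_primes_in[of p P] p P unfolding S_def by simp
      then show "real (nroots p) * (\<delta> * b / real p) - real d \<le> (\<Sum>g\<in>Box d K - {0}. real (nroots_of p g))"
        using nr[OF p] by (simp add: algebra_simps)
      show "0 \<le> ln (real p)" using p ln_primes_in unfolding S_def by blast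
    qed
    finally show ?thesis .
  qed
  also have "\<dots> \<le> (\<Sum>p\<in>S. ln (real p) * ((\<Sum>g\<in>Box d K - {0}. real (multiplicity (int p) (Nm g)))
      + (\<Sum>g\<in>Box d K - {0}. \<bar>real (multiplicity (int p) (Nm g)) - real (nroots_of p g)\<bar>)))"
  proof (intro sum_mono mult_left_mono)
    fix p assume p: "p \<in> S"
    show "0 \<le> ln (real p)" using p ln_primes_in unfolding S_def by blast
    show "(\<Sum>g\<in>Box d K - {0}. real (nroots_of p g)) \<le> (\<Sum>g\<in>Box d K - {0}. real (multiplicity (int p) (Nm g)))
      + (\<Sum>g\<in>Box d K - {0}. \<bar>real (multiplicity (int p) (Nm g)) - real (nroots_of p g)\<bar>)"
      unfolding sum.distrib[symmetric] by (intro sum_mono) linarith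
  qed
  also have "\<dots> = (\<Sum>g\<in>Box d K - {0}. \<Sum>p\<in>S. real (multiplicity (int p) (Nm g)) * ln (real p))
      + (\<Sum>p\<in>S. ln (real p) * (\<Sum>g\<in>Box d K - {0}. \<bar>real (multiplicity (int p) (Nm g)) - real (nroots_of p g)\<bar>))"
    unfolding distrib_left sum.distrib
    by (subst sum.swap) (simp add: sum_distrib_left mult.commute)
  also have "\<dots> \<le> b * ln (real Y) + (real d + 1) * exceptional_const * ln (real Y) * (b / real P + real (card (primes_in 0 Y)))"
  proof (rule add_mono)
    have "(\<Sum>g\<in>Box d K - {0}. \<Sum>p\<in>S. real (multiplicity (int p) (Nm g)) * ln (real p)) \<le> of_nat (card (Box d K - {0})) * ln (real Y)"
    proof (rule sum_bounded_above)
      fix g assume g: "g \<in> Box d K - {0}"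
      have nz: "Nm g \<noteq> 0" using Nm_Box_nz[OF g] .
      have bd: "\<bar>Nm g\<bar> \<le> int Y" using norm_const(2)[of g K] g Y by simp
      have "(\<Sum>p\<in>S. real (multiplicity (int p) (Nm g)) * ln (real p)) \<le> ln (real_of_int \<bar>Nm g\<bar>)"
        using S by (intro sum_mult_ln_le[OF nz bd]) (auto simp: primes_in_def)
      also have "\<dots> \<le> ln (real Y)"
      proof (rule ln_mono)
        show "real_of_int \<bar>Nm g\<bar> \<le> real Y" using bd by linarith
      qed (use nz in simp)
      finally show "(\<Sum>p\<in>S. real (multiplicity (int p) (Nm g)) * ln (real p)) \<le> ln (real Y)" .
    qed
    also have "\<dots> \<le> b * ln (real Y)"
    proof (rule mult_right_mono[OF _ lnY])
      have "card (Box d K - {0}) \<le> card (Box d K)" by (rule card_mono) auto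
      then have "real (card (Box d K - {0})) \<le> real ((2 * K + 1) ^ d)" unfolding card_Box by (rule of_nat_mono)
      then show "real (card (Box d K - {0})) \<le> b" unfolding b by (simp add: add.commute)
    qed
    finally show "(\<Sum>g\<in>Box d K - {0}. \<Sum>p\<in>S. real (multiplicity (int p) (Nm g)) * ln (real p)) \<le> b * ln (real Y)" .
  qed (unfold b, rule sum_deviation_le[OF P S Y K1])
  finally have main: "\<delta> * b * mertens_sum P (H ^ d) - real d * (\<Sum>p\<in>S. ln (real p))
    \<le> b * ln (real Y) + (real d + 1) * exceptional_const * ln (real Y) * (b / real P + real (card (primes_in 0 Y)))" .
  have "(\<Sum>p\<in>S. ln (real p)) \<le> (\<Sum>p\<in>primes_in 0 (H ^ d). ln (real p))"
    unfolding S_def using ln_primes_in by (intro sum_mono2) (auto simp: primes_in_def)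
  also have "\<dots> \<le> 4 * real (H ^ d)" by (rule theta_bound)
  also have "real (H ^ d) \<le> b"
  proof -
    have "real H ^ d \<le> (2 * real K + 1) ^ d"
    proof (rule power_mono)
      have "1 * H \<le> k * H" using k1 by (rule mult_right_mono) simp
      then have "real H \<le> real K" unfolding K by (metis mult_1 of_nat_le_iff)
      then show "real H \<le> 2 * real K + 1" by simp
    qed simp
    then show ?thesis unfolding b by simp
  qed
  finally have "real d * (\<Sum>p\<in>S. ln (real p)) \<le> real d * (4 * b)" by (intro mult_left_mono) auto
  then have "b * (\<delta> * mertens_sum P (H ^ d)) \<le> b * (ln (real Y) + 4 * real d
     + (real d + 1) * exceptional_const * ln (real Y) * (1 / real P + real (card (primes_in 0 Y)) / b))"
    using main b0 by (simp add: distrib_left mult_ac)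
  then show ?thesis unfolding \<delta>_def using b0 by (simp only: mult_le_cancel_left_pos)
qed

text \<open>Primes up to \<open>P\<close> include the bad ones. Their valuation is capped at d j +
  1, except on a set of polynomials of proportion about d/2^j, where ln Y is used instead;
  \<open>j\<close> can be chosen after \<open>P\<close>.\<close>

lemma small_primes_le:
  assumes K: "K \<ge> 1" and Y: "Y = (norm_const * K) ^ d" and b: "b = (2 * real K + 1) ^ d"
  shows "(\<Sum>g\<in>Box d K - {0}. \<Sum>p\<in>primes_in 0 P. real (multiplicity (int p) (Nm g)) * ln (real p))
    \<le> b * (real (d * j + 1) * (4 * real P)) + b * (ln (real Y) * (real P * (real d * (1 / 2 ^ j + 1 / (2 * real K + 1)))))"
proof -
  have "Y \<ge> 1" unfolding Y using norm_const(1) K by simp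
  then have lnY: "ln (real Y) \<ge> 0" by simp
  have b0: "b > 0" unfolding b by simp
  let ?q = "\<lambda>p. int p ^ (d * j + 1)"
  have "(\<Sum>g\<in>Box d K - {0}. \<Sum>p\<in>primes_in 0 P. real (multiplicity (int p) (Nm g)) * ln (real p))
    \<le> (\<Sum>g\<in>Box d K - {0}. \<Sum>p\<in>primes_in 0 P. real (d * j + 1) * ln (real p) + (if ?q p dvd Nm g then ln (real Y) else 0))"
  proof (intro sum_mono)
    fix g p assume g: "g \<in> Box d K - {0}" and p: "p \<in> primes_in 0 P"
    have pr: "prime p" using p unfolding primes_in_def by simp
    have lnp: "ln (real p) \<ge> 0" using ln_primes_in p by blast
    have nz: "Nm g \<noteq> 0" using Nm_Box_nz[OF g] .
    have bd: "\<bar>Nm g\<bar> \<le> int Y" using norm_const(2)[of g K] g Y by simp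
    show "real (multiplicity (int p) (Nm g)) * ln (real p) \<le> real (d * j + 1) * ln (real p) + (if ?q p dvd Nm g then ln (real Y) else 0)"
    proof (cases "?q p dvd Nm g")
      case True
      then have "int p dvd Nm g" by (metis Suc_eq_plus1 dvd_mult_left power_Suc)
      then have "int p \<le> \<bar>Nm g\<bar>" using nz dvd_imp_le_int[of "Nm g" "int p"] by simp
      then have pY: "p \<le> Y" using bd by linarith
      have "real (multiplicity (int p) (Nm g)) * ln (real p) \<le> ln (real_of_int \<bar>Nm g\<bar>)"
        using sum_mult_ln_le[OF nz bd, of "{p}"] pr pY p by (simp add: primes_in_def)
      also have "\<dots> \<le> ln (real Y)"
      proof (rule ln_mono)
        show "real_of_int \<bar>Nm g\<bar> \<le> real Y" using bd by linarith
      qed (use nz in simp)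
      finally show ?thesis using True lnp by (simp add: add_increasing)
    next
      case False
      have "\<not> is_unit (int p)" using pr by (meson not_prime_unit prime_nat_int_transfer)
      then have "\<not> (d * j + 1 \<le> multiplicity (int p) (Nm g))"
        using False nz power_dvd_iff_le_multiplicity[of "Nm g" "int p" "d * j + 1"] by simp
      then have "multiplicity (int p) (Nm g) \<le> d * j + 1" by simp
      then have "real (multiplicity (int p) (Nm g)) \<le> real (d * j + 1)" by (rule of_nat_mono)
      then have "real (multiplicity (int p) (Nm g)) * ln (real p) \<le> real (d * j + 1) * ln (real p)"
        using lnp by (rule mult_right_mono)
      then show ?thesis using False by simp
    qed
  qed
  also have "\<dots> = real (card (Box d K - {0})) * (real (d * j + 1) * (\<Sum>p\<in>primes_in 0 P. ln (real p)))
     + (\<Sum>p\<in>primes_in 0 P. \<Sum>g\<in>Box d K - {0}. if ?q p dvd Nm g then ln (real Y) else 0)"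
    unfolding sum.distrib by (subst (2) sum.swap) (simp add: sum_distrib_left)
  also have "\<dots> \<le> b * (real (d * j + 1) * (4 * real P)) + b * (ln (real Y) * (real P * (real d * (1 / 2 ^ j + 1 / (2 * real K + 1)))))"
  proof (rule add_mono)
    show "real (card (Box d K - {0})) * (real (d * j + 1) * (\<Sum>p\<in>primes_in 0 P. ln (real p))) \<le> b * (real (d * j + 1) * (4 * real P))"
    proof (intro mult_mono theta_bound)
      have "card (Box d K - {0}) \<le> card (Box d K)" by (rule card_mono) auto
      then have "real (card (Box d K - {0})) \<le> real ((2 * K + 1) ^ d)" unfolding card_Box by (rule of_nat_mono)
      then show "real (card (Box d K - {0})) \<le> b" unfolding b by (simp add: add.commute)
      show "0 \<le> (\<Sum>p\<in>primes_in 0 P. ln (real p))" using ln_primes_in by (intro sum_nonneg) blast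
      then show "0 \<le> real (d * j + 1) * (\<Sum>p\<in>primes_in 0 P. ln (real p))" by simp
    qed (use b0 in auto)
    have "(\<Sum>p\<in>primes_in 0 P. \<Sum>g\<in>Box d K - {0}. if ?q p dvd Nm g then ln (real Y) else 0)
       \<le> of_nat (card (primes_in 0 P)) * (b * (ln (real Y) * (real d * (1 / 2 ^ j + 1 / (2 * real K + 1)))))"
    proof (rule sum_bounded_above)
      fix p assume p: "p \<in> primes_in 0 P"
      have pr: "prime p" using p unfolding primes_in_def by simp
      have "(\<Sum>g\<in>Box d K - {0}. if ?q p dvd Nm g then ln (real Y) else 0) = real (card ((Box d K - {0}) \<inter> {g. ?q p dvd Nm g})) * ln (real Y)"
        by (simp add: sum.If_cases)
      also have "\<dots> \<le> real (card {g \<in> Box d K. ?q p dvd Nm g}) * ln (real Y)"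
      proof (rule mult_right_mono[OF _ lnY], rule of_nat_mono, rule card_mono)
        show "finite {g \<in> Box d K. ?q p dvd Nm g}" by (rule finite_subset[of _ "Box d K"]) auto
      qed auto
      also have "\<dots> \<le> (real d * ((2 * real K + 1) / real p ^ j + 1) * (2 * real K + 1) ^ (d - 1)) * ln (real Y)"
        by (rule mult_right_mono[OF card_norm_prime_power_le[OF pr] lnY])
      also have "\<dots> \<le> (real d * ((2 * real K + 1) / 2 ^ j + 1) * (2 * real K + 1) ^ (d - 1)) * ln (real Y)"
      proof (intro mult_right_mono mult_left_mono add_right_mono divide_left_mono)
        show "(2::real) ^ j \<le> real p ^ j" using prime_ge_2_nat[OF pr] by (intro power_mono) auto
      qed (use lnY prime_gt_0_nat[OF pr] in auto)
      also have "\<dots> = b * (ln (real Y) * (real d * (1 / 2 ^ j + 1 / (2 * real K + 1))))"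
      proof -
        define B where "B = 2 * real K + 1"
        have B: "B > 0" unfolding B_def by simp
        have "b = B * B ^ (d - 1)" unfolding b B_def[symmetric] using d_pos by (metis Suc_diff_le diff_Suc_1 power_Suc One_nat_def Suc_pred less_eq_Suc_le)
        moreover have "B / 2 ^ j + 1 = B * (1 / 2 ^ j + 1 / B)" using B by (simp add: distrib_left)
        ultimately show ?thesis unfolding B_def[symmetric] by (simp only: mult_ac)
      qed
      finally show "(\<Sum>g\<in>Box d K - {0}. if ?q p dvd Nm g then ln (real Y) else 0) \<le> b * (ln (real Y) * (real d * (1 / 2 ^ j + 1 / (2 * real K + 1))))" .
    qed
    also have "\<dots> \<le> real P * (b * (ln (real Y) * (real d * (1 / 2 ^ j + 1 / (2 * real K + 1)))))"
    proof (rule mult_right_mono)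
      have "card (primes_in 0 P) \<le> card {1..P}" by (rule card_mono) (auto simp: primes_in_def)
      then show "real (card (primes_in 0 P)) \<le> real P" by simp
    qed (use b0 lnY in auto)
    also have "\<dots> = b * (ln (real Y) * (real P * (real d * (1 / 2 ^ j + 1 / (2 * real K + 1)))))" by (simp only: mult_ac)
    finally show "(\<Sum>p\<in>primes_in 0 P. \<Sum>g\<in>Box d K - {0}. if ?q p dvd Nm g then ln (real Y) else 0)
      \<le> b * (ln (real Y) * (real P * (real d * (1 / 2 ^ j + 1 / (2 * real K + 1)))))" .
  qed
  finally show ?thesis .
qed

text \<open>Norms below H^d occur for at most a proportion 2d/k of the box, since (2H + 1) k \<le> 2
  (2K + 1). The other nonzero norms have nonnegative logarithm and can only help.\<close>

lemma sum_ln_norm_ge: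
  assumes k: "k \<ge> 1" and H: "H \<ge> 1" and K: "K = k * H" and b: "b = (2 * real K + 1) ^ d"
  shows "b * ((1 - 2 * real d / real k) * (real d * ln (real H))) \<le> (\<Sum>g\<in>Box d K - {0}. ln (real_of_int \<bar>Nm g\<bar>))"
proof -
  let ?S = "{g \<in> Box d K. \<bar>Nm g\<bar> < int H ^ d}"
  have finS: "finite ?S" by (rule finite_subset[of _ "Box d K"]) auto
  have lnH: "ln (real H) \<ge> 0" using H by simp
  have small: "real (card ?S) \<le> 2 * real d / real k * b"
  proof -
    define B where "B = 2 * real K + 1"
    have B: "B > 0" unfolding B_def by simp
    have "k * 1 \<le> k * H" using H by (rule mult_left_mono) simp
    then have "real k \<le> real K" unfolding K by (metis mult_1_right of_nat_le_iff)
    then have "(2 * real H + 1) * real k \<le> 2 * B" unfolding B_def K by (simp add: algebra_simps)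
    then have hk: "2 * real H + 1 \<le> 2 * B / real k" using k by (simp add: pos_le_divide_eq)
    have "real (card ?S) \<le> real d * (2 * real H + 1) * B ^ (d - 1)" unfolding B_def by (rule card_small_norm_le)
    also have "\<dots> \<le> real d * (2 * B / real k) * B ^ (d - 1)"
      using hk B by (intro mult_right_mono mult_left_mono) auto
    also have "\<dots> = 2 * real d / real k * (B * B ^ (d - 1))" by simp
    also have "B * B ^ (d - 1) = b" unfolding b B_def[symmetric] using d_pos
      by (metis Suc_diff_le diff_Suc_1 power_Suc One_nat_def Suc_pred less_eq_Suc_le)
    finally show ?thesis .
  qed
  have "b * ((1 - 2 * real d / real k) * (real d * ln (real H))) = (b - 2 * real d / real k * b) * (real d * ln (real H))"
    by (simp add: algebra_simps)
  also have "\<dots> \<le> real (card (Box d K - ?S)) * (real d * ln (real H))"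
  proof (rule mult_right_mono)
    have "card (Box d K - ?S) = card (Box d K) - card ?S" by (rule card_Diff_subset[OF finS]) auto
    moreover have "card ?S \<le> card (Box d K)" by (rule card_mono) auto
    ultimately have "real (card (Box d K - ?S)) = real ((2 * K + 1) ^ d) - real (card ?S)"
      by (simp add: of_nat_diff card_Box)
    also have "real ((2 * K + 1) ^ d) = b" unfolding b by (simp add: add.commute)
    finally show "b - 2 * real d / real k * b \<le> real (card (Box d K - ?S))" using small by simp
  qed (use lnH in simp)
  also have "\<dots> \<le> (\<Sum>g\<in>Box d K - ?S. ln (real_of_int \<bar>Nm g\<bar>))"
  proof (rule sum_bounded_below)
    fix g assume "g \<in> Box d K - ?S"
    then have "int H ^ d \<le> \<bar>Nm g\<bar>" by auto
    then have "real_of_int (int H ^ d) \<le> real_of_int \<bar>Nm g\<bar>" by (simp only: of_int_le_iff)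
    then have "ln (real H ^ d) \<le> ln (real_of_int \<bar>Nm g\<bar>)" using H by (intro ln_mono) auto
    then show "real d * ln (real H) \<le> ln (real_of_int \<bar>Nm g\<bar>)" using H by (simp add: ln_realpow)
  qed
  also have "\<dots> \<le> (\<Sum>g\<in>Box d K - {0}. ln (real_of_int \<bar>Nm g\<bar>))"
  proof (rule sum_mono2)
    have "Nm 0 = 0" using Nm_eq_0_iff[of 0] d_pos by simp
    then have "0 \<in> ?S" using H by (simp add: coeff_box_def)
    then show "Box d K - ?S \<subseteq> Box d K - {0}" by blast
  next
    fix g assume "g \<in> Box d K - {0} - (Box d K - ?S)"
    then have "Nm g \<noteq> 0" using Nm_Box_nz by blast
    then have "\<bar>Nm g\<bar> \<ge> 1" by linarith
    then show "0 \<le> ln (real_of_int \<bar>Nm g\<bar>)" by simp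
  qed simp
  finally show ?thesis .
qed

text \<open>The average logarithm of the norm is nearly ln(H^d), and it is distributed over the
  primes up to \<open>P\<close>, in (P, H^d] and in (H^d, Y]. Only the middle range gives the
  Mertens sum; the first and the last contribute bounded amounts or small multiples of ln Y.\<close>

lemma mertens_sum_lower:
  assumes k: "k \<ge> 1" and H: "H \<ge> 1" and P: "P \<ge> prime_bound" "P > 0" "P \<le> H ^ d"
    and K: "K = k * H" and Y: "Y = (norm_const * K) ^ d" and b: "b = (2 * real K + 1) ^ d"
  shows "(1 - 2 * real d / real k) * (real d * ln (real H))
     \<le> (1 + real lattice_const / real k) ^ d * mertens_sum P (H ^ d)
       + 4 * real d * (1 + real lattice_const * real norm_const) ^ d * (real norm_const * real k) ^ d
       + real (d * j + 1) * (4 * real P)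
       + ln (real Y) * (real P * (real d * (1 / 2 ^ j + 1 / (2 * real K + 1))))
       + (real d + 1) * exceptional_const * ln (real Y) * (1 / real P + real (card (primes_in 0 Y)) / b)"
proof -
  let ?C = "lattice_const" and ?N = "norm_const"
  have K1: "K \<ge> 1" unfolding K using k H by simp
  have Y1: "Y \<ge> 1" unfolding Y using norm_const(1) K1 by simp
  then have lnY: "ln (real Y) \<ge> 0" by simp
  have b0: "b > 0" unfolding b by simp
  have HY: "H ^ d \<le> Y" unfolding Y K
  proof (rule power_mono)
    have "1 * (1 * H) \<le> ?N * (k * H)" using norm_const(1) k by (intro mult_mono) auto
    then show "H \<le> ?N * (k * H)" by simp
  qed simp
  define \<Delta> where "\<Delta> = (1 + real ?C / real k) ^ d"
  define \<Gamma> where "\<Gamma> = (1 + real ?C * real ?N) ^ d"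
  have \<Gamma>0: "\<Gamma> \<ge> 0" unfolding \<Gamma>_def by simp
  have nr1: "(\<Sum>g\<in>Box d K - {0}. real (nroots_of p g)) \<le> real (nroots p) * (\<Delta> * b / real p)" if p: "p \<in> primes_in P (H ^ d)" for p
  proof -
    have pr: "prime p" "p \<le> H ^ d" using p unfolding primes_in_def by auto
    have "(\<Sum>s | shift_root p s. real (card (root_ideal p (- c * int s) \<inter> Box d K)) - 1) \<le> of_nat (card {s. shift_root p s}) * (\<Delta> * b / real p)"
    proof (rule sum_bounded_above)
      fix s assume "s \<in> {s. shift_root p s}"
      then have s: "shift_root p s" by simp
      have "(2 * (real K + real ?C * real H) + 1) ^ d \<le> ((1 + real ?C / real k) * (2 * real K + 1)) ^ d"
      proof (rule power_mono)
        have "(1 + real ?C / real k) * (2 * real K + 1) = 2 * real K + 1 + 2 * real ?C * real H + real ?C / real k"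
          unfolding K using k by (simp add: field_simps)
        then show "2 * (real K + real ?C * real H) + 1 \<le> (1 + real ?C / real k) * (2 * real K + 1)" by simp
      qed simp
      also have "\<dots> = \<Delta> * b" unfolding \<Delta>_def b by (simp add: power_mult_distrib)
      finally have "(2 * (real K + real ?C * real H) + 1) ^ d / real p \<le> \<Delta> * b / real p" by (simp add: divide_right_mono)
      then show "real (card (root_ideal p (- c * int s) \<inter> Box d K)) - 1 \<le> \<Delta> * b / real p"
        using root_box_count(1)[OF pr(1) s pr(2), of K] by linarith
    qed
    then show ?thesis unfolding sum_nroots_of nroots_def by simp
  qed
  \<comment> \<open>Beyond H^d the lattice is not fine compared with the ratio K/H, so the count is
    known only up to the constant factor \<Gamma>. This suffices because the range (H^d, Y] is
    bounded in logarithmic scale.\<close>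
  have nr2: "(\<Sum>g\<in>Box d K - {0}. real (nroots_of p g)) \<le> real d * (\<Gamma> * b / real p)" if p: "p \<in> primes_in (H ^ d) Y" for p
  proof -
    have pr: "prime p" "p \<le> (?N * K) ^ d" using p unfolding primes_in_def Y by auto
    have gd: "good p" using good_primes_in[OF p] P by simp
    have "(\<Sum>s | shift_root p s. real (card (root_ideal p (- c * int s) \<inter> Box d K)) - 1) \<le> of_nat (card {s. shift_root p s}) * (\<Gamma> * b / real p)"
    proof (rule sum_bounded_above)
      fix s assume "s \<in> {s. shift_root p s}"
      then have s: "shift_root p s" by simp
      have "(2 * (real K + real ?C * real (?N * K)) + 1) ^ d \<le> ((1 + real ?C * real ?N) * (2 * real K + 1)) ^ d"
        by (rule power_mono) (simp_all add: algebra_simps)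
      also have "\<dots> = \<Gamma> * b" unfolding \<Gamma>_def b by (simp add: power_mult_distrib)
      finally have "(2 * (real K + real ?C * real (?N * K)) + 1) ^ d / real p \<le> \<Gamma> * b / real p" by (simp add: divide_right_mono)
      then show "real (card (root_ideal p (- c * int s) \<inter> Box d K)) - 1 \<le> \<Gamma> * b / real p"
        using root_box_count(1)[OF pr(1) s pr(2), of K] by linarith
    qed
    also have "\<dots> \<le> real d * (\<Gamma> * b / real p)"
      using nroots_le[OF gd] \<Gamma>0 b0 unfolding nroots_def by (intro mult_right_mono) auto
    finally show ?thesis unfolding sum_nroots_of .
  qed
  let ?S = "primes_in P Y"
  have "b * ((1 - 2 * real d / real k) * (real d * ln (real H))) \<le> (\<Sum>g\<in>Box d K - {0}. ln (real_of_int \<bar>Nm g\<bar>))"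
    by (rule sum_ln_norm_ge[OF k H K b])
  also have "\<dots> = (\<Sum>g\<in>Box d K - {0}. (\<Sum>p\<in>primes_in 0 P. real (multiplicity (int p) (Nm g)) * ln (real p))
      + (\<Sum>p\<in>?S. real (multiplicity (int p) (Nm g)) * ln (real p)))"
  proof (rule sum.cong)
    fix g assume g: "g \<in> Box d K - {0}"
    have bd: "\<bar>Nm g\<bar> \<le> int Y" using norm_const(2)[of g K] g Y by simp
    show "ln (real_of_int \<bar>Nm g\<bar>) = (\<Sum>p\<in>primes_in 0 P. real (multiplicity (int p) (Nm g)) * ln (real p))
      + (\<Sum>p\<in>?S. real (multiplicity (int p) (Nm g)) * ln (real p))"
      unfolding ln_prime_factorization[OF Nm_Box_nz[OF g] bd]
      by (rule sum_primes_in_split) (use P HY in auto)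
  qed simp
  also have "\<dots> = (\<Sum>g\<in>Box d K - {0}. \<Sum>p\<in>primes_in 0 P. real (multiplicity (int p) (Nm g)) * ln (real p))
      + (\<Sum>p\<in>?S. ln (real p) * (\<Sum>g\<in>Box d K - {0}. real (multiplicity (int p) (Nm g))))"
    unfolding sum.distrib by (subst (2) sum.swap) (simp add: sum_distrib_left mult.commute)
  also have "(\<Sum>p\<in>?S. ln (real p) * (\<Sum>g\<in>Box d K - {0}. real (multiplicity (int p) (Nm g))))
     \<le> (\<Sum>p\<in>?S. ln (real p) * ((\<Sum>g\<in>Box d K - {0}. real (nroots_of p g))
      + (\<Sum>g\<in>Box d K - {0}. \<bar>real (multiplicity (int p) (Nm g)) - real (nroots_of p g)\<bar>)))"
  proof (intro sum_mono mult_left_mono)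
    fix p assume p: "p \<in> ?S"
    show "0 \<le> ln (real p)" using p ln_primes_in by blast
    show "(\<Sum>g\<in>Box d K - {0}. real (multiplicity (int p) (Nm g))) \<le> (\<Sum>g\<in>Box d K - {0}. real (nroots_of p g))
      + (\<Sum>g\<in>Box d K - {0}. \<bar>real (multiplicity (int p) (Nm g)) - real (nroots_of p g)\<bar>)"
      unfolding sum.distrib[symmetric] by (intro sum_mono) linarith
  qed
  also have "\<dots> = (\<Sum>p\<in>primes_in P (H ^ d). ln (real p) * (\<Sum>g\<in>Box d K - {0}. real (nroots_of p g)))
      + (\<Sum>p\<in>primes_in (H ^ d) Y. ln (real p) * (\<Sum>g\<in>Box d K - {0}. real (nroots_of p g)))
      + (\<Sum>p\<in>?S. ln (real p) * (\<Sum>g\<in>Box d K - {0}. \<bar>real (multiplicity (int p) (Nm g)) - real (nroots_of p g)\<bar>))"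
    unfolding distrib_left sum.distrib by (subst sum_primes_in_split[OF P(3) HY]) simp
  also have "\<dots> \<le> \<Delta> * b * mertens_sum P (H ^ d) + real d * \<Gamma> * b * (4 * (real ?N * real k) ^ d)
      + (real d + 1) * exceptional_const * ln (real Y) * (b / real P + real (card (primes_in 0 Y)))"
  proof (intro add_mono)
    have "(\<Sum>p\<in>primes_in P (H ^ d). ln (real p) * (\<Sum>g\<in>Box d K - {0}. real (nroots_of p g)))
      \<le> (\<Sum>p\<in>primes_in P (H ^ d). ln (real p) * (real (nroots p) * (\<Delta> * b / real p)))"
      using nr1 ln_primes_in by (intro sum_mono mult_left_mono) blast+
    also have "\<dots> = \<Delta> * b * mertens_sum P (H ^ d)"
      unfolding mertens_sum_def sum_distrib_left by (intro sum.cong) (simp_all add: mult_ac)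
    finally show "(\<Sum>p\<in>primes_in P (H ^ d). ln (real p) * (\<Sum>g\<in>Box d K - {0}. real (nroots_of p g))) \<le> \<Delta> * b * mertens_sum P (H ^ d)" .
    have Hd: "real H ^ d > 0" using H by simp
    \<comment> \<open>Every such \<open>p\<close> is at least H^d and the logarithms add up to at
      most 4Y, so the contribution is a multiple of Y / H^d, which depends only on
      \<open>k\<close>.\<close>
    have "(\<Sum>p\<in>primes_in (H ^ d) Y. ln (real p) * (\<Sum>g\<in>Box d K - {0}. real (nroots_of p g)))
      \<le> (\<Sum>p\<in>primes_in (H ^ d) Y. ln (real p) * (real d * (\<Gamma> * b / real H ^ d)))"
    proof (intro sum_mono mult_left_mono)
      fix p assume p: "p \<in> primes_in (H ^ d) Y"
      show "0 \<le> ln (real p)" using p ln_primes_in by blast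
      have "H ^ d \<le> p" using p unfolding primes_in_def by simp
      then have "real H ^ d \<le> real p" by (metis of_nat_le_iff of_nat_power)
      then have "\<Gamma> * b / real p \<le> \<Gamma> * b / real H ^ d" using \<Gamma>0 b0 Hd ln_primes_in(2)[OF p] by (intro divide_left_mono) auto
      then have "real d * (\<Gamma> * b / real p) \<le> real d * (\<Gamma> * b / real H ^ d)" by (intro mult_left_mono) auto
      then show "(\<Sum>g\<in>Box d K - {0}. real (nroots_of p g)) \<le> real d * (\<Gamma> * b / real H ^ d)" using nr2[OF p] by linarith
    qed
    also have "\<dots> = (\<Sum>p\<in>primes_in (H ^ d) Y. ln (real p)) * (real d * (\<Gamma> * b / real H ^ d))"
      by (rule sum_distrib_right[symmetric])
    also have "\<dots> \<le> (4 * real Y) * (real d * (\<Gamma> * b / real H ^ d))"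
    proof (rule mult_right_mono)
      have "(\<Sum>p\<in>primes_in (H ^ d) Y. ln (real p)) \<le> (\<Sum>p\<in>primes_in 0 Y. ln (real p))"
        using ln_primes_in by (intro sum_mono2) (auto simp: primes_in_def)
      then show "(\<Sum>p\<in>primes_in (H ^ d) Y. ln (real p)) \<le> 4 * real Y" using theta_bound[of Y] by linarith
    qed (use \<Gamma>0 b0 Hd in auto)
    also have "real Y = (real ?N * real k) ^ d * real H ^ d" unfolding Y K by (simp add: power_mult_distrib mult_ac)
    also have "4 * ((real ?N * real k) ^ d * real H ^ d) * (real d * (\<Gamma> * b / real H ^ d)) = real d * \<Gamma> * b * (4 * (real ?N * real k) ^ d)"
    proof -
      have "4 * (x * h) * (real d * (\<Gamma> * b / h)) = real d * \<Gamma> * b * (4 * x)" if "h > 0" for x h :: real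
        using that by simp
      then show ?thesis using Hd by blast
    qed
    finally show "(\<Sum>p\<in>primes_in (H ^ d) Y. ln (real p) * (\<Sum>g\<in>Box d K - {0}. real (nroots_of p g))) \<le> real d * \<Gamma> * b * (4 * (real ?N * real k) ^ d)" .
  qed (unfold b, rule sum_deviation_le[OF P(1,2) _ Y K1], simp)
  finally have main: "b * ((1 - 2 * real d / real k) * (real d * ln (real H)))
    \<le> (\<Sum>g\<in>Box d K - {0}. \<Sum>p\<in>primes_in 0 P. real (multiplicity (int p) (Nm g)) * ln (real p))
      + (\<Delta> * b * mertens_sum P (H ^ d) + real d * \<Gamma> * b * (4 * (real ?N * real k) ^ d)
      + (real d + 1) * exceptional_const * ln (real Y) * (b / real P + real (card (primes_in 0 Y))))" by simp
  have "b * ((1 - 2 * real d / real k) * (real d * ln (real H)))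
    \<le> b * (\<Delta> * mertens_sum P (H ^ d) + 4 * real d * \<Gamma> * (real ?N * real k) ^ d + real (d * j + 1) * (4 * real P)
       + ln (real Y) * (real P * (real d * (1 / 2 ^ j + 1 / (2 * real K + 1))))
       + (real d + 1) * exceptional_const * ln (real Y) * (1 / real P + real (card (primes_in 0 Y)) / b))"
  proof -
    have "b * (1 / real P + real (card (primes_in 0 Y)) / b) = b / real P + real (card (primes_in 0 Y))"
      using b0 by (simp add: distrib_left)
    then have "b * ((real d + 1) * exceptional_const * ln (real Y) * (1 / real P + real (card (primes_in 0 Y)) / b))
        = (real d + 1) * exceptional_const * ln (real Y) * (b / real P + real (card (primes_in 0 Y)))"
      by (metis mult.left_commute)
    moreover have "b * (\<Delta> * mertens_sum P (H ^ d)) = \<Delta> * b * mertens_sum P (H ^ d)" by simp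
    moreover have "b * (4 * real d * \<Gamma> * (real ?N * real k) ^ d) = real d * \<Gamma> * b * (4 * (real ?N * real k) ^ d)" by simp
    ultimately show ?thesis
      using main small_primes_le[OF K1 Y b, of P j] unfolding distrib_left[of b] by linarith
  qed
  then show ?thesis unfolding \<Delta>_def \<Gamma>_def using b0 by (simp only: mult_le_cancel_left_pos)
qed

lemma mertens_sum_split: "a \<le> b \<Longrightarrow> b \<le> e \<Longrightarrow> mertens_sum a e = mertens_sum a b + mertens_sum b e"
  unfolding mertens_sum_def by (rule sum_primes_in_split)

lemma mertens_sum_mono: "a \<le> b \<Longrightarrow> b \<le> e \<Longrightarrow> mertens_sum a b \<le> mertens_sum a e"
  using mertens_sum_split[of a b e] mertens_sum_nonneg[of b e] by simp

lemma Y_at_top: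
  assumes "k \<ge> 1"
  shows "filterlim (\<lambda>H. (norm_const * (k * H)) ^ d) at_top sequentially"
proof -
  have "H \<le> (norm_const * (k * H)) ^ d" for H
  proof (cases "H = 0")
    case False
    have "1 * (1 * H) \<le> norm_const * (k * H)" using norm_const(1) assms by (intro mult_mono) auto
    then have "H \<le> norm_const * (k * H)" by simp
    also have "\<dots> \<le> (norm_const * (k * H)) ^ d"
      using d_pos False norm_const(1) assms by (intro self_le_power) auto
    finally show ?thesis .
  qed simp
  then show ?thesis by (intro filterlim_at_top_mono[OF filterlim_ident]) auto
qed

text \<open>\<open>Y\<close> and the box volume are both of order H^d for fixed \<open>k\<close>, so
  it is enough that the primes have density zero.\<close>

lemma prime_count_negligible:
  assumes k: "k \<ge> 1" and \<epsilon>: "\<epsilon> > 0"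
  shows "eventually (\<lambda>H. real (card (primes_in 0 ((norm_const * (k * H)) ^ d))) / (2 * real (k * H) + 1) ^ d \<le> \<epsilon>) sequentially"
proof -
  define N where "N = real norm_const ^ d"
  have N: "N > 0" unfolding N_def using norm_const(1) by simp
  have "eventually (\<lambda>n::nat. real (card (primes_in 0 n)) \<le> \<epsilon> / N * real n) sequentially"
    using card_primes_little_o[of "\<epsilon> / N"] \<epsilon> N by simp
  then have "eventually (\<lambda>H. real (card (primes_in 0 ((norm_const * (k * H)) ^ d))) \<le> \<epsilon> / N * real ((norm_const * (k * H)) ^ d)) sequentially"
    using Y_at_top[OF k] by (rule eventually_compose_filterlim)
  then show ?thesis
  proof eventually_elim
    case (elim H)
    have "real ((norm_const * (k * H)) ^ d) = N * real (k * H) ^ d" unfolding N_def by (simp add: power_mult_distrib)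
    also have "\<dots> \<le> N * (2 * real (k * H) + 1) ^ d" using N by (intro mult_left_mono power_mono) auto
    finally have "\<epsilon> / N * real ((norm_const * (k * H)) ^ d) \<le> \<epsilon> / N * (N * (2 * real (k * H) + 1) ^ d)"
      using \<epsilon> N by (intro mult_left_mono) auto
    also have "\<dots> = \<epsilon> * (2 * real (k * H) + 1) ^ d" using N by simp
    finally have "real (card (primes_in 0 ((norm_const * (k * H)) ^ d))) \<le> \<epsilon> * (2 * real (k * H) + 1) ^ d"
      using elim by linarith
    moreover have "(2 * real (k * H) + 1) ^ d > 0" by (intro zero_less_power) linarith
    ultimately show ?case by (simp only: pos_divide_le_eq)
  qed
qed

lemma ln_Y: "k \<ge> 1 \<Longrightarrow> H \<ge> 1 \<Longrightarrow> ln (real ((norm_const * (k * H)) ^ d)) = real d * (ln (real (norm_const * k)) + ln (real H))"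
proof -
  assume "k \<ge> 1" "H \<ge> 1"
  then have "real (norm_const * k) > 0" "real H > 0" using norm_const(1) by auto
  then have "ln (real (norm_const * k) * real H) = ln (real (norm_const * k)) + ln (real H)" by (rule ln_mult_pos)
  moreover have "real ((norm_const * (k * H)) ^ d) = (real (norm_const * k) * real H) ^ d" by (simp add: mult_ac)
  ultimately show ?thesis using \<open>real H > 0\<close> \<open>real (norm_const * k) > 0\<close> by (simp add: ln_realpow del: of_nat_mult)
qed

lemma ln_dominates:
  assumes "\<epsilon> > 0"
  shows "eventually (\<lambda>H::nat. A \<le> \<epsilon> * ln (real H)) sequentially"
proof -
  have "filterlim (\<lambda>H::nat. ln (real H)) at_top sequentially" by real_asymp
  then have "eventually (\<lambda>H::nat. A / \<epsilon> \<le> ln (real H)) sequentially" by (simp add: filterlim_at_top)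
  then show ?thesis using assms by (auto simp: pos_divide_le_eq mult.commute elim: eventually_mono)
qed

lemma exists_good_k:
  assumes "\<epsilon> > 0"
  shows "\<exists>k. k \<ge> 1 \<and> k \<ge> lattice_const \<and> 1 - \<epsilon> \<le> (1 - real lattice_const / real k) ^ d
     \<and> (1 + real lattice_const / real k) ^ d \<le> 1 + \<epsilon> \<and> 2 * real d / real k \<le> \<epsilon>"
proof -
  have l0: "((\<lambda>k::nat. real lattice_const / real k) \<longlongrightarrow> 0) sequentially"
    and l3: "((\<lambda>k::nat. 2 * real d / real k) \<longlongrightarrow> 0) sequentially"
    by real_asymp+
  have "((\<lambda>k::nat. (1 - real lattice_const / real k) ^ d) \<longlongrightarrow> (1 - 0) ^ d) sequentially"
    by (intro tendsto_intros l0)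
  then have l1: "eventually (\<lambda>k::nat. (1 - real lattice_const / real k) ^ d > 1 - \<epsilon>) sequentially"
    using assms by (intro order_tendstoD(1)) auto
  have "((\<lambda>k::nat. (1 + real lattice_const / real k) ^ d) \<longlongrightarrow> (1 + 0) ^ d) sequentially"
    by (intro tendsto_intros l0)
  then have l2: "eventually (\<lambda>k::nat. (1 + real lattice_const / real k) ^ d < 1 + \<epsilon>) sequentially"
    using assms by (intro order_tendstoD(2)) auto
  have "eventually (\<lambda>k. k \<ge> 1 \<and> k \<ge> lattice_const \<and> 1 - \<epsilon> \<le> (1 - real lattice_const / real k) ^ d
     \<and> (1 + real lattice_const / real k) ^ d \<le> 1 + \<epsilon> \<and> 2 * real d / real k \<le> \<epsilon>) sequentially"
    using l1 l2 order_tendstoD(2)[OF l3 assms] eventually_ge_at_top[of 1] eventually_ge_at_top[of lattice_const]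
    by eventually_elim auto
  from eventually_happens'[OF sequentially_bot this] show ?thesis .
qed

text \<open>The parameters are fixed in the order \<open>k\<close>, \<open>P\<close>,
  \<open>H\<close>: first the lattice distortion, then the tail of 1/p^2 is made small, and finally
  ln H outgrows all remaining constants, among them the sum over primes up to
  \<open>P\<close>.\<close>

lemma mertens_sum_power_upper:
  assumes \<epsilon>: "\<epsilon> > 0" "\<epsilon> < 1"
  shows "eventually (\<lambda>H. (1 - \<epsilon>) * mertens_sum prime_bound (H ^ d) \<le> (1 + \<epsilon>) * (real d * ln (real H))) sequentially"
proof -
  obtain k where k: "k \<ge> 1" "k \<ge> lattice_const" "1 - \<epsilon> \<le> (1 - real lattice_const / real k) ^ d"
    using exists_good_k[OF \<epsilon>(1)] by blast
  define A where "A = (real d + 1) * exceptional_const"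
  have A: "A > 0" unfolding A_def using exceptional_const(1) by simp
  \<comment> \<open>\<open>A\<close> ln Y multiplies a sum of two terms of size at most
    \<open>e\<close>, so the error stays below \<epsilon>/2 ln Y.\<close>
  define e where "e = \<epsilon> / (4 * A)"
  have e: "e > 0" unfolding e_def using \<epsilon> A by simp
  obtain n where n: "1 / real (Suc n) < e" using nat_approx_posE[OF e] by blast
  define P where "P = max prime_bound (Suc n)"
  have P: "P \<ge> prime_bound" "P > 0" unfolding P_def by auto
  have Pe: "1 / real P \<le> e"
  proof -
    have "1 / real P \<le> 1 / real (Suc n)" unfolding P_def by (intro divide_left_mono) auto
    then show ?thesis using n by simp
  qed
  define Cst where "Cst = (1 + \<epsilon> / 2) * (real d * ln (real (norm_const * k))) + 4 * real d + mertens_sum prime_bound P"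
  have ePow: "eventually (\<lambda>H. P \<le> H ^ d) sequentially"
    using eventually_ge_at_top[of P]
  proof eventually_elim
    case (elim H)
    have "H \<le> H ^ d" using d_pos elim P by (intro self_le_power) auto
    then show ?case using elim by simp
  qed
  have "eventually (\<lambda>H::nat. Cst \<le> (\<epsilon> / 2) * ln (real H)) sequentially"
    using \<epsilon> by (intro ln_dominates) auto
  then show ?thesis
    using prime_count_negligible[OF k(1) e] eventually_ge_at_top[of 1] ePow
  proof eventually_elim
    case (elim H)
    define K where "K = k * H"
    define Y where "Y = (norm_const * K) ^ d"
    define b where "b = (2 * real K + 1) ^ d"
    have H: "H \<ge> 1" using elim by simp
    have lnH: "ln (real H) \<ge> 0" using H by simp
    have lnY: "ln (real Y) = real d * (ln (real (norm_const * k)) + ln (real H))"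
      unfolding Y_def K_def using ln_Y[OF k(1) H] by simp
    have "Y \<ge> 1" unfolding Y_def K_def using norm_const(1) k(1) H by simp
    then have lnY0: "ln (real Y) \<ge> 0" by simp
    have "1 / real P + real (card (primes_in 0 Y)) / b \<le> e + e"
      using Pe elim(2) unfolding Y_def K_def b_def by (intro add_mono) auto
    then have "A * ln (real Y) * (1 / real P + real (card (primes_in 0 Y)) / b) \<le> A * ln (real Y) * (2 * e)"
      using A lnY0 by (intro mult_left_mono) auto
    also have "\<dots> = \<epsilon> / 2 * ln (real Y)" unfolding e_def using A by simp
    finally have "A * ln (real Y) * (1 / real P + real (card (primes_in 0 Y)) / b) \<le> \<epsilon> / 2 * ln (real Y)" .
    then have 1: "(1 - real lattice_const / real k) ^ d * mertens_sum P (H ^ d) \<le> (1 + \<epsilon> / 2) * ln (real Y) + 4 * real d"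
    proof -
      have "(1 + \<epsilon> / 2) * ln (real Y) + 4 * real d = ln (real Y) + 4 * real d + \<epsilon> / 2 * ln (real Y)"
        by (simp add: algebra_simps)
      then show ?thesis
        using mertens_sum_upper[OF k(2) H P K_def Y_def b_def, folded A_def]
          \<open>A * ln (real Y) * (1 / real P + real (card (primes_in 0 Y)) / b) \<le> \<epsilon> / 2 * ln (real Y)\<close> by linarith
    qed
    have "(1 - \<epsilon>) * mertens_sum P (H ^ d) \<le> (1 - real lattice_const / real k) ^ d * mertens_sum P (H ^ d)"
      using k(3) mertens_sum_nonneg by (intro mult_right_mono) auto
    moreover have "(1 - \<epsilon>) * mertens_sum prime_bound P \<le> 1 * mertens_sum prime_bound P"
      using \<epsilon> mertens_sum_nonneg by (intro mult_right_mono) auto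
    moreover have "(1 - \<epsilon>) * mertens_sum prime_bound (H ^ d) = (1 - \<epsilon>) * mertens_sum prime_bound P + (1 - \<epsilon>) * mertens_sum P (H ^ d)"
      using mertens_sum_split[OF P(1) elim(4)] by (simp add: distrib_left)
    ultimately have "(1 - \<epsilon>) * mertens_sum prime_bound (H ^ d) \<le> mertens_sum prime_bound P + ((1 + \<epsilon> / 2) * ln (real Y) + 4 * real d)"
      using 1 by linarith
    also have "\<dots> = Cst + (1 + \<epsilon> / 2) * (real d * ln (real H))"
      unfolding lnY Cst_def by (simp add: distrib_left)
    also have "\<dots> \<le> (\<epsilon> / 2) * (real d * ln (real H)) + (1 + \<epsilon> / 2) * (real d * ln (real H))"
    proof -
      have "1 * ln (real H) \<le> real d * ln (real H)" using d_pos lnH by (intro mult_right_mono) auto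
      then have "(\<epsilon> / 2) * ln (real H) \<le> (\<epsilon> / 2) * (real d * ln (real H))" using \<epsilon> by (intro mult_left_mono) auto
      then show ?thesis using elim(1) by linarith
    qed
    also have "\<dots> = (1 + \<epsilon>) * (real d * ln (real H))" by (simp add: algebra_simps)
    finally show ?case .
  qed
qed

lemma mertens_sum_power_lower:
  assumes \<epsilon>: "\<epsilon> > 0" "\<epsilon> < 1"
  shows "eventually (\<lambda>H. (1 - \<epsilon>) * (real d * ln (real H)) \<le> (1 + \<epsilon>) * mertens_sum prime_bound (H ^ d)) sequentially"
proof -
  obtain k where k: "k \<ge> 1" "(1 + real lattice_const / real k) ^ d \<le> 1 + \<epsilon>" "2 * real d / real k \<le> \<epsilon> / 8"
  proof -
    obtain k where *: "k \<ge> 1" "(1 + real lattice_const / real k) ^ d \<le> 1 + \<epsilon> / 8" "2 * real d / real k \<le> \<epsilon> / 8"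
      using exists_good_k[of "\<epsilon> / 8"] \<epsilon> by auto
    then show thesis using that[of k] \<epsilon> by linarith
  qed
  define A where "A = (real d + 1) * exceptional_const"
  have A: "A > 0" unfolding A_def using exceptional_const(1) by simp
  define e where "e = \<epsilon> / (8 * A)"
  have e: "e > 0" unfolding e_def using \<epsilon> A by simp
  obtain n where n: "1 / real (Suc n) < e" using nat_approx_posE[OF e] by blast
  define P where "P = max prime_bound (Suc n)"
  have P: "P \<ge> prime_bound" "P > 0" unfolding P_def by auto
  have Pe: "1 / real P \<le> e"
  proof -
    have "1 / real P \<le> 1 / real (Suc n)" unfolding P_def by (intro divide_left_mono) auto
    then show ?thesis using n by simp
  qed
  define Q where "Q = real P * real d"
  have Q: "Q > 0" unfolding Q_def using P d_pos by simp
  \<comment> \<open>\<open>j\<close> comes after \<open>P\<close> because the exceptional proportion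
    in \<open>small_primes_le\<close> is multiplied by P d, here \<open>Q\<close>.\<close>
  have "((\<lambda>j::nat. 1 / 2 ^ j :: real) \<longlongrightarrow> 0) sequentially" by real_asymp
  then have "eventually (\<lambda>j::nat. 1 / 2 ^ j < \<epsilon> / (8 * Q)) sequentially"
    using \<epsilon> Q by (intro order_tendstoD(2)) auto
  from eventually_happens'[OF sequentially_bot this] obtain j :: nat where "1 / 2 ^ j < \<epsilon> / (8 * Q)" ..
  then have j: "Q * (1 / 2 ^ j) \<le> \<epsilon> / 8" using Q by (simp add: field_simps)
  define Cst where "Cst = 4 * real d * (1 + real lattice_const * real norm_const) ^ d * (real norm_const * real k) ^ d
       + real (d * j + 1) * (4 * real P) + real d * ln (real (norm_const * k))"
  have ePow: "eventually (\<lambda>H. P \<le> H ^ d) sequentially"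
    using eventually_ge_at_top[of P]
  proof eventually_elim
    case (elim H)
    have "H \<le> H ^ d" using d_pos elim P by (intro self_le_power) auto
    then show ?case using elim by simp
  qed
  have "((\<lambda>H::nat. Q * (1 / (2 * (real k * real H) + 1))) \<longlongrightarrow> 0) sequentially" using k(1) by real_asymp
  then have eK: "eventually (\<lambda>H::nat. Q * (1 / (2 * (real k * real H) + 1)) < \<epsilon> / 8) sequentially"
    using \<epsilon> by (intro order_tendstoD(2)) auto
  have "eventually (\<lambda>H::nat. Cst \<le> (\<epsilon> / 8) * ln (real H)) sequentially"
    using \<epsilon> by (intro ln_dominates) auto
  then show ?thesis
    using prime_count_negligible[OF k(1) e] eventually_ge_at_top[of 1] ePow eK
  proof eventually_elim
    case (elim H)
    define K where "K = k * H"
    define Y where "Y = (norm_const * K) ^ d"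
    define b where "b = (2 * real K + 1) ^ d"
    define L where "L = real d * ln (real H)"
    have H: "H \<ge> 1" using elim by simp
    have lnH: "ln (real H) \<ge> 0" using H by simp
    have L: "ln (real H) \<le> L" "L \<ge> 0"
      unfolding L_def using mult_right_mono[of 1 "real d" "ln (real H)"] d_pos lnH by auto
    have lnY: "ln (real Y) = real d * ln (real (norm_const * k)) + L"
      unfolding Y_def K_def L_def using ln_Y[OF k(1) H] by (simp add: distrib_left)
    have "Y \<ge> 1" unfolding Y_def K_def using norm_const(1) k(1) H by simp
    then have lnY0: "ln (real Y) \<ge> 0" by simp
    have "1 / real P + real (card (primes_in 0 Y)) / b \<le> e + e"
      using Pe elim(2) unfolding Y_def K_def b_def by (intro add_mono) auto
    then have "A * ln (real Y) * (1 / real P + real (card (primes_in 0 Y)) / b) \<le> A * ln (real Y) * (2 * e)"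
      using A lnY0 by (intro mult_left_mono) auto
    also have "\<dots> = \<epsilon> / 4 * ln (real Y)" unfolding e_def using A by simp
    finally have 1: "A * ln (real Y) * (1 / real P + real (card (primes_in 0 Y)) / b) \<le> \<epsilon> / 4 * ln (real Y)" .
    have "real P * (real d * (1 / 2 ^ j + 1 / (2 * real K + 1))) = Q * (1 / 2 ^ j) + Q * (1 / (2 * real K + 1))"
      unfolding Q_def by (simp add: algebra_simps)
    also have "\<dots> \<le> \<epsilon> / 8 + \<epsilon> / 8" using j elim(5) unfolding K_def by (intro add_mono) auto
    finally have "ln (real Y) * (real P * (real d * (1 / 2 ^ j + 1 / (2 * real K + 1)))) \<le> ln (real Y) * (\<epsilon> / 4)"
      using lnY0 by (intro mult_left_mono) auto
    then have 2: "(1 - 2 * real d / real k) * L \<le> (1 + real lattice_const / real k) ^ d * mertens_sum P (H ^ d)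
       + 4 * real d * (1 + real lattice_const * real norm_const) ^ d * (real norm_const * real k) ^ d
       + real (d * j + 1) * (4 * real P) + \<epsilon> / 2 * ln (real Y)"
    proof -
      define m1 where "m1 = (1 + real lattice_const / real k) ^ d * mertens_sum P (H ^ d)"
      define m2 where "m2 = 4 * real d * (1 + real lattice_const * real norm_const) ^ d * (real norm_const * real k) ^ d"
      define m3 where "m3 = real (d * j + 1) * (4 * real P)"
      define m4 where "m4 = ln (real Y) * (real P * (real d * (1 / 2 ^ j + 1 / (2 * real K + 1))))"
      define m5 where "m5 = A * ln (real Y) * (1 / real P + real (card (primes_in 0 Y)) / b)"
      have "(1 - 2 * real d / real k) * L \<le> m1 + m2 + m3 + m4 + m5"
        using mertens_sum_lower[OF k(1) H P elim(4) K_def Y_def b_def, of j]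
        unfolding m1_def m2_def m3_def m4_def m5_def A_def L_def .
      moreover have "m4 \<le> ln (real Y) * (\<epsilon> / 4)"
        unfolding m4_def using \<open>ln (real Y) * (real P * (real d * (1 / 2 ^ j + 1 / (2 * real K + 1)))) \<le> ln (real Y) * (\<epsilon> / 4)\<close> .
      moreover have "m5 \<le> \<epsilon> / 4 * ln (real Y)" unfolding m5_def by (rule 1)
      moreover have "ln (real Y) * (\<epsilon> / 4) + \<epsilon> / 4 * ln (real Y) = \<epsilon> / 2 * ln (real Y)" by simp
      ultimately have "(1 - 2 * real d / real k) * L \<le> m1 + m2 + m3 + \<epsilon> / 2 * ln (real Y)" by linarith
      then show ?thesis unfolding m1_def m2_def m3_def .
    qed
    have "\<epsilon> / 2 * ln (real Y) \<le> real d * ln (real (norm_const * k)) + \<epsilon> / 2 * L"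
    proof -
      have nk: "1 \<le> norm_const * k" using norm_const(1) k(1) by simp
      have "0 \<le> real d * ln (real (norm_const * k))"
        by (intro mult_nonneg_nonneg) (use nk in \<open>auto simp del: of_nat_mult\<close>)
      then have "\<epsilon> / 2 * (real d * ln (real (norm_const * k))) \<le> 1 * (real d * ln (real (norm_const * k)))"
        using \<epsilon> by (intro mult_right_mono) auto
      then show ?thesis unfolding lnY by (simp add: distrib_left)
    qed
    then have 3: "(1 - 2 * real d / real k) * L \<le> (1 + real lattice_const / real k) ^ d * mertens_sum P (H ^ d) + Cst + \<epsilon> / 2 * L"
      using 2 unfolding Cst_def by linarith
    have "(1 + real lattice_const / real k) ^ d * mertens_sum P (H ^ d) \<le> (1 + \<epsilon>) * mertens_sum prime_bound (H ^ d)"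
      using mertens_sum_split[OF P(1) elim(4)] mertens_sum_nonneg[of prime_bound P] mertens_sum_nonneg[of P "H ^ d"] k(2) \<epsilon>
      by (intro mult_mono) auto
    moreover have "Cst \<le> \<epsilon> / 8 * L"
      using elim(1) mult_left_mono[OF L(1), of "\<epsilon> / 8"] \<epsilon> by linarith
    moreover have "(1 - \<epsilon> / 8) * L \<le> (1 - 2 * real d / real k) * L"
      using k(3) L(2) by (intro mult_right_mono) auto
    ultimately have "(1 - \<epsilon> / 8) * L \<le> (1 + \<epsilon>) * mertens_sum prime_bound (H ^ d) + \<epsilon> / 8 * L + \<epsilon> / 2 * L"
      using 3 by linarith
    moreover define w where "w = \<epsilon> * L"
    moreover have "w \<ge> 0" unfolding w_def using \<epsilon> L(2) by simp
    moreover have "(1 - \<epsilon> / 8) * L = L - w / 8" "\<epsilon> / 8 * L = w / 8" "\<epsilon> / 2 * L = w / 2" "(1 - \<epsilon>) * L = L - w"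
      unfolding w_def by (simp_all add: algebra_simps)
    ultimately have "(1 - \<epsilon>) * L \<le> (1 + \<epsilon>) * mertens_sum prime_bound (H ^ d)" by linarith
    then show ?case unfolding L_def .
  qed
qed

text \<open>The Mertens sum is monotone, and consecutive d-th powers H^d and (H + 1)^d differ in
  logarithm by at most d ln 2; hence the asymptotics along d-th powers extend to all
  \<open>y\<close>.\<close>

lemma mertens_for_roots:
  assumes \<epsilon>: "\<epsilon> > 0"
  shows "eventually (\<lambda>y. \<bar>mertens_sum prime_bound y - ln (real y)\<bar> \<le> \<epsilon> * ln (real y)) sequentially"
proof -
  \<comment> \<open>For e \<le> 1/4 the accumulated factors (1 + e)(1 + e/2)/(1 - e) and (1 - e)(1 -
    e/2)/(1 + e) lie between 1 - 8e and 1 + 8e.\<close>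
  define e where "e = min (1 / 4) (\<epsilon> / 8)"
  have e: "e > 0" "e < 1" "e \<le> 1 / 4" "e \<le> \<epsilon> / 8" unfolding e_def using \<epsilon> by auto
  have "eventually (\<lambda>H. (1 - e) * mertens_sum prime_bound (H ^ d) \<le> (1 + e) * (real d * ln (real H))
      \<and> (1 - e) * (real d * ln (real H)) \<le> (1 + e) * mertens_sum prime_bound (H ^ d) \<and> H \<ge> 1 \<and> prime_bound \<le> H) sequentially"
    using mertens_sum_power_upper[OF e(1,2)] mertens_sum_power_lower[OF e(1,2)] eventually_ge_at_top[of 1] eventually_ge_at_top[of prime_bound]
    by eventually_elim auto
  then obtain H0 where H0: "\<And>H. H \<ge> H0 \<Longrightarrow> (1 - e) * mertens_sum prime_bound (H ^ d) \<le> (1 + e) * (real d * ln (real H))"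
    "\<And>H. H \<ge> H0 \<Longrightarrow> (1 - e) * (real d * ln (real H)) \<le> (1 + e) * mertens_sum prime_bound (H ^ d)"
    "\<And>H. H \<ge> H0 \<Longrightarrow> H \<ge> 1" "\<And>H. H \<ge> H0 \<Longrightarrow> prime_bound \<le> H"
    unfolding eventually_sequentially by blast
  have "eventually (\<lambda>y::nat. 2 * (real d * ln 2) \<le> e * ln (real y)) sequentially"
    using e by (intro ln_dominates) auto
  then show ?thesis using eventually_ge_at_top[of "(H0 + 1) ^ d"]
  proof eventually_elim
    case (elim y)
    obtain H where H: "H ^ d \<le> y" "y < (H + 1) ^ d" using exists_int_root by blast
    have "(H0 + 1) ^ d < (H + 1) ^ d" using elim(2) H(2) by linarith
    then have "H0 + 1 < H + 1" by (rule power_less_imp_less_base) simp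
    then have HH0: "H \<ge> H0" by simp
    note h = H0(3,4)[OF HH0]
    have PH: "prime_bound \<le> H ^ d" using h d_pos self_le_power[OF h(1), of d] by linarith
    define u where "u = real d * ln (real H)"
    define v where "v = real d * ln (real (H + 1))"
    define l where "l = ln (real y)"
    have u: "u \<le> l"
    proof -
      have "real H ^ d \<le> real y" using H(1) by (metis of_nat_le_iff of_nat_power)
      then have "ln (real H ^ d) \<le> ln (real y)" using h by (intro ln_mono) auto
      then show ?thesis unfolding u_def l_def using h by (simp add: ln_realpow)
    qed
    have v: "l \<le> v"
    proof -
      have "H ^ d > 0" using h by simp
      then have y0: "real y > 0" using H(1) by linarith
      have "real y \<le> real (H + 1) ^ d" using H(2) by (metis less_imp_le of_nat_le_iff of_nat_power)
      then have "ln (real y) \<le> ln (real (H + 1) ^ d)" using y0 by (intro ln_mono) auto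
      then show ?thesis unfolding v_def l_def by (simp add: ln_realpow)
    qed
    have uv: "v \<le> u + real d * ln 2"
    proof -
      have "ln (real (H + 1)) \<le> ln (2 * real H)" using h by (intro ln_mono) auto
      also have "\<dots> = ln 2 + ln (real H)" using h by (intro ln_mult_pos) auto
      finally have "real d * ln (real (H + 1)) \<le> real d * (ln 2 + ln (real H))" by (intro mult_left_mono) auto
      then show ?thesis unfolding u_def v_def by (simp add: algebra_simps)
    qed
    have "u \<ge> 0" using h unfolding u_def by simp
    then have l0: "l \<ge> 0" using u by linarith
    have small: "2 * (real d * ln 2) \<le> e * l" using elim(1) unfolding l_def .
    have Mu: "mertens_sum prime_bound y \<le> mertens_sum prime_bound ((H + 1) ^ d)" using PH H by (intro mertens_sum_mono) auto
    have Ml: "mertens_sum prime_bound (H ^ d) \<le> mertens_sum prime_bound y" using PH H by (intro mertens_sum_mono) auto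
    have m0: "mertens_sum prime_bound y \<ge> 0" by (rule mertens_sum_nonneg)
    have "(1 - e) * mertens_sum prime_bound y \<le> (1 - e) * mertens_sum prime_bound ((H + 1) ^ d)" using Mu e by (intro mult_left_mono) auto
    also have "\<dots> \<le> (1 + e) * v" using H0(1)[of "H + 1"] HH0 unfolding v_def by simp
    also have "\<dots> \<le> (1 + e) * (l + e * l / 2)" using uv u small e by (intro mult_left_mono) auto
    finally have a1: "(1 - e) * mertens_sum prime_bound y \<le> (1 + e) * (1 + e / 2) * l" by (simp add: algebra_simps)
    have "(1 - e) * (l - e * l / 2) \<le> (1 - e) * u" using uv v small e by (intro mult_left_mono) auto
    also have "\<dots> \<le> (1 + e) * mertens_sum prime_bound (H ^ d)" using H0(2)[OF HH0] unfolding u_def .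
    also have "\<dots> \<le> (1 + e) * mertens_sum prime_bound y" using Ml e by (intro mult_left_mono) auto
    finally have a2: "(1 - e) * (1 - e / 2) * l \<le> (1 + e) * mertens_sum prime_bound y" by (simp add: algebra_simps)
    have "(1 + e) * (1 + e / 2) \<le> (1 - e) * (1 + 8 * e)"
    proof -
      have "(1 - e) * (1 + 8 * e) - (1 + e) * (1 + e / 2) = e * (11 / 2 - 17 / 2 * e)" by (simp add: field_simps)
      also have "\<dots> \<ge> 0" using e by (intro mult_nonneg_nonneg) auto
      finally show ?thesis by simp
    qed
    then have "(1 + e) * (1 + e / 2) * l \<le> (1 - e) * (1 + 8 * e) * l" using l0 by (rule mult_right_mono)
    then have "(1 - e) * mertens_sum prime_bound y \<le> (1 - e) * ((1 + 8 * e) * l)" using a1 by (simp add: mult.assoc)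
    then have b1: "mertens_sum prime_bound y \<le> (1 + 8 * e) * l" using e by (simp add: mult_le_cancel_left_pos)
    have "(1 + e) * (1 - 8 * e) \<le> (1 - e) * (1 - e / 2)"
    proof -
      have "(1 - e) * (1 - e / 2) - (1 + e) * (1 - 8 * e) = e * (11 / 2 + 17 / 2 * e)" by (simp add: field_simps)
      also have "\<dots> \<ge> 0" using e by (intro mult_nonneg_nonneg) auto
      finally show ?thesis by simp
    qed
    then have "(1 + e) * (1 - 8 * e) * l \<le> (1 - e) * (1 - e / 2) * l" using l0 by (rule mult_right_mono)
    then have "(1 + e) * ((1 - 8 * e) * l) \<le> (1 + e) * mertens_sum prime_bound y" using a2 by (simp add: mult.assoc)
    then have b2: "(1 - 8 * e) * l \<le> mertens_sum prime_bound y" using e by (simp add: mult_le_cancel_left_pos)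
    have "8 * e * l \<le> \<epsilon> * l" using e l0 by (intro mult_right_mono) auto
    then show ?case using b1 b2 unfolding l_def[symmetric] by (simp add: abs_le_iff algebra_simps)
  qed
qed

end

section \<open>Integers whose shifted norm is smooth\<close>

lemma card_residue_bounds:
  assumes s: "s < (p::nat)"
  shows "real (card {n \<in> {1..N}. n mod p = s}) \<le> real N / real p + 1"
    "real N / real p - 1 \<le> real (card {n \<in> {1..N}. n mod p = s})"
proof -
  let ?A = "{n \<in> {1..N}. n mod p = s}"
  have p: "p > 0" using s by simp
  have finA: "finite ?A" by (rule finite_subset[of _ "{1..N}"]) auto
  have "card (int ` ?A) = card ?A" by (rule card_image) (simp add: inj_on_def)
  moreover have "real (card (int ` ?A)) \<le> real N / real p + 1"
  proof (rule card_congruent_le[OF _ p])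
    show "int ` ?A \<subseteq> {1..<1 + int N}" by auto
    fix x y assume "x \<in> int ` ?A" "y \<in> int ` ?A"
    then obtain a b where ab: "x = int a" "y = int b" "a mod p = s" "b mod p = s" by blast
    then have "x mod int p = y mod int p" by (metis of_nat_mod)
    then show "int p dvd x - y" by (simp add: mod_eq_dvd_iff)
  qed
  ultimately show "real (card ?A) \<le> real N / real p + 1" by simp
  \<comment> \<open>The class of 0 starts at \<open>p\<close> and not at 0, because the integers
    counted begin at 1.\<close>
  define g where "g = (\<lambda>q. if s = 0 then (q + 1) * p else q * p + s)"
  have "g ` {..<N div p} \<subseteq> ?A"
  proof (rule image_subsetI)
    fix q assume "q \<in> {..<N div p}"
    then have "q + 1 \<le> N div p" by simp
    then have "(q + 1) * p \<le> N div p * p" by (rule mult_right_mono) simp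
    then have le: "(q + 1) * p \<le> N" using div_times_less_eq_dividend[of N p] by linarith
    show "g q \<in> ?A"
    proof (cases "s = 0")
      case True
      have "1 \<le> (q + 1) * p" using p by simp
      then show ?thesis using True le unfolding g_def by (simp del: add_mult_distrib)
    next
      case False
      have "q * p + s \<le> (q + 1) * p" using s by simp
      then have "q * p + s \<le> N" using le by linarith
      moreover have "(q * p + s) mod p = s" using s by simp
      ultimately show ?thesis using False unfolding g_def by simp
    qed
  qed
  moreover have "inj_on g {..<N div p}" unfolding g_def inj_on_def using p by auto
  ultimately have "card {..<N div p} \<le> card ?A" using finA by (intro card_inj_on_le) auto
  then have "real (N div p) \<le> real (card ?A)" by simp
  moreover have "real N / real p - 1 \<le> real (N div p)"
  proof -
    have "N < (N div p + 1) * p" using p by (metis Suc_eq_plus1 dividend_less_div_times mult.commute mult_Suc_right add.commute)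
    then have "real N < real ((N div p + 1) * p)" by (simp only: of_nat_less_iff)
    then have "real N < (real (N div p) + 1) * real p" by (simp add: algebra_simps)
    then have "real N / real p < real (N div p) + 1" using p by (simp add: pos_divide_less_eq)
    then show ?thesis by simp
  qed
  ultimately show "real N / real p - 1 \<le> real (card ?A)" by linarith
qed

text \<open>Taylor expansion to first order with an integral remainder, the ingredient of the Hensel
  argument in \<open>card_square_multiples\<close>.\<close>

lemma poly_diff_linear: "\<exists>q. poly f (t :: int) - poly f s = (t - s) * (poly (pderiv f) s + (t - s) * q)"
proof (induction f)
  case 0
  then show ?case by simp
next
  case (pCons a f)
  then obtain q where q: "poly f t - poly f s = (t - s) * (poly (pderiv f) s + (t - s) * q)" by blast
  have "poly (pCons a f) t - poly (pCons a f) s = t * poly f t - s * poly f s" by simp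
  also have "\<dots> = s * (poly f t - poly f s) + (t - s) * (poly f t - poly f s) + (t - s) * poly f s"
    by (simp add: algebra_simps)
  also have "\<dots> = (t - s) * ((poly f s + s * poly (pderiv f) s) + (t - s) * (s * q + poly (pderiv f) s + (t - s) * q))"
    unfolding q by (simp add: algebra_simps)
  also have "poly f s + s * poly (pderiv f) s = poly (pderiv (pCons a f)) s" by (simp add: pderiv_pCons)
  finally show ?case by blast
qed

context scaled_field_poly
begin

text \<open>The F(n) of the overview.\<close>

definition shifted_norm :: "nat \<Rightarrow> int" where "shifted_norm n = Nm [:c * int n, 1:]"

lemma dvd_shifted_norm_iff: "k dvd shifted_norm n \<longleftrightarrow> k dvd poly f (- c * int n)"
  unfolding shifted_norm_def Nm_linear by (cases "even d") simp_all

lemma shifted_norm_nonzero: "d \<ge> 2 \<Longrightarrow> shifted_norm n \<noteq> 0"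
  unfolding shifted_norm_def by (subst Nm_eq_0_iff) auto

lemma shift_root_mod:
  assumes "p > 0"
  shows "int p dvd shifted_norm n \<longleftrightarrow> shift_root p (n mod p)"
proof -
  have "int p dvd (- c * int n) - (- c * int (n mod p))"
  proof -
    have "int n mod int p = int (n mod p) mod int p" by (simp add: of_nat_mod)
    then have "int p dvd int n - int (n mod p)" by (simp add: mod_eq_dvd_iff)
    then have "int p dvd - c * (int n - int (n mod p))" by (rule dvd_mult)
    then show ?thesis by (simp add: right_diff_distrib)
  qed
  then have "int p dvd poly f (- c * int n) - poly f (- c * int (n mod p))"
    using poly_diff_linear[of f "- c * int n" "- c * int (n mod p)"] by (metis dvd_mult2)
  then have "int p dvd poly f (- c * int n) \<longleftrightarrow> int p dvd poly f (- c * int (n mod p))"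
    by (metis dvd_diff_commute dvd_diff_right_iff dvd_add_right_iff diff_add_cancel)
  then show ?thesis unfolding dvd_shifted_norm_iff shift_root_def using assms by simp
qed

definition mult_set :: "nat \<Rightarrow> nat \<Rightarrow> nat set" where
  "mult_set p N = {n \<in> {1..N}. int p dvd shifted_norm n}"

lemma mult_set_eq: "p > 0 \<Longrightarrow> mult_set p N = (\<Union>s\<in>{s. shift_root p s}. {n \<in> {1..N}. n mod p = s})"
  unfolding mult_set_def shift_root_mod by auto

lemma card_mult_set: "p > 0 \<Longrightarrow> card (mult_set p N) = (\<Sum>s | shift_root p s. card {n \<in> {1..N}. n mod p = s})"
  unfolding mult_set_eq by (intro card_UN_disjoint) auto

lemma card_mult_set_bounds:
  assumes "p > 0"
  shows "real (card (mult_set p N)) \<le> real (nroots p) * (real N / real p + 1)"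
    "real (nroots p) * (real N / real p - 1) \<le> real (card (mult_set p N))"
proof -
  have "(\<Sum>s | shift_root p s. real (card {n \<in> {1..N}. n mod p = s})) \<le> of_nat (card {s. shift_root p s}) * (real N / real p + 1)"
    by (intro sum_bounded_above card_residue_bounds) (auto simp: shift_root_def)
  then show "real (card (mult_set p N)) \<le> real (nroots p) * (real N / real p + 1)"
    unfolding card_mult_set[OF assms] nroots_def by simp
  have "of_nat (card {s. shift_root p s}) * (real N / real p - 1) \<le> (\<Sum>s | shift_root p s. real (card {n \<in> {1..N}. n mod p = s}))"
    by (intro sum_bounded_below card_residue_bounds) (auto simp: shift_root_def)
  then show "real (nroots p) * (real N / real p - 1) \<le> real (card (mult_set p N))"
    unfolding card_mult_set[OF assms] nroots_def by simp
qed

lemma card_mult_set_pair: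
  assumes p: "prime p" "prime q" "p \<noteq> q"
  shows "real (card (mult_set p N \<inter> mult_set q N)) \<le> real (nroots p) * real (nroots q) * (real N / (real p * real q) + 1)"
proof -
  have p0: "p > 0" "q > 0" using p prime_gt_0_nat by auto
  let ?I = "{s. shift_root p s} \<times> {s. shift_root q s}"
  let ?F = "\<lambda>(s, t). {n \<in> {1..N}. n mod p = s \<and> n mod q = t}"
  have "mult_set p N \<inter> mult_set q N \<subseteq> (\<Union>i\<in>?I. ?F i)"
    unfolding mult_set_eq[OF p0(1)] mult_set_eq[OF p0(2)] by auto
  moreover have fin: "finite (?F i)" for i by (rule finite_subset[of _ "{1..N}"]) auto
  ultimately have "card (mult_set p N \<inter> mult_set q N) \<le> card (\<Union>i\<in>?I. ?F i)"
    by (intro card_mono) auto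
  also have "\<dots> \<le> (\<Sum>i\<in>?I. card (?F i))" by (rule card_UN_le) auto
  finally have "real (card (mult_set p N \<inter> mult_set q N)) \<le> real (\<Sum>i\<in>?I. card (?F i))" by (rule of_nat_mono)
  also have "\<dots> = (\<Sum>i\<in>?I. real (card (?F i)))" by simp
  also have "\<dots> \<le> of_nat (card ?I) * (real N / real (p * q) + 1)"
  proof (rule sum_bounded_above)
    fix i assume "i \<in> ?I"
    obtain s t where i: "i = (s, t)" by (cases i)
    have "card (int ` ?F i) = card (?F i)" by (rule card_image) (simp add: inj_on_def)
    moreover have "real (card (int ` ?F i)) \<le> real N / real (p * q) + 1"
    proof (rule card_congruent_le)
      show "int ` ?F i \<subseteq> {1..<1 + int N}" unfolding i by auto
      show "p * q > 0" using p0 by simp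
      fix x y assume "x \<in> int ` ?F i" "y \<in> int ` ?F i"
      then obtain a b where ab: "x = int a" "y = int b" "a mod p = b mod p" "a mod q = b mod q" unfolding i by auto
      then have "x mod int p = y mod int p" "x mod int q = y mod int q" by (metis of_nat_mod)+
      then have "int p dvd x - y" "int q dvd x - y" by (simp_all add: mod_eq_dvd_iff)
      moreover have "Rings.coprime (int p) (int q)" using p primes_coprime[of p q] by simp
      ultimately show "int (p * q) dvd x - y" by (simp add: divides_mult)
    qed
    ultimately show "real (card (?F i)) \<le> real N / real (p * q) + 1" by simp
  qed
  also have "\<dots> = real (nroots p) * real (nroots q) * (real N / (real p * real q) + 1)"
    unfolding nroots_def by (simp add: card_cartesian_product)
  finally show ?thesis .
qed

text \<open>A root modulo \<open>p\<close> is congruent to some conjugate theta. If \<open>p\<close>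
  divided the derivative there, f'(theta) would lie in \<open>P\<close> and \<open>discr\<close>
  with it.\<close>

lemma not_dvd_pderiv_root:
  assumes p: "good p" and v: "int p dvd poly f v"
  shows "\<not> int p dvd poly (pderiv f) v"
proof
  assume a: "int p dvd poly (pderiv f) v"
  have pr: "prime p" and pD: "\<not> int p dvd discr" using p unfolding good_def by auto
  obtain P where P: "prime_ideal_over p P" using prime_ideal_over_exists[OF pr] by blast
  note D = prime_ideal_overD[OF P]
  obtain \<theta> where \<theta>: "\<theta> \<in> \<Theta>" "of_int v - \<theta> \<in> P" using root_congruent_conjugate[OF pr P v] by blast
  have "of_int (poly (pderiv f) v) - (of_int (poly (pderiv f) v) - ev (pderiv f) \<theta>) \<in> P"
    using a prime_ideal_over_of_int[OF pr P] \<theta> by (intro D(10)[OF _ ev_diff_mem[OF P]]) auto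
  then have "ev (pderiv f) \<theta> \<in> P" by simp
  then have "of_int discr \<in> P" unfolding discr_def of_int_Nm using \<theta>(1)
    by (intro prime_ideal_over_prod_mem[OF P, of _ \<theta>]) auto
  then show False using prime_ideal_over_of_int[OF pr P] pD by blast
qed

text \<open>Uniqueness in Hensel's lemma: two solutions in the same class modulo \<open>p\<close>
  have f(u) - f(v) = (u - v)(f'(v) + multiple of p) divisible by p^2, and the second factor is a
  unit modulo \<open>p\<close>. So each of the at most d roots lifts to at most one class modulo
  p^2.\<close>

lemma card_square_multiples:
  assumes p: "good p"
  shows "real (card {n \<in> {1..N}. int p ^ 2 dvd shifted_norm n}) \<le> real d * (real N / real p ^ 2 + 1)"
proof -
  have pr: "prime p" and pc: "\<not> int p dvd c" using p unfolding good_def by auto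
  have p0: "p > 0" using pr prime_gt_0_nat by simp
  let ?A = "{n \<in> {1..N}. int p ^ 2 dvd shifted_norm n}"
  let ?F = "\<lambda>s. {n \<in> ?A. n mod p = s}"
  have fin: "finite ?A" by (rule finite_subset[of _ "{1..N}"]) auto
  have "?A \<subseteq> (\<Union>s\<in>{s. shift_root p s}. ?F s)"
  proof
    fix n assume n: "n \<in> ?A"
    then have "int p ^ 2 dvd shifted_norm n" by blast
    then have "int p dvd shifted_norm n" by (metis dvd_mult_left power2_eq_square)
    then have "shift_root p (n mod p)" using shift_root_mod[OF p0] by simp
    then show "n \<in> (\<Union>s\<in>{s. shift_root p s}. ?F s)" using n by blast
  qed
  then have "card ?A \<le> card (\<Union>s\<in>{s. shift_root p s}. ?F s)" using fin by (intro card_mono) auto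
  also have "\<dots> \<le> (\<Sum>s | shift_root p s. card (?F s))" by (rule card_UN_le) auto
  finally have "real (card ?A) \<le> real (\<Sum>s | shift_root p s. card (?F s))" by (rule of_nat_mono)
  also have "\<dots> = (\<Sum>s | shift_root p s. real (card (?F s)))" by simp
  also have "\<dots> \<le> of_nat (card {s. shift_root p s}) * (real N / real (p ^ 2) + 1)"
  proof (rule sum_bounded_above)
    fix s
    have "card (int ` ?F s) = card (?F s)" by (rule card_image) (simp add: inj_on_def)
    moreover have "real (card (int ` ?F s)) \<le> real N / real (p ^ 2) + 1"
    proof (rule card_congruent_le)
      show "int ` ?F s \<subseteq> {1..<1 + int N}" by auto
      show "p ^ 2 > 0" using p0 by simp
      fix x y assume "x \<in> int ` ?F s" "y \<in> int ` ?F s"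
      then obtain a b where ab: "x = int a" "y = int b" "a mod p = b mod p" "int p ^ 2 dvd shifted_norm a" "int p ^ 2 dvd shifted_norm b" by auto
      then have "x mod int p = y mod int p" by (metis of_nat_mod)
      then have pxy: "int p dvd x - y" by (simp add: mod_eq_dvd_iff)
      define u where "u = - c * x"
      define v where "v = - c * y"
      have uv: "u - v = - c * (x - y)" unfolding u_def v_def by (simp add: algebra_simps)
      have fu: "int p ^ 2 dvd poly f u" "int p ^ 2 dvd poly f v" using ab unfolding u_def v_def dvd_shifted_norm_iff by auto
      obtain w where w: "poly f u - poly f v = (u - v) * (poly (pderiv f) v + (u - v) * w)"
        using poly_diff_linear by blast
      have "int p dvd poly f v" using fu(2) by (metis dvd_mult_left power2_eq_square)
      then have pf': "\<not> int p dvd poly (pderiv f) v" by (rule not_dvd_pderiv_root[OF p])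
      have "int p dvd (u - v) * w" using pxy unfolding uv by simp
      then have "\<not> int p dvd poly (pderiv f) v + (u - v) * w" using pf' by (simp add: dvd_add_left_iff)
      then have cop: "Rings.coprime (int p ^ 2) (poly (pderiv f) v + (u - v) * w)"
        using pr by (simp add: prime_imp_coprime)
      have "int p ^ 2 dvd (u - v) * (poly (pderiv f) v + (u - v) * w)" unfolding w[symmetric] using fu by (rule dvd_diff)
      then have "int p ^ 2 dvd u - v" using cop by (simp add: coprime_dvd_mult_left_iff)
      then have "int p ^ 2 dvd c * (x - y)" unfolding uv by simp
      moreover have "Rings.coprime (int p ^ 2) c" using pr pc by (simp add: prime_imp_coprime)
      ultimately show "int (p ^ 2) dvd x - y" by (simp add: coprime_dvd_mult_right_iff)
    qed
    ultimately show "real (card (?F s)) \<le> real N / real (p ^ 2) + 1" by simp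
  qed
  also have "\<dots> \<le> real d * (real N / real (p ^ 2) + 1)"
    using nroots_le[OF p] unfolding nroots_def by (intro mult_right_mono) auto
  finally show ?thesis by simp
qed

text \<open>F(n) has leading coefficient c^d up to sign. This exponent e satisfies |c^d| < 2^e \<le>
  p^e for every prime, as the count of prime power divisors demands.\<close>

definition lead_exp :: nat where "lead_exp = nat (\<bar>c\<bar> ^ d)"

lemma card_shifted_norm_prime_power_le:
  assumes p: "prime p"
  shows "real (card {n \<in> {1..N}. int p ^ (d * j + lead_exp) dvd shifted_norm n}) \<le> real d * (real N / 2 ^ j + 1)"
proof -
  define h where "h = (\<Prod>\<theta>\<in>\<Theta>. [:\<theta>, of_int c:])"
  have cc: "of_int c \<noteq> (0::complex)" using c_nz by simp
  let ?A = "{n \<in> {1..N}. int p ^ (d * j + lead_exp) dvd shifted_norm n}"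
  have "real (card {t \<in> {1..<1 + int N}. int p ^ (d * j + lead_exp) dvd Nm [:c * t, 1:]})
    \<le> real d * (real N / real (p ^ j) + 1)"
  proof (rule card_prime_power_roots_le)
    show "degree h = d" unfolding h_def using cc by (subst degree_prod_eq_sum_degree) (auto simp: card_\<Theta>)
    show "lead_coeff h = of_int (c ^ d)" unfolding h_def using cc by (simp add: lead_coeff_prod card_\<Theta>)
    show "c ^ d \<noteq> 0" using c_nz by simp
    show "poly h (of_int t) = of_int (Nm [:c * t, 1:])" for t
      unfolding h_def of_int_Nm by (simp add: poly_prod add.commute mult.commute)
    have "\<bar>c ^ d\<bar> = int lead_exp" unfolding lead_exp_def by (simp add: power_abs)
    also have "\<dots> < int (2 ^ lead_exp)" using less_exp[of lead_exp] by (simp only: of_nat_less_iff)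
    also have "\<dots> \<le> int (p ^ lead_exp)" using prime_ge_2_nat[OF p] by (simp only: of_nat_le_iff power_mono)
    finally show "\<bar>c ^ d\<bar> < int p ^ (d * j + lead_exp - d * j)" by simp
  qed (use p in auto)
  also have "{t \<in> {1..<1 + int N}. int p ^ (d * j + lead_exp) dvd Nm [:c * t, 1:]} = int ` ?A"
  proof (intro equalityI subsetI)
    fix t assume t: "t \<in> {t \<in> {1..<1 + int N}. int p ^ (d * j + lead_exp) dvd Nm [:c * t, 1:]}"
    then have "t = int (nat t)" "nat t \<in> ?A" unfolding shifted_norm_def by auto
    then show "t \<in> int ` ?A" by blast
  qed (auto simp: shifted_norm_def)
  also have "card (int ` ?A) = card ?A" by (rule card_image) (simp add: inj_on_def)
  also have "real d * (real N / real (p ^ j) + 1) \<le> real d * (real N / 2 ^ j + 1)"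
  proof (intro mult_left_mono add_right_mono divide_left_mono)
    have "(2::real) ^ j \<le> real p ^ j" using prime_ge_2_nat[OF p] by (intro power_mono) auto
    then show "(2::real) ^ j \<le> real (p ^ j)" by simp
  qed (use prime_gt_0_nat[OF p] in auto)
  finally show ?thesis .
qed

lemma shifted_norm_upper: "\<exists>C::nat. C \<ge> 1 \<and> (\<forall>N n. 1 \<le> n \<longrightarrow> n \<le> N \<longrightarrow> \<bar>shifted_norm n\<bar> \<le> int ((C * N) ^ d))"
proof -
  define C0 where "C0 = real_of_int \<bar>c\<bar> + (\<Sum>\<theta>\<in>\<Theta>. norm \<theta>)"
  obtain C :: nat where C: "C0 \<le> real C" using real_arch_simple by blast
  have "\<bar>shifted_norm n\<bar> \<le> int (((C + 1) * N) ^ d)" if n: "1 \<le> n" "n \<le> N" for n N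
  proof -
    have "real_of_int \<bar>shifted_norm n\<bar> = norm (of_int (shifted_norm n) :: complex)" by simp
    also have "\<dots> = (\<Prod>\<theta>\<in>\<Theta>. norm (of_int (c * int n) + \<theta>))" unfolding shifted_norm_def of_int_Nm by (simp add: prod_norm)
    also have "\<dots> \<le> (\<Prod>\<theta>\<in>\<Theta>. real ((C + 1) * N))"
    proof (rule prod_mono)
      fix \<theta> assume \<theta>: "\<theta> \<in> \<Theta>"
      have "norm (of_int (c * int n) + \<theta>) \<le> norm (of_int (c * int n) :: complex) + norm \<theta>" by (rule norm_triangle_ineq)
      also have "norm (of_int (c * int n) :: complex) = real_of_int \<bar>c\<bar> * real n" by (simp add: norm_mult)
      also have "real_of_int \<bar>c\<bar> * real n \<le> real_of_int \<bar>c\<bar> * real N" using n by (intro mult_left_mono) auto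
      also have "norm \<theta> \<le> (\<Sum>\<theta>\<in>\<Theta>. norm \<theta>) * 1" using \<theta> by (simp add: member_le_sum)
      also have "(\<Sum>\<theta>\<in>\<Theta>. norm \<theta>) * 1 \<le> (\<Sum>\<theta>\<in>\<Theta>. norm \<theta>) * real N" using n by (intro mult_left_mono sum_nonneg) auto
      also have "real_of_int \<bar>c\<bar> * real N + (\<Sum>\<theta>\<in>\<Theta>. norm \<theta>) * real N = C0 * real N" unfolding C0_def by (simp add: algebra_simps)
      also have "\<dots> \<le> real (C + 1) * real N" using C by (intro mult_right_mono) auto
      finally show "0 \<le> norm (of_int (c * int n) + \<theta>) \<and> norm (of_int (c * int n) + \<theta>) \<le> real ((C + 1) * N)" by (simp add: algebra_simps)
    qed
    also have "\<dots> = real_of_int (int (((C + 1) * N) ^ d))" by (simp add: card_\<Theta>)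
    finally show ?thesis by (simp only: of_int_le_iff)
  qed
  then show ?thesis by (intro exI[of _ "C + 1"]) auto
qed

lemma shifted_norm_lower: "\<exists>n0::nat. \<forall>n\<ge>n0. (real n / 2) ^ d \<le> real_of_int \<bar>shifted_norm n\<bar>"
proof -
  obtain n0 :: nat where n0: "2 * (\<Sum>\<theta>\<in>\<Theta>. norm \<theta>) \<le> real n0" using real_arch_simple by blast
  have "(real n / 2) ^ d \<le> real_of_int \<bar>shifted_norm n\<bar>" if n: "n \<ge> n0" for n
  proof -
    have "(real n / 2) ^ d = (\<Prod>\<theta>\<in>\<Theta>. real n / 2)" by (simp add: card_\<Theta>)
    also have "\<dots> \<le> (\<Prod>\<theta>\<in>\<Theta>. norm (of_int (c * int n) + \<theta>))"
    proof (rule prod_mono)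
      fix \<theta> assume \<theta>: "\<theta> \<in> \<Theta>"
      have "norm \<theta> \<le> (\<Sum>\<theta>\<in>\<Theta>. norm \<theta>)" using \<theta> by (simp add: member_le_sum)
      then have 1: "norm \<theta> \<le> real n / 2" using n0 n by linarith
      have "1 * real n \<le> real_of_int \<bar>c\<bar> * real n" using c_nz by (intro mult_right_mono) auto
      also have "\<dots> = norm (of_int (c * int n) :: complex)" by (simp add: norm_mult)
      also have "\<dots> \<le> norm (of_int (c * int n) + \<theta>) + norm \<theta>"
        using norm_triangle_ineq4[of "of_int (c * int n) + \<theta>" \<theta>] by simp
      finally show "0 \<le> real n / 2 \<and> real n / 2 \<le> norm (of_int (c * int n) + \<theta>)" using 1 by simp
    qed
    also have "\<dots> = norm (of_int (shifted_norm n) :: complex)" unfolding shifted_norm_def of_int_Nm by (simp add: prod_norm)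
    finally show ?thesis by simp
  qed
  then show ?thesis by blast
qed

section \<open>First and second moments of the prime factors of F(n)\<close>

definition log_weight :: "nat \<Rightarrow> nat \<Rightarrow> real" where
  "log_weight R n = (\<Sum>p\<in>primes_in prime_bound R. if int p dvd shifted_norm n then ln (real p) else 0)"

lemma sum_indicator_mult_set:
  "(\<Sum>n\<in>{1..N}. if int p dvd shifted_norm n then x else 0) = real (card (mult_set p N)) * x"
proof -
  have "(\<Sum>n\<in>{1..N}. if int p dvd shifted_norm n then x else 0) = (\<Sum>n\<in>mult_set p N. x)"
    unfolding mult_set_def by (rule sum.inter_filter[symmetric]) simp
  then show ?thesis by simp
qed

lemma prime_of_primes_in: "p \<in> primes_in a b \<Longrightarrow> prime p" "p \<in> primes_in a b \<Longrightarrow> p > 0"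
  unfolding primes_in_def using prime_gt_0_nat by auto

lemma sum_ln_primes_in_le: "(\<Sum>p\<in>primes_in a b. ln (real p)) \<le> 4 * real b"
proof -
  have "(\<Sum>p\<in>primes_in a b. ln (real p)) \<le> (\<Sum>p\<in>primes_in 0 b. ln (real p))"
    using ln_primes_in by (intro sum_mono2) (auto simp: primes_in_def)
  then show ?thesis using theta_bound[of b] by linarith
qed

lemma first_moment_upper:
  assumes a: "a \<ge> prime_bound"
  shows "(\<Sum>n\<in>{1..N}. \<Sum>p\<in>primes_in a b. if int p dvd shifted_norm n then ln (real p) else 0) \<le> real N * mertens_sum a b + 4 * real d * real b"
proof -
  have "(\<Sum>n\<in>{1..N}. \<Sum>p\<in>primes_in a b. if int p dvd shifted_norm n then ln (real p) else 0)
      = (\<Sum>p\<in>primes_in a b. real (card (mult_set p N)) * ln (real p))"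
    by (subst sum.swap) (simp only: sum_indicator_mult_set)
  also have "\<dots> \<le> (\<Sum>p\<in>primes_in a b. real N * (real (nroots p) * ln (real p) / real p) + real d * ln (real p))"
  proof (rule sum_mono)
    fix p assume p: "p \<in> primes_in a b"
    have nd: "real (nroots p) \<le> real d" using nroots_le[OF good_primes_in[OF p a]] by simp
    have l: "ln (real p) \<ge> 0" using ln_primes_in(1)[OF p] .
    have "real (card (mult_set p N)) * ln (real p) \<le> real (nroots p) * (real N / real p + 1) * ln (real p)"
      using card_mult_set_bounds(1)[OF prime_of_primes_in(2)[OF p]] l by (rule mult_right_mono)
    also have "\<dots> = real N * (real (nroots p) * ln (real p) / real p) + real (nroots p) * ln (real p)"
      by (simp add: algebra_simps)
    also have "\<dots> \<le> real N * (real (nroots p) * ln (real p) / real p) + real d * ln (real p)"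
      using nd l by (intro add_left_mono mult_right_mono)
    finally show "real (card (mult_set p N)) * ln (real p) \<le> real N * (real (nroots p) * ln (real p) / real p) + real d * ln (real p)" .
  qed
  also have "\<dots> = real N * mertens_sum a b + real d * (\<Sum>p\<in>primes_in a b. ln (real p))"
    unfolding mertens_sum_def sum.distrib sum_distrib_left ..
  also have "\<dots> \<le> real N * mertens_sum a b + real d * (4 * real b)"
    by (intro add_left_mono mult_left_mono sum_ln_primes_in_le) simp
  finally show ?thesis by simp
qed

lemma first_moment_lower:
  "real N * mertens_sum prime_bound R - 4 * real d * real R \<le> (\<Sum>n\<in>{1..N}. log_weight R n)"
proof -
  have "real N * mertens_sum prime_bound R - real d * (4 * real R) \<le> real N * mertens_sum prime_bound R - real d * (\<Sum>p\<in>primes_in prime_bound R. ln (real p))"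
    by (intro diff_left_mono mult_left_mono sum_ln_primes_in_le) simp
  also have "\<dots> = (\<Sum>p\<in>primes_in prime_bound R. real N * (real (nroots p) * ln (real p) / real p) - real d * ln (real p))"
    unfolding mertens_sum_def sum_subtractf sum_distrib_left ..
  also have "\<dots> \<le> (\<Sum>p\<in>primes_in prime_bound R. real (card (mult_set p N)) * ln (real p))"
  proof (rule sum_mono)
    fix p assume p: "p \<in> primes_in prime_bound R"
    have nd: "real (nroots p) \<le> real d" using nroots_le[OF good_primes_in[OF p]] by simp
    have l: "ln (real p) \<ge> 0" using ln_primes_in(1)[OF p] .
    have "real N * (real (nroots p) * ln (real p) / real p) - real d * ln (real p)
        \<le> real N * (real (nroots p) * ln (real p) / real p) - real (nroots p) * ln (real p)"
      using nd l by (intro diff_left_mono mult_right_mono)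
    also have "\<dots> = real (nroots p) * (real N / real p - 1) * ln (real p)"
      by (simp add: algebra_simps)
    also have "\<dots> \<le> real (card (mult_set p N)) * ln (real p)"
      using card_mult_set_bounds(2)[OF prime_of_primes_in(2)[OF p]] l by (rule mult_right_mono)
    finally show "real N * (real (nroots p) * ln (real p) / real p) - real d * ln (real p) \<le> real (card (mult_set p N)) * ln (real p)" .
  qed
  also have "\<dots> = (\<Sum>n\<in>{1..N}. log_weight R n)"
    unfolding log_weight_def by (subst sum.swap) (simp only: sum_indicator_mult_set)
  finally show ?thesis by simp
qed

definition log_square_sum :: "nat \<Rightarrow> real" where
  "log_square_sum R = (\<Sum>p\<in>primes_in prime_bound R. real (nroots p) * ln (real p) ^ 2 / real p)"

text \<open>For p different from q, the Chinese remainder theorem gives density rho(p) rho(q)/(p q)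
  with an error of at most d^2; weighted by ln p ln q these errors total at most (4 d R)^2, harmless
  for R near sqrt N. The diagonal yields \<open>log_square_sum\<close>, the source of the
  variance.\<close>

lemma second_moment:
  assumes R: "R \<ge> 1"
  shows "(\<Sum>n\<in>{1..N}. log_weight R n ^ 2)
    \<le> real N * mertens_sum prime_bound R ^ 2 + (4 * real d * real R) ^ 2 + real N * log_square_sum R + 4 * real d * real R * ln (real R)"
proof -
  let ?S = "primes_in prime_bound R"
  let ?i = "\<lambda>p n. if int p dvd shifted_norm n then ln (real p) else 0"
  let ?w = "\<lambda>p. real (nroots p) * ln (real p) / real p"
  have "(\<Sum>n\<in>{1..N}. log_weight R n ^ 2) = (\<Sum>n\<in>{1..N}. \<Sum>p\<in>?S. \<Sum>q\<in>?S. ?i p n * ?i q n)"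
    unfolding log_weight_def power2_eq_square by (simp only: sum_product)
  also have "\<dots> = (\<Sum>p\<in>?S. \<Sum>q\<in>?S. \<Sum>n\<in>{1..N}. ?i p n * ?i q n)"
    by (subst sum.swap, rule sum.cong[OF refl], rule sum.swap)
  also have "\<dots> \<le> (\<Sum>p\<in>?S. \<Sum>q\<in>?S. (real N * (?w p * ?w q) + real d ^ 2 * (ln (real p) * ln (real q)))
     + (if p = q then real N * (real (nroots p) * ln (real p) ^ 2 / real p) + real d * ln (real R) * ln (real p) else 0))"
  proof (intro sum_mono)
    fix p q assume p: "p \<in> ?S" and q: "q \<in> ?S"
    have lp: "ln (real p) \<ge> 0" and lq: "ln (real q) \<ge> 0" using ln_primes_in(1) p q by blast+
    have p0: "p > 0" "q > 0" using prime_of_primes_in(2) p q by blast+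
    have nd: "real (nroots p) \<le> real d" "real (nroots q) \<le> real d"
      using nroots_le[OF good_primes_in[OF p]] nroots_le[OF good_primes_in[OF q]] by simp_all
    have "(\<Sum>n\<in>{1..N}. ?i p n * ?i q n) = (\<Sum>n\<in>{1..N}. if n \<in> mult_set p N \<inter> mult_set q N then ln (real p) * ln (real q) else 0)"
      by (intro sum.cong) (auto simp: mult_set_def)
    also have "\<dots> = (\<Sum>n\<in>mult_set p N \<inter> mult_set q N. ln (real p) * ln (real q))"
    proof -
      have "{1..N} \<inter> (mult_set p N \<inter> mult_set q N) = mult_set p N \<inter> mult_set q N" by (auto simp: mult_set_def)
      then show ?thesis
        using sum.inter_restrict[of "{1..N}" "\<lambda>_. ln (real p) * ln (real q)" "mult_set p N \<inter> mult_set q N"] by simp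
    qed
    finally have eq: "(\<Sum>n\<in>{1..N}. ?i p n * ?i q n) = real (card (mult_set p N \<inter> mult_set q N)) * (ln (real p) * ln (real q))" by simp
    show "(\<Sum>n\<in>{1..N}. ?i p n * ?i q n) \<le> (real N * (?w p * ?w q) + real d ^ 2 * (ln (real p) * ln (real q)))
     + (if p = q then real N * (real (nroots p) * ln (real p) ^ 2 / real p) + real d * ln (real R) * ln (real p) else 0)"
    proof (cases "p = q")
      case False
      have "real (card (mult_set p N \<inter> mult_set q N)) * (ln (real p) * ln (real q))
        \<le> real (nroots p) * real (nroots q) * (real N / (real p * real q) + 1) * (ln (real p) * ln (real q))"
        using card_mult_set_pair[of p q N] prime_of_primes_in(1)[OF p] prime_of_primes_in(1)[OF q] False lp lq
        by (intro mult_right_mono) auto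
      also have "\<dots> = real N * (?w p * ?w q) + real (nroots p) * real (nroots q) * (ln (real p) * ln (real q))"
        by (simp add: algebra_simps)
      also have "real (nroots p) * real (nroots q) * (ln (real p) * ln (real q)) \<le> real d ^ 2 * (ln (real p) * ln (real q))"
        unfolding power2_eq_square using nd lp lq by (intro mult_right_mono mult_mono) auto
      finally show ?thesis unfolding eq using False by simp
    next
      case True
      have "real (card (mult_set p N)) * (ln (real p) * ln (real p))
        \<le> real (nroots p) * (real N / real p + 1) * (ln (real p) * ln (real p))"
        using card_mult_set_bounds(1)[OF p0(1), of N] lp by (intro mult_right_mono) auto
      also have "\<dots> = real N * (real (nroots p) * ln (real p) ^ 2 / real p) + real (nroots p) * (ln (real p) * ln (real p))"
        by (simp add: algebra_simps power2_eq_square)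
      also have "real (nroots p) * (ln (real p) * ln (real p)) \<le> real d * (ln (real R) * ln (real p))"
      proof (rule mult_mono[OF nd(1)])
        have "real p \<le> real R" using p unfolding primes_in_def by simp
        then have "ln (real p) \<le> ln (real R)" using p0 by (intro ln_mono) auto
        then show "ln (real p) * ln (real p) \<le> ln (real R) * ln (real p)" using lp by (rule mult_right_mono)
      qed (use lp in auto)
      finally have "real (card (mult_set p N)) * (ln (real p) * ln (real p))
        \<le> real N * (real (nroots p) * ln (real p) ^ 2 / real p) + real d * ln (real R) * ln (real p)" by simp
      \<comment> \<open>On the diagonal the product terms are not present; adding them, as
        nonnegative quantities, completes the double sums to squares.\<close>
      moreover have "0 \<le> real N * (?w p * ?w p) + real d ^ 2 * (ln (real p) * ln (real p))" using lp by simp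
      ultimately have "real (card (mult_set p N)) * (ln (real p) * ln (real p))
        \<le> (real N * (?w p * ?w p) + real d ^ 2 * (ln (real p) * ln (real p)))
          + (real N * (real (nroots p) * ln (real p) ^ 2 / real p) + real d * ln (real R) * ln (real p))" by linarith
      then show ?thesis unfolding eq by (simp only: True[symmetric] Int_absorb simp_thms if_True)
    qed
  qed
  also have "\<dots> = real N * (\<Sum>p\<in>?S. \<Sum>q\<in>?S. ?w p * ?w q) + real d ^ 2 * (\<Sum>p\<in>?S. \<Sum>q\<in>?S. ln (real p) * ln (real q))
      + (real N * log_square_sum R + real d * ln (real R) * (\<Sum>p\<in>?S. ln (real p)))"
    unfolding sum.distrib log_square_sum_def by (simp add: sum_distrib_left sum.distrib)
  also have "(\<Sum>p\<in>?S. \<Sum>q\<in>?S. ?w p * ?w q) = mertens_sum prime_bound R ^ 2"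
    unfolding mertens_sum_def power2_eq_square by (simp only: sum_product)
  also have "(\<Sum>p\<in>?S. \<Sum>q\<in>?S. ln (real p) * ln (real q)) = (\<Sum>p\<in>?S. ln (real p)) ^ 2"
    unfolding power2_eq_square by (simp only: sum_product)
  also have "real N * mertens_sum prime_bound R ^ 2 + real d ^ 2 * (\<Sum>p\<in>?S. ln (real p)) ^ 2
      + (real N * log_square_sum R + real d * ln (real R) * (\<Sum>p\<in>?S. ln (real p)))
    \<le> real N * mertens_sum prime_bound R ^ 2 + real d ^ 2 * (4 * real R) ^ 2 + (real N * log_square_sum R + real d * ln (real R) * (4 * real R))"
  proof (intro add_mono mult_left_mono power_mono sum_ln_primes_in_le)
    show "0 \<le> (\<Sum>p\<in>?S. ln (real p))" using ln_primes_in by (intro sum_nonneg) blast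
  qed (use R mertens_sum_nonneg in auto)
  finally show ?thesis by (simp add: power_mult_distrib mult_ac)
qed

section \<open>The size of F(n) on smooth integers\<close>

definition smooth_set :: "nat \<Rightarrow> nat set" where
  "smooth_set N = {n \<in> {1..N}. \<forall>p. prime p \<longrightarrow> int p dvd shifted_norm n \<longrightarrow> p \<le> N}"

definition shifted_norm_const :: nat where
  "shifted_norm_const = (SOME C::nat. C \<ge> 1 \<and> (\<forall>N n. 1 \<le> n \<longrightarrow> n \<le> N \<longrightarrow> \<bar>shifted_norm n\<bar> \<le> int ((C * N) ^ d)))"

lemma shifted_norm_const: "shifted_norm_const \<ge> 1" "1 \<le> n \<Longrightarrow> n \<le> N \<Longrightarrow> \<bar>shifted_norm n\<bar> \<le> int ((shifted_norm_const * N) ^ d)"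
  using someI_ex[OF shifted_norm_upper, folded shifted_norm_const_def] by blast+

lemma ln_shifted_norm_smooth:
  assumes d2: "d \<ge> 2" and n: "n \<in> smooth_set N"
  shows "ln (real_of_int \<bar>shifted_norm n\<bar>) = (\<Sum>p\<in>primes_in 0 N. real (multiplicity (int p) (shifted_norm n)) * ln (real p))"
proof -
  define Y where "Y = (shifted_norm_const * N) ^ d"
  have n1: "1 \<le> n" "n \<le> N" using n unfolding smooth_set_def by auto
  have NY: "N \<le> Y"
  proof -
    have "1 * N \<le> shifted_norm_const * N" using shifted_norm_const(1) by (rule mult_right_mono) simp
    also have "\<dots> \<le> (shifted_norm_const * N) ^ d" using shifted_norm_const(1) n1 d_pos by (intro self_le_power) auto
    finally show ?thesis unfolding Y_def by simp
  qed
  have bd: "\<bar>shifted_norm n\<bar> \<le> int Y" unfolding Y_def by (rule shifted_norm_const(2)[OF n1])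
  have "(\<Sum>p\<in>primes_in N Y. real (multiplicity (int p) (shifted_norm n)) * ln (real p)) = 0"
  proof (intro sum.neutral ballI)
    fix p assume p: "p \<in> primes_in N Y"
    then have "\<not> int p dvd shifted_norm n" using n unfolding smooth_set_def primes_in_def by auto
    then show "real (multiplicity (int p) (shifted_norm n)) * ln (real p) = 0" by (simp add: not_dvd_imp_multiplicity_0)
  qed
  then show ?thesis
    unfolding ln_prime_factorization[OF shifted_norm_nonzero[OF d2] bd]
    using sum_primes_in_split[of 0 N Y "\<lambda>p. real (multiplicity (int p) (shifted_norm n)) * ln (real p)"] NY by simp
qed

text \<open>Prime factors may be counted without multiplicity at small cost: for p \<le> P the
  exponent is bounded except on few \<open>n\<close>, and for larger \<open>p\<close> a repeated
  factor needs p^2 to divide F(n), which happens for a proportion of order 1/p^2.\<close>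

lemma sum_smooth_upper:
  assumes d2: "d \<ge> 2" and P: "P \<ge> prime_bound" "P > 0" "P \<le> N" and Y: "Y = (shifted_norm_const * N) ^ d"
  shows "(\<Sum>n\<in>smooth_set N. ln (real_of_int \<bar>shifted_norm n\<bar>))
    \<le> (\<Sum>n\<in>smooth_set N. \<Sum>p\<in>primes_in prime_bound N. if int p dvd shifted_norm n then ln (real p) else 0)
      + (real N * (real (d * j + lead_exp) * (4 * real P)) + ln (real Y) * (real P * (real d * (real N / 2 ^ j + 1)))
      + ln (real Y) * (real d * (real N / real P + real (card (primes_in 0 N)))))"
proof -
  have N: "N \<ge> 1" using P by simp
  have "Y \<ge> 1" unfolding Y using shifted_norm_const(1) N by simp
  then have lnY: "ln (real Y) \<ge> 0" by simp
  let ?K = "d * j + lead_exp"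
  \<comment> \<open>Cost of repeated prime factors at \<open>n\<close>. It is nonnegative, so it can
    be summed over all n \<le> N, where counts in residue classes are available.\<close>
  define D where "D = (\<lambda>n. (\<Sum>p\<in>primes_in 0 P. real ?K * ln (real p) + (if int p ^ ?K dvd shifted_norm n then ln (real Y) else 0))
    + (\<Sum>p\<in>primes_in P N. if int p ^ 2 dvd shifted_norm n then ln (real Y) else 0))"
  have D0: "D n \<ge> 0" for n unfolding D_def
    using lnY ln_primes_in(1) by (intro add_nonneg_nonneg sum_nonneg) (auto intro!: mult_nonneg_nonneg)
  have small: "real (multiplicity (int p) (shifted_norm n)) * ln (real p) \<le> ln (real Y)"
    if n: "1 \<le> n" "n \<le> N" and p: "prime p" "p \<le> N" for n p
  proof -
    have bd: "\<bar>shifted_norm n\<bar> \<le> int Y" unfolding Y by (rule shifted_norm_const(2)[OF n])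
    have nz: "shifted_norm n \<noteq> 0" by (rule shifted_norm_nonzero[OF d2])
    show ?thesis
    proof (cases "int p dvd shifted_norm n")
      case False
      then show ?thesis using lnY by (simp add: not_dvd_imp_multiplicity_0)
    next
      case True
      then have "int p \<le> \<bar>shifted_norm n\<bar>" using nz dvd_imp_le_int[of "shifted_norm n" "int p"] by simp
      then have pY: "p \<le> Y" using bd by linarith
      have "real (multiplicity (int p) (shifted_norm n)) * ln (real p) \<le> ln (real_of_int \<bar>shifted_norm n\<bar>)"
        using sum_mult_ln_le[OF nz bd, of "{p}"] p pY prime_gt_0_nat[OF p(1)] by (simp add: primes_in_def)
      also have "\<dots> \<le> ln (real Y)"
      proof (rule ln_mono)
        show "real_of_int \<bar>shifted_norm n\<bar> \<le> real Y" using bd by linarith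
      qed (use nz in simp)
      finally show ?thesis .
    qed
  qed
  have power: "real (multiplicity (int p) (shifted_norm n)) * ln (real p) \<le> real m * ln (real p) + (if int p ^ Suc m dvd shifted_norm n then ln (real Y) else 0)"
    if n: "1 \<le> n" "n \<le> N" and p: "prime p" "p \<le> N" for n p m
  proof (cases "int p ^ Suc m dvd shifted_norm n")
    case True
    have "ln (real p) \<ge> 0" using prime_ge_1_nat[OF p(1)] by simp
    then show ?thesis using small[OF n p] True by (simp add: add_increasing)
  next
    case False
    have "\<not> is_unit (int p)" using p(1) by (meson not_prime_unit prime_nat_int_transfer)
    then have "\<not> (Suc m \<le> multiplicity (int p) (shifted_norm n))"
      using False shifted_norm_nonzero[OF d2, of n] power_dvd_iff_le_multiplicity[of "shifted_norm n" "int p" "Suc m"] by simp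
    then have "multiplicity (int p) (shifted_norm n) \<le> m" by simp
    moreover have "ln (real p) \<ge> 0" using prime_ge_1_nat[OF p(1)] by simp
    ultimately have "real (multiplicity (int p) (shifted_norm n)) * ln (real p) \<le> real m * ln (real p)"
      by (intro mult_right_mono) auto
    then show ?thesis using False by simp
  qed
  have ce: "lead_exp \<ge> 1"
  proof -
    have "\<bar>c\<bar> ^ d \<ge> 1" using c_nz by (intro one_le_power) auto
    then show ?thesis unfolding lead_exp_def by simp
  qed
  have each: "ln (real_of_int \<bar>shifted_norm n\<bar>) \<le> (\<Sum>p\<in>primes_in prime_bound N. if int p dvd shifted_norm n then ln (real p) else 0) + D n"
    if n: "n \<in> smooth_set N" for n
  proof -
    have n1: "1 \<le> n" "n \<le> N" using n unfolding smooth_set_def by auto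
    have "ln (real_of_int \<bar>shifted_norm n\<bar>) = (\<Sum>p\<in>primes_in 0 P. real (multiplicity (int p) (shifted_norm n)) * ln (real p))
        + (\<Sum>p\<in>primes_in P N. real (multiplicity (int p) (shifted_norm n)) * ln (real p))"
      unfolding ln_shifted_norm_smooth[OF d2 n] by (rule sum_primes_in_split) (use P in auto)
    also have "\<dots> \<le> (\<Sum>p\<in>primes_in 0 P. real ?K * ln (real p) + (if int p ^ ?K dvd shifted_norm n then ln (real Y) else 0))
        + (\<Sum>p\<in>primes_in P N. (if int p dvd shifted_norm n then ln (real p) else 0) + (if int p ^ 2 dvd shifted_norm n then ln (real Y) else 0))"
    proof (intro add_mono sum_mono)
      fix p assume p: "p \<in> primes_in 0 P"
      have pN: "p \<le> N" using p P unfolding primes_in_def by auto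
      obtain m where m: "?K = Suc m" using ce by (metis Suc_pred add_gr_0 less_eq_Suc_le One_nat_def)
      have l: "ln (real p) \<ge> 0" using ln_primes_in(1)[OF p] .
      have "real m * ln (real p) \<le> real ?K * ln (real p)" unfolding m using l by (intro mult_right_mono) auto
      then show "real (multiplicity (int p) (shifted_norm n)) * ln (real p) \<le> real ?K * ln (real p) + (if int p ^ ?K dvd shifted_norm n then ln (real Y) else 0)"
        using power[OF n1 prime_of_primes_in(1)[OF p] pN, of m] unfolding m by linarith
    next
      fix p assume p: "p \<in> primes_in P N"
      have pN: "p \<le> N" using p unfolding primes_in_def by auto
      show "real (multiplicity (int p) (shifted_norm n)) * ln (real p)
        \<le> (if int p dvd shifted_norm n then ln (real p) else 0) + (if int p ^ 2 dvd shifted_norm n then ln (real Y) else 0)"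
      proof (cases "int p dvd shifted_norm n")
        case False
        then show ?thesis using lnY by (simp add: not_dvd_imp_multiplicity_0)
      next
        case True
        then show ?thesis using power[OF n1 prime_of_primes_in(1)[OF p] pN, of 1] by (simp add: numeral_2_eq_2)
      qed
    qed
    also have "\<dots> = (\<Sum>p\<in>primes_in P N. if int p dvd shifted_norm n then ln (real p) else 0) + D n"
      unfolding D_def sum.distrib by simp
    also have "(\<Sum>p\<in>primes_in P N. if int p dvd shifted_norm n then ln (real p) else 0) \<le> (\<Sum>p\<in>primes_in prime_bound N. if int p dvd shifted_norm n then ln (real p) else 0)"
    proof (rule sum_mono2)
      show "primes_in P N \<subseteq> primes_in prime_bound N" using P unfolding primes_in_def by auto
    qed (use ln_primes_in in auto)
    finally show ?thesis by simp
  qed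
  have fin: "finite (smooth_set N)" "smooth_set N \<subseteq> {1..N}"
    unfolding smooth_set_def by (auto intro: finite_subset[of _ "{1..N}"])
  have "(\<Sum>n\<in>smooth_set N. ln (real_of_int \<bar>shifted_norm n\<bar>)) \<le> (\<Sum>n\<in>smooth_set N. (\<Sum>p\<in>primes_in prime_bound N. if int p dvd shifted_norm n then ln (real p) else 0) + D n)"
    by (intro sum_mono each)
  also have "\<dots> = (\<Sum>n\<in>smooth_set N. \<Sum>p\<in>primes_in prime_bound N. if int p dvd shifted_norm n then ln (real p) else 0) + (\<Sum>n\<in>smooth_set N. D n)"
    by (rule sum.distrib)
  also have "(\<Sum>n\<in>smooth_set N. D n) \<le> (\<Sum>n\<in>{1..N}. D n)"
    using fin D0 by (intro sum_mono2) auto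
  also have "\<dots> = real N * (real ?K * (\<Sum>p\<in>primes_in 0 P. ln (real p)))
      + (\<Sum>p\<in>primes_in 0 P. \<Sum>n\<in>{1..N}. if int p ^ ?K dvd shifted_norm n then ln (real Y) else 0)
      + (\<Sum>p\<in>primes_in P N. \<Sum>n\<in>{1..N}. if int p ^ 2 dvd shifted_norm n then ln (real Y) else 0)"
    unfolding D_def sum.distrib
    by (subst (2) sum.swap, subst (4) sum.swap) (simp add: sum_distrib_left)
  also have "\<dots> \<le> real N * (real ?K * (4 * real P)) + ln (real Y) * (real P * (real d * (real N / 2 ^ j + 1)))
      + ln (real Y) * (real d * (real N / real P + real (card (primes_in 0 N))))"
  proof (intro add_mono)
    show "real N * (real ?K * (\<Sum>p\<in>primes_in 0 P. ln (real p))) \<le> real N * (real ?K * (4 * real P))"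
      by (intro mult_left_mono theta_bound) auto
    have cnt: "(\<Sum>n\<in>{1..N}. if Q n then ln (real Y) else 0) = real (card {n \<in> {1..N}. Q n}) * ln (real Y)" for Q
      by (subst sum.inter_filter[symmetric]) auto
    have "(\<Sum>p\<in>primes_in 0 P. \<Sum>n\<in>{1..N}. if int p ^ ?K dvd shifted_norm n then ln (real Y) else 0)
      \<le> of_nat (card (primes_in 0 P)) * (real d * (real N / 2 ^ j + 1) * ln (real Y))"
    proof (rule sum_bounded_above)
      fix p assume "p \<in> primes_in 0 P"
      then have "prime p" by (rule prime_of_primes_in)
      then show "(\<Sum>n\<in>{1..N}. if int p ^ ?K dvd shifted_norm n then ln (real Y) else 0) \<le> real d * (real N / 2 ^ j + 1) * ln (real Y)"
        unfolding cnt using card_shifted_norm_prime_power_le lnY by (intro mult_right_mono) auto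
    qed
    also have "\<dots> \<le> real P * (real d * (real N / 2 ^ j + 1) * ln (real Y))"
    proof (rule mult_right_mono)
      have "card (primes_in 0 P) \<le> card {1..P}" by (rule card_mono) (auto simp: primes_in_def)
      then show "real (card (primes_in 0 P)) \<le> real P" by simp
    qed (use lnY in auto)
    finally show "(\<Sum>p\<in>primes_in 0 P. \<Sum>n\<in>{1..N}. if int p ^ ?K dvd shifted_norm n then ln (real Y) else 0)
      \<le> ln (real Y) * (real P * (real d * (real N / 2 ^ j + 1)))" by (simp only: mult_ac)
    have "(\<Sum>p\<in>primes_in P N. \<Sum>n\<in>{1..N}. if int p ^ 2 dvd shifted_norm n then ln (real Y) else 0)
      \<le> (\<Sum>p\<in>primes_in P N. ln (real Y) * (real d * (real N * (1 / real p ^ 2) + 1)))"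
    proof (rule sum_mono)
      fix p assume p: "p \<in> primes_in P N"
      have "real (card {n \<in> {1..N}. int p ^ 2 dvd shifted_norm n}) * ln (real Y) \<le> real d * (real N / real p ^ 2 + 1) * ln (real Y)"
        using card_square_multiples[OF good_primes_in[OF p P(1)]] lnY by (rule mult_right_mono)
      then show "(\<Sum>n\<in>{1..N}. if int p ^ 2 dvd shifted_norm n then ln (real Y) else 0) \<le> ln (real Y) * (real d * (real N * (1 / real p ^ 2) + 1))"
        unfolding cnt by (simp add: mult_ac)
    qed
    also have "\<dots> = ln (real Y) * (real d * (real N * (\<Sum>p\<in>primes_in P N. 1 / real p ^ 2) + real (card (primes_in P N))))"
      by (simp only: sum_distrib_left[symmetric] sum.distrib) simp
    also have "\<dots> \<le> ln (real Y) * (real d * (real N * (1 / real P) + real (card (primes_in 0 N))))"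
    proof (intro mult_left_mono add_mono sum_inverse_squares[OF P(2)])
      have "card (primes_in P N) \<le> card (primes_in 0 N)" by (rule card_mono) (auto simp: primes_in_def)
      then show "real (card (primes_in P N)) \<le> real (card (primes_in 0 N))" by simp
    qed (use lnY in auto)
    finally show "(\<Sum>p\<in>primes_in P N. \<Sum>n\<in>{1..N}. if int p ^ 2 dvd shifted_norm n then ln (real Y) else 0)
      \<le> ln (real Y) * (real d * (real N / real P + real (card (primes_in 0 N))))" by simp
  qed
  finally show ?thesis by linarith
qed

text \<open>Integers n < N/k are discarded; there are at most N/k + 1 of them, counting 0. For the
  remaining ones |F(n)| is at least (N/(2k))^d.\<close>

lemma sum_smooth_lower:
  assumes d2: "d \<ge> 2" and n0: "\<And>n. n \<ge> n0 \<Longrightarrow> (real n / 2) ^ d \<le> real_of_int \<bar>shifted_norm n\<bar>"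
    and k: "k \<ge> 1" and N: "N \<ge> k * n0" "N \<ge> 2 * k"
  shows "(real (card (smooth_set N)) - real N / real k - 1) * (real d * ln (real N / (2 * real k))) \<le> (\<Sum>n\<in>smooth_set N. ln (real_of_int \<bar>shifted_norm n\<bar>))"
proof -
  let ?T = "{n \<in> smooth_set N. real N / real k \<le> real n}"
  have fin: "finite (smooth_set N)" unfolding smooth_set_def by (auto intro: finite_subset[of _ "{1..N}"])
  have "smooth_set N \<subseteq> ?T \<union> {..N div k}"
  proof
    fix n assume n: "n \<in> smooth_set N"
    show "n \<in> ?T \<union> {..N div k}"
    proof (cases "real N / real k \<le> real n")
      case False
      then have "real n * real k < real N" using k by (simp add: not_le pos_less_divide_eq)
      then have "n * k \<le> N" by (metis less_imp_le of_nat_less_iff of_nat_mult)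
      then have "n \<le> N div k" using k by (simp add: less_eq_div_iff_mult_less_eq)
      then show ?thesis by simp
    qed (use n in simp)
  qed
  then have "card (smooth_set N) \<le> card (?T \<union> {..N div k})" using fin by (intro card_mono) auto
  also have "\<dots> \<le> card ?T + card {..N div k}" by (rule card_Un_le)
  finally have "real (card (smooth_set N)) \<le> real (card ?T) + (real (N div k) + 1)" by simp
  then have c: "real (card (smooth_set N)) - real N / real k - 1 \<le> real (card ?T)"
    using of_nat_div_le_of_nat[of N k, where 'a=real] by linarith
  have "real N / (2 * real k) \<ge> 1"
  proof -
    have "real (2 * k) \<le> real N" using N(2) by (rule of_nat_mono)
    then show ?thesis using k by (simp add: pos_le_divide_eq)
  qed
  then have l0: "ln (real N / (2 * real k)) \<ge> 0" and pos: "real N / (2 * real k) > 0" by simp_all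
  have "(real (card (smooth_set N)) - real N / real k - 1) * (real d * ln (real N / (2 * real k)))
      \<le> of_nat (card ?T) * (real d * ln (real N / (2 * real k)))"
    using c l0 by (intro mult_right_mono) auto
  also have "\<dots> \<le> (\<Sum>n\<in>?T. ln (real_of_int \<bar>shifted_norm n\<bar>))"
  proof (rule sum_bounded_below)
    fix n assume "n \<in> ?T"
    then have n: "real N / real k \<le> real n" by simp
    have "real (k * n0) \<le> real N" using N(1) by (rule of_nat_mono)
    then have "real n0 \<le> real N / real k" using k by (simp add: pos_le_divide_eq mult.commute)
    then have "n \<ge> n0" using n by linarith
    have "(real N / (2 * real k)) ^ d \<le> (real n / 2) ^ d"
      using n pos by (intro power_mono) auto
    also have "\<dots> \<le> real_of_int \<bar>shifted_norm n\<bar>" by (rule n0) fact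
    finally have "ln ((real N / (2 * real k)) ^ d) \<le> ln (real_of_int \<bar>shifted_norm n\<bar>)" using pos by (intro ln_mono) auto
    then show "real d * ln (real N / (2 * real k)) \<le> ln (real_of_int \<bar>shifted_norm n\<bar>)" using pos by (simp add: ln_realpow)
  qed
  also have "\<dots> \<le> (\<Sum>n\<in>smooth_set N. ln (real_of_int \<bar>shifted_norm n\<bar>))"
  proof (rule sum_mono2[OF fin])
    fix n
    have "\<bar>shifted_norm n\<bar> \<ge> 1" using shifted_norm_nonzero[OF d2, of n] by linarith
    then show "0 \<le> ln (real_of_int \<bar>shifted_norm n\<bar>)" by simp
  qed auto
  finally show ?thesis .
qed

end

section \<open>Partial summation and the variance\<close>

lemma ln_telescope: "n \<ge> 1 \<Longrightarrow> (\<Sum>m\<in>{1..<n}. ln (1 + 1 / real m)) = ln (real n)"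
proof (induction n rule: nat_induct_at_least)
  case (Suc n)
  have "{1..<Suc n} = insert n {1..<n}" using Suc.hyps by auto
  then have "(\<Sum>m\<in>{1..<Suc n}. ln (1 + 1 / real m)) = ln (1 + 1 / real n) + ln (real n)" using Suc.IH by simp
  also have "\<dots> = ln ((1 + 1 / real n) * real n)" using Suc.hyps by (intro ln_mult_pos[symmetric]) (auto intro: add_pos_nonneg)
  also have "(1 + 1 / real n) * real n = real (Suc n)" using Suc.hyps by (simp add: field_simps)
  finally show ?case .
qed simp

text \<open>Discrete form of the integral of ln t / t. With a the increment of the logarithm, a^2
  \<le> a, so the linear correction absorbs the quadratic term.\<close>

lemma ln_telescope_square:
  "n \<ge> 1 \<Longrightarrow> (ln (real n) ^ 2 - ln (real n)) / 2 \<le> (\<Sum>m\<in>{1..<n}. ln (1 + 1 / real m) * ln (real m))"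
proof (induction n rule: nat_induct_at_least)
  case (Suc n)
  define a where "a = ln (1 + 1 / real n)"
  define l where "l = ln (real n)"
  have l': "ln (real (Suc n)) = a + l"
    using ln_telescope[of "Suc n"] ln_telescope[of n] Suc.hyps unfolding a_def l_def by simp
  have a0: "a \<ge> 0" unfolding a_def by simp
  have "a \<le> 1 / real n" unfolding a_def by (rule ln_add_one_self_le_self) simp
  also have "\<dots> \<le> 1" using Suc.hyps by simp
  finally have a1: "a \<le> 1" .
  have "a * a \<le> a * 1" using a0 a1 by (intro mult_left_mono)
  then have "((a + l) ^ 2 - (a + l)) / 2 \<le> a * l + (l ^ 2 - l) / 2"
    by (simp add: power2_eq_square algebra_simps)
  moreover have "{1..<Suc n} = insert n {1..<n}" using Suc.hyps by auto
  then have "(\<Sum>m\<in>{1..<Suc n}. ln (1 + 1 / real m) * ln (real m)) = a * l + (\<Sum>m\<in>{1..<n}. ln (1 + 1 / real m) * ln (real m))"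
    unfolding a_def l_def by simp
  ultimately show ?case using Suc.IH unfolding l' l_def[symmetric] by linarith
qed simp

context scaled_field_poly
begin

text \<open>Partial summation: ln p is written as the sum of ln(1 + 1/m) over m < p, and the
  exchange of sums leaves tails of the Mertens sum, each at most about ln R - ln m. Integrating
  gives ln^2 R - 1/2 ln^2 R.\<close>

lemma log_square_sum_upper:
  assumes \<epsilon>: "\<epsilon> > 0"
  shows "eventually (\<lambda>R. log_square_sum R \<le> (1 / 2 + \<epsilon>) * ln (real R) ^ 2) sequentially"
proof -
  define e where "e = min 1 (\<epsilon> / 2)"
  have e: "e > 0" "e \<le> 1" "2 * e \<le> \<epsilon>" unfolding e_def using \<epsilon> by auto
  obtain y0 where y0: "\<And>y. y \<ge> y0 \<Longrightarrow> \<bar>mertens_sum prime_bound y - ln (real y)\<bar> \<le> e * ln (real y)"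
    using mertens_for_roots[OF e(1)] unfolding eventually_sequentially by blast
  define C where "C = ln (real (Suc y0))"
  have C0: "C \<ge> 0" unfolding C_def by simp
  have low: "(1 - e) * ln (real m) - C \<le> mertens_sum prime_bound m" if m: "m \<ge> 1" for m
  proof (cases "m \<ge> y0")
    case True
    then show ?thesis using y0[of m] C0 by (simp add: abs_le_iff algebra_simps)
  next
    case False
    have l: "ln (real m) \<ge> 0" using m by simp
    have "(1 - e) * ln (real m) \<le> 1 * ln (real m)" using e l by (intro mult_right_mono) auto
    also have "1 * ln (real m) \<le> C" unfolding C_def using m False by simp
    finally show ?thesis using mertens_sum_nonneg[of prime_bound m] by linarith
  qed
  have "eventually (\<lambda>R::nat. C + 1 / 2 \<le> (e / 2) * ln (real R)) sequentially"
    using e by (intro ln_dominates) auto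
  then show ?thesis using eventually_ge_at_top[of y0] eventually_ge_at_top[of 1]
  proof eventually_elim
    case (elim R)
    define l where "l = ln (real R)"
    have l0: "l \<ge> 0" unfolding l_def using elim by simp
    let ?S = "primes_in prime_bound R"
    let ?w = "\<lambda>p. real (nroots p) * ln (real p) / real p"
    have w0: "?w p \<ge> 0" if "p \<in> ?S" for p using ln_primes_in(1)[OF that] by simp
    have "log_square_sum R = (\<Sum>p\<in>?S. ?w p * ln (real p))"
      unfolding log_square_sum_def by (intro sum.cong) (simp_all add: power2_eq_square)
    also have "\<dots> = (\<Sum>p\<in>?S. \<Sum>m\<in>{1..<R}. if m < p then ?w p * ln (1 + 1 / real m) else 0)"
    proof (rule sum.cong)
      fix p assume p: "p \<in> ?S"
      have "p \<ge> 1" "p \<le> R" using p unfolding primes_in_def by auto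
      then have "{m \<in> {1..<R}. m < p} = {1..<p}" by auto
      then have "(\<Sum>m\<in>{1..<R}. if m < p then ?w p * ln (1 + 1 / real m) else 0) = (\<Sum>m\<in>{1..<p}. ?w p * ln (1 + 1 / real m))"
        by (subst sum.inter_filter[symmetric]) auto
      also have "\<dots> = ?w p * ln (real p)" unfolding sum_distrib_left[symmetric] ln_telescope[OF \<open>p \<ge> 1\<close>] ..
      finally show "?w p * ln (real p) = (\<Sum>m\<in>{1..<R}. if m < p then ?w p * ln (1 + 1 / real m) else 0)" ..
    qed simp
    also have "\<dots> = (\<Sum>m\<in>{1..<R}. \<Sum>p\<in>?S. if m < p then ?w p * ln (1 + 1 / real m) else 0)" by (rule sum.swap)
    also have "\<dots> \<le> (\<Sum>m\<in>{1..<R}. ln (1 + 1 / real m) * ((1 + e) * l - (1 - e) * ln (real m) + C))"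
    proof (rule sum_mono)
      fix m assume m: "m \<in> {1..<R}"
      have a0: "ln (1 + 1 / real m) \<ge> 0" by simp
      have "(\<Sum>p\<in>?S. if m < p then ?w p * ln (1 + 1 / real m) else 0) = (\<Sum>p\<in>{p \<in> ?S. m < p}. ?w p * ln (1 + 1 / real m))"
        by (subst sum.inter_filter) auto
      also have "\<dots> = ln (1 + 1 / real m) * (\<Sum>p\<in>{p \<in> ?S. m < p}. ?w p)" by (simp add: sum_distrib_left mult.commute)
      also have "(\<Sum>p\<in>{p \<in> ?S. m < p}. ?w p) \<le> mertens_sum prime_bound R - mertens_sum prime_bound m"
      proof -
        have "{p \<in> ?S. m < p} \<inter> primes_in prime_bound m = {}" unfolding primes_in_def by auto
        then have "(\<Sum>p\<in>{p \<in> ?S. m < p}. ?w p) + mertens_sum prime_bound m = (\<Sum>p\<in>{p \<in> ?S. m < p} \<union> primes_in prime_bound m. ?w p)"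
          unfolding mertens_sum_def by (subst sum.union_disjoint) auto
        also have "\<dots> \<le> mertens_sum prime_bound R" unfolding mertens_sum_def
        proof (rule sum_mono2)
          show "{p \<in> ?S. m < p} \<union> primes_in prime_bound m \<subseteq> ?S" using m unfolding primes_in_def by auto
        qed (use w0 in auto)
        finally show ?thesis by simp
      qed
      also have "mertens_sum prime_bound R - mertens_sum prime_bound m \<le> (1 + e) * l - (1 - e) * ln (real m) + C"
        using y0[of R] elim low[of m] m unfolding l_def by (simp add: abs_le_iff algebra_simps)
      finally show "(\<Sum>p\<in>?S. if m < p then ?w p * ln (1 + 1 / real m) else 0) \<le> ln (1 + 1 / real m) * ((1 + e) * l - (1 - e) * ln (real m) + C)"
        using a0 by (simp add: mult_left_mono)
    qed
    also have "\<dots> = ((1 + e) * l + C) * (\<Sum>m\<in>{1..<R}. ln (1 + 1 / real m)) - (1 - e) * (\<Sum>m\<in>{1..<R}. ln (1 + 1 / real m) * ln (real m))"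
      unfolding sum_distrib_left sum_subtractf[symmetric] by (intro sum.cong) (simp_all add: algebra_simps)
    also have "\<dots> \<le> ((1 + e) * l + C) * l - (1 - e) * ((l ^ 2 - l) / 2)"
      unfolding ln_telescope[OF elim(3)] l_def
      using ln_telescope_square[OF elim(3)] e by (intro diff_left_mono mult_left_mono) auto
    also have "\<dots> = (1 / 2 + 3 / 2 * e) * l ^ 2 + (C + 1 / 2 - e / 2) * l"
      by (simp add: power2_eq_square algebra_simps add_divide_distrib diff_divide_distrib)
    also have "\<dots> \<le> (1 / 2 + 3 / 2 * e) * l ^ 2 + (e / 2 * l) * l"
      using elim(1) e l0 unfolding l_def by (intro add_left_mono mult_right_mono) auto
    also have "\<dots> = (1 / 2 + 2 * e) * l ^ 2" by (simp add: power2_eq_square algebra_simps add_divide_distrib diff_divide_distrib)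
    also have "\<dots> \<le> (1 / 2 + \<epsilon>) * l ^ 2" using e by (intro mult_right_mono) auto
    finally show ?case unfolding l_def .
  qed
qed

definition isqrt :: "nat \<Rightarrow> nat" where "isqrt N = nat \<lfloor>sqrt (real N)\<rfloor>"

lemma isqrt: "real (isqrt N) \<le> sqrt (real N)" "sqrt (real N) < real (isqrt N) + 1"
  unfolding isqrt_def using floor_correct[of "sqrt (real N)"] by (simp_all add: of_nat_nat)

lemma isqrt_at_top: "filterlim isqrt at_top sequentially"
proof -
  have "filterlim (\<lambda>N::nat. \<lfloor>sqrt (real N)\<rfloor>) at_top sequentially" by real_asymp
  then show ?thesis unfolding isqrt_def by (rule filterlim_compose[OF filterlim_nat_sequentially])
qed

lemma ln_isqrt:
  assumes "N \<ge> 1"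
  shows "isqrt N \<ge> 1" "ln (real (isqrt N)) \<le> ln (real N) / 2" "ln (real N) / 2 - ln 2 \<le> ln (real (isqrt N))"
proof -
  have "sqrt (real N) \<ge> 1" using assms by simp
  then show r1: "isqrt N \<ge> 1" using isqrt(2)[of N] by linarith
  have "ln (real (isqrt N)) \<le> ln (sqrt (real N))" using isqrt(1)[of N] r1 by (intro ln_mono) auto
  then show "ln (real (isqrt N)) \<le> ln (real N) / 2" using assms by (simp add: ln_sqrt)
  have "ln (sqrt (real N)) \<le> ln (2 * real (isqrt N))" using isqrt(2)[of N] r1 assms by (intro ln_mono) auto
  also have "\<dots> = ln 2 + ln (real (isqrt N))" using r1 by (intro ln_mult_pos) auto
  finally show "ln (real N) / 2 - ln 2 \<le> ln (real (isqrt N))" using assms by (simp add: ln_sqrt)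
qed

lemma mertens_sum_isqrt:
  assumes e: "e > 0" "e \<le> 1"
  shows "eventually (\<lambda>N. \<bar>mertens_sum prime_bound (isqrt N) - ln (real N) / 2\<bar> \<le> e * ln (real N)) sequentially"
proof -
  have "eventually (\<lambda>R. \<bar>mertens_sum prime_bound R - ln (real R)\<bar> \<le> e * ln (real R)) sequentially"
    by (rule mertens_for_roots[OF e(1)])
  then have "eventually (\<lambda>N. \<bar>mertens_sum prime_bound (isqrt N) - ln (real (isqrt N))\<bar> \<le> e * ln (real (isqrt N))) sequentially"
    using isqrt_at_top by (rule eventually_compose_filterlim)
  moreover have "eventually (\<lambda>N::nat. ln 2 \<le> (e / 2) * ln (real N)) sequentially"
    using e by (intro ln_dominates) auto
  ultimately show ?thesis using eventually_ge_at_top[of 1]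
  proof eventually_elim
    case (elim N)
    have 1: "e * ln (real (isqrt N)) \<le> e * (ln (real N) / 2)" using ln_isqrt(2)[OF elim(3)] e by (intro mult_left_mono) auto
    have "ln (real N) \<ge> 0" using elim by simp
    then have 2: "e * ln (real N) \<ge> 0" using e by simp
    show ?case using elim(1,2) ln_isqrt(2,3)[OF elim(3)] 1 2 by (simp add: abs_le_iff)
  qed
qed

text \<open>The variance constant: 1/2 (ln sqrt N)^2 = 1/8 ln^2 N.\<close>

lemma log_square_sum_isqrt:
  assumes e: "e > 0"
  shows "eventually (\<lambda>N. log_square_sum (isqrt N) \<le> (1 / 8 + e) * ln (real N) ^ 2) sequentially"
proof -
  have "eventually (\<lambda>R. log_square_sum R \<le> (1 / 2 + e) * ln (real R) ^ 2) sequentially" by (rule log_square_sum_upper[OF e])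
  then have "eventually (\<lambda>N. log_square_sum (isqrt N) \<le> (1 / 2 + e) * ln (real (isqrt N)) ^ 2) sequentially"
    using isqrt_at_top by (rule eventually_compose_filterlim)
  then show ?thesis using eventually_ge_at_top[of 1]
  proof eventually_elim
    case (elim N)
    have "(1 / 2 + e) * ln (real (isqrt N)) ^ 2 \<le> (1 / 2 + e) * (ln (real N) / 2) ^ 2"
      using ln_isqrt[OF elim(2)] e by (intro mult_left_mono power_mono) auto
    also have "\<dots> = (1 / 8 + e / 4) * ln (real N) ^ 2" by (simp add: power2_eq_square algebra_simps add_divide_distrib diff_divide_distrib)
    also have "\<dots> \<le> (1 / 8 + e) * ln (real N) ^ 2" using e by (intro mult_right_mono) auto
    finally show ?case using elim(1) by linarith
  qed
qed

lemma error_small: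
  assumes e: "e > 0"
  obtains P j where "P \<ge> prime_bound" "P > 0"
    "eventually (\<lambda>N. real N * (real (d * j + lead_exp) * (4 * real P)) + ln (real ((shifted_norm_const * N) ^ d)) * (real P * (real d * (real N / 2 ^ j + 1)))
      + ln (real ((shifted_norm_const * N) ^ d)) * (real d * (real N / real P + real (card (primes_in 0 N)))) \<le> e * real N * ln (real N)) sequentially"
proof -
  define D where "D = real d"
  have D: "D \<ge> 1" unfolding D_def using d_pos by simp
  \<comment> \<open>Eventually ln Y \<le> 2 D L, and both bracketed quantities are at most 2 D e1 N.
    Each product is thus at most 4 D^2 e1 N L, a quarter of the allowed error.\<close>
  define e1 where "e1 = e / (16 * D * D)"
  have e1: "e1 > 0" unfolding e1_def using e D by simp
  obtain n where n: "1 / real (Suc n) < e1" using nat_approx_posE[OF e1] by blast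
  define P where "P = max prime_bound (Suc n)"
  have P: "P \<ge> prime_bound" "P > 0" unfolding P_def by auto
  have Pe: "1 / real P \<le> e1"
  proof -
    have "1 / real P \<le> 1 / real (Suc n)" unfolding P_def by (intro divide_left_mono) auto
    then show ?thesis using n by simp
  qed
  have "((\<lambda>j::nat. 1 / 2 ^ j :: real) \<longlongrightarrow> 0) sequentially" by real_asymp
  then have "eventually (\<lambda>j::nat. 1 / 2 ^ j < e1 / real P) sequentially"
    using e1 P by (intro order_tendstoD(2)) auto
  from eventually_happens'[OF sequentially_bot this] obtain j :: nat where "1 / 2 ^ j < e1 / real P" ..
  then have j: "real P * (1 / 2 ^ j) \<le> e1" using P by (simp add: pos_less_divide_eq mult.commute)
  show thesis
  proof (rule that[OF P, of j])
    have 1: "eventually (\<lambda>N::nat. real (d * j + lead_exp) * (4 * real P) \<le> (e / 4) * ln (real N)) sequentially"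
      using e by (intro ln_dominates) auto
    have 2: "eventually (\<lambda>N::nat. ln (real shifted_norm_const) \<le> 1 * ln (real N)) sequentially"
      by (intro ln_dominates) auto
    have 3: "eventually (\<lambda>N::nat. real (card (primes_in 0 N)) \<le> e1 * real N) sequentially"
      by (rule card_primes_little_o[OF e1])
    have "((\<lambda>N::nat. real P / real N) \<longlongrightarrow> 0) sequentially" by real_asymp
    then have 4: "eventually (\<lambda>N::nat. real P / real N < e1) sequentially"
      using e1 by (rule order_tendstoD)
    show "eventually (\<lambda>N. real N * (real (d * j + lead_exp) * (4 * real P)) + ln (real ((shifted_norm_const * N) ^ d)) * (real P * (real d * (real N / 2 ^ j + 1)))
      + ln (real ((shifted_norm_const * N) ^ d)) * (real d * (real N / real P + real (card (primes_in 0 N)))) \<le> e * real N * ln (real N)) sequentially"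
      using 1 2 3 4 eventually_ge_at_top[of 1]
    proof eventually_elim
      case (elim N)
      define L where "L = ln (real N)"
      have N: "N \<ge> 1" using elim by simp
      have L0: "L \<ge> 0" unfolding L_def using N by simp
      have "ln (real ((shifted_norm_const * N) ^ d)) = D * ln (real shifted_norm_const * real N)"
        unfolding D_def using shifted_norm_const(1) N by (simp add: ln_realpow)
      also have "ln (real shifted_norm_const * real N) = ln (real shifted_norm_const) + L"
        unfolding L_def using shifted_norm_const(1) N by (intro ln_mult_pos) auto
      also have "D * (ln (real shifted_norm_const) + L) \<le> D * (2 * L)" using elim(2) D unfolding L_def by (intro mult_left_mono) auto
      finally have lnY: "ln (real ((shifted_norm_const * N) ^ d)) \<le> 2 * D * L" by simp
      have a: "real N * (real (d * j + lead_exp) * (4 * real P)) \<le> real N * (e / 4 * L)"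
        using elim(1) unfolding L_def by (intro mult_left_mono) auto
      have "real P * (real N / 2 ^ j + 1) = real N * (real P * (1 / 2 ^ j) + real P / real N)"
        using N by (simp add: distrib_left mult.commute)
      also have "\<dots> \<le> real N * (e1 + e1)" using j elim(4) by (intro mult_left_mono add_mono) auto
      finally have f1: "D * (real P * (real N / 2 ^ j + 1)) \<le> D * (real N * (e1 + e1))" by (rule mult_left_mono) (use D in simp)
      have "ln (real ((shifted_norm_const * N) ^ d)) * (D * (real P * (real N / 2 ^ j + 1))) \<le> (2 * D * L) * (D * (real N * (e1 + e1)))"
        by (rule mult_mono[OF lnY f1]) (use D L0 in auto)
      also have "\<dots> = e / 4 * real N * L" unfolding e1_def using D by (simp add: field_simps)
      finally have b: "ln (real ((shifted_norm_const * N) ^ d)) * (real P * (D * (real N / 2 ^ j + 1))) \<le> e / 4 * real N * L"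
        by (simp only: mult.left_commute)
      have "real N / real P + real (card (primes_in 0 N)) \<le> real N * e1 + e1 * real N"
      proof (rule add_mono)
        have "real N * (1 / real P) \<le> real N * e1" using Pe by (intro mult_left_mono) auto
        then show "real N / real P \<le> real N * e1" by simp
      qed (rule elim(3))
      then have "real N / real P + real (card (primes_in 0 N)) \<le> real N * (e1 + e1)" by (simp add: algebra_simps)
      then have f2: "D * (real N / real P + real (card (primes_in 0 N))) \<le> D * (real N * (e1 + e1))"
        by (rule mult_left_mono) (use D in simp)
      have "ln (real ((shifted_norm_const * N) ^ d)) * (D * (real N / real P + real (card (primes_in 0 N)))) \<le> (2 * D * L) * (D * (real N * (e1 + e1)))"
        by (rule mult_mono[OF lnY f2]) (use D L0 in auto)
      also have "\<dots> = e / 4 * real N * L" unfolding e1_def using D by (simp add: field_simps)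
      finally have cc: "ln (real ((shifted_norm_const * N) ^ d)) * (D * (real N / real P + real (card (primes_in 0 N)))) \<le> e / 4 * real N * L" .
      have "0 \<le> e * real N * L" using e L0 by simp
      moreover have "real N * (e / 4 * L) = e / 4 * real N * L" by simp
      ultimately show ?case using a b cc unfolding D_def L_def by linarith
    qed
  qed
qed

end

section \<open>The density of smooth integers\<close>

text \<open>The weight 1 - s on \<open>S\<close> and -s elsewhere has sum zero, so an arbitrary
  \<mu> may be subtracted from \<open>B\<close> before Cauchy-Schwarz is applied; its squares sum to
  |I| s(1 - s).\<close>

lemma weighted_cauchy_schwarz:
  fixes B :: "nat \<Rightarrow> real"
  assumes S: "S \<subseteq> I" "finite I" "card I > 0" and s: "s = real (card S) / real (card I)"
  shows "(\<Sum>n\<in>S. B n) \<le> s * (\<Sum>n\<in>I. B n) + sqrt (real (card I) * (s * (1 - s)) * (\<Sum>n\<in>I. (B n - \<mu>) ^ 2))"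
proof -
  define w where "w = (\<lambda>n. (if n \<in> S then 1 else 0) - s)"
  have finS: "finite S" using S finite_subset by blast
  have IS: "I \<inter> S = S" using S by blast
  have ind: "(\<Sum>n\<in>I. if n \<in> S then g n else 0) = (\<Sum>n\<in>S. g n)" for g :: "nat \<Rightarrow> real"
    using sum.inter_restrict[OF S(2), of g S] unfolding IS by simp
  have sI: "s * real (card I) = real (card S)" unfolding s using S(3) by simp
  have w0: "(\<Sum>n\<in>I. w n) = 0"
    unfolding w_def sum_subtractf using ind[of "\<lambda>_. 1"] sI by (simp add: mult.commute)
  have "(\<Sum>n\<in>I. w n ^ 2) = (\<Sum>n\<in>I. (if n \<in> S then 1 - 2 * s else 0) + s ^ 2)"
    unfolding w_def by (intro sum.cong) (auto simp: power2_eq_square algebra_simps)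
  also have "\<dots> = (1 - 2 * s) * real (card S) + s ^ 2 * real (card I)"
    unfolding sum.distrib ind by simp
  also have "\<dots> = real (card I) * (s * (1 - s))"
    unfolding sI[symmetric] by (simp add: power2_eq_square algebra_simps)
  finally have w2: "(\<Sum>n\<in>I. w n ^ 2) = real (card I) * (s * (1 - s))" .
  have "(\<Sum>n\<in>I. w n * (B n - \<mu>)) = (\<Sum>n\<in>I. (if n \<in> S then B n else 0) - s * B n - \<mu> * w n)"
    unfolding w_def by (intro sum.cong) (auto simp: algebra_simps)
  also have "\<dots> = (\<Sum>n\<in>S. B n) - s * (\<Sum>n\<in>I. B n)"
    unfolding sum_subtractf ind sum_distrib_left[symmetric] w0 by simp
  finally have "\<bar>(\<Sum>n\<in>S. B n) - s * (\<Sum>n\<in>I. B n)\<bar> = \<bar>\<Sum>n\<in>I. w n * (B n - \<mu>)\<bar>" by simp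
  also have "\<dots> \<le> (\<Sum>n\<in>I. \<bar>w n\<bar> * \<bar>B n - \<mu>\<bar>)"
    unfolding abs_mult[symmetric] by (rule sum_abs)
  also have "\<dots> \<le> L2_set w I * L2_set (\<lambda>n. B n - \<mu>) I" by (rule L2_set_mult_ineq)
  also have "\<dots> = sqrt (real (card I) * (s * (1 - s)) * (\<Sum>n\<in>I. (B n - \<mu>) ^ 2))"
    unfolding L2_set_def w2 by (simp only: real_sqrt_mult)
  finally show ?thesis by linarith
qed

context scaled_field_poly
begin

text \<open>After division by N ln N, the size of F(n) on smooth \<open>n\<close> gives d s. Primes
  above sqrt N give 1/2, from averaging over all n \<le> N; primes below give s/2 plus a fluctuation
  bounded by the variance.\<close>

lemma smooth_density_bound_aux:
  assumes d2: "d \<ge> 2" and e: "e > 0" "e \<le> 1" and k: "k \<ge> 1"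
  shows "eventually (\<lambda>N. let s = real (card (smooth_set N)) / real N in
    real d * s \<le> 1 / 2 + s / 2 + sqrt (s * (1 - s) / 8) + (8 * e + sqrt (7 * e) + real d / real k)) sequentially"
proof -
  obtain n0 where n0: "\<And>n. n \<ge> n0 \<Longrightarrow> (real n / 2) ^ d \<le> real_of_int \<bar>shifted_norm n\<bar>" using shifted_norm_lower by blast
  obtain P j where P: "P \<ge> prime_bound" "P > 0" and err:
    "eventually (\<lambda>N. real N * (real (d * j + lead_exp) * (4 * real P)) + ln (real ((shifted_norm_const * N) ^ d)) * (real P * (real d * (real N / 2 ^ j + 1)))
      + ln (real ((shifted_norm_const * N) ^ d)) * (real d * (real N / real P + real (card (primes_in 0 N)))) \<le> e * real N * ln (real N)) sequentially"
    by (rule error_small[OF e(1)])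
  have e1: "eventually (\<lambda>N::nat. 16 * real d ^ 2 + 1 \<le> e * ln (real N)) sequentially"
    by (rule ln_dominates[OF e(1)])
  have e2: "eventually (\<lambda>N::nat. real d * ln (2 * real k) \<le> e / 2 * ln (real N)) sequentially"
    using e by (intro ln_dominates) auto
  have e3: "eventually (\<lambda>N::nat. real d \<le> e / 2 * real N) sequentially"
    using e by real_asymp
  show ?thesis
    using err e1 e2 e3 mertens_for_roots[OF e(1)] mertens_sum_isqrt[OF e] log_square_sum_isqrt[OF e(1)] eventually_ge_at_top[of P]
      eventually_ge_at_top[of "k * n0"] eventually_ge_at_top[of "2 * k"] eventually_ge_at_top[of "prime_bound ^ 2"]
  proof eventually_elim
    case (elim N)
    define L where "L = ln (real N)"
    define x where "x = real N"
    define R where "R = isqrt N"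
    define M where "M = mertens_sum prime_bound R"
    define s where "s = real (card (smooth_set N)) / real N"
    have N1: "N \<ge> 1" using elim(8) P by simp
    then have x1: "x \<ge> 1" unfolding x_def by simp
    have D: "real d \<ge> 2" using d2 by simp
    have eL: "16 * real d ^ 2 + 1 \<le> e * L" using elim(2) unfolding L_def .
    have L0: "L \<ge> 0" unfolding L_def using N1 by simp
    have "e * L \<le> 1 * L" using e L0 by (intro mult_right_mono) auto
    then have L1: "L \<ge> 1" using eL by (smt (verit) zero_le_power2)
    have dd: "real d \<le> real d ^ 2" using D by (simp add: power2_eq_square)
    have xL: "x * L \<ge> 0" using x1 L0 by simp
    have "e * (x * L) \<ge> 0" using e(1) xL by (metis mult_nonneg_nonneg less_imp_le)
    then have exL: "e * x * L \<ge> 0" by (simp only: mult.assoc)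
    have d4: "4 * real d \<le> e * L" using eL dd by linarith
    have R1: "R \<ge> 1" unfolding R_def by (rule ln_isqrt(1)[OF N1])
    have Rsqrt: "real R \<le> sqrt x" unfolding R_def x_def by (rule isqrt(1))
    have R2: "real R ^ 2 \<le> x" using Rsqrt x1 by (metis of_nat_0_le_iff order_trans power_mono real_sqrt_pow2 zero_le_one)
    have "real R * 1 \<le> real R * real R" using R1 by (intro mult_left_mono) auto
    then have Rx: "real R \<le> x" using R2 by (simp add: power2_eq_square)
    have RN: "R \<le> N" using Rx unfolding x_def by simp
    have P0R: "prime_bound \<le> R"
    proof -
      have "real prime_bound ^ 2 \<le> real N" using elim(11) by (metis of_nat_le_iff of_nat_power)
      then have "real prime_bound \<le> sqrt (real N)" by (rule real_le_rsqrt)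
      then have "real prime_bound < real R + 1" using isqrt(2)[of N] unfolding R_def by linarith
      then show ?thesis by simp
    qed
    have M: "\<bar>M - L / 2\<bar> \<le> e * L" using elim(6) unfolding M_def R_def L_def .
    have M0: "M \<ge> 0" unfolding M_def by (rule mertens_sum_nonneg)
    have MN: "\<bar>mertens_sum prime_bound N - L\<bar> \<le> e * L" using elim(5) unfolding L_def .
    have "4 * real d * real R \<le> (e * L) * x" by (rule mult_mono[OF d4 Rx]) (use e L0 in auto)
    then have dR: "4 * real d * real R \<le> e * x * L" by (simp add: mult_ac)
    define A1 where "A1 = (\<Sum>n\<in>{1..N}. log_weight R n)"
    have A1u: "A1 \<le> x * (L / 2) + 2 * (e * x * L)"
    proof -
      have "A1 \<le> x * M + 4 * real d * real R"
        unfolding A1_def log_weight_def x_def M_def using first_moment_upper[where a = prime_bound and b = R and N = N] by simp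
      moreover have "x * M \<le> x * (L / 2 + e * L)" using M x1 by (intro mult_left_mono) auto
      ultimately show ?thesis using dR by (simp add: algebra_simps)
    qed
    have A1l: "x * (L / 2) - 2 * (e * x * L) \<le> A1"
    proof -
      have "x * M - 4 * real d * real R \<le> A1"
        unfolding A1_def x_def M_def by (rule first_moment_lower)
      moreover have "x * (L / 2 - e * L) \<le> x * M" using M x1 by (intro mult_left_mono) auto
      ultimately show ?thesis using dR by (simp add: algebra_simps)
    qed
    define A2 where "A2 = (\<Sum>n\<in>{1..N}. log_weight R n ^ 2)"
    have A2: "A2 \<le> x * L ^ 2 * (3 / 8 + 5 * e)"
    proof -
      have "A2 \<le> x * M ^ 2 + (4 * real d * real R) ^ 2 + x * log_square_sum R + 4 * real d * real R * ln (real R)"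
        unfolding A2_def x_def M_def by (rule second_moment[OF R1])
      moreover have "x * M ^ 2 \<le> x * ((1 / 4 + 2 * e) * L ^ 2)"
      proof (rule mult_left_mono)
        have "M ^ 2 \<le> (L / 2 + e * L) ^ 2" using M M0 by (intro power_mono) auto
        also have "\<dots> = (1 / 4 + e + e * e) * L ^ 2" by (simp add: power2_eq_square algebra_simps)
        also have "\<dots> \<le> (1 / 4 + 2 * e) * L ^ 2"
        proof (rule mult_right_mono)
          have "e * e \<le> e * 1" using e by (intro mult_left_mono) auto
          then show "1 / 4 + e + e * e \<le> 1 / 4 + 2 * e" by simp
        qed simp
        finally show "M ^ 2 \<le> (1 / 4 + 2 * e) * L ^ 2" .
      qed (use x1 in simp)
      moreover have "(4 * real d * real R) ^ 2 \<le> x * (e * L ^ 2)"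
      proof -
        have "(4 * real d * real R) ^ 2 = 16 * real d ^ 2 * real R ^ 2" by (simp add: power_mult_distrib)
        also have "16 * real d ^ 2 \<le> e * L" using eL by simp
        then have "16 * real d ^ 2 * real R ^ 2 \<le> (e * L) * x" by (rule mult_mono[OF _ R2]) (use e L0 in auto)
        also have "\<dots> \<le> (e * L) * x * L" using e L0 L1 x1 mult_left_mono[OF L1, of "e * L * x"] by simp
        finally show ?thesis by (simp add: power2_eq_square mult_ac)
      qed
      moreover have "x * log_square_sum R \<le> x * ((1 / 8 + e) * L ^ 2)"
        using elim(7) x1 unfolding R_def L_def by (intro mult_left_mono) auto
      moreover have "4 * real d * real R * ln (real R) \<le> x * (e * L ^ 2)"
      proof -
        have lR: "ln (real R) \<le> L" using ln_isqrt(2)[OF N1] L0 unfolding R_def L_def by linarith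
        have "4 * real d * real R * ln (real R) \<le> (e * x * L) * L"
          by (rule mult_mono[OF dR lR]) (use R1 exL in auto)
        then show ?thesis by (simp add: power2_eq_square mult_ac)
      qed
      ultimately have "A2 \<le> x * ((1 / 4 + 2 * e) * L ^ 2) + x * (e * L ^ 2) + x * ((1 / 8 + e) * L ^ 2) + x * (e * L ^ 2)"
        by linarith
      also have "\<dots> = x * L ^ 2 * (3 / 8 + 5 * e)" by (simp add: algebra_simps)
      finally show ?thesis .
    qed
    \<comment> \<open>The centre L/2 is only the asymptotic mean, but the first moment is close to
      it from below as well: 3/8 - 1/2 + 1/4 = 1/8.\<close>
    define V where "V = (\<Sum>n\<in>{1..N}. (log_weight R n - L / 2) ^ 2)"
    have V: "V \<le> x * L ^ 2 * (1 / 8 + 7 * e)"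
    proof -
      have "V = (\<Sum>n\<in>{1..N}. log_weight R n ^ 2 - L * log_weight R n + L ^ 2 / 4)"
        unfolding V_def by (intro sum.cong) (auto simp: power2_eq_square algebra_simps)
      also have "\<dots> = A2 - L * A1 + x * (L ^ 2 / 4)"
        unfolding A1_def A2_def x_def sum.distrib sum_subtractf sum_distrib_left by simp
      also have "\<dots> \<le> x * L ^ 2 * (3 / 8 + 5 * e) - L * (x * (L / 2) - 2 * (e * x * L)) + x * (L ^ 2 / 4)"
        using A2 A1l L0 by (intro add_right_mono diff_mono mult_left_mono)
      also have "\<dots> = x * L ^ 2 * (1 / 8 + 7 * e)" by (simp add: power2_eq_square algebra_simps)
      finally show ?thesis .
    qed
    have sub: "smooth_set N \<subseteq> {1..N}" unfolding smooth_set_def by auto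
    have "card (smooth_set N) \<le> card {1..N}" using sub by (intro card_mono) auto
    then have cs: "real (card (smooth_set N)) \<le> x" unfolding x_def by simp
    have sx: "s * x = real (card (smooth_set N))" unfolding s_def x_def using N1 by simp
    have s01: "0 \<le> s" "s \<le> 1" unfolding s_def using cs N1 unfolding x_def by (simp_all add: divide_le_eq_1)
    have ss: "s * (1 - s) \<le> 1" "s * (1 - s) \<ge> 0" using s01 mult_mono[of s 1 "1 - s" 1] by auto
    have SB: "(\<Sum>n\<in>smooth_set N. log_weight R n) \<le> x * L * (s / 2 + 2 * e + sqrt (s * (1 - s) / 8) + sqrt (7 * e))"
    proof -
      have "(\<Sum>n\<in>smooth_set N. log_weight R n) \<le> s * A1 + sqrt (x * (s * (1 - s)) * V)"
        unfolding A1_def V_def x_def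
        using weighted_cauchy_schwarz[OF sub, of s "log_weight R" "L / 2"] N1 unfolding s_def by simp
      also have "s * A1 \<le> s * (x * (L / 2)) + 2 * (e * x * L)"
      proof -
        have "s * A1 \<le> s * (x * (L / 2) + 2 * (e * x * L))" using A1u s01 by (intro mult_left_mono)
        moreover have "s * (2 * (e * x * L)) \<le> 1 * (2 * (e * x * L))" using s01 exL by (intro mult_right_mono) auto
        ultimately show ?thesis by (simp add: distrib_left)
      qed
      also have "sqrt (x * (s * (1 - s)) * V) \<le> sqrt ((x * L) ^ 2 * (s * (1 - s) / 8 + 7 * e))"
      proof (rule real_sqrt_le_mono)
        have "x * (s * (1 - s)) * V \<le> x * (s * (1 - s)) * (x * L ^ 2 * (1 / 8 + 7 * e))"
          using V ss x1 by (intro mult_left_mono) auto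
        also have "\<dots> = (x * L) ^ 2 * (s * (1 - s) / 8 + s * (1 - s) * (7 * e))"
          by (simp add: power2_eq_square distrib_left mult_ac)
        also have "\<dots> \<le> (x * L) ^ 2 * (s * (1 - s) / 8 + 1 * (7 * e))"
          using ss e by (intro mult_left_mono add_left_mono mult_right_mono) auto
        finally show "x * (s * (1 - s)) * V \<le> (x * L) ^ 2 * (s * (1 - s) / 8 + 7 * e)" by simp
      qed
      also have "sqrt ((x * L) ^ 2 * (s * (1 - s) / 8 + 7 * e)) = x * L * sqrt (s * (1 - s) / 8 + 7 * e)"
        using xL by (simp add: real_sqrt_mult)
      also have "\<dots> \<le> x * L * (sqrt (s * (1 - s) / 8) + sqrt (7 * e))"
        using ss e xL by (intro mult_left_mono sqrt_add_le_add_sqrt) auto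
      finally show ?thesis by (simp add: algebra_simps)
    qed
    \<comment> \<open>All terms are nonnegative, so the sum is extended from smooth \<open>n\<close>
      to all n \<le> N; this is where smoothness is given away and the constant 1/2 arises, as ln N
      - ln sqrt N.\<close>
    have tail: "(\<Sum>n\<in>smooth_set N. \<Sum>p\<in>primes_in R N. if int p dvd shifted_norm n then ln (real p) else 0) \<le> x * L * (1 / 2 + 3 * e)"
    proof -
      have "(\<Sum>n\<in>smooth_set N. \<Sum>p\<in>primes_in R N. if int p dvd shifted_norm n then ln (real p) else 0)
        \<le> (\<Sum>n\<in>{1..N}. \<Sum>p\<in>primes_in R N. if int p dvd shifted_norm n then ln (real p) else 0)"
        using sub ln_primes_in(1) by (intro sum_mono2 sum_nonneg) auto
      also have "\<dots> \<le> x * mertens_sum R N + 4 * real d * x"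
        unfolding x_def by (rule first_moment_upper[OF P0R])
      also have "mertens_sum R N = mertens_sum prime_bound N - M" unfolding M_def using mertens_sum_split[OF P0R RN] by simp
      also have "x * (mertens_sum prime_bound N - M) \<le> x * (L / 2 + 2 * (e * L))" using MN M x1 by (intro mult_left_mono) auto
      also have "4 * real d * x \<le> (e * L) * x" using d4 x1 by (intro mult_right_mono) auto
      finally show ?thesis by (simp add: algebra_simps)
    qed
    have up: "(\<Sum>n\<in>smooth_set N. ln (real_of_int \<bar>shifted_norm n\<bar>)) \<le> x * L * (1 / 2 + s / 2 + sqrt (s * (1 - s) / 8) + sqrt (7 * e) + 6 * e)"
    proof -
      have "(\<Sum>n\<in>smooth_set N. \<Sum>p\<in>primes_in prime_bound N. if int p dvd shifted_norm n then ln (real p) else 0)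
        = (\<Sum>n\<in>smooth_set N. log_weight R n) + (\<Sum>n\<in>smooth_set N. \<Sum>p\<in>primes_in R N. if int p dvd shifted_norm n then ln (real p) else 0)"
        unfolding log_weight_def sum.distrib[symmetric] using P0R RN by (intro sum.cong refl sum_primes_in_split)
      moreover have "(\<Sum>n\<in>smooth_set N. ln (real_of_int \<bar>shifted_norm n\<bar>))
        \<le> (\<Sum>n\<in>smooth_set N. \<Sum>p\<in>primes_in prime_bound N. if int p dvd shifted_norm n then ln (real p) else 0) + e * x * L"
        using sum_smooth_upper[OF d2 P elim(8) refl, of j] elim(1) unfolding x_def L_def by linarith
      ultimately have "(\<Sum>n\<in>smooth_set N. ln (real_of_int \<bar>shifted_norm n\<bar>)) \<le>
        x * L * (s / 2 + 2 * e + sqrt (s * (1 - s) / 8) + sqrt (7 * e)) + x * L * (1 / 2 + 3 * e) + e * x * L"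
        using SB tail by linarith
      also have "\<dots> = x * L * (1 / 2 + s / 2 + sqrt (s * (1 - s) / 8) + sqrt (7 * e) + 6 * e)"
        by (simp add: algebra_simps)
      finally show ?thesis .
    qed
    \<comment> \<open>One half of the loss \<open>e\<close> pays for d ln(2k), the other for the -1
      of \<open>sum_smooth_lower\<close>.\<close>
    have low: "x * L * (real d * s - real d / real k - e) \<le> (\<Sum>n\<in>smooth_set N. ln (real_of_int \<bar>shifted_norm n\<bar>))"
    proof -
      define t where "t = ln (2 * real k)"
      have t0: "t \<ge> 0" unfolding t_def using k by simp
      have kx: "real N / real k = x / real k" unfolding x_def ..
      have "ln (real N / (2 * real k)) = L - t" unfolding L_def t_def using N1 k by (simp add: ln_divide_pos)
      then have 1: "(s * x - x / real k - 1) * (real d * (L - t)) \<le> (\<Sum>n\<in>smooth_set N. ln (real_of_int \<bar>shifted_norm n\<bar>))"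
        using sum_smooth_lower[OF d2 n0 k elim(9,10)] unfolding sx kx by simp
      have "(s * x - x / real k - 1) * (real d * t) \<le> x * (real d * t)"
      proof (rule mult_right_mono)
        have "s * x \<le> 1 * x" using s01 x1 by (intro mult_right_mono) auto
        then show "s * x - x / real k - 1 \<le> x" using x1 divide_nonneg_nonneg[of x "real k"] by linarith
      qed (use t0 in simp)
      also have "x * (real d * t) \<le> x * (e / 2 * L)" using elim(3) x1 unfolding t_def L_def by (intro mult_left_mono) auto
      finally have 2: "(s * x - x / real k - 1) * (real d * t) \<le> x * (e / 2 * L)" .
      have 3: "real d * L \<le> (e / 2 * x) * L" using elim(4) L0 unfolding x_def by (rule mult_right_mono)
      have "x * L * (real d * s - real d / real k - e) = (s * x - x / real k - 1) * (real d * L) + real d * L - e * x * L"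
        by (simp add: algebra_simps)
      also have "\<dots> = (s * x - x / real k - 1) * (real d * (L - t)) + (s * x - x / real k - 1) * (real d * t) + real d * L - e * x * L"
        by (simp add: algebra_simps)
      also have "\<dots> \<le> (s * x - x / real k - 1) * (real d * (L - t)) + x * (e / 2 * L) + (e / 2 * x) * L - e * x * L"
        using 2 3 by linarith
      also have "\<dots> = (s * x - x / real k - 1) * (real d * (L - t))" by (simp add: algebra_simps)
      finally show ?thesis using 1 by linarith
    qed
    have xLpos: "x * L > 0" using x1 L1 by simp
    have "x * L * (real d * s - real d / real k - e) \<le> x * L * (1 / 2 + s / 2 + sqrt (s * (1 - s) / 8) + sqrt (7 * e) + 6 * e)"
      using low up by linarith
    then have "real d * s - real d / real k - e \<le> 1 / 2 + s / 2 + sqrt (s * (1 - s) / 8) + sqrt (7 * e) + 6 * e"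
      using xLpos by (simp only: mult_le_cancel_left_pos)
    then have "real d * s \<le> 1 / 2 + s / 2 + sqrt (s * (1 - s) / 8) + (8 * e + sqrt (7 * e) + real d / real k)"
      using e by linarith
    then show ?case unfolding Let_def s_def .
  qed
qed

lemma smooth_density_bound:
  assumes d2: "d \<ge> 2" and \<epsilon>: "\<epsilon> > 0"
  shows "eventually (\<lambda>N. let s = real (card (smooth_set N)) / real N in
    real d * s \<le> 1 / 2 + s / 2 + sqrt (s * (1 - s) / 8) + \<epsilon>) sequentially"
proof -
  \<comment> \<open>Each of 8e, sqrt(7e) and d/k then costs at most a quarter of \<epsilon>.\<close>
  define e where "e = min 1 (min (\<epsilon> / 32) (\<epsilon> ^ 2 / 112))"
  have e: "e > 0" "e \<le> 1" "e \<le> \<epsilon> / 32" "e \<le> \<epsilon> ^ 2 / 112" unfolding e_def using \<epsilon> by auto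
  have "sqrt (7 * e) \<le> sqrt ((\<epsilon> / 4) ^ 2)" using e by (intro real_sqrt_le_mono) (simp add: power2_eq_square)
  then have sq: "sqrt (7 * e) \<le> \<epsilon> / 4" using \<epsilon> by simp
  obtain k0 :: nat where k0: "4 * real d / \<epsilon> \<le> real k0" using real_arch_simple by blast
  define k where "k = k0 + 1"
  have "4 * real d / \<epsilon> \<le> real k" unfolding k_def using k0 by simp
  then have k: "k \<ge> 1" "real d / real k \<le> \<epsilon> / 4" unfolding k_def using \<epsilon> by (simp_all add: field_simps)
  have "8 * e + sqrt (7 * e) + real d / real k \<le> \<epsilon>" using e sq k by linarith
  then show ?thesis
    using smooth_density_bound_aux[OF d2 e(1,2) k(1)]
    unfolding Let_def by (auto elim!: eventually_mono)
qed

end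

text \<open>The positive solution \<open>s\<close> of \<open>d s = 1/2 + \<surd>(3s/8)\<close>.\<close>

definition crit_density :: "nat \<Rightarrow> real" where
  "crit_density d = 1 / (2 * real d) + 3 / (16 * real d ^ 2) + 1 / real d * sqrt (3 / (16 * real d) + (3 / (16 * real d)) ^ 2)"

text \<open>Put y = d s - 1/2. From the critical density on, y^2 \<ge> 3s/8. On the other side s/2 +
  sqrt(s(1 - s)/8) < sqrt(3s/8), which after squaring reduces to (3s - 2)^2 > 0. The single
  exception s = 2/3 is settled by d \<ge> 2.\<close>

lemma crit_density_gap_pos:
  assumes d: "d \<ge> 2" and s: "crit_density d \<le> s" "s \<le> 1"
  shows "0 < real d * s - 1 / 2 - s / 2 - sqrt (s * (1 - s) / 8)"
proof -
  define D where "D = real d"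
  have D: "D \<ge> 2" unfolding D_def using d by simp
  define T where "T = 3 / (16 * D) + (3 / (16 * D)) ^ 2"
  have T0: "T \<ge> 0" unfolding T_def using D by simp
  define u where "u = s - (1 / (2 * D) + 3 / (16 * D ^ 2))"
  have u: "u \<ge> sqrt T / D" unfolding u_def T_def using s(1) unfolding crit_density_def D_def by simp
  have u0: "u \<ge> 0" using u T0 D by (meson divide_nonneg_nonneg order_trans real_sqrt_ge_zero zero_le_numeral)
  have "D * u \<ge> sqrt T" using u D by (simp add: divide_le_eq mult.commute)
  then have "(D * u) ^ 2 \<ge> T" using T0 by (metis power_mono real_sqrt_ge_zero real_sqrt_pow2)
  have s_eq: "D * s = D * u + 1 / 2 + 3 / (16 * D)" unfolding u_def using D by (simp add: field_simps power2_eq_square)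
  have s0: "s > 0"
  proof -
    have "D * s > 0" unfolding s_eq using D u0 by (intro add_nonneg_pos add_nonneg_nonneg) auto
    then show ?thesis using D by (simp add: zero_less_mult_iff)
  qed
  define y where "y = D * s - 1 / 2"
  have y0: "y \<ge> 0" unfolding y_def s_eq using D u0 by simp
  \<comment> \<open>The substitution by \<open>u\<close> completes the square: y^2 - 3s/8 = (D u)^2
    - T.\<close>
  have y2: "3 / 8 * s \<le> y ^ 2"
  proof -
    have "s = (D * u + 1 / 2 + 3 / (16 * D)) / D" using s_eq D by (simp add: field_simps)
    then have "3 / 8 * s = 2 * (3 / (16 * D)) * (D * u + 1 / 2 + 3 / (16 * D))" by (simp add: field_simps)
    moreover have "y = D * u + 3 / (16 * D)" unfolding y_def s_eq by simp
    then have "y ^ 2 = (D * u) ^ 2 + 2 * (3 / (16 * D)) * (D * u) + (3 / (16 * D)) ^ 2"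
      by (simp add: power2_eq_square algebra_simps)
    ultimately have "y ^ 2 - 3 / 8 * s = (D * u) ^ 2 - T"
      unfolding T_def by (simp add: power2_eq_square algebra_simps)
    then show ?thesis using \<open>(D * u) ^ 2 \<ge> T\<close> by simp
  qed
  then have hs: "sqrt (3 / 8 * s) \<le> y" using y0 by (rule real_le_lsqrt[rotated])
  define r where "r = sqrt (s * (1 - s) / 8)"
  have r0: "r \<ge> 0" unfolding r_def using s0 s(2) by simp
  have r2: "r ^ 2 = s * (1 - s) / 8" unfolding r_def using s0 s(2) by simp
  show ?thesis
  proof (cases "s = 2 / 3")
    case True
    have "r = 1 / 6"
    proof -
      have "r ^ 2 = (1 / 6) ^ 2" unfolding r2 True by (simp add: power2_eq_square)
      then show ?thesis using r0 by (simp add: power2_eq_iff_nonneg)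
    qed
    moreover have "D * s \<ge> 4 / 3" unfolding True using D by simp
    ultimately show ?thesis unfolding r_def[symmetric] D_def[symmetric] using True by linarith
  next
    case False
    have "r < (2 - s) / 8"
    proof (rule power_less_imp_less_base)
      have "(3 * s - 2) ^ 2 > 0" using False by simp
      then have "8 * (s * (1 - s)) < (2 - s) ^ 2" by (simp add: power2_eq_square algebra_simps)
      then show "r ^ 2 < ((2 - s) / 8) ^ 2" unfolding r2 by (simp add: power_divide)
      show "0 \<le> (2 - s) / 8" using s(2) by simp
    qed
    then have "s * r < s * ((2 - s) / 8)" using s0 by simp
    then have "(s / 2 + r) ^ 2 < 3 / 8 * s"
      using r2 by (simp add: power2_eq_square algebra_simps)
    then have "s / 2 + r < sqrt (3 / 8 * s)" by (rule real_less_rsqrt)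
    then have "s / 2 + r < y" using hs by linarith
    then show ?thesis unfolding y_def r_def D_def by simp
  qed
qed

lemma crit_density_less_1: "d \<ge> 2 \<Longrightarrow> crit_density d < 0.457"
proof -
  assume d: "d \<ge> 2"
  define D where "D = real d"
  have D: "D \<ge> 2" unfolding D_def using d by simp
  have 1: "1 / (2 * D) \<le> 1 / 4" using D by (simp add: divide_simps)
  have D2: "D ^ 2 \<ge> 4" using D power_mono[of 2 D 2] by simp
  have 2: "3 / (16 * D ^ 2) \<le> 3 / 64" using D2 by (simp add: divide_simps)
  have t: "3 / (16 * D) \<le> 3 / 32" "3 / (16 * D) \<ge> 0" using D by (simp_all add: divide_simps)
  have "(3 / (16 * D)) ^ 2 \<le> (3 / 32) ^ 2" using t by (intro power_mono)
  then have "3 / (16 * D) + (3 / (16 * D)) ^ 2 \<le> 3 / 32 + (3 / 32) ^ 2" using t by linarith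
  \<comment> \<open>Every term of the density decreases with d, so d = 2 is the extreme case; 1/4 +
    3/64 + 0.32025/2 = 0.457 exactly.\<close>
  also have "\<dots> < 0.32025 ^ 2" by (simp add: power2_eq_square)
  finally have "sqrt (3 / (16 * D) + (3 / (16 * D)) ^ 2) < 0.32025" by (intro real_less_lsqrt) auto
  moreover have "1 / D \<le> 1 / 2" using D by (simp add: divide_simps)
  moreover have "sqrt (3 / (16 * D) + (3 / (16 * D)) ^ 2) \<ge> 0" using t by simp
  ultimately have "1 / D * sqrt (3 / (16 * D) + (3 / (16 * D)) ^ 2) \<le> 1 / 2 * sqrt (3 / (16 * D) + (3 / (16 * D)) ^ 2)"
    "1 / 2 * sqrt (3 / (16 * D) + (3 / (16 * D)) ^ 2) < 1 / 2 * 0.32025"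
    by (auto intro!: mult_right_mono simp del: times_divide_eq_left)
  then show ?thesis unfolding crit_density_def D_def[symmetric] using 1 2 by simp
qed

text \<open>By continuity the strict gap persists slightly to the left of the critical density, and
  by compactness it has a positive minimum up to 1. Thus a small error in the density inequality
  still leaves a definite saving \<open>\<delta>\<close>, which later pays for passing from integer
  to real \<open>x\<close>.\<close>

lemma crit_density_gap:
  assumes d: "d \<ge> 2"
  obtains \<delta> \<epsilon> where "\<delta> > 0" "\<epsilon> > 0"
    "\<And>s. 0 \<le> s \<Longrightarrow> s \<le> 1 \<Longrightarrow> real d * s \<le> 1 / 2 + s / 2 + sqrt (s * (1 - s) / 8) + \<epsilon> \<Longrightarrow> s \<le> crit_density d - \<delta>"
proof -
  define g where "g = (\<lambda>s. real d * s - 1 / 2 - s / 2 - sqrt (s * (1 - s) / 8))"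
  have cont: "continuous_on A g" for A :: "real set"
    unfolding g_def by (intro continuous_intros) auto
  define s0 where "s0 = crit_density d"
  have s0: "s0 < 1" unfolding s0_def using crit_density_less_1[OF d] by simp
  have "isCont g s0" using cont[of UNIV] by (simp add: continuous_on_eq_continuous_at)
  then have "(g \<longlongrightarrow> g s0) (at s0)" by (simp add: isCont_def)
  moreover have g0: "g s0 > 0" unfolding g_def s0_def by (rule crit_density_gap_pos[OF d]) (use s0 s0_def in auto)
  ultimately have "eventually (\<lambda>s. g s > 0) (at s0)" by (rule order_tendstoD)
  then obtain r where r: "r > 0" "\<And>s. s \<noteq> s0 \<Longrightarrow> dist s s0 < r \<Longrightarrow> g s > 0"
    unfolding eventually_at by auto
  define \<delta> where "\<delta> = r / 2"
  have pos: "g s > 0" if "s0 - \<delta> \<le> s" "s \<le> 1" for s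
  proof (cases "s < s0")
    case True
    then have "dist s s0 < r" using that r(1) unfolding \<delta>_def dist_real_def by linarith
    then show ?thesis using r(2)[of s] True by simp
  next
    case False
    then show ?thesis unfolding g_def using that crit_density_gap_pos[OF d, of s] unfolding s0_def by simp
  qed
  have "compact {s0 - \<delta>..1}" by (rule compact_Icc)
  have "{s0 - \<delta>..1} \<noteq> {}" using s0 r(1) unfolding \<delta>_def by simp
  have "\<exists>m\<in>{s0 - \<delta>..1}. \<forall>s\<in>{s0 - \<delta>..1}. g m \<le> g s"
    by (rule continuous_attains_inf) fact+
  then obtain m where m: "m \<in> {s0 - \<delta>..1}" "\<And>s. s \<in> {s0 - \<delta>..1} \<Longrightarrow> g m \<le> g s"
    by blast
  have gm: "g m > 0" using pos m(1) by simp
  show thesis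
  proof (rule that[of \<delta> "g m / 2"])
    show "\<delta> > 0" unfolding \<delta>_def using r(1) by simp
    show "g m / 2 > 0" using gm by simp
    fix s :: real assume s: "0 \<le> s" "s \<le> 1" "real d * s \<le> 1 / 2 + s / 2 + sqrt (s * (1 - s) / 8) + g m / 2"
    show "s \<le> crit_density d - \<delta>"
    proof (rule ccontr)
      assume "\<not> s \<le> crit_density d - \<delta>"
      then have "s \<in> {s0 - \<delta>..1}" using s unfolding s0_def by simp
      then have "g m \<le> g s" by (rule m(2))
      also have "g s \<le> g m / 2" using s(3) g_def[THEN fun_cong, of s] by linarith
      finally show False using gm by simp
    qed
  qed
qed

context scaled_field_poly
begin

lemma smooth_set_bound:
  assumes d2: "d \<ge> 2"
  obtains \<delta> where "\<delta> > 0" "eventually (\<lambda>N. real (card (smooth_set N)) \<le> (crit_density d - \<delta>) * real N) sequentially"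
proof -
  obtain \<delta> \<epsilon> where de: "\<delta> > 0" "\<epsilon> > 0"
    "\<And>s. 0 \<le> s \<Longrightarrow> s \<le> 1 \<Longrightarrow> real d * s \<le> 1 / 2 + s / 2 + sqrt (s * (1 - s) / 8) + \<epsilon> \<Longrightarrow> s \<le> crit_density d - \<delta>"
    using crit_density_gap[OF d2] by blast
  have "eventually (\<lambda>N. real (card (smooth_set N)) \<le> (crit_density d - \<delta>) * real N) sequentially"
    using smooth_density_bound[OF d2 de(2)] eventually_ge_at_top[of 1]
  proof eventually_elim
    case (elim N)
    define s where "s = real (card (smooth_set N)) / real N"
    have "card (smooth_set N) \<le> card {1..N}" unfolding smooth_set_def by (intro card_mono) auto
    then have cs: "real (card (smooth_set N)) \<le> real N" by simp
    have s01: "0 \<le> s" "s \<le> 1" unfolding s_def using cs elim(2) by (simp_all add: divide_le_eq_1)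
    have "s \<le> crit_density d - \<delta>" using elim(1) by (intro de(3) s01) (simp add: s_def Let_def)
    then have "s * real N \<le> (crit_density d - \<delta>) * real N" by (rule mult_right_mono) simp
    then show ?case unfolding s_def using elim(2) by simp
  qed
  then show thesis using that de(1) by blast
qed

end

section \<open>Private primes\<close>

lemma complex_field_simps [simp]:
  "carrier complex_field = UNIV" "x \<otimes>\<^bsub>complex_field\<^esub> y = x * y" "x \<oplus>\<^bsub>complex_field\<^esub> y = x + y"
  "\<one>\<^bsub>complex_field\<^esub> = 1" "\<zero>\<^bsub>complex_field\<^esub> = 0"
  unfolding ring_of_type_algebra_def by simp_all

lemma field_complex_field: "field complex_field"
  by (rule field_from_type_algebra)

interpretation CF: ring complex_field
  using field_complex_field by (simp add: field_def domain_def cring_def)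

lemma complex_field_a_inv [simp]: "\<ominus>\<^bsub>complex_field\<^esub> x = - x"
  using CF.minus_equality[of "- x" x] by simp

lemma complex_field_m_inv: "x \<noteq> 0 \<Longrightarrow> inv\<^bsub>complex_field\<^esub> x = inverse x"
  using CF.inv_unique'[of x "inverse x"] by simp

lemma rat_adjoin_rules:
  "1 \<in> rat_adjoin \<alpha>" "\<alpha> \<in> rat_adjoin \<alpha>" "x \<in> rat_adjoin \<alpha> \<Longrightarrow> - x \<in> rat_adjoin \<alpha>"
  "x \<in> rat_adjoin \<alpha> \<Longrightarrow> x \<noteq> 0 \<Longrightarrow> inverse x \<in> rat_adjoin \<alpha>"
  "x \<in> rat_adjoin \<alpha> \<Longrightarrow> y \<in> rat_adjoin \<alpha> \<Longrightarrow> x + y \<in> rat_adjoin \<alpha>"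
  "x \<in> rat_adjoin \<alpha> \<Longrightarrow> y \<in> rat_adjoin \<alpha> \<Longrightarrow> x * y \<in> rat_adjoin \<alpha>"
  using generate_field.one[of complex_field "{\<alpha>}"] generate_field.incl[of \<alpha> "{\<alpha>}" complex_field]
    generate_field.a_inv[of x complex_field "{\<alpha>}"] generate_field.m_inv[of x complex_field "{\<alpha>}"]
    generate_field.eng_add[of x complex_field "{\<alpha>}" y] generate_field.eng_mult[of x complex_field "{\<alpha>}" y]
  unfolding rat_adjoin_def by (simp_all add: complex_field_m_inv)

lemma rat_adjoin_0: "0 \<in> rat_adjoin \<alpha>"
  using rat_adjoin_rules(5)[OF rat_adjoin_rules(1) rat_adjoin_rules(3)[OF rat_adjoin_rules(1)], of \<alpha>] by simp

lemma rat_adjoin_of_nat: "of_nat n \<in> rat_adjoin \<alpha>"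
  by (induction n) (auto intro: rat_adjoin_0 rat_adjoin_rules)

lemma rat_adjoin_of_int: "of_int k \<in> rat_adjoin \<alpha>"
  by (cases k) (use rat_adjoin_of_nat[of _ \<alpha>] rat_adjoin_rules(3)[OF rat_adjoin_of_nat, of _ \<alpha>] in \<open>auto simp del: of_nat_Suc\<close>)

lemma rat_adjoin_ev: "z \<in> rat_adjoin \<alpha> \<Longrightarrow> ev g z \<in> rat_adjoin \<alpha>"
  by (induction g) (auto intro: rat_adjoin_0 rat_adjoin_of_int rat_adjoin_rules)

locale integers_of_field =
  fixes K :: "complex set" and \<alpha> :: complex
  assumes K_def: "K = rat_adjoin \<alpha>"
begin

definition \<O> :: "complex set" where "\<O> = {x \<in> K. algebraic_int x}"

lemma O_closed:
  "0 \<in> \<O>" "1 \<in> \<O>" "of_int k \<in> \<O>" "x \<in> \<O> \<Longrightarrow> y \<in> \<O> \<Longrightarrow> x + y \<in> \<O>" "x \<in> \<O> \<Longrightarrow> y \<in> \<O> \<Longrightarrow> x * y \<in> \<O>"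
  "x \<in> \<O> \<Longrightarrow> - x \<in> \<O>"
  unfolding \<O>_def
  by (auto intro: rat_adjoin_0[of \<alpha>, folded K_def] rat_adjoin_of_int[of _ \<alpha>, folded K_def]
      rat_adjoin_rules[where \<alpha> = \<alpha>, folded K_def])

lemma O_diff: "x \<in> \<O> \<Longrightarrow> y \<in> \<O> \<Longrightarrow> x - y \<in> \<O>"
  using O_closed(4)[of x "- y"] O_closed(6)[of y] by simp

lemma integer_ring_simps [simp]:
  "carrier (integer_ring K) = \<O>" "x \<otimes>\<^bsub>integer_ring K\<^esub> y = x * y" "x \<oplus>\<^bsub>integer_ring K\<^esub> y = x + y"
  "\<one>\<^bsub>integer_ring K\<^esub> = 1" "\<zero>\<^bsub>integer_ring K\<^esub> = 0"
  unfolding integer_ring_def \<O>_def by simp_all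

lemma cring_integer_ring: "cring (integer_ring K)"
proof (rule cringI)
  show "abelian_group (integer_ring K)"
  proof (rule abelian_groupI)
    fix x assume "x \<in> carrier (integer_ring K)"
    then show "\<exists>y\<in>carrier (integer_ring K). y \<oplus>\<^bsub>integer_ring K\<^esub> x = \<zero>\<^bsub>integer_ring K\<^esub>"
      using O_closed(6) by (intro bexI[of _ "- x"]) auto
  qed (auto intro: O_closed)
  show "Group.comm_monoid (integer_ring K)"
    by (rule comm_monoidI) (auto intro: O_closed)
qed (auto simp: distrib_right)

interpretation R: cring "integer_ring K" by (rule cring_integer_ring)

lemma ideal_iff:
  "ideal I (integer_ring K) \<longleftrightarrow> I \<subseteq> \<O> \<and> 0 \<in> I \<and> (\<forall>x\<in>I. \<forall>y\<in>I. x + y \<in> I) \<and> (\<forall>x\<in>I. \<forall>a\<in>\<O>. a * x \<in> I)"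
proof
  assume I: "ideal I (integer_ring K)"
  interpret ideal I "integer_ring K" by (rule I)
  show "I \<subseteq> \<O> \<and> 0 \<in> I \<and> (\<forall>x\<in>I. \<forall>y\<in>I. x + y \<in> I) \<and> (\<forall>x\<in>I. \<forall>a\<in>\<O>. a * x \<in> I)"
    using a_subset zero_closed a_closed I_l_closed by auto
next
  assume I: "I \<subseteq> \<O> \<and> 0 \<in> I \<and> (\<forall>x\<in>I. \<forall>y\<in>I. x + y \<in> I) \<and> (\<forall>x\<in>I. \<forall>a\<in>\<O>. a * x \<in> I)"
  show "ideal I (integer_ring K)"
  proof (rule idealI)
    show "ring (integer_ring K)" by (rule R.ring_axioms)
    show "subgroup I (add_monoid (integer_ring K))"
    proof (rule R.add.subgroupI)
      fix a assume a: "a \<in> I"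
      then have "a \<in> \<O>" using I by blast
      have "\<ominus>\<^bsub>integer_ring K\<^esub> a = - a"
        using R.minus_equality[of "- a" a] \<open>a \<in> \<O>\<close> O_closed(6) by simp
      moreover have "- 1 * a \<in> I" using I a O_closed(2,6) by blast
      ultimately show "\<ominus>\<^bsub>integer_ring K\<^esub> a \<in> I" by simp
    qed (use I in auto)
  qed (use I in \<open>auto simp: mult.commute\<close>)
qed

lemma idealD:
  assumes "ideal I (integer_ring K)"
  shows "x \<in> I \<Longrightarrow> x \<in> \<O>" "0 \<in> I" "x \<in> I \<Longrightarrow> y \<in> I \<Longrightarrow> x + y \<in> I" "x \<in> I \<Longrightarrow> a \<in> \<O> \<Longrightarrow> a * x \<in> I"
    "x \<in> I \<Longrightarrow> a \<in> \<O> \<Longrightarrow> x * a \<in> I"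
  using assms[unfolded ideal_iff] by (auto simp: mult.commute)

lemma ideal_prod_subset:
  assumes "ideal J (integer_ring K)" "\<And>x y. x \<in> A \<Longrightarrow> y \<in> B \<Longrightarrow> x * y \<in> J"
  shows "ideal_prod (integer_ring K) A B \<subseteq> J"
proof
  fix z assume "z \<in> ideal_prod (integer_ring K) A B"
  then show "z \<in> J"
    by (induction rule: ideal_prod.induct) (use assms idealD(3)[OF assms(1)] in auto)
qed

text \<open>The module O + u O is an inverse of \<open>P\<close>: its product with \<open>P\<close>
  lies in O and contains a u + b = 1. Hence C = I (O + u O), integral because \<open>I\<close> is
  contained in \<open>P\<close>, is the cofactor with P C = I.\<close>

lemma divides_of_locally_inverse:
  assumes P: "ideal P (integer_ring K)" and I: "ideal I (integer_ring K)" "I \<subseteq> P"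
    and u: "\<And>y. y \<in> P \<Longrightarrow> u * y \<in> \<O>" and ab: "a \<in> P" "b \<in> P" "a * u + b = 1"
  shows "P divides\<^bsub>ideals_set (integer_ring K)\<^esub> I"
proof -
  note DI = idealD[OF I(1)]
  define C where "C = {u * x + y | x y. x \<in> I \<and> y \<in> I}"
  have "ideal C (integer_ring K)"
    unfolding ideal_iff
  proof (intro conjI ballI)
    show "C \<subseteq> \<O>" unfolding C_def using u I(2) DI(1) O_closed by blast
    have "u * 0 + 0 = 0" by simp
    then show "0 \<in> C" unfolding C_def using DI(2) by force
  next
    fix s t assume "s \<in> C" "t \<in> C"
    then obtain x y x' y' where *: "s = u * x + y" "t = u * x' + y'" "x \<in> I" "y \<in> I" "x' \<in> I" "y' \<in> I"
      unfolding C_def by blast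
    have "s + t = u * (x + x') + (y + y')" unfolding * by (simp add: algebra_simps)
    then show "s + t \<in> C" unfolding C_def using * DI(3) by blast
  next
    fix s t assume "s \<in> C" "t \<in> \<O>"
    then obtain x y where *: "s = u * x + y" "x \<in> I" "y \<in> I" unfolding C_def by blast
    have "t * s = u * (t * x) + t * y" unfolding * by (simp add: algebra_simps)
    then show "t * s \<in> C" unfolding C_def using * DI(4) \<open>t \<in> \<O>\<close> by blast
  qed
  moreover have "I = ideal_prod (integer_ring K) P C"
  proof
    show "ideal_prod (integer_ring K) P C \<subseteq> I"
    proof (rule ideal_prod_subset[OF I(1)])
      fix x y assume x: "x \<in> P" and y: "y \<in> C"
      then obtain z w where *: "y = u * z + w" "z \<in> I" "w \<in> I" unfolding C_def by blast
      have "x * y = (u * x) * z + x * w" unfolding * by (simp add: algebra_simps)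
      also have "\<dots> \<in> I" using DI(3,4) u[OF x] idealD(1)[OF P x] * by blast
      finally show "x * y \<in> I" .
    qed
    show "I \<subseteq> ideal_prod (integer_ring K) P C"
    proof
      fix z assume z: "z \<in> I"
      have "u * z + 0 \<in> C" "u * 0 + z \<in> C" unfolding C_def using z DI(2) by blast+
      then have "u * z \<in> C" "z \<in> C" by simp_all
      then have "a * (u * z) \<in> ideal_prod (integer_ring K) P C" "b * z \<in> ideal_prod (integer_ring K) P C"
        using ideal_prod.prod[of a P "u * z" C "integer_ring K"] ideal_prod.prod[of b P z C "integer_ring K"] ab by simp_all
      then have "a * (u * z) + b * z \<in> ideal_prod (integer_ring K) P C"
        using ideal_prod.sum[of "a * (u * z)" "integer_ring K" P C "b * z"] by simp
      also have "a * (u * z) + b * z = (a * u + b) * z" by (simp add: algebra_simps)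
      finally show "z \<in> ideal_prod (integer_ring K) P C" using ab(3) by simp
    qed
  qed
  ultimately show ?thesis unfolding factor_def ideals_set_def by auto
qed

text \<open>A multiple of \<open>P\<close> is contained in \<open>P\<close>, whereas multiplying one
  element outside \<open>P\<close> from each factor produces an element of the product outside the
  prime ideal \<open>P\<close>.\<close>

lemma not_divides_finprod:
  assumes P: "primeideal P (integer_ring K)" and A: "finite A"
    and T: "\<And>m. m \<in> A \<Longrightarrow> ideal (T m) (integer_ring K)" "\<And>m. m \<in> A \<Longrightarrow> \<exists>x\<in>T m. x \<notin> P"
  shows "\<not> P divides\<^bsub>ideals_set (integer_ring K)\<^esub> finprod (ideals_set (integer_ring K)) T A"
proof -
  interpret P: primeideal P "integer_ring K" by (rule P)
  interpret IS: Group.comm_monoid "ideals_set (integer_ring K)" by (rule R.ideals_set_is_comm_monoid)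
  have "(\<exists>x\<in>finprod (ideals_set (integer_ring K)) T A. x \<notin> P)"
    using A T
  proof (induction A rule: finite_induct)
    case empty
    have "1 \<notin> P"
    proof
      assume "1 \<in> P"
      then have "\<O> \<subseteq> P" using P.I_l_closed[of 1] by auto
      then show False using P.I_notcarr P.a_subset by auto
    qed
    moreover have "finprod (ideals_set (integer_ring K)) T {} = \<O>"
      unfolding IS.finprod_empty by (simp add: ideals_set_def)
    ultimately show ?case using O_closed(2) by blast
  next
    case (insert m A)
    have TI: "T i \<in> carrier (ideals_set (integer_ring K))" if "i \<in> insert m A" for i
      using insert.prems(1)[OF that] by (simp add: ideals_set_def)
    have eq: "finprod (ideals_set (integer_ring K)) T (insert m A) = ideal_prod (integer_ring K) (T m) (finprod (ideals_set (integer_ring K)) T A)"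
      using IS.finprod_insert[of A m T] insert.hyps TI by (simp add: ideals_set_def Pi_def)
    obtain y where y: "y \<in> finprod (ideals_set (integer_ring K)) T A" "y \<notin> P" using insert by blast
    have "finprod (ideals_set (integer_ring K)) T A \<in> carrier (ideals_set (integer_ring K))"
      using TI by (intro IS.finprod_closed) auto
    then have "ideal (finprod (ideals_set (integer_ring K)) T A) (integer_ring K)" by (simp add: ideals_set_def)
    then have yO: "y \<in> \<O>" using idealD(1) y(1) by blast
    obtain x where x: "x \<in> T m" "x \<notin> P" using insert.prems(2)[of m] by blast
    have xO: "x \<in> \<O>" using idealD(1)[OF insert.prems(1)[of m]] x(1) by blast
    have "x * y \<notin> P" using P.I_prime[of x y] xO yO x(2) y(2) by auto
    moreover have "x * y \<in> ideal_prod (integer_ring K) (T m) (finprod (ideals_set (integer_ring K)) T A)"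
      using ideal_prod.prod[OF x(1) y(1), of "integer_ring K"] by simp
    ultimately show ?case unfolding eq by blast
  qed
  then obtain x where x: "x \<in> finprod (ideals_set (integer_ring K)) T A" "x \<notin> P" by blast
  show ?thesis
  proof
    assume "P divides\<^bsub>ideals_set (integer_ring K)\<^esub> finprod (ideals_set (integer_ring K)) T A"
    then obtain C where C: "ideal C (integer_ring K)" "finprod (ideals_set (integer_ring K)) T A = ideal_prod (integer_ring K) P C"
      unfolding factor_def ideals_set_def by auto
    have "ideal_prod (integer_ring K) P C \<subseteq> P"
      using P.I_r_closed idealD(1)[OF C(1)] by (intro ideal_prod_subset[OF P.is_ideal]) auto
    then show False using x C(2) by blast
  qed
qed

end

section \<open>Primes of degree one\<close>

context number_field_poly
begin

text \<open>A monic equation for s(theta), composed with \<open>s\<close>, is a polynomial relation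
  for theta and so holds at every conjugate.\<close>

lemma algebraic_int_conj:
  assumes "\<theta> \<in> \<Theta>" "\<theta>' \<in> \<Theta>" "algebraic_int (evr s \<theta>)"
  shows "algebraic_int (evr s \<theta>')"
proof -
  obtain q where q: "ev q (evr s \<theta>) = 0" "lead_coeff q = 1"
    using assms(3) unfolding algebraic_int_altdef_ipoly ev_def by blast
  have "ev q (evr s \<theta>') = 0"
    using evr_conj[OF assms(1,2), of "pcompose (map_poly of_int q) s"] q(1)
    by (simp add: evr_pcompose evr_of_int)
  then show ?thesis unfolding algebraic_int_altdef_ipoly using q(2) unfolding ev_def by blast
qed

lemma evr_reduce:
  obtains s where "degree s < d" "\<And>\<theta>. \<theta> \<in> \<Theta> \<Longrightarrow> evr s \<theta> = evr b \<theta>"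
proof (rule that[of "b mod fr"])
  show "degree (b mod fr) < d"
    using degree_mod_less'[of fr b] f_nz deg d_pos by (cases "b mod fr = 0") auto
  fix \<theta> assume "\<theta> \<in> \<Theta>"
  moreover have "evr b \<theta> = evr fr \<theta> * evr (b div fr) \<theta> + evr (b mod fr) \<theta>"
    by (metis evr_simps(3,5) mult_div_mod_eq)
  ultimately show "evr (b mod fr) \<theta> = evr b \<theta>"
    by (simp add: evr_of_int \<Theta>_def)
qed

lemma evr_inverse:
  assumes "\<theta> \<in> \<Theta>" "evr s \<theta> \<noteq> 0"
  obtains t where "evr t \<theta> = inverse (evr s \<theta>)"
proof -
  have "\<not> fr dvd s"
    using assms by (auto simp: dvd_def evr_of_int \<Theta>_def)
  then have "Rings.coprime fr s"
    using irr by (simp add: prime_elem_imp_coprime irreducible_imp_prime_elem_gcd)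
  then obtain a b where ab: "a * fr + b * s = 1"
    using bezout_coefficients_fst_snd[of fr s] by (metis coprime_imp_gcd_eq_1)
  have "evr (a * fr + b * s) \<theta> = 1" unfolding ab by simp
  then have "evr b \<theta> * evr s \<theta> = 1" using assms by (simp add: evr_of_int \<Theta>_def)
  then show thesis using that[of b] inverse_unique[of "evr s \<theta>" "evr b \<theta>"] by (simp add: mult.commute)
qed

text \<open>The reduction theta -> r modulo \<open>m\<close> is well defined on Z[theta] as soon as
  \<open>m\<close> divides f(r).\<close>

lemma dvd_poly_diff_of_ev_eq:
  assumes "\<theta> \<in> \<Theta>" "ev g \<theta> = ev h \<theta>" "m dvd poly f r"
  shows "m dvd poly g r - poly h r"
proof -
  have "f dvd g - h" using f_dvd[OF assms(1), of "g - h"] assms(2) by simp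
  then obtain q where "g - h = f * q" by (auto elim: dvdE)
  then have "poly (g - h) r = poly (f * q) r" by simp
  then show ?thesis using assms(3) by simp
qed

end

locale generated_field = scaled_field_poly f d c + integers_of_field K \<alpha>
  for f d c K \<alpha> +
  assumes root: "of_int c * \<alpha> \<in> \<Theta>"
begin

interpretation R: cring "integer_ring K" by (rule cring_integer_ring)

definition \<theta>\<^sub>0 :: complex where "\<theta>\<^sub>0 = of_int c * \<alpha>"

lemma root' [simp]: "\<theta>\<^sub>0 \<in> \<Theta>" using root by (simp add: \<theta>\<^sub>0_def)

lemma \<theta>\<^sub>0_mem: "\<theta>\<^sub>0 \<in> \<O>"
  using algebraic_int_\<Theta>[OF root'] rat_adjoin_of_int rat_adjoin_rules(2,6)
  unfolding \<O>_def \<theta>\<^sub>0_def unfolding K_def by auto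

lemma ev_\<theta>\<^sub>0_mem: "ev g \<theta>\<^sub>0 \<in> \<O>"
  using algebraic_int_ev[of \<theta>\<^sub>0 g] \<theta>\<^sub>0_mem rat_adjoin_ev unfolding \<O>_def unfolding K_def by auto

lemma field_element_evr: "y \<in> K \<Longrightarrow> \<exists>s. y = evr s \<theta>\<^sub>0"
  unfolding K_def rat_adjoin_def
proof (induction rule: generate_field.induct)
  case one
  then show ?case by (intro exI[of _ 1]) simp
next
  case (incl h)
  then show ?case
    using c_nz by (intro exI[of _ "[:0, inverse (of_int c):]"]) (simp add: \<theta>\<^sub>0_def of_rat_inverse)
next
  case (a_inv h)
  then obtain s where "h = evr s \<theta>\<^sub>0" by blast
  then show ?case by (intro exI[of _ "- s"]) simp
next
  case (m_inv h)
  then obtain s where s: "h = evr s \<theta>\<^sub>0" by blast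
  have "h \<noteq> 0" using m_inv by simp
  then obtain t where "evr t \<theta>\<^sub>0 = inverse h" using evr_inverse[OF root', of s] s by metis
  then show ?case using \<open>h \<noteq> 0\<close> by (intro exI[of _ t]) (simp add: complex_field_m_inv)
next
  case (eng_add h1 h2)
  then obtain s t where "h1 = evr s \<theta>\<^sub>0" "h2 = evr t \<theta>\<^sub>0" by blast
  then show ?case by (intro exI[of _ "s + t"]) simp
next
  case (eng_mult h1 h2)
  then obtain s t where "h1 = evr s \<theta>\<^sub>0" "h2 = evr t \<theta>\<^sub>0" by blast
  then show ?case by (intro exI[of _ "s * t"]) simp
qed

text \<open>The discriminant clears the denominators of algebraic integers written in powers of \<open>\<theta>\<close>.\<close>

definition rep :: "int poly \<Rightarrow> complex \<Rightarrow> bool" where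
  "rep g y \<longleftrightarrow> of_int discr * y = ev g \<theta>\<^sub>0"

lemma rep_exists:
  assumes "y \<in> \<O>"
  obtains g where "degree g < d" "rep g y"
proof -
  obtain b where b: "y = evr b \<theta>\<^sub>0" using field_element_evr assms unfolding \<O>_def by blast
  obtain s where s: "degree s < d" "\<And>\<theta>. \<theta> \<in> \<Theta> \<Longrightarrow> evr s \<theta> = evr b \<theta>" using evr_reduce by blast
  have ys: "evr s \<theta>\<^sub>0 = y" using b s(2) by simp
  have "algebraic_int (evr s \<theta>)" if "\<theta> \<in> \<Theta>" for \<theta>
    using algebraic_int_conj[OF root' that, of s] assms unfolding \<O>_def ys by simp
  then obtain t where "degree t < d" "\<And>z. ev t z = of_int discr * evr s z" using discr_integral[OF s(1)] by blast
  then show thesis using that[of t] ys unfolding rep_def by simp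
qed

lemma rep_mult:
  assumes "rep g y" "rep h z" "rep k (y * z)" "m dvd poly f r"
  shows "m dvd discr * poly k r - poly g r * poly h r"
proof -
  have "of_int discr * (of_int discr * (y * z)) = (of_int discr * y) * (of_int discr * z)" by simp
  then have "ev (smult discr k) \<theta>\<^sub>0 = ev (g * h) \<theta>\<^sub>0" using assms(1-3) unfolding rep_def by simp
  then show ?thesis using dvd_poly_diff_of_ev_eq[OF root' _ assms(4), of "smult discr k" "g * h"] by simp
qed

text \<open>The kernel of the reduction theta -> r modulo \<open>p\<close>, extended from Z[theta]
  to the full ring of integers: \<open>discr\<close> is a unit modulo a good prime, so y can be
  tested through discr y.\<close>

definition root_prime :: "nat \<Rightarrow> int \<Rightarrow> complex set" where
  "root_prime p r = {y \<in> \<O>. \<exists>g. rep g y \<and> int p dvd poly g r}"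

context
  fixes p :: nat and r :: int
  assumes good: "good p" and dvd: "int p dvd poly f r"
begin

lemma p_prime: "prime p" "\<not> int p dvd discr" "\<not> int p dvd c"
  using good unfolding good_def by auto

lemma root_prime_iff: "rep g y \<Longrightarrow> y \<in> \<O> \<Longrightarrow> y \<in> root_prime p r \<longleftrightarrow> int p dvd poly g r"
proof -
  assume g: "rep g y" and y: "y \<in> \<O>"
  have "int p dvd poly g r" if "rep h y" "int p dvd poly h r" for h
  proof -
    have "int p dvd poly g r - poly h r"
      by (rule dvd_poly_diff_of_ev_eq[OF root' _ dvd]) (use g that in \<open>simp add: rep_def\<close>)
    then show ?thesis using that(2) by (metis diff_add_cancel dvd_add)
  qed
  then show ?thesis unfolding root_prime_def using g y by blast
qed

lemma root_prime_ev: "ev g \<theta>\<^sub>0 \<in> root_prime p r \<longleftrightarrow> int p dvd poly g r"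
proof -
  have "rep (smult discr g) (ev g \<theta>\<^sub>0)" unfolding rep_def by simp
  then have "ev g \<theta>\<^sub>0 \<in> root_prime p r \<longleftrightarrow> int p dvd poly (smult discr g) r"
    using root_prime_iff ev_\<theta>\<^sub>0_mem by blast
  also have "\<dots> \<longleftrightarrow> int p dvd poly g r"
    using p_prime by (simp add: prime_dvd_mult_iff)
  finally show ?thesis .
qed

lemma root_prime_of_int: "of_int k \<in> root_prime p r \<longleftrightarrow> int p dvd k"
  using root_prime_ev[of "[:k:]"] by simp

text \<open>Representatives satisfy discr k(r) = g(r) h(r) modulo \<open>p\<close>, and
  \<open>discr\<close> is a unit there. One direction gives absorption, the other primality.\<close>

lemma root_prime_mult_iff:
  assumes y: "y \<in> \<O>" and z: "z \<in> \<O>"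
  shows "y * z \<in> root_prime p r \<longleftrightarrow> y \<in> root_prime p r \<or> z \<in> root_prime p r"
proof -
  obtain g where g: "rep g y" using rep_exists[OF y] by blast
  obtain h where h: "rep h z" using rep_exists[OF z] by blast
  obtain k where k: "rep k (y * z)" using rep_exists[OF O_closed(5)[OF y z]] by blast
  have "int p dvd discr * poly k r \<longleftrightarrow> int p dvd poly g r * poly h r"
    using rep_mult[OF g h k dvd] by (metis diff_add_cancel dvd_add_right_iff)
  then show ?thesis
    using root_prime_iff[OF g y] root_prime_iff[OF h z] root_prime_iff[OF k O_closed(5)[OF y z]] p_prime
    by (simp add: prime_dvd_mult_iff)
qed

lemma ideal_root_prime: "ideal (root_prime p r) (integer_ring K)"
  unfolding ideal_iff
proof (intro conjI ballI)
  show "root_prime p r \<subseteq> \<O>" unfolding root_prime_def by blast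
  show "0 \<in> root_prime p r" using root_prime_of_int[of 0] by simp
next
  fix x y assume "x \<in> root_prime p r" "y \<in> root_prime p r"
  then obtain g h where "x \<in> \<O>" "y \<in> \<O>" "rep g x" "rep h y" "int p dvd poly g r" "int p dvd poly h r"
    unfolding root_prime_def by blast
  moreover from this have "rep (g + h) (x + y)" unfolding rep_def by (simp add: algebra_simps)
  ultimately show "x + y \<in> root_prime p r" using root_prime_iff[of "g + h" "x + y"] O_closed(4) by simp
next
  fix x a assume "x \<in> root_prime p r" "a \<in> \<O>"
  then show "a * x \<in> root_prime p r" using root_prime_mult_iff[of a x] unfolding root_prime_def by blast
qed

lemma primeideal_root_prime: "primeideal (root_prime p r) (integer_ring K)"
proof (rule primeidealI)
  show "ideal (root_prime p r) (integer_ring K)" by (rule ideal_root_prime)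
  show "cring (integer_ring K)" by (rule cring_integer_ring)
  have "1 \<notin> root_prime p r" using root_prime_of_int[of 1] p_prime(1) by (auto simp: prime_nat_iff)
  then show "carrier (integer_ring K) \<noteq> root_prime p r" using O_closed(2) by auto
qed (use root_prime_mult_iff in simp)

lemma root_prime_nz: "root_prime p r \<noteq> {0}"
proof -
  have "of_int (int p) \<in> root_prime p r" using root_prime_of_int[of "int p"] by simp
  moreover have "of_int (int p) \<noteq> (0 :: complex)" using p_prime(1) by auto
  ultimately show ?thesis by blast
qed

text \<open>The multiplier is \<open>h(\<theta>)/p\<close>, where \<open>f - f(r) = (X - r) h\<close>: since \<open>h(r) = f'(r)\<close> is not divisible by
  \<open>p\<close>, it generates the inverse of the prime locally.\<close>

lemma root_prime_locally_inverse:
  obtains u a b where "\<And>y. y \<in> root_prime p r \<Longrightarrow> u * y \<in> \<O>" "a \<in> root_prime p r" "b \<in> root_prime p r"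
    "a * u + b = 1"
proof -
  have p0: "p \<noteq> 0" using p_prime(1) by auto
  have "[:- r, 1:] dvd f - [:poly f r:]" by (simp add: poly_eq_0_iff_dvd[symmetric])
  then obtain h where h: "f - [:poly f r:] = [:- r, 1:] * h" by (auto elim: dvdE)
  have "pderiv (f - [:poly f r:]) = pderiv ([:- r, 1:] * h)" unfolding h ..
  also have "\<dots> = h + [:- r, 1:] * pderiv h"
    by (subst pderiv_mult) (simp add: pderiv_pCons del: mult_pCons_left)
  finally have "poly (pderiv f) r = poly h r" by (simp add: pderiv_diff pderiv_pCons)
  then have "\<not> int p dvd poly h r" using not_dvd_pderiv_root[OF good dvd] by simp
  then obtain w v where wv: "w * poly h r = 1 + int p * v" using inverse_mod_prime[OF p_prime(1)] by blast
  have "ev (f - [:poly f r:]) \<theta>\<^sub>0 = ev ([:- r, 1:] * h) \<theta>\<^sub>0" unfolding h ..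
  then have fr': "(\<theta>\<^sub>0 - of_int r) * ev h \<theta>\<^sub>0 = - of_int (poly f r)"
    using root' by (simp add: \<Theta>_def del: mult_pCons_left root')
  obtain m where m: "poly f r = int p * m" using dvd by (auto elim: dvdE)
  obtain k where k: "\<And>z. ev h z - of_int (poly h r) = (z - of_int r) * ev k z" using ev_diff_dvd by metis
  define u where "u = ev h \<theta>\<^sub>0 / of_nat p"
  have pu: "of_nat p * u = ev h \<theta>\<^sub>0" unfolding u_def using p0 by simp
  show thesis
  \<comment> \<open>From w h(r) = 1 + p v and h(theta) = h(r) + (theta - r) k(theta) it follows that
    w p u = w h(theta) = 1 + p v + w (theta - r) k(theta); the last two terms lie in the prime, and
    their negative is the second witness.\<close>
  proof (rule that[of u "of_int (w * int p)" "ev (- [:int p * v:] - [:- r, 1:] * (smult w k)) \<theta>\<^sub>0"])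
    show "of_int (w * int p) \<in> root_prime p r" by (subst root_prime_of_int) simp
    show "ev (- [:int p * v:] - [:- r, 1:] * (smult w k)) \<theta>\<^sub>0 \<in> root_prime p r"
      by (subst root_prime_ev) simp
    have hk: "ev h \<theta>\<^sub>0 = of_int (poly h r) + (\<theta>\<^sub>0 - of_int r) * ev k \<theta>\<^sub>0"
      using k[of \<theta>\<^sub>0] by (simp add: algebra_simps)
    have "of_int (w * int p) * u = of_int w * (of_nat p * u)" by simp
    also have "\<dots> = of_int w * (of_int (poly h r) + (\<theta>\<^sub>0 - of_int r) * ev k \<theta>\<^sub>0)"
      unfolding pu hk ..
    also have "\<dots> = of_int (w * poly h r) + of_int w * (\<theta>\<^sub>0 - of_int r) * ev k \<theta>\<^sub>0"
      by (simp add: algebra_simps)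
    finally show "of_int (w * int p) * u + ev (- [:int p * v:] - [:- r, 1:] * (smult w k)) \<theta>\<^sub>0 = 1"
      unfolding wv by (simp add: algebra_simps)
  next
    fix y assume y: "y \<in> root_prime p r"
    then obtain g where g: "y \<in> \<O>" "rep g y" "int p dvd poly g r" unfolding root_prime_def by blast
    obtain l where l: "poly g r = int p * l" using g(3) by (auto elim: dvdE)
    obtain q where q: "\<And>z. ev g z - of_int (poly g r) = (z - of_int r) * ev q z" using ev_diff_dvd by metis
    have "of_nat p * (of_int discr * (u * y)) = (of_int discr * y) * ev h \<theta>\<^sub>0"
      unfolding pu[symmetric] by (simp add: algebra_simps)
    also have "of_int discr * y = of_int (poly g r) + (\<theta>\<^sub>0 - of_int r) * ev q \<theta>\<^sub>0"
      using g(2) q[of \<theta>\<^sub>0] unfolding rep_def by (simp add: algebra_simps)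
    also have "\<dots> * ev h \<theta>\<^sub>0 = of_int (poly g r) * ev h \<theta>\<^sub>0 + ev q \<theta>\<^sub>0 * ((\<theta>\<^sub>0 - of_int r) * ev h \<theta>\<^sub>0)"
      by (simp add: algebra_simps)
    also have "\<dots> = of_nat p * ev (smult l h - smult m q) \<theta>\<^sub>0"
      unfolding fr' l m by (simp add: algebra_simps)
    finally have Du: "of_int discr * (u * y) = ev (smult l h - smult m q) \<theta>\<^sub>0" using p0 by simp
    \<comment> \<open>Both discr u y and p u y are integral, and \<open>discr\<close> and
      \<open>p\<close> are coprime, so u y itself is integral.\<close>
    obtain a b where ab: "a * discr = 1 + int p * b" using inverse_mod_prime[OF p_prime(1,2)] by blast
    have "u * y = of_int (a * discr - int p * b) * (u * y)" unfolding ab by simp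
    also have "\<dots> = of_int a * (of_int discr * (u * y)) - of_int b * ((of_nat p * u) * y)"
      by (simp add: algebra_simps)
    also have "\<dots> \<in> \<O>" unfolding Du pu by (intro O_diff O_closed ev_\<theta>\<^sub>0_mem g)
    finally show "u * y \<in> \<O>" .
  qed
qed

end

text \<open>For a nonzero element a, represented by \<open>g\<close>, the integer discr Nm(g) is an
  integral multiple of a.\<close>

lemma ideal_contains_int:
  assumes I: "ideal I (integer_ring K)" "I \<noteq> {0}"
  obtains k where "k \<noteq> 0" "of_int k \<in> I"
proof -
  note D = idealD[OF I(1)]
  obtain a where a: "a \<in> I" "a \<noteq> 0" using I(2) D(2) by blast
  obtain g where g: "degree g < d" "rep g a" using rep_exists[OF D(1)[OF a(1)]] by blast
  have "g \<noteq> 0" using g(2) a(2) discr_neq_0 unfolding rep_def by auto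
  then have N: "Nm g \<noteq> 0" using Nm_eq_0_iff[OF g(1)] by simp
  obtain t where t: "ev t \<theta>\<^sub>0 * ev g \<theta>\<^sub>0 = of_int (discr * Nm g)" using exists_cofactor[OF N] root' by blast
  have "of_int (discr * Nm g) = ev t \<theta>\<^sub>0 * (of_int discr * a)"
    using t g(2) unfolding rep_def by metis
  also have "\<dots> = (ev t \<theta>\<^sub>0 * of_int discr) * a" by (simp only: mult.assoc)
  also have "\<dots> \<in> I" by (rule D(4)[OF a(1)]) (intro O_closed ev_\<theta>\<^sub>0_mem)
  finally show thesis using that[of "discr * Nm g"] N discr_neq_0 by simp
qed

end

section \<open>The ideal denominator and private primes\<close>

locale denominator_of_generator = generated_field +
  fixes \<aa> :: "complex set"
  assumes denom: "is_ideal_denominator K \<alpha> \<aa>"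
begin

interpretation R: cring "integer_ring K" by (rule cring_integer_ring)

lemma \<aa>_ideal: "ideal \<aa> (integer_ring K)" "\<aa> \<noteq> {0}"
  using denom unfolding is_ideal_denominator_def by auto

text \<open>As a member of b a^(-1), \<alpha> is a sum of products i j with i in b and j y integral
  for each y in the denominator. Integrality of the shifted ideals rests on this.\<close>

lemma \<alpha>_mult_\<aa>: "y \<in> \<aa> \<Longrightarrow> \<alpha> * y \<in> \<O>"
proof -
  assume y: "y \<in> \<aa>"
  obtain \<bb> where b: "ideal \<bb> (integer_ring K)"
      "principal_frac K \<alpha> = ideal_prod complex_field \<bb> (ideal_inverse K \<aa>)"
    using denom unfolding is_ideal_denominator_def by blast
  have "z * y \<in> \<O>" if "z \<in> ideal_prod complex_field \<bb> (ideal_inverse K \<aa>)" for z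
    using that
  proof (induction rule: ideal_prod.induct)
    case (prod i j)
    have "i \<in> \<O>" "j * y \<in> \<O>" using prod y idealD(1)[OF b(1)] unfolding ideal_inverse_def by auto
    then show ?case using O_closed(5)[of i "j * y"] by (simp add: mult.assoc)
  next
    case (sum s1 s2)
    then show ?case using O_closed(4)[of "s1 * y" "s2 * y"] by (simp add: algebra_simps)
  qed
  moreover have "\<alpha> * 1 \<in> principal_frac K \<alpha>"
    unfolding principal_frac_def using O_closed(2) by auto
  ultimately show "\<alpha> * y \<in> \<O>" unfolding b(2) by simp
qed

text \<open>A principal factor makes sums of products collapse to single products, so elements can
  be handled explicitly.\<close>

lemma shifted_ideal_eq: "shifted_ideal \<alpha> \<aa> n = {(of_int n + \<alpha>) * y | y. y \<in> \<aa>}"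
proof -
  note D = idealD[OF \<aa>_ideal(1)]
  define P where "P = principal_frac (rat_adjoin \<alpha>) (of_int n + \<alpha>)"
  have P: "P = {(of_int n + \<alpha>) * y | y. y \<in> \<O>}"
    unfolding P_def principal_frac_def K_def[symmetric] by simp
  have "z \<in> {(of_int n + \<alpha>) * y | y. y \<in> \<aa>}" if "z \<in> ideal_prod complex_field P \<aa>" for z
    using that
  proof (induction rule: ideal_prod.induct)
    case (prod i j)
    then obtain y where y: "i = (of_int n + \<alpha>) * y" "y \<in> \<O>" unfolding P by blast
    have "y * j \<in> \<aa>" using D(4) prod(2) y(2) by blast
    moreover have "i \<otimes>\<^bsub>complex_field\<^esub> j = (of_int n + \<alpha>) * (y * j)" using y by simp
    ultimately show ?case by blast
  next
    case (sum s1 s2)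
    then obtain y z where yz: "s1 = (of_int n + \<alpha>) * y" "s2 = (of_int n + \<alpha>) * z" "y \<in> \<aa>" "z \<in> \<aa>" by blast
    have "s1 \<oplus>\<^bsub>complex_field\<^esub> s2 = (of_int n + \<alpha>) * (y + z)" using yz by (simp add: algebra_simps)
    then show ?case using D(3) yz by blast
  qed
  moreover have "(of_int n + \<alpha>) * y \<in> ideal_prod complex_field P \<aa>" if "y \<in> \<aa>" for y
  proof -
    have "(of_int n + \<alpha>) * 1 \<in> P" unfolding P using O_closed(2) by blast
    then show ?thesis using ideal_prod.prod[of "of_int n + \<alpha>" P y \<aa> complex_field] that by simp
  qed
  ultimately show ?thesis unfolding shifted_ideal_def P_def[symmetric] by blast
qed

lemma ideal_shifted_ideal: "ideal (shifted_ideal \<alpha> \<aa> n) (integer_ring K)"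
  unfolding ideal_iff
proof (intro conjI ballI)
  note D = idealD[OF \<aa>_ideal(1)]
  show "shifted_ideal \<alpha> \<aa> n \<subseteq> \<O>"
  proof
    fix x assume "x \<in> shifted_ideal \<alpha> \<aa> n"
    then obtain y where y: "x = (of_int n + \<alpha>) * y" "y \<in> \<aa>" unfolding shifted_ideal_eq by blast
    have "of_int n * y + \<alpha> * y \<in> \<O>" using D(1) \<alpha>_mult_\<aa> y(2) O_closed by blast
    then show "x \<in> \<O>" unfolding y(1) by (simp add: algebra_simps)
  qed
  show "0 \<in> shifted_ideal \<alpha> \<aa> n" unfolding shifted_ideal_eq using D(2) by force
next
  note D = idealD[OF \<aa>_ideal(1)]
  fix x y assume "x \<in> shifted_ideal \<alpha> \<aa> n" "y \<in> shifted_ideal \<alpha> \<aa> n"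
  then obtain s t where st: "x = (of_int n + \<alpha>) * s" "s \<in> \<aa>" "y = (of_int n + \<alpha>) * t" "t \<in> \<aa>"
    unfolding shifted_ideal_eq by blast
  have "x + y = (of_int n + \<alpha>) * (s + t)" unfolding st by (simp add: algebra_simps)
  then show "x + y \<in> shifted_ideal \<alpha> \<aa> n" unfolding shifted_ideal_eq using D(3) st by blast
next
  note D = idealD[OF \<aa>_ideal(1)]
  fix x a assume "x \<in> shifted_ideal \<alpha> \<aa> n" and a: "a \<in> \<O>"
  then obtain s where s: "x = (of_int n + \<alpha>) * s" "s \<in> \<aa>"
    unfolding shifted_ideal_eq by blast
  have "a * x = (of_int n + \<alpha>) * (a * s)" unfolding s by (simp add: algebra_simps)
  then show "a * x \<in> shifted_ideal \<alpha> \<aa> n" unfolding shifted_ideal_eq using D(4) s a by blast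
qed

text \<open>Let P be the prime (p, theta + c n). It contains c (n + \<alpha>) = theta + c n but not
  \<open>c\<close>, hence it contains, and therefore divides, the ideal at \<open>n\<close>. At
  another \<open>m\<close> the element (m + \<alpha>) k stays outside: otherwise c (m - n) k would
  lie in P, although \<open>p\<close> exceeds |k| and |m - n| and does not divide
  \<open>c\<close>.\<close>

lemma has_private_primeI:
  assumes k: "k \<noteq> 0" "of_int k \<in> \<aa>" and p: "good p" "int p > \<bar>k\<bar>" "int p dvd poly f (- c * n)"
    and x: "x < real p" and n: "1 \<le> n" "of_int n \<le> x"
  shows "has_private_prime \<alpha> \<aa> x n"
proof -
  define P where "P = root_prime p (- c * n)"
  define r where "r = - c * n"
  note PI = ideal_root_prime[OF p(1,3), folded P_def] and PP = primeideal_root_prime[OF p(1,3), folded P_def]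
  note D = idealD[OF PI] and Pint = root_prime_of_int[OF p(1,3), folded P_def]
  note Pmult = root_prime_mult_iff[OF p(1,3), folded P_def]
  have pr: "prime (int p)" "\<not> int p dvd c" using p(1) unfolding good_def by auto
  have \<theta>r: "\<theta>\<^sub>0 - of_int r \<in> P"
    using root_prime_ev[OF p(1,3), of "[:- r, 1:]"] by (simp add: P_def r_def algebra_simps)
  have c: "of_int c \<notin> P" using Pint pr by blast
  have sub: "shifted_ideal \<alpha> \<aa> n \<subseteq> P"
  proof
    fix z assume z: "z \<in> shifted_ideal \<alpha> \<aa> n"
    then have zO: "z \<in> \<O>" using idealD(1)[OF ideal_shifted_ideal] by blast
    obtain y where y: "z = (of_int n + \<alpha>) * y" "y \<in> \<aa>" using z unfolding shifted_ideal_eq by blast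
    have "(\<theta>\<^sub>0 - of_int r) * y \<in> P" using D(5)[OF \<theta>r] idealD(1)[OF \<aa>_ideal(1) y(2)] by blast
    also have "(\<theta>\<^sub>0 - of_int r) * y = of_int c * z"
      unfolding y(1) r_def \<theta>\<^sub>0_def by (simp add: algebra_simps)
    finally show "z \<in> P" using Pmult[OF O_closed(3) zO] c by blast
  qed
  obtain u a b where "\<And>y. y \<in> P \<Longrightarrow> u * y \<in> \<O>" "a \<in> P" "b \<in> P" "a * u + b = 1"
    using root_prime_locally_inverse[OF p(1,3), folded P_def] by blast
  then have "P divides\<^bsub>ideals_set (integer_ring K)\<^esub> shifted_ideal \<alpha> \<aa> n"
    by (intro divides_of_locally_inverse[OF PI ideal_shifted_ideal sub])
  moreover have "\<not> P divides\<^bsub>ideals_set (integer_ring K)\<^esub>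
            finprod (ideals_set (integer_ring K)) (shifted_ideal \<alpha> \<aa>) {m. 1 \<le> m \<and> of_int m \<le> x \<and> m \<noteq> n}"
  proof (rule not_divides_finprod[OF PP])
    have "{m. 1 \<le> m \<and> of_int m \<le> x \<and> m \<noteq> n} \<subseteq> {1..\<lfloor>x\<rfloor>}" by (auto simp: le_floor_iff)
    then show "finite {m. 1 \<le> m \<and> of_int m \<le> x \<and> m \<noteq> n}" by (rule finite_subset) simp
    fix m assume "m \<in> {m. 1 \<le> m \<and> of_int m \<le> x \<and> m \<noteq> n}"
    then have m: "1 \<le> m" "of_int m \<le> x" "m \<noteq> n" by auto
    show "ideal (shifted_ideal \<alpha> \<aa> m) (integer_ring K)" by (rule ideal_shifted_ideal)
    show "\<exists>x\<in>shifted_ideal \<alpha> \<aa> m. x \<notin> P"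
    \<comment> \<open>A fixed nonzero integer \<open>k\<close> of the denominator supplies an
      element of the ideal at every \<open>m\<close>.\<close>
    proof (rule bexI[of _ "(of_int m + \<alpha>) * of_int k"], rule notI)
      assume "(of_int m + \<alpha>) * of_int k \<in> P"
      then have "of_int c * ((of_int m + \<alpha>) * of_int k) \<in> P" using D(4) O_closed(3) by blast
      moreover have "(\<theta>\<^sub>0 - of_int r) * of_int (- k) \<in> P" using D(5)[OF \<theta>r] O_closed(3) by blast
      ultimately have "of_int c * ((of_int m + \<alpha>) * of_int k) + (\<theta>\<^sub>0 - of_int r) * of_int (- k) \<in> P"
        using D(3) by blast
      also have "of_int c * ((of_int m + \<alpha>) * of_int k) + (\<theta>\<^sub>0 - of_int r) * of_int (- k) = of_int (c * (m - n) * k)"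
        unfolding r_def \<theta>\<^sub>0_def by (simp add: algebra_simps)
      finally have "int p dvd c * (m - n) * k" using Pint by blast
      then have "int p dvd m - n \<or> int p dvd k" using pr by (auto simp: prime_dvd_mult_iff)
      moreover have "\<not> int p dvd k" using p(2) k(1) zdvd_not_zless[of "\<bar>k\<bar>" "int p"] by auto
      moreover have "\<not> int p dvd m - n"
      proof -
        have "of_int m < real p" "of_int n < real p" using m x n by linarith+
        then have "m < int p" "n < int p" by linarith+
        then have "\<bar>m - n\<bar> < int p" "\<bar>m - n\<bar> > 0" using m n by linarith+
        then show ?thesis using zdvd_not_zless[of "\<bar>m - n\<bar>" "int p"] by auto
      qed
      ultimately show False by blast
    next
      show "(of_int m + \<alpha>) * of_int k \<in> shifted_ideal \<alpha> \<aa> m" unfolding shifted_ideal_eq using k by blast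
    qed
  qed
  moreover have "P \<noteq> {0}" unfolding P_def by (rule root_prime_nz[OF p(1,3)])
  ultimately show ?thesis
    unfolding has_private_prime_def Let_def K_def[symmetric] using PP by blast
qed

lemma private_prime_of_large_divisor:
  "\<exists>B. \<forall>p x n. prime p \<longrightarrow> p > B \<longrightarrow> x < real p \<longrightarrow> 1 \<le> n \<longrightarrow> of_int (int n) \<le> x \<longrightarrow> int p dvd shifted_norm n
     \<longrightarrow> has_private_prime \<alpha> \<aa> x (int n)"
proof -
  obtain k where k: "k \<noteq> 0" "of_int k \<in> \<aa>" using ideal_contains_int[OF \<aa>_ideal] by blast
  have "has_private_prime \<alpha> \<aa> x (int n)"
    if "prime p" "p > max prime_bound (nat \<bar>k\<bar>)" "x < real p" "1 \<le> n" "of_int (int n) \<le> x" "int p dvd shifted_norm n" for p x n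
  proof (rule has_private_primeI[OF k])
    show "good p" using good_of_large that by simp
    show "\<bar>k\<bar> < int p" using that(2) by linarith
    show "int p dvd poly f (- c * int n)" using that(6) dvd_shifted_norm_iff by blast
  qed (use that in auto)
  then show ?thesis by blast
qed

end

section \<open>The minimal polynomial\<close>

lemma rational_minimal_polynomial:
  assumes "algebraic \<alpha>"
  obtains m where "lead_coeff m = 1" "evr m \<alpha> = 0" "\<And>s. evr s \<alpha> = 0 \<Longrightarrow> s \<noteq> 0 \<Longrightarrow> degree m \<le> degree s"
proof -
  obtain p where p: "\<And>i. coeff p i \<in> \<int>" "p \<noteq> 0" "poly p \<alpha> = 0"
    using assms unfolding algebraic_def by blast
  have "rat_coeffs p" unfolding rat_coeffs_def using p(1) Ints_subset_Rats by blast
  then obtain s where s: "p = map_poly of_rat s" unfolding rat_coeffs_iff by blast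
  have ex: "evr s \<alpha> = 0 \<and> s \<noteq> 0" using p(2,3) s unfolding evr_def by auto
  define m where "m = arg_min degree (\<lambda>s. evr s \<alpha> = 0 \<and> s \<noteq> 0)"
  have m: "evr m \<alpha> = 0 \<and> m \<noteq> 0" "\<And>s. evr s \<alpha> = 0 \<and> s \<noteq> 0 \<Longrightarrow> degree m \<le> degree s"
    unfolding m_def using arg_min_nat_lemma[of "\<lambda>s. evr s \<alpha> = 0 \<and> s \<noteq> 0" s degree] ex by blast+
  show thesis
    by (rule that[of "smult (inverse (lead_coeff m)) m"]) (use m in auto)
qed

lemma irreducible_of_minimal_degree:
  fixes m :: "rat poly"
  assumes "evr m z = 0" "m \<noteq> 0" "\<And>s. evr s z = 0 \<Longrightarrow> s \<noteq> 0 \<Longrightarrow> degree m \<le> degree s"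
  shows "irreducible m"
proof (rule Factorial_Ring.irreducibleI)
  show "m \<noteq> 0" by fact
  show "\<not> m dvd 1"
  proof
    assume "m dvd 1"
    then obtain k where "1 = m * k" by (rule dvdE)
    then have "evr 1 z = evr (m * k) z" by simp
    then show False using assms(1) by simp
  qed
  fix a b assume ab: "m = a * b"
  have nz: "a \<noteq> 0" "b \<noteq> 0" using assms(2) ab by auto
  have dg: "degree m = degree a + degree b" unfolding ab using nz by (rule degree_mult_eq)
  have "evr a z = 0 \<or> evr b z = 0" using assms(1) unfolding ab by simp
  then have "degree a = 0 \<or> degree b = 0" using assms(3)[of a] assms(3)[of b] nz dg by auto
  then show "a dvd 1 \<or> b dvd 1" using nz by (auto simp: is_unit_iff_degree)
qed

lemma common_denominator: "\<exists>c::int. c > 0 \<and> (\<forall>i. of_int c * coeff (m :: rat poly) i \<in> \<int>)"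
proof (induction m)
  case 0
  then show ?case by (intro exI[of _ 1]) auto
next
  case (pCons a m)
  then obtain c where c: "c > 0" "\<And>i. of_int c * coeff m i \<in> \<int>" by blast
  obtain n k where nk: "quotient_of a = (n, k)" by (cases "quotient_of a")
  have a: "a = of_int n / of_int k" "k > 0" using quotient_of_div[OF nk] quotient_of_denom_pos[OF nk] by auto
  have "of_int (c * k) * coeff (pCons a m) i \<in> \<int>" for i
  proof (cases i)
    case 0
    have "of_int (c * k) * coeff (pCons a m) i = of_int (c * n)" using a 0 by simp
    then show ?thesis by (metis Ints_of_int)
  next
    case (Suc j)
    have "of_int (c * k) * coeff (pCons a m) i = of_int k * (of_int c * coeff m j)" using Suc by simp
    then show ?thesis using c(2) by (metis Ints_mult Ints_of_int)
  qed
  moreover have "c * k > 0" using c(1) a(2) by simp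
  ultimately show ?case by blast
qed

section \<open>The degree as defined through \<open>Irr\<close>\<close>

lemma subfield_rationals: "subfield \<rat> complex_field"
proof -
  interpret CF: field complex_field by (rule field_complex_field)
  show ?thesis
  proof (rule CF.subfieldI')
    show "subring \<rat> complex_field" by (rule CF.subringI) auto
    show "inv\<^bsub>complex_field\<^esub> k \<in> \<rat>" if "k \<in> \<rat> - {\<zero>\<^bsub>complex_field\<^esub>}" for k
      using that by (simp add: complex_field_m_inv)
  qed
qed

lemma complex_field_pow: "x [^]\<^bsub>complex_field\<^esub> (n::nat) = x ^ n"
  by (induction n) (simp_all add: CF.nat_pow_Suc mult.commute)

text \<open>The list polynomials have the leading coefficient first, whereas \<open>Poly\<close>
  expects the constant coefficient first; hence the reversal.\<close>

lemma complex_field_eval: "ring.eval complex_field p x = poly (Poly (rev p)) x"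
proof (induction p)
  case Nil
  then show ?case by (simp add: CF.eval.simps)
next
  case (Cons a p)
  then show ?case
    by (simp add: CF.eval.simps complex_field_pow Poly_append poly_monom mult.commute)
qed

lemma complex_field_polynomial:
  "p \<in> carrier (univ_poly complex_field \<rat>) \<longleftrightarrow> p = [] \<or> (set p \<subseteq> \<rat> \<and> hd p \<noteq> 0)"
  unfolding univ_poly_def by (simp add: polynomial_def)

text \<open>Both polynomials vanish at \<alpha>. Translated to a list, \<open>m\<close> is a
  multiple of \<open>Irr\<close>, and \<open>Irr\<close> translated back competes with
  \<open>m\<close> for minimal degree, so each degree bounds the other.\<close>

lemma alg_degree_eqI:
  assumes "m \<noteq> 0" "evr m \<alpha> = 0" "\<And>s. evr s \<alpha> = 0 \<Longrightarrow> s \<noteq> 0 \<Longrightarrow> degree m \<le> degree s"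
  shows "alg_degree \<alpha> = degree m"
proof -
  interpret CF: field complex_field by (rule field_complex_field)
  note Q = subfield_rationals
  define P where "P = (map_poly of_rat m :: complex poly)"
  define q where "q = rev (coeffs P)"
  have P: "P \<noteq> 0" "degree P = degree m" unfolding P_def using assms(1) by simp_all
  have q_ne: "q \<noteq> []" unfolding q_def using P(1) by simp
  have "set q \<subseteq> \<rat>" unfolding q_def P_def by (auto simp: coeffs_def coeff_map_poly)
  moreover have "hd q \<noteq> 0" unfolding q_def using P(1) by (simp add: hd_rev last_coeffs_eq_coeff_degree)
  ultimately have q: "q \<in> carrier (univ_poly complex_field \<rat>)" unfolding complex_field_polynomial by blast
  have "Poly (rev q) = P" unfolding q_def by simp
  then have ev: "ring.eval complex_field q \<alpha> = \<zero>\<^bsub>complex_field\<^esub>"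
    unfolding complex_field_eval using assms(2) by (simp add: P_def evr_def)
  have alg: "(CF.algebraic over \<rat>) \<alpha>" by (rule CF.algebraicI[OF q q_ne ev])
  have \<alpha>: "\<alpha> \<in> carrier complex_field" by simp
  note I = CF.IrrE[OF Q \<alpha> alg]
  define r where "r = CF.Irr \<rat> \<alpha>"
  have "r pdivides\<^bsub>complex_field\<^esub> q" unfolding r_def by (rule CF.Irr_minimal[OF Q \<alpha> alg q ev])
  then have "Polynomials.degree r \<le> Polynomials.degree q"
    using CF.pdivides_imp_degree_le[OF subfieldE(1)[OF Q] I(1) q q_ne] unfolding r_def by blast
  also have "Polynomials.degree q = degree m"
    unfolding q_def using P by (simp add: length_coeffs_degree)
  finally have le: "Polynomials.degree r \<le> degree m" .
  have r_ne: "r \<noteq> []" using CF.IrrE(2)[OF Q \<alpha> alg] unfolding r_def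
    by (auto simp: ring_irreducible_def univ_poly_zero)
  have r: "set r \<subseteq> \<rat>" "hd r \<noteq> 0" using I(1) r_ne unfolding r_def complex_field_polynomial by blast+
  have "rat_coeffs (Poly (rev r))" unfolding rat_coeffs_def
  proof
    fix i
    have "nth_default 0 (rev r) i \<in> \<rat>"
      using r(1) nth_mem[of i "rev r"] by (auto simp: nth_default_def simp del: nth_mem)
    then show "coeff (Poly (rev r)) i \<in> \<rat>" by (simp add: coeff_Poly_eq)
  qed
  then obtain s where s: "Poly (rev r) = map_poly of_rat s" unfolding rat_coeffs_iff by blast
  \<comment> \<open>The head of \<open>r\<close> is the nonzero leading coefficient, so the reversed
    list has no trailing zeros for \<open>Poly\<close> to strip.\<close>
  have co: "coeffs (Poly (rev r)) = rev r"
    using r(2) r_ne by (cases r) simp_all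
  have "degree (Poly (rev r)) = length r - 1"
    using degree_eq_length_coeffs[of "Poly (rev r)"] unfolding co by simp
  then have ds: "degree s = Polynomials.degree r" unfolding s by simp
  have "Poly (rev r) \<noteq> 0" using co r_ne by (metis coeffs_0_eq_Nil rev_is_Nil_conv)
  then have "s \<noteq> 0" using s by auto
  moreover have "evr s \<alpha> = 0"
    using I(4) s unfolding r_def[symmetric] complex_field_eval evr_def by simp
  ultimately have "degree m \<le> degree s" using assms(3) by blast
  then show ?thesis using le ds unfolding alg_degree_def r_def[symmetric] by simp
qed

text \<open>With \<open>c\<close> a common denominator of the minimal polynomial m of \<alpha>, the
  polynomial c^n m(X/c) is monic, integral and minimal for c \<alpha>. Degree below 2 would make
  \<alpha> rational.\<close>

lemma scaled_field_poly_exists: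
  assumes "algebraic \<alpha>" "\<alpha> \<notin> \<rat>"
  obtains f c where "scaled_field_poly f (alg_degree \<alpha>) c" "ev f (of_int c * \<alpha>) = 0" "alg_degree \<alpha> \<ge> 2"
proof -
  obtain m where m: "lead_coeff m = 1" "evr m \<alpha> = 0" "\<And>s. evr s \<alpha> = 0 \<Longrightarrow> s \<noteq> 0 \<Longrightarrow> degree m \<le> degree s"
    using rational_minimal_polynomial[OF assms(1)] by blast
  have m0: "m \<noteq> 0" using m(1) by auto
  define n where "n = degree m"
  have deg: "alg_degree \<alpha> = n" unfolding n_def by (rule alg_degree_eqI[OF m0 m(2,3)])
  have n2: "n \<ge> 2"
  proof (rule ccontr)
    assume "\<not> n \<ge> 2"
    then have "coeff m i = 0" if "i \<ge> 2" for i using that unfolding n_def by (intro coeff_eq_0) simp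
    then have "m = [:coeff m 0, coeff m 1:]"
      by (intro poly_eqI) (auto simp: coeff_pCons numeral_2_eq_2 split: nat.splits)
    then have "evr [:coeff m 0, coeff m 1:] \<alpha> = 0" "[:coeff m 0, coeff m 1:] \<noteq> 0" using m(2) m0 by simp_all
    then have *: "of_rat (coeff m 0) + \<alpha> * of_rat (coeff m 1) = 0" "coeff m 0 \<noteq> 0 \<or> coeff m 1 \<noteq> 0" by auto
    then have "coeff m 1 \<noteq> 0" by auto
    then have "\<alpha> = of_rat (- coeff m 0 / coeff m 1)"
      using *(1) by (simp add: of_rat_divide of_rat_minus eq_divide_eq add_eq_0_iff2)
    then show False using assms(2) by auto
  qed
  obtain c :: int where c: "c > 0" "\<And>i. of_int c * coeff m i \<in> \<int>" using common_denominator[of m] by blast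
  define M where "M = smult (of_int c ^ n) (pcompose m [:0, inverse (of_int c):])"
  have cM: "coeff M i = of_int c ^ n * (inverse (of_int c) ^ i * coeff m i)" for i
    unfolding M_def by (simp add: coeff_pcompose_linear)
  have "coeff M i \<in> \<int>" for i
  proof -
    consider "i > n" | "i = n" | "i < n" by linarith
    then show ?thesis
    proof cases
      case 1
      then have "coeff m i = 0" unfolding n_def by (rule coeff_eq_0)
      then show ?thesis unfolding cM by simp
    next
      case 2
      then show ?thesis unfolding cM using m(1) c(1) by (simp add: n_def power_inverse)
    next
      case 3
      \<comment> \<open>The coefficient is c^(n - i) times that of \<open>m\<close>, and n - i \<ge>
        1 leaves at least one factor \<open>c\<close> to clear its denominator.\<close>
      then have "n = (n - i - 1) + 1 + i" by simp
      then have "(of_int c :: rat) ^ n = of_int c ^ (n - i - 1) * of_int c * of_int c ^ i"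
        by (metis power_add power_one_right)
      then have "coeff M i = of_int c ^ (n - i - 1) * (of_int c * coeff m i)"
        unfolding cM using c(1) by (simp add: power_inverse)
      then show ?thesis using c(2)[of i] by (auto intro: Ints_mult Ints_power)
    qed
  qed
  then have fl: "of_int \<lfloor>coeff M i\<rfloor> = coeff M i" for i by simp
  define f where "f = map_poly floor M"
  have fM: "map_poly of_int f = M"
    by (intro poly_eqI) (simp add: f_def coeff_map_poly fl)
  have dM: "degree M = n" unfolding M_def using c(1) by (simp add: n_def)
  have lM: "lead_coeff M = 1" unfolding dM cM using m(1) c(1) by (simp add: n_def power_inverse)
  have eM: "evr M (of_int c * \<alpha>) = 0"
  proof -
    have "of_int c * \<alpha> * inverse (of_int c) = (of_int c * inverse (of_int c)) * \<alpha>" by simp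
    also have "\<dots> = \<alpha>" using c(1) by (subst right_inverse) auto
    finally have "evr m (of_int c * \<alpha> * inverse (of_int c)) = evr m \<alpha>" by (rule arg_cong)
    then show ?thesis unfolding M_def using m(2) by (simp add: evr_pcompose of_rat_inverse del: mult_cancel_left1 mult_cancel_right1)
  qed
  have "irreducible M"
  proof (rule irreducible_of_minimal_degree[OF eM])
    show "M \<noteq> 0" using lM by auto
    fix s assume s: "evr s (of_int c * \<alpha>) = 0" "s \<noteq> 0"
    have "evr (pcompose s [:0, of_int c:]) \<alpha> = 0" using s(1) by (simp add: evr_pcompose mult.commute)
    moreover have "pcompose s [:0, of_int c:] \<noteq> 0" using s(2) c(1) pcompose_eq_0[of s "[:0, of_int c:]"] by auto
    ultimately have "degree m \<le> degree (pcompose s [:0, of_int c:])" by (rule m(3))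
    then show "degree M \<le> degree s" unfolding dM n_def using c(1) by simp
  qed
  moreover have "degree f = n" using dM unfolding fM[symmetric] by simp
  moreover from this have "lead_coeff f = 1"
    using lM unfolding dM fM[symmetric] by (simp add: coeff_map_poly)
  ultimately have "scaled_field_poly f (alg_degree \<alpha>) c"
    unfolding deg using n2 c(1) fM by unfold_locales auto
  moreover have "ev f (of_int c * \<alpha>) = 0" using eM unfolding fM[symmetric] evr_of_int .
  ultimately show thesis using that deg n2 by blast
qed

theorem theorem1p2:
  fixes \<alpha> :: complex and d :: nat and K \<aa> :: "complex set"
  assumes "algebraic \<alpha>" and "\<alpha> \<notin> \<rat>"
    and "d = alg_degree \<alpha>"
    and "K = rat_adjoin \<alpha>"
    and "is_ideal_denominator K \<alpha> \<aa>"
  shows "(\<forall>\<^sub>F x in at_top. real (private_prime_count \<alpha> \<aa> x) \<ge>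
            (1 - 1 / (2 * real d) - 3 / (16 * (real d)\<^sup>2)
               - 1 / real d * sqrt (3 / (16 * real d) + (3 / (16 * real d))\<^sup>2)) * x)
       \<and> (\<forall>\<^sub>F x in at_top. real (private_prime_count \<alpha> \<aa> x) > 0.543 * x)"
proof -
  obtain f c where fc: "scaled_field_poly f d c" "ev f (of_int c * \<alpha>) = 0" and d2: "d \<ge> 2"
    using scaled_field_poly_exists[OF assms(1,2)] assms(3) by blast
  interpret scaled_field_poly f d c by (rule fc)
  interpret denominator_of_generator f d c K \<alpha> \<aa>
    by unfold_locales (use assms(4,5) fc(2) in \<open>auto simp: \<Theta>_def\<close>)
  from private_prime_of_large_divisor obtain B where
    B: "\<forall>p x n. prime p \<longrightarrow> p > B \<longrightarrow> x < real p \<longrightarrow> 1 \<le> n \<longrightarrow> of_int (int n) \<le> x \<longrightarrow> int p dvd shifted_norm n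
      \<longrightarrow> has_private_prime \<alpha> \<aa> x (int n)"
    by (rule exE)
  obtain \<delta> where \<delta>: "\<delta> > 0"
    "eventually (\<lambda>N. real (card (smooth_set N)) \<le> (crit_density d - \<delta>) * real N) sequentially"
    using smooth_set_bound[OF d2] by blast
  define N where "N = (\<lambda>x::real. nat \<lfloor>x\<rfloor>)"
  have count: "real (private_prime_count \<alpha> \<aa> x) \<ge> real (N x) - real (card (smooth_set (N x)))"
    if x: "x \<ge> 1" "N x \<ge> B" for x
  proof -
    define S where "S = {n::int. 1 \<le> n \<and> of_int n \<le> x \<and> has_private_prime \<alpha> \<aa> x n}"
    have Nx: "real (N x) \<le> x" "x < real (N x) + 1" unfolding N_def using x(1) by linarith+
    have "S \<subseteq> {1..\<lfloor>x\<rfloor>}" unfolding S_def by (auto simp: le_floor_iff)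
    then have finS: "finite S" by (rule finite_subset) simp
    have "int ` ({1..N x} - smooth_set (N x)) \<subseteq> S"
    proof (rule image_subsetI)
      fix n assume n: "n \<in> {1..N x} - smooth_set (N x)"
      then have "\<not> (\<forall>p. prime p \<longrightarrow> int p dvd shifted_norm n \<longrightarrow> p \<le> N x)" unfolding smooth_set_def by blast
      then obtain p where p: "prime p" "int p dvd shifted_norm n" "p > N x" unfolding not_le[symmetric] by blast
      \<comment> \<open>\<open>p\<close> is an integer above the integer part of \<open>x\<close>,
        so it exceeds \<open>x\<close> itself.\<close>
      have "x < real p" using p(3) Nx(2) by linarith
      moreover have "real n \<le> x" using n Nx(1) by (simp add: order_trans[OF _ Nx(1)])
      ultimately have "has_private_prime \<alpha> \<aa> x (int n)"
        using p n x(2) by (intro B[rule_format, of p]) auto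
      then show "int n \<in> S" unfolding S_def using n \<open>real n \<le> x\<close> by simp
    qed
    then have "card (int ` ({1..N x} - smooth_set (N x))) \<le> card S" by (rule card_mono[OF finS])
    also have "card (int ` ({1..N x} - smooth_set (N x))) = card ({1..N x} - smooth_set (N x))"
      by (rule card_image) simp
    also have "\<dots> = N x - card (smooth_set (N x))"
      by (subst card_Diff_subset) (auto simp: smooth_set_def intro: finite_subset[of _ "{1..N x}"])
    finally have "N x - card (smooth_set (N x)) \<le> card S" .
    then show ?thesis unfolding private_prime_count_def S_def[symmetric] by linarith
  qed
  have Nlim: "filterlim N sequentially at_top"
    unfolding N_def by (rule filterlim_compose[OF filterlim_nat_sequentially filterlim_floor_sequentially])
  have main: "\<forall>\<^sub>F x in at_top. real (private_prime_count \<alpha> \<aa> x) \<ge> (1 - crit_density d) * x"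
    using eventually_compose_filterlim[OF \<delta>(2) Nlim]
      eventually_compose_filterlim[OF eventually_ge_at_top[of B] Nlim]
      eventually_ge_at_top[of 1] eventually_ge_at_top[of "(1 + \<bar>crit_density d\<bar> + \<delta>) / \<delta>"]
  proof eventually_elim
    case (elim x)
    have "x - 1 \<le> real (N x)" "0 \<le> real (N x)" "real (N x) \<le> x" unfolding N_def using elim(3) by linarith+
    have cd: "1 - crit_density d + \<delta> \<ge> 0" using crit_density_less_1[OF d2] \<delta>(1) by simp
    have "(1 - crit_density d + \<delta>) * (x - 1) \<le> (1 - crit_density d + \<delta>) * real (N x)"
      using cd \<open>x - 1 \<le> real (N x)\<close> by (intro mult_left_mono)
    also have "\<dots> \<le> real (private_prime_count \<alpha> \<aa> x)"
      using count[OF elim(3,2)] elim(1) by (simp add: algebra_simps)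
    finally have *: "(1 - crit_density d + \<delta>) * (x - 1) \<le> real (private_prime_count \<alpha> \<aa> x)" .
    \<comment> \<open>Replacing the integer part of \<open>x\<close> by x - 1 loses at most 1 -
      \<open>crit_density d\<close> + \<delta>, which \<delta> x covers for large
      \<open>x\<close>.\<close>
    have "1 + \<bar>crit_density d\<bar> + \<delta> \<le> \<delta> * x" using elim(4) \<delta>(1) by (simp add: divide_le_eq mult.commute)
    then have "(1 - crit_density d) * x \<le> (1 - crit_density d + \<delta>) * (x - 1)"
      by (simp add: algebra_simps abs_if split: if_splits)
    then show ?case using * by linarith
  qed
  have "\<forall>\<^sub>F x in at_top. real (private_prime_count \<alpha> \<aa> x) > 0.543 * x"
    using main eventually_gt_at_top[of 0]
  proof eventually_elim
    case (elim x)
    have "0.543 * x < (1 - crit_density d) * x"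
      using crit_density_less_1[OF d2] elim(2) by (intro mult_strict_right_mono) simp_all
    then show ?case using elim(1) by linarith
  qed
  moreover have eq: "1 - crit_density d = 1 - 1 / (2 * real d) - 3 / (16 * (real d)\<^sup>2)
               - 1 / real d * sqrt (3 / (16 * real d) + (3 / (16 * real d))\<^sup>2)"
    unfolding crit_density_def by simp
  ultimately show ?thesis using main unfolding eq by blast
qed

end
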